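(* Let $\mathbb{K}$ be an arbitrary field and let $\mathscr{A}$ be a hyperplane arrangement in a finite-dimensional $\mathbb{K}$-vector space. Let $H_0 \in \mathscr{A}$, $m_0 \in \mathbb{Z}_{\ge 1}$ and let $\delta = \delta_{H_0,m_0}$ be the multiplicity on $\mathscr{A}$ concentrated at $H_0$, i.e. $\delta(H_0)=m_0$ and $\delta(H)=1$ for all $H\in\mathscr{A}\setminus\{H_0\}$. Then the simple arrangement $\mathscr{A}$ is inductively free if and only if the multiarrangement $(\mathscr{A}, \delta)$ is inductively free.
   Context: Arrangements. Let $V=\mathbb{K}^\ell$. An arrangement $\mathscr{A}$ in $V$ is a finite set of linear hyperplanes of $V$; $\Phi_\ell$ is the empty arrangement in $\mathbb{K}^\ell$. $L(\mathscr{A})$ is the set of all intersections of subsets of $\mathscr{A}$ (including $V$, the empty intersection). For $X\in L(\mathscr{A})$: $\mathscr{A}_X=\{H\in\mathscr{A}\mid X\subseteq H\}$ is the localization, and $\mathscr{A}^X=\{X\cap H\mid H\in\mathscr{A}\setminus\mathscr{A}_X\}$ is the restriction, an arrangement in $X$. Freeness. $S$ is the symmetric algebra of $V^*$, $S\cong\mathbb{K}[x_1,\dots,x_\ell]$; $\operatorname{Der}(S)$ is its module of $\mathbb{K}$-derivations with basis $D_i=\partial/\partial x_i$; $\theta=\sum f_iD_i$ is homogeneous of polynomial degree $\operatorname{pdeg}\theta=p$ if each $f_i$ is $0$ or homogeneous of degree $p$. Write $H=\ker\alpha_H$ with $\alpha_H\in V^*$. A multiarrangement $(\mathscr{A},\mu)$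 is an arrangement with a function $\mu:\mathscr{A}\to\mathbb{Z}_{\ge0}$ (hyperplanes of multiplicity $0$ may be discarded; $\mu\equiv 0$ gives the empty arrangement). $D(\mathscr{A},\mu)=\{\theta\in\operatorname{Der}(S)\mid\theta(\alpha_H)\in\alpha_H^{\mu(H)}S\ \forall H\in\mathscr{A}\}$. $(\mathscr{A},\mu)$ is free if $D(\mathscr{A},\mu)$ is a free $S$-module; it then has a homogeneous basis, and the multiset of polynomial degrees of its members is $\exp(\mathscr{A},\mu)$. For the simple arrangement $\mathscr{A}$ take $\mu\equiv1$, giving freeness and $\exp\mathscr{A}$. Inductive freeness (simple). For $H_0\in\mathscr{A}$ set $\mathscr{A}'=\mathscr{A}\setminus\{H_0\}$, $\mathscr{A}''=\mathscr{A}^{H_0}$. The class of inductively free arrangements is the smallest class containing all $\Phi_\ell$ ($\ell\ge0$) and containing $\mathscr{A}$ whenever there is $H_0\in\mathscr{A}$ with $\mathscr{A}',\mathscr{A}''$ in the class and $\exp\mathscr{A}''\subseteq\exp\mathscr{A}'$ (as multisets). Inductive freeness (multi). Let $(\mathscr{A},\mu)$ be nonempty, with $\mu(H_0)\ge1$. Deletion $(\mathscr{A}',\mu')$: lower the multiplicity of $H_0$ by one (removing $H_0$ if $\mu(H_0)=1$), all others unchanged. Euler restriction $(\mathscr{A}'',\mu^* )$: $\mathscr{A}''=\mathscr{A}^{H_0}$, and for $Y\in\mathscr{A}''$ the rank $2$ multiarrangement $(\mathscr{A}_Y,\mu|_{\mathscr{A}_Y})$ is free; in coordinates with $\alpha_H\in\langle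 x_1,x_2\rangle$ for $H\in\mathscr{A}_Y$, its derivation module has a homogeneous basis $\{\theta_Y,\psi_Y,D_3,\dots,D_\ell\}$ with $\theta_Y\notin\alpha_{H_0}\operatorname{Der}(S)$ and $\psi_Y\in\alpha_{H_0}\operatorname{Der}(S)$; put $\mu^*(Y)=\operatorname{pdeg}\theta_Y$. The class of inductively free multiarrangements is the smallest class containing all $\Phi_\ell$ and containing $(\mathscr{A},\mu)$ whenever there is $H_0\in\mathscr{A}$ such that $(\mathscr{A}',\mu')$ and $(\mathscr{A}'',\mu^* )$ are in the class and $\exp(\mathscr{A}'',\mu^* )\subseteq\exp(\mathscr{A}',\mu')$. *)

theory Defs
  imports Complex_Main "HOL-Library.Poly_Mapping" "HOL-Library.Multiset"
begin

(* Polynomials are finitely supported maps from exponent vectors to coefficients.  The type has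
   infinitely many variables x_0, x_1, ...; the polynomial ring in n variables is the subring
   poly_ring n. *)

type_synonym 'k mpoly = "(nat \<Rightarrow>\<^sub>0 nat) \<Rightarrow>\<^sub>0 'k"

definition poly_ring :: "nat \<Rightarrow> 'k::field mpoly set" where
  "poly_ring n = {f. \<forall>m\<in>Poly_Mapping.keys f. Poly_Mapping.keys m \<subseteq> {..<n}}"

definition const :: "'k \<Rightarrow> 'k::field mpoly" where
  "const c = Poly_Mapping.single 0 c"

definition var :: "nat \<Rightarrow> 'k::field mpoly" where
  "var i = Poly_Mapping.single (Poly_Mapping.single i 1) 1"

(* The zero polynomial is homogeneous of every degree. *)
definition homogeneous :: "nat \<Rightarrow> 'k::field mpoly \<Rightarrow> bool" where
  "homogeneous d f \<longleftrightarrow>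
     (\<forall>m\<in>Poly_Mapping.keys f. (\<Sum>i\<in>Poly_Mapping.keys m. Poly_Mapping.lookup m i) = d)"

(* The K-linear derivations of S = poly_ring n.  They are functions on the whole polynomial type,
   made to vanish outside S so that equality of functions is equality of derivations of S. *)
definition Der :: "nat \<Rightarrow> ('k::field mpoly \<Rightarrow> 'k mpoly) set" where
  "Der n = {\<theta>.
     (\<forall>f\<in>poly_ring n. \<theta> f \<in> poly_ring n) \<and>
     (\<forall>f. f \<notin> poly_ring n \<longrightarrow> \<theta> f = 0) \<and>
     (\<forall>f\<in>poly_ring n. \<forall>g\<in>poly_ring n. \<theta> (f + g) = \<theta> f + \<theta> g) \<and>
     (\<forall>c. \<forall>f\<in>poly_ring n. \<theta> (const c * f) = const c * \<theta> f) \<and>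
     (\<forall>f\<in>poly_ring n. \<forall>g\<in>poly_ring n. \<theta> (f * g) = f * \<theta> g + g * \<theta> f)}"

definition partial :: "nat \<Rightarrow> nat \<Rightarrow> 'k::field mpoly \<Rightarrow> 'k mpoly" where
  "partial n i f =
     (if f \<in> poly_ring n then
        \<Sum>m\<in>Poly_Mapping.keys f.
          Poly_Mapping.single (m - Poly_Mapping.single i 1)
            (of_nat (Poly_Mapping.lookup m i) * Poly_Mapping.lookup f m)
      else 0)"

(* pdeg \<theta> = d, where \<theta> = \<Sum>i<n. \<theta>(x_i) D_i; the zero derivation has every degree. *)
definition has_pdeg :: "nat \<Rightarrow> ('k::field mpoly \<Rightarrow> 'k mpoly) \<Rightarrow> nat \<Rightarrow> bool" where
  "has_pdeg n \<theta> d \<longleftrightarrow> (\<forall>i<n. homogeneous d (\<theta> (var i)))"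

definition lin_comb ::
  "(nat \<Rightarrow> 'k::field mpoly) \<Rightarrow> ('k mpoly \<Rightarrow> 'k mpoly) list \<Rightarrow> 'k mpoly \<Rightarrow> 'k mpoly" where
  "lin_comb c \<theta>s = (\<lambda>f. \<Sum>i<length \<theta>s. c i * (\<theta>s ! i) f)"

(* \<theta>s is a basis of the poly_ring n - submodule D of Der n. *)
definition module_basis ::
  "nat \<Rightarrow> ('k::field mpoly \<Rightarrow> 'k mpoly) set \<Rightarrow> ('k mpoly \<Rightarrow> 'k mpoly) list \<Rightarrow> bool" where
  "module_basis n D \<theta>s \<longleftrightarrow>
     set \<theta>s \<subseteq> D \<and>
     (\<forall>\<theta>\<in>D. \<exists>c. (\<forall>i<length \<theta>s. c i \<in> poly_ring n) \<and> \<theta> = lin_comb c \<theta>s) \<and>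
     (\<forall>c. (\<forall>i<length \<theta>s. c i \<in> poly_ring n) \<and> lin_comb c \<theta>s = (\<lambda>_. 0)
        \<longrightarrow> (\<forall>i<length \<theta>s. c i = 0))"

(* A basis whose members are homogeneous, with polynomial degrees ds. *)
definition homogeneous_basis ::
  "nat \<Rightarrow> ('k::field mpoly \<Rightarrow> 'k mpoly) set \<Rightarrow> ('k mpoly \<Rightarrow> 'k mpoly) list \<Rightarrow> nat list \<Rightarrow> bool" where
  "homogeneous_basis n D \<theta>s ds \<longleftrightarrow> module_basis n D \<theta>s \<and> list_all2 (has_pdeg n) \<theta>s ds"

(* The coordinate polynomial \<Sum>i. \<alpha>(b_i) x_i of a linear form \<alpha>, where x_i is the i-th member of
   the basis dual to bs. *)
definition form_poly :: "'v list \<Rightarrow> ('v \<Rightarrow> 'k) \<Rightarrow> 'k::field mpoly" where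
  "form_poly bs \<alpha> = (\<Sum>i<length bs. const (\<alpha> (bs ! i)) * var i)"

definition localization :: "'v set set \<Rightarrow> 'v set \<Rightarrow> 'v set set" where
  "localization A X = {H \<in> A. X \<subseteq> H}"

definition restriction :: "'v set set \<Rightarrow> 'v set \<Rightarrow> 'v set set" where
  "restriction A X = {X \<inter> H |H. H \<in> A - localization A X}"

definition deletion :: "'v set set \<Rightarrow> ('v set \<Rightarrow> nat) \<Rightarrow> 'v set \<Rightarrow> 'v set set" where
  "deletion A \<mu> H0 = (if \<mu> H0 = 1 then A - {H0} else A)"

definition deletion_mult :: "('v set \<Rightarrow> nat) \<Rightarrow> 'v set \<Rightarrow> ('v set \<Rightarrow> nat)" where
  "deletion_mult \<mu> H0 = \<mu>(H0 := \<mu> H0 - 1)"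

definition concentrated_mult :: "'v set \<Rightarrow> nat \<Rightarrow> ('v set \<Rightarrow> nat)" where
  "concentrated_mult H0 m0 = (\<lambda>H. if H = H0 then m0 else 1)"

locale arrangement_space = vector_space scale
  for scale :: "'k::field \<Rightarrow> 'v::ab_group_add \<Rightarrow> 'v"
begin

(* Arrangements live in finite-dimensional subspaces X of the ambient space, which need not be
   finite-dimensional itself; restriction passes from X to a smaller subspace. *)

definition dual_space :: "'v set \<Rightarrow> ('v \<Rightarrow> 'k) set" where
  "dual_space X = {\<alpha>. (\<forall>u\<in>X. \<forall>v\<in>X. \<alpha> (u + v) = \<alpha> u + \<alpha> v) \<and>
                       (\<forall>c. \<forall>v\<in>X. \<alpha> (scale c v) = c * \<alpha> v)}"

definition defining_form :: "'v set \<Rightarrow> 'v set \<Rightarrow> ('v \<Rightarrow> 'k) \<Rightarrow> bool" where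
  "defining_form X H \<alpha> \<longleftrightarrow> \<alpha> \<in> dual_space X \<and> (\<exists>v\<in>X. \<alpha> v \<noteq> 0) \<and> H = {v \<in> X. \<alpha> v = 0}"

definition hyperplane :: "'v set \<Rightarrow> 'v set \<Rightarrow> bool" where
  "hyperplane X H \<longleftrightarrow> (\<exists>\<alpha>. defining_form X H \<alpha>)"

definition arrangement :: "'v set \<Rightarrow> 'v set set \<Rightarrow> bool" where
  "arrangement X A \<longleftrightarrow>
     (\<exists>B. finite B \<and> X = span B) \<and> finite A \<and> (\<forall>H\<in>A. hyperplane X H)"

(* Hyperplanes of multiplicity 0 are discarded, so multiplicities are positive. *)
definition multiarrangement :: "'v set \<Rightarrow> 'v set set \<Rightarrow> ('v set \<Rightarrow> nat) \<Rightarrow> bool" where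
  "multiarrangement X A \<mu> \<longleftrightarrow> arrangement X A \<and> (\<forall>H\<in>A. \<mu> H \<ge> 1)"

definition ordered_basis :: "'v set \<Rightarrow> 'v list \<Rightarrow> bool" where
  "ordered_basis X bs \<longleftrightarrow> distinct bs \<and> independent (set bs) \<and> span (set bs) = X"

(* D(A, \<mu>) in the coordinates on X given by the ordered basis bs.  The condition does not depend
   on the choice of the form \<alpha> defining H, which is unique up to a nonzero scalar. *)
definition D_mod ::
  "'v set \<Rightarrow> 'v list \<Rightarrow> 'v set set \<Rightarrow> ('v set \<Rightarrow> nat) \<Rightarrow> ('k mpoly \<Rightarrow> 'k mpoly) set" where
  "D_mod X bs A \<mu> = {\<theta> \<in> Der (length bs).
     \<forall>H\<in>A. \<forall>\<alpha>. defining_form X H \<alpha> \<longrightarrow>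
       (\<exists>g\<in>poly_ring (length bs). \<theta> (form_poly bs \<alpha>) = form_poly bs \<alpha> ^ \<mu> H * g)}"

(* (A, \<mu>) is free with exp(A, \<mu>) = E.  By the uniqueness of the exponents of a free
   multiarrangement, which also are the same in all coordinates, there is at most one such E. *)
definition has_exponents :: "'v set \<Rightarrow> 'v set set \<Rightarrow> ('v set \<Rightarrow> nat) \<Rightarrow> nat multiset \<Rightarrow> bool" where
  "has_exponents X A \<mu> E \<longleftrightarrow>
     (\<exists>bs \<theta>s ds. ordered_basis X bs \<and>
        homogeneous_basis (length bs) (D_mod X bs A \<mu>) \<theta>s ds \<and> E = mset ds)"

(* \<mu>^*(Y) = d.  The second conjunct says that the forms of the members of A_Y lie in the span of
   the first two coordinates, which have indices 0 and 1. *)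
definition euler_mult_at ::
  "'v set \<Rightarrow> 'v set set \<Rightarrow> ('v set \<Rightarrow> nat) \<Rightarrow> 'v set \<Rightarrow> 'v set \<Rightarrow> nat \<Rightarrow> bool" where
  "euler_mult_at X A \<mu> H0 Y d \<longleftrightarrow>
     (\<exists>bs \<alpha>0 \<theta> \<psi> ds. ordered_basis X bs \<and>
        (\<forall>H\<in>localization A Y. \<forall>\<alpha>. defining_form X H \<alpha> \<longrightarrow>
           (\<forall>i. 2 \<le> i \<and> i < length bs \<longrightarrow> \<alpha> (bs ! i) = 0)) \<and>
        homogeneous_basis (length bs) (D_mod X bs (localization A Y) \<mu>)
          (\<theta> # \<psi> # map (partial (length bs)) [2..<length bs]) (d # ds) \<and>
        defining_form X H0 \<alpha>0 \<and>
        \<theta> \<notin> {(\<lambda>f. form_poly bs \<alpha>0 * \<eta> f) |\<eta>. \<eta> \<in> Der (length bs)} \<and>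
        \<psi> \<in> {(\<lambda>f. form_poly bs \<alpha>0 * \<eta> f) |\<eta>. \<eta> \<in> Der (length bs)})"

definition euler_mult ::
  "'v set \<Rightarrow> 'v set set \<Rightarrow> ('v set \<Rightarrow> nat) \<Rightarrow> 'v set \<Rightarrow> ('v set \<Rightarrow> nat) \<Rightarrow> bool" where
  "euler_mult X A \<mu> H0 \<mu>' \<longleftrightarrow> (\<forall>Y\<in>restriction A H0. euler_mult_at X A \<mu> H0 Y (\<mu>' Y))"

inductive inductively_free :: "'v set \<Rightarrow> 'v set set \<Rightarrow> bool" where
  empty: "arrangement X {} \<Longrightarrow> inductively_free X {}"
| step: "\<lbrakk>arrangement X A; H0 \<in> A;
          inductively_free X (A - {H0});
          inductively_free H0 (restriction A H0);
          has_exponents X (A - {H0}) (\<lambda>_. 1) E';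
          has_exponents H0 (restriction A H0) (\<lambda>_. 1) E'';
          E'' \<subseteq># E'\<rbrakk> \<Longrightarrow> inductively_free X A"

inductive multi_inductively_free :: "'v set \<Rightarrow> 'v set set \<Rightarrow> ('v set \<Rightarrow> nat) \<Rightarrow> bool" where
  empty: "arrangement X {} \<Longrightarrow> multi_inductively_free X {} \<mu>"
| step: "\<lbrakk>multiarrangement X A \<mu>; H0 \<in> A;
          multi_inductively_free X (deletion A \<mu> H0) (deletion_mult \<mu> H0);
          euler_mult X A \<mu> H0 \<mu>';
          multi_inductively_free H0 (restriction A H0) \<mu>';
          has_exponents X (deletion A \<mu> H0) (deletion_mult \<mu> H0) E';
          has_exponents H0 (restriction A H0) \<mu>' E'';
          E'' \<subseteq># E'\<rbrakk> \<Longrightarrow> multi_inductively_free X A \<mu>"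

end

end

theory Submission
  imports Defs "Jordan_Normal_Form.Determinant"
begin

text \<open>Freeness is handled through matrices of coefficients. By Saito's criterion, homogeneous logarithmic
  derivations form a basis exactly if their determinant is a nonzero multiple of the defining
  polynomial (saito_expand, saito_of_basis), so that statements on exponents become statements on
  determinants and degrees.

  On this level, thickening a single hyperplane H0 is harmless. Whenever there is a basis, it can be
  chosen to contain the Euler derivation times a power of the form of H0. Splitting it off leaves derivations that annihilate the
  form of H0, and these are tangent to H0 to every order. So the concentrated multiplicities for all
  m are free together, and their exponents differ only in the exponent m (core_of_saito,
  saito_of_core). The restrictions of the remaining derivations to H0 prove Ziegler's theorem: with
  the multiplicity that counts the hyperplanes over each member, the restriction to H0 is free, and
  its exponents are those of the arrangement with a 1 removed (saito_ziegler).

  Let the concentrated multiarrangement be inductively free. An Euler multiplicity is the degree of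
  one of two derivations of a localization of rank two, which are known explicitly if the
  multiplicity is concentrated (conc_pair). If the deleted hyperplane H1 is not H0, it follows that
  the Euler restriction is concentrated at the intersection of H0 and H1. If it is H0, with a
  multiplicity of at least 2, the arrangement does not change. So the chain of deletions becomes one
  of simple arrangements (concentrated_imp_inductively_free).

  Let conversely the simple arrangement A be inductively free. The multiplicity of H0 is raised from 1
  to m one by one. In each step, the Euler restriction is Ziegler's restriction to H0, and the latter
  has to be inductively free. This is proved for all members H0 along with the induction
  (inductively_free_imp). Let H1 be the last hyperplane added. If H1 is not H0, let Y be the
  intersection of H0 and H1. Lowering the multiplicity of Y in Ziegler's restriction of A gives
  Ziegler's restriction of A - {H1}, and the Euler restriction to Y is Ziegler's restriction to Y of
  the restriction of A to H1 (euler_mult_ziegler). If H1 is H0, the simple restriction is inductively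
  free. All multiplicities between the simple one and Ziegler's are then free (saito_intermediate),
  and the Euler restrictions in the steps between them are again Ziegler restrictions
  (euler_mult_intermediate).

  The last two Euler multiplicities are the heart of the proof. They are local, while the hypothesis
  on exponents is global. What mediates is that the addition theorem makes restriction of derivations
  to H1 surjective (addition). A derivation of a localization becomes one of the whole restriction
  after multiplication by the forms outside of the localization. The latter lifts, and the lift of the
  local derivation is found in it as the coefficient of a monomial along the flat that occurs in the
  product of those forms (local_lift, local_transversal). Thus no generic points are used, and the
  field may be finite.\<close>

section \<open>Polynomials\<close>

lemma poly_as_sum: "f = (\<Sum>m\<in>Poly_Mapping.keys f. Poly_Mapping.single m (Poly_Mapping.lookup f m))"
proof (rule poly_mapping_eqI)
  fix k
  have "Poly_Mapping.lookup (\<Sum>m\<in>Poly_Mapping.keys f. Poly_Mapping.single m (Poly_Mapping.lookup f m)) k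
      = (\<Sum>m\<in>Poly_Mapping.keys f. if m = k then Poly_Mapping.lookup f k else 0)"
    by (auto simp: lookup_sum lookup_single when_def intro!: sum.cong)
  also have "\<dots> = Poly_Mapping.lookup f k"
    by (simp add: in_keys_iff)
  finally show "Poly_Mapping.lookup f k = Poly_Mapping.lookup
    (\<Sum>m\<in>Poly_Mapping.keys f. Poly_Mapping.single m (Poly_Mapping.lookup f m)) k" by simp
qed

lemma mpoly_add_induct [case_names zero single add]:
  fixes f :: "('a \<Rightarrow>\<^sub>0 'b::comm_monoid_add)"
  assumes "P 0" and "\<And>m c. P (Poly_Mapping.single m c)"
    and "\<And>f g. P f \<Longrightarrow> P g \<Longrightarrow> P (f + g)"
  shows "P f"
proof -
  have "P (\<Sum>m\<in>S. Poly_Mapping.single m (Poly_Mapping.lookup f m))" if "finite S" for S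
    using that by induction (use assms in auto)
  from this[of "Poly_Mapping.keys f"] show ?thesis by (simp flip: poly_as_sum)
qed

lemma const_simps [simp]:
  "const 0 = 0" "const 1 = 1" "const (a + b) = const a + const b" "const (- a) = - const a"
  "const (a - b) = const a - const b" "const (a * b) = const a * const b"
  by (simp_all add: const_def single_add single_uminus single_diff mult_single)

lemma const_eq_0_iff [simp]: "const c = 0 \<longleftrightarrow> c = 0"
  by (metis const_def const_simps(1) lookup_single_eq)

lemma const_sum: "const (\<Sum>i\<in>S. f i) = (\<Sum>i\<in>S. const (f i))"
  by (induction S rule: infinite_finite_induct) auto

lemma const_prod: "const (\<Prod>i\<in>S. f i) = (\<Prod>i\<in>S. const (f i))"
  by (induction S rule: infinite_finite_induct) auto

lemma const_power: "const (c ^ k) = const c ^ k"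
  by (induction k) auto

lemma const_inverse [simp]: "c \<noteq> 0 \<Longrightarrow> const c * const (inverse c) = 1"
  by (metis const_simps(2,6) right_inverse)

lemma lookup_const [simp]: "Poly_Mapping.lookup (const c * f) m = c * Poly_Mapping.lookup f m"
  unfolding const_def mult_map_scale_conv_mult[symmetric] by (simp add: Poly_Mapping.map.rep_eq when_def)

lemma const_unit: assumes "c \<noteq> 0" shows "const c * f dvd g \<longleftrightarrow> f dvd g"
proof
  assume "f dvd g"
  then obtain h where "g = f * h" by (auto simp: dvd_def)
  then have "g = (const c * f) * (const (inverse c) * h)"
    using const_inverse[OF assms] by (simp only: mult_ac) (metis mult.left_commute mult_1_right)
  then show "const c * f dvd g" by (metis dvd_triv_left)
qed (rule dvd_mult_right)

lemma const_unit2: assumes "c \<noteq> 0" shows "f dvd const c * g \<longleftrightarrow> f dvd g"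
proof
  assume "f dvd const c * g"
  then have "f dvd const (inverse c) * (const c * g)" by (rule dvd_mult)
  also have "const (inverse c) * (const c * g) = (const c * const (inverse c)) * g"
    by (simp only: mult_ac)
  also have "\<dots> = g" using const_inverse[OF assms] by simp
  finally show "f dvd g" .
qed (rule dvd_mult)

subsection \<open>The subrings in finitely many variables\<close>

lemma poly_ring_closed [simp, intro]:
  "0 \<in> poly_ring n" "1 \<in> poly_ring n" "const c \<in> poly_ring n" "i < n \<Longrightarrow> var i \<in> poly_ring n"
  "f \<in> poly_ring n \<Longrightarrow> g \<in> poly_ring n \<Longrightarrow> f + g \<in> poly_ring n"
  "f \<in> poly_ring n \<Longrightarrow> g \<in> poly_ring n \<Longrightarrow> f * g \<in> poly_ring n"
  "f \<in> poly_ring n \<Longrightarrow> - f \<in> poly_ring n"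
proof -
  show "0 \<in> poly_ring n" "1 \<in> poly_ring n" "const c \<in> poly_ring n"
    by (auto simp: poly_ring_def const_def)
  show "var i \<in> poly_ring n" if "i < n"
    using that by (auto simp: poly_ring_def var_def)
  show "f + g \<in> poly_ring n" if "f \<in> poly_ring n" "g \<in> poly_ring n"
    using that Poly_Mapping.keys_add[of f g] unfolding poly_ring_def by blast
  show "- f \<in> poly_ring n" if "f \<in> poly_ring n"
    using that by (simp add: poly_ring_def in_keys_iff)
  show "f * g \<in> poly_ring n" if "f \<in> poly_ring n" "g \<in> poly_ring n"
  proof -
    { fix m assume "m \<in> Poly_Mapping.keys (f * g)"
      then obtain p q where "p \<in> Poly_Mapping.keys f" "q \<in> Poly_Mapping.keys g" "m = p + q"
        using keys_mult[of f g] by blast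
      then have "Poly_Mapping.keys m \<subseteq> {..<n}"
        using that Poly_Mapping.keys_add[of p q] unfolding poly_ring_def by blast }
    then show ?thesis by (simp add: poly_ring_def)
  qed
qed

lemma poly_ring_closed2 [simp, intro]:
  "f \<in> poly_ring n \<Longrightarrow> g \<in> poly_ring n \<Longrightarrow> f - g \<in> poly_ring n"
  "(\<And>i. i \<in> S \<Longrightarrow> F i \<in> poly_ring n) \<Longrightarrow> (\<Sum>i\<in>S. F i) \<in> poly_ring n"
  "(\<And>i. i \<in> S \<Longrightarrow> F i \<in> poly_ring n) \<Longrightarrow> (\<Prod>i\<in>S. F i) \<in> poly_ring n"
  "f \<in> poly_ring n \<Longrightarrow> f ^ k \<in> poly_ring n"
proof -
  show "f \<in> poly_ring n \<Longrightarrow> g \<in> poly_ring n \<Longrightarrow> f - g \<in> poly_ring n"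
    using poly_ring_closed(5)[of f n "- g"] by simp
  show "(\<And>i. i \<in> S \<Longrightarrow> F i \<in> poly_ring n) \<Longrightarrow> (\<Sum>i\<in>S. F i) \<in> poly_ring n"
    by (induction S rule: infinite_finite_induct) auto
  show "(\<And>i. i \<in> S \<Longrightarrow> F i \<in> poly_ring n) \<Longrightarrow> (\<Prod>i\<in>S. F i) \<in> poly_ring n"
    by (induction S rule: infinite_finite_induct) auto
  show "f \<in> poly_ring n \<Longrightarrow> f ^ k \<in> poly_ring n"
    by (induction k) auto
qed

lemma poly_ring_mono: "n \<le> n' \<Longrightarrow> f \<in> poly_ring n \<Longrightarrow> f \<in> poly_ring n'"
  by (fastforce simp: poly_ring_def)

lemma poly_ring_single: "Poly_Mapping.keys m \<subseteq> {..<n} \<Longrightarrow> Poly_Mapping.single m c \<in> poly_ring n"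
  by (auto simp: poly_ring_def)

subsection \<open>Homogeneous polynomials\<close>

definition mon_deg :: "(nat \<Rightarrow>\<^sub>0 nat) \<Rightarrow> nat" where
  "mon_deg m = (\<Sum>i\<in>Poly_Mapping.keys m. Poly_Mapping.lookup m i)"

lemma mon_deg_superset: "finite S \<Longrightarrow> Poly_Mapping.keys m \<subseteq> S \<Longrightarrow> mon_deg m = (\<Sum>i\<in>S. Poly_Mapping.lookup m i)"
  unfolding mon_deg_def by (rule sum.mono_neutral_left) (auto simp: in_keys_iff)

lemma mon_deg_add [simp]: "mon_deg (p + q) = mon_deg p + mon_deg q"
proof -
  let ?S = "Poly_Mapping.keys p \<union> Poly_Mapping.keys q"
  have "mon_deg (p + q) = (\<Sum>i\<in>?S. Poly_Mapping.lookup (p + q) i)"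
    by (rule mon_deg_superset) (use Poly_Mapping.keys_add[of p q] in auto)
  also have "\<dots> = mon_deg p + mon_deg q"
    by (simp add: lookup_add sum.distrib mon_deg_superset[of ?S p] mon_deg_superset[of ?S q])
  finally show ?thesis .
qed

lemma mon_deg_zero [simp]: "mon_deg 0 = 0" "mon_deg (Poly_Mapping.single i k) = k"
  by (auto simp: mon_deg_def)

lemma mon_deg_eq_0 [simp]: "mon_deg m = 0 \<longleftrightarrow> m = 0"
  by (auto simp: mon_deg_def in_keys_iff intro!: poly_mapping_eqI)

lemma homogeneous_alt: "homogeneous d f \<longleftrightarrow> (\<forall>m\<in>Poly_Mapping.keys f. mon_deg m = d)"
  by (simp add: homogeneous_def mon_deg_def)

lemma homogeneous_add: "homogeneous d f \<Longrightarrow> homogeneous d g \<Longrightarrow> homogeneous d (f + g)"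
  using Poly_Mapping.keys_add[of f g] unfolding homogeneous_alt by blast

lemma homogeneous_uminus: "homogeneous d f \<Longrightarrow> homogeneous d (- f)"
  by (simp add: homogeneous_alt in_keys_iff)

lemma homogeneous_diff: "homogeneous d f \<Longrightarrow> homogeneous d g \<Longrightarrow> homogeneous d (f - g)"
  using homogeneous_add[OF _ homogeneous_uminus, of d f g] by simp

lemma homogeneous_base:
  "homogeneous d 0" "homogeneous 0 1" "homogeneous 0 (const c)" "homogeneous 1 (var i)" "homogeneous (Suc 0) (var i)"
  by (auto simp: homogeneous_alt const_def var_def)

lemmas homogeneous_intros [simp, intro] =
  homogeneous_base homogeneous_add homogeneous_uminus homogeneous_diff

lemma homogeneous_mult: "homogeneous d f \<Longrightarrow> homogeneous e g \<Longrightarrow> homogeneous (d + e) (f * g)"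
  using keys_mult[of f g] unfolding homogeneous_alt by fastforce

lemma homogeneous_const_mult: "homogeneous d g \<Longrightarrow> homogeneous d (const c * g)"
  using homogeneous_mult[of 0 "const c" d g] by simp

lemma homogeneous_sum: "(\<And>i. i \<in> S \<Longrightarrow> homogeneous d (F i)) \<Longrightarrow> homogeneous d (\<Sum>i\<in>S. F i)"
  by (induction S rule: infinite_finite_induct) auto

lemma homogeneous_prod:
  "(\<And>i. i \<in> S \<Longrightarrow> homogeneous (d i) (F i)) \<Longrightarrow> homogeneous (\<Sum>i\<in>S. d i) (\<Prod>i\<in>S. F i)"
  by (induction S rule: infinite_finite_induct) (auto intro: homogeneous_mult)

lemma homogeneous_power: "homogeneous d f \<Longrightarrow> homogeneous (d * k) (f ^ k)"
  by (induction k) (auto intro: homogeneous_mult)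

lemma homogeneous_unique: "homogeneous d f \<Longrightarrow> homogeneous e f \<Longrightarrow> f \<noteq> 0 \<Longrightarrow> d = e"
  unfolding homogeneous_alt keys_eq_empty[symmetric] by (metis all_not_in_conv)

lemma homogeneous_0_const: "homogeneous 0 f \<Longrightarrow> f = const (Poly_Mapping.lookup f 0)"
  unfolding const_def
  by (rule poly_mapping_eqI) (auto simp: homogeneous_alt lookup_single when_def in_keys_iff)

text \<open>Replacing each coefficient of an expansion by its homogeneous component of the right
  degree turns any expansion of a homogeneous element into a homogeneous one.\<close>

lift_definition hcomp :: "nat \<Rightarrow> 'k::field mpoly \<Rightarrow> 'k mpoly"
  is "\<lambda>d f m. if mon_deg m = d then f m else 0"
  by (auto intro: finite_subset)

lemma hcomp_add [simp]: "hcomp d (f + g) = hcomp d f + hcomp d g"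
  by (rule poly_mapping_eqI) (simp add: hcomp.rep_eq lookup_add)

lemma hcomp_0 [simp]: "hcomp d 0 = 0"
  by (rule poly_mapping_eqI) (simp add: hcomp.rep_eq)

lemma hcomp_sum: "hcomp d (\<Sum>i\<in>S. F i) = (\<Sum>i\<in>S. hcomp d (F i))"
  by (induction S rule: infinite_finite_induct) auto

lemma hcomp_single: "hcomp d (Poly_Mapping.single m c) = (if mon_deg m = d then Poly_Mapping.single m c else 0)"
  by (rule poly_mapping_eqI) (auto simp: hcomp.rep_eq lookup_single when_def)

lemma homogeneous_hcomp [simp, intro]: "homogeneous d (hcomp d f)"
  by (auto simp: homogeneous_alt in_keys_iff hcomp.rep_eq split: if_splits)

lemma hcomp_id: "homogeneous d f \<Longrightarrow> hcomp d f = f"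
  by (rule poly_mapping_eqI) (auto simp: hcomp.rep_eq homogeneous_alt in_keys_iff)

lemma poly_ring_hcomp [simp, intro]: "f \<in> poly_ring n \<Longrightarrow> hcomp d f \<in> poly_ring n"
  unfolding poly_ring_def by (auto simp: in_keys_iff[of _ f] in_keys_iff[of _ "hcomp d f"] hcomp.rep_eq split: if_splits)

lemma lookup_hcomp_0 [simp]: "hcomp 0 f = const (Poly_Mapping.lookup f 0)"
  by (rule poly_mapping_eqI) (auto simp: hcomp.rep_eq const_def lookup_single when_def)

lemma hcomp_mult:
  assumes "homogeneous e p"
  shows "hcomp d (p * f) = (if e \<le> d then p * hcomp (d - e) f else 0)"
proof (induction f rule: mpoly_add_induct)
  case (single m c)
  have "hcomp d (p * Poly_Mapping.single m c) =
    (\<Sum>k\<in>Poly_Mapping.keys p. hcomp d (Poly_Mapping.single k (Poly_Mapping.lookup p k) * Poly_Mapping.single m c))"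
    by (subst poly_as_sum[of p]) (simp add: sum_distrib_right hcomp_sum)
  also have "\<dots> = (\<Sum>k\<in>Poly_Mapping.keys p. if e \<le> d then
      Poly_Mapping.single k (Poly_Mapping.lookup p k) * hcomp (d - e) (Poly_Mapping.single m c) else 0)"
    by (rule sum.cong) (use assms in \<open>auto simp: mult_single hcomp_single homogeneous_alt\<close>)
  also have "\<dots> = (if e \<le> d then p * hcomp (d - e) (Poly_Mapping.single m c) else 0)"
  proof (cases "e \<le> d")
    case True
    then show ?thesis
      by (simp only: if_True sum_distrib_right[symmetric] poly_as_sum[of p, symmetric])
  qed simp
  finally show ?case .
qed (auto simp: algebra_simps)

lemma homogeneous_factor:
  assumes "homogeneous d (f * g)" "homogeneous e f" "f \<noteq> 0" "g \<noteq> 0"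
  shows "e \<le> d \<and> homogeneous (d - e) g"
proof -
  have "f * g = (if e \<le> d then f * hcomp (d - e) g else 0)"
    using hcomp_id[OF assms(1)] hcomp_mult[OF assms(2)] by simp
  then show ?thesis using assms(3,4) by (auto split: if_splits) (metis homogeneous_hcomp)
qed

lemma homogeneous_dvd_hcomp: "homogeneous e p \<Longrightarrow> p dvd f \<Longrightarrow> p dvd hcomp d f"
  by (auto simp: dvd_def hcomp_mult)

lemma homogeneous_unit:
  assumes "homogeneous d f" "f dvd 1" shows "\<exists>c. c \<noteq> 0 \<and> f = const c"
proof -
  obtain g where g: "1 = f * g" using assms by (auto simp: dvd_def)
  then have "f \<noteq> 0" "g \<noteq> 0" by auto
  with homogeneous_factor[of 0 f g d] assms g have "d = 0" by auto
  then show ?thesis using assms homogeneous_0_const \<open>f \<noteq> 0\<close> by (metis const_simps(1))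
qed

subsection \<open>Substitution\<close>

definition mon_eval :: "(nat \<Rightarrow> 'k::field mpoly) \<Rightarrow> (nat \<Rightarrow>\<^sub>0 nat) \<Rightarrow> 'k mpoly" where
  "mon_eval s m = (\<Prod>i\<in>Poly_Mapping.keys m. s i ^ Poly_Mapping.lookup m i)"

definition poly_subst :: "(nat \<Rightarrow> 'k::field mpoly) \<Rightarrow> 'k mpoly \<Rightarrow> 'k mpoly" where
  "poly_subst s f = (\<Sum>m\<in>Poly_Mapping.keys f. const (Poly_Mapping.lookup f m) * mon_eval s m)"

lemma mon_eval_superset:
  "finite S \<Longrightarrow> Poly_Mapping.keys m \<subseteq> S \<Longrightarrow> mon_eval s m = (\<Prod>i\<in>S. s i ^ Poly_Mapping.lookup m i)"
  unfolding mon_eval_def by (rule prod.mono_neutral_left) (auto simp: in_keys_iff)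

lemma mon_eval_add: "mon_eval s (p + q) = mon_eval s p * mon_eval s q"
proof -
  let ?S = "Poly_Mapping.keys p \<union> Poly_Mapping.keys q"
  have "mon_eval s (p + q) = (\<Prod>i\<in>?S. s i ^ Poly_Mapping.lookup (p + q) i)"
    by (rule mon_eval_superset) (use Poly_Mapping.keys_add[of p q] in auto)
  also have "\<dots> = mon_eval s p * mon_eval s q"
    by (simp add: lookup_add power_add prod.distrib mon_eval_superset[of ?S p] mon_eval_superset[of ?S q])
  finally show ?thesis .
qed

lemma poly_subst_superset:
  assumes "finite S" "Poly_Mapping.keys f \<subseteq> S"
  shows "poly_subst s f = (\<Sum>m\<in>S. const (Poly_Mapping.lookup f m) * mon_eval s m)"
  unfolding poly_subst_def by (rule sum.mono_neutral_left) (use assms in \<open>auto simp: in_keys_iff\<close>)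

lemma poly_subst_add [simp]: "poly_subst s (f + g) = poly_subst s f + poly_subst s g"
proof -
  let ?S = "Poly_Mapping.keys f \<union> Poly_Mapping.keys g"
  have "poly_subst s (f + g) = (\<Sum>m\<in>?S. const (Poly_Mapping.lookup (f + g) m) * mon_eval s m)"
    by (rule poly_subst_superset) (use Poly_Mapping.keys_add[of f g] in auto)
  then show ?thesis
    by (simp add: lookup_add algebra_simps sum.distrib poly_subst_superset[of ?S f] poly_subst_superset[of ?S g])
qed

lemma poly_subst_single: "poly_subst s (Poly_Mapping.single m c) = const c * mon_eval s m"
  by (auto simp: poly_subst_def)

lemma poly_subst_simps [simp]:
  "poly_subst s 0 = 0" "poly_subst s (const c) = const c" "poly_subst s (var i) = s i" "poly_subst s 1 = 1"
proof -
  show "poly_subst s 0 = 0" by (simp add: poly_subst_def)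
  show *: "poly_subst s (const c) = const c" for c
    by (simp add: const_def poly_subst_single) (simp add: const_def mon_eval_def)
  show "poly_subst s 1 = 1" using *[of 1] by simp
  show "poly_subst s (var i) = s i"
    by (simp add: var_def poly_subst_single) (simp add: mon_eval_def)
qed

lemma poly_subst_mult [simp]: "poly_subst s (f * g) = poly_subst s f * poly_subst s g"
proof (induction f rule: mpoly_add_induct)
  case (single m c)
  show ?case
    by (induction g rule: mpoly_add_induct)
      (simp_all add: mult_single poly_subst_single mon_eval_add algebra_simps)
qed (auto simp: algebra_simps)

lemma poly_subst_uminus [simp]: "poly_subst s (- f) = - poly_subst s f"
  using poly_subst_add[of s f "- f"] by (simp add: eq_neg_iff_add_eq_0 add.commute)

lemma poly_subst_minus [simp]: "poly_subst s (f - g) = poly_subst s f - poly_subst s g"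
  using poly_subst_add[of s f "- g"] by simp

lemma poly_subst_sum: "poly_subst s (\<Sum>i\<in>S. F i) = (\<Sum>i\<in>S. poly_subst s (F i))"
  by (induction S rule: infinite_finite_induct) auto

lemma poly_subst_prod: "poly_subst s (\<Prod>i\<in>S. F i) = (\<Prod>i\<in>S. poly_subst s (F i))"
  by (induction S rule: infinite_finite_induct) auto

lemma poly_subst_power [simp]: "poly_subst s (f ^ k) = poly_subst s f ^ k"
  by (induction k) auto

lemma poly_subst_hom: "comm_ring_hom (poly_subst s)"
  by unfold_locales auto

lemma poly_subst_dvd: "f dvd g \<Longrightarrow> poly_subst s f dvd poly_subst s g"
  by (auto simp: dvd_def)

lemma poly_subst_id [simp]: "poly_subst var f = f"
proof (induction f rule: mpoly_add_induct)
  case (single m c)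
  have "mon_eval var m = Poly_Mapping.single (\<Sum>i\<in>S. Poly_Mapping.single i (Poly_Mapping.lookup m i)) (1::'a)"
    if "S = Poly_Mapping.keys m" for S
    unfolding mon_eval_def that[symmetric]
  proof (induction S rule: infinite_finite_induct)
    case (insert i F)
    have "(var i :: 'a mpoly) ^ k = Poly_Mapping.single (Poly_Mapping.single i k) 1" for k
      by (induction k) (auto simp: var_def mult_single simp flip: Poly_Mapping.single_add)
    then show ?case using insert by (simp add: mult_single)
  qed auto
  then have "mon_eval var m = Poly_Mapping.single m (1::'a)" using poly_as_sum[of m] by simp
  then show ?case by (simp add: poly_subst_single const_def mult_single)
qed auto

lemma poly_subst_comp: "poly_subst s (poly_subst t f) = poly_subst (\<lambda>i. poly_subst s (t i)) f"
proof (induction f rule: mpoly_add_induct)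
  case (single m c)
  show ?case by (simp add: poly_subst_single mon_eval_def poly_subst_prod)
qed auto

lemma mon_eval_cong: "(\<And>i. i \<in> Poly_Mapping.keys m \<Longrightarrow> s i = t i) \<Longrightarrow> mon_eval s m = mon_eval t m"
  unfolding mon_eval_def by (rule prod.cong) auto

lemma poly_subst_in_poly_ring:
  assumes "f \<in> poly_ring n" "\<And>i. i < n \<Longrightarrow> s i \<in> poly_ring k"
  shows "poly_subst s f \<in> poly_ring k"
  using assms unfolding poly_subst_def mon_eval_def poly_ring_def[of n] by (auto intro!: poly_ring_closed2 poly_ring_closed)

lemma homogeneous_poly_subst:
  assumes "homogeneous d f" "\<And>i. homogeneous 1 (s i)"
  shows "homogeneous d (poly_subst s f)"
proof -
  have "homogeneous (mon_deg m) (mon_eval s m)" for m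
    unfolding mon_deg_def mon_eval_def
    by (rule homogeneous_prod) (use homogeneous_power[OF assms(2)] in auto)
  then show ?thesis using assms unfolding poly_subst_def homogeneous_alt[of d f]
    by (intro homogeneous_sum homogeneous_const_mult) force
qed

lemma poly_subst_congruent:
  assumes "\<And>i. d dvd s i - t i"
  shows "d dvd poly_subst s f - poly_subst t f"
proof -
  have pow: "d dvd s i ^ k - t i ^ k" for i k
  proof (induction k)
    case (Suc k)
    have "s i ^ Suc k - t i ^ Suc k = s i * (s i ^ k - t i ^ k) + (s i - t i) * t i ^ k"
      by (simp add: algebra_simps)
    then show ?case using Suc assms by (auto intro!: dvd_add dvd_mult dvd_mult2)
  qed auto
  have pr: "d dvd (\<Prod>i\<in>S. s i ^ e i) - (\<Prod>i\<in>S. t i ^ e i)" if "finite S" for S and e :: "nat \<Rightarrow> nat"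
    using that
  proof (induction S)
    case (insert x F)
    have "(\<Prod>i\<in>insert x F. s i ^ e i) - (\<Prod>i\<in>insert x F. t i ^ e i)
      = s x ^ e x * ((\<Prod>i\<in>F. s i ^ e i) - (\<Prod>i\<in>F. t i ^ e i)) + (s x ^ e x - t x ^ e x) * (\<Prod>i\<in>F. t i ^ e i)"
      using insert by (simp add: algebra_simps)
    then show ?case using insert pow by (auto intro!: dvd_add dvd_mult dvd_mult2)
  qed auto
  have "poly_subst s f - poly_subst t f =
    (\<Sum>m\<in>Poly_Mapping.keys f. const (Poly_Mapping.lookup f m) * (mon_eval s m - mon_eval t m))"
    by (simp add: poly_subst_def algebra_simps sum_subtractf)
  also have "d dvd \<dots>"
    by (intro dvd_sum dvd_mult) (auto simp: mon_eval_def pr)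
  finally show ?thesis .
qed

subsection \<open>Coefficients with respect to the last variables\<close>

text \<open>A polynomial is regarded as one in the variables of index at least r, with
  coefficients in the polynomial ring of the first r variables; this is the coefficient of the
  monomial a. The map is linear over that ring. For a = 0 it serves to find quotients within a
  polynomial ring, and for other a to extract derivations of a localization.\<close>

lift_definition zcoeff :: "nat \<Rightarrow> (nat \<Rightarrow>\<^sub>0 nat) \<Rightarrow> 'k::field mpoly \<Rightarrow> 'k mpoly"
  is "\<lambda>r a f m. if Poly_Mapping.keys m \<subseteq> {..<r} then f (m + a) else 0"
proof -
  fix r a and f :: "(nat \<Rightarrow>\<^sub>0 nat) \<Rightarrow> 'k" assume "finite {x. f x \<noteq> 0}"
  then have "finite ((\<lambda>m. m + a) -` {x. f x \<noteq> 0})"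
    by (rule finite_vimageI) (simp add: inj_def)
  then show "finite {m. (if Poly_Mapping.keys m \<subseteq> {..<r} then f (m + a) else 0) \<noteq> 0}"
    by (rule rev_finite_subset) auto
qed

lemma zcoeff_add [simp]: "zcoeff r a (f + g) = zcoeff r a f + zcoeff r a g"
  by (rule poly_mapping_eqI) (simp add: zcoeff.rep_eq lookup_add)

lemma zcoeff_0 [simp]: "zcoeff r a 0 = 0"
  by (rule poly_mapping_eqI) (simp add: zcoeff.rep_eq)

lemma zcoeff_sum: "zcoeff r a (\<Sum>i\<in>S. F i) = (\<Sum>i\<in>S. zcoeff r a (F i))"
  by (induction S rule: infinite_finite_induct) auto

lemma zcoeff_in_poly_ring [simp, intro]: "zcoeff r a f \<in> poly_ring r"
  unfolding poly_ring_def by (auto simp: in_keys_iff[of _ "zcoeff r a f"] zcoeff.rep_eq split: if_splits)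

lemma lookup_zcoeff_0 [simp]: "Poly_Mapping.lookup (zcoeff r a f) 0 = Poly_Mapping.lookup f a"
  by (simp add: zcoeff.rep_eq)

lemma zcoeff_single_mult:
  assumes a: "Poly_Mapping.keys a \<inter> {..<r} = {}" and k: "Poly_Mapping.keys k \<subseteq> {..<r}"
  shows "zcoeff r a (Poly_Mapping.single k u * f) = Poly_Mapping.single k u * zcoeff r a f"
proof (induction f rule: mpoly_add_induct)
  case (single m v)
  have la: "Poly_Mapping.lookup a i = 0" if "i < r" for i
    using a that by (metis IntI empty_iff in_keys_iff lessThan_iff)
  have lk: "Poly_Mapping.lookup j i = 0" if "r \<le> i" "Poly_Mapping.keys j \<subseteq> {..<r}" for i j
    using that by (metis subsetD in_keys_iff lessThan_iff not_less)
  define cond where "cond m' = (\<forall>i. i < r \<or> Poly_Mapping.lookup m' i = Poly_Mapping.lookup a i)" for m'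
  have eq: "zcoeff r a (Poly_Mapping.single m' w) = (if cond m' then Poly_Mapping.single (m' - a) w else 0)"
    for m' and w :: 'a
  proof (rule poly_mapping_eqI)
    fix j
    have "m' = j + a \<and> Poly_Mapping.keys j \<subseteq> {..<r} \<longleftrightarrow> cond m' \<and> m' - a = j"
    proof (intro iffI conjI; elim conjE)
      assume *: "m' = j + a" "Poly_Mapping.keys j \<subseteq> {..<r}"
      show "cond m'" using lk[OF _ *(2)] by (simp add: cond_def *(1) lookup_add linorder_not_less disj_imp)
      show "m' - a = j" using * by simp
    next
      assume *: "cond m'" "m' - a = j"
      show "m' = j + a"
      proof (rule poly_mapping_eqI)
        fix i show "Poly_Mapping.lookup m' i = Poly_Mapping.lookup (j + a) i"
          unfolding *(2)[symmetric] using *(1) la[of i] by (cases "i < r") (auto simp: cond_def lookup_add lookup_minus)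
      qed
      show "Poly_Mapping.keys j \<subseteq> {..<r}"
      proof
        fix i assume "i \<in> Poly_Mapping.keys j"
        then have "Poly_Mapping.lookup j i \<noteq> 0" by (simp add: in_keys_iff)
        then show "i \<in> {..<r}" unfolding *(2)[symmetric] using *(1)
          by (cases "i < r") (auto simp: cond_def lookup_minus)
      qed
    qed
    then show "Poly_Mapping.lookup (zcoeff r a (Poly_Mapping.single m' w)) j
      = Poly_Mapping.lookup (if cond m' then Poly_Mapping.single (m' - a) w else 0) j"
      by (auto simp: zcoeff.rep_eq lookup_single when_def)
  qed
  have c: "cond (k + m) = cond m"
    using lk[OF _ k] by (simp add: cond_def lookup_add disj_imp linorder_not_less)
  moreover have "k + m - a = k + (m - a)" if "cond m"
  proof (rule poly_mapping_eqI)
    fix i show "Poly_Mapping.lookup (k + m - a) i = Poly_Mapping.lookup (k + (m - a)) i"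
      using that la[of i] lk[OF _ k, of i] by (cases "i < r") (auto simp: cond_def lookup_add lookup_minus)
  qed
  ultimately show ?case using eq by (simp add: mult_single)
qed (auto simp: algebra_simps)

lemma zcoeff_mult:
  assumes a: "Poly_Mapping.keys a \<inter> {..<r} = {}" and p: "p \<in> poly_ring r"
  shows "zcoeff r a (p * f) = p * zcoeff r a f"
proof -
  have "zcoeff r a (p * f) =
    (\<Sum>k\<in>Poly_Mapping.keys p. zcoeff r a (Poly_Mapping.single k (Poly_Mapping.lookup p k) * f))"
    by (subst poly_as_sum[of p]) (simp add: sum_distrib_right zcoeff_sum)
  also have "\<dots> = (\<Sum>k\<in>Poly_Mapping.keys p. Poly_Mapping.single k (Poly_Mapping.lookup p k) * zcoeff r a f)"
    by (rule sum.cong) (use p in \<open>auto intro!: zcoeff_single_mult[OF a] simp: poly_ring_def\<close>)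
  also have "\<dots> = p * zcoeff r a f"
    by (simp only: sum_distrib_right[symmetric] poly_as_sum[of p, symmetric])
  finally show ?thesis .
qed

lemma zcoeff_id: "f \<in> poly_ring n \<Longrightarrow> zcoeff n 0 f = f"
proof (rule poly_mapping_eqI)
  fix k assume "f \<in> poly_ring n"
  then have "Poly_Mapping.lookup f k = 0" if "\<not> Poly_Mapping.keys k \<subseteq> {..<n}"
    using that unfolding poly_ring_def by (metis (no_types, lifting) in_keys_iff mem_Collect_eq)
  then show "Poly_Mapping.lookup (zcoeff n 0 f) k = Poly_Mapping.lookup f k"
    by (simp add: zcoeff.rep_eq)
qed

lemma dvd_in_poly_ring:
  assumes "f dvd g" "f \<in> poly_ring n" "g \<in> poly_ring n"
  shows "\<exists>h\<in>poly_ring n. g = f * h"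
proof -
  obtain h where h: "g = f * h" using assms by (auto simp: dvd_def)
  have "zcoeff n 0 (f * h) = f * zcoeff n 0 h"
    using assms by (intro zcoeff_mult) auto
  then have "g = f * zcoeff n 0 h" using zcoeff_id[OF assms(3)] h by metis
  then show ?thesis by blast
qed

section \<open>Linear forms\<close>

definition lform :: "nat \<Rightarrow> (nat \<Rightarrow> 'k::field) \<Rightarrow> 'k mpoly" where
  "lform n a = (\<Sum>i<n. const (a i) * var i)"

lemma lform_in_poly_ring [simp, intro]: "lform n a \<in> poly_ring n"
  by (auto simp: lform_def)

lemma homogeneous_lform [simp, intro]: "homogeneous 1 (lform n a)" "homogeneous (Suc 0) (lform n a)"
  unfolding lform_def by (auto intro!: homogeneous_sum homogeneous_const_mult)

lemma lform_cong: "(\<And>i. i < n \<Longrightarrow> a i = b i) \<Longrightarrow> lform n a = lform n b"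
  by (simp add: lform_def)

lemma lform_scale: "lform n (\<lambda>i. c * a i) = const c * lform n a"
  by (simp add: lform_def sum_distrib_left mult.assoc)

lemma poly_subst_lform: "poly_subst s (lform n a) = (\<Sum>i<n. const (a i) * s i)"
  by (simp add: lform_def poly_subst_sum)

lemma single_1_eq_iff [simp]: "Poly_Mapping.single i (1::nat) = Poly_Mapping.single k 1 \<longleftrightarrow> i = k"
proof
  assume "Poly_Mapping.single i (1::nat) = Poly_Mapping.single k 1"
  from arg_cong[OF this, of Poly_Mapping.keys] show "i = k" by simp
qed simp

lemma lookup_lform: "k < n \<Longrightarrow> Poly_Mapping.lookup (lform n a) (Poly_Mapping.single k 1) = a k"
proof -
  assume k: "k < n"
  have "Poly_Mapping.lookup (const (a i) * var i) (Poly_Mapping.single k 1) = (if i = k then a k else 0)" for i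
    unfolding var_def lookup_const lookup_single when_def single_1_eq_iff by simp
  then show ?thesis using k by (simp add: lform_def lookup_sum)
qed

lemma lform_eq_0_iff: "lform n a = 0 \<longleftrightarrow> (\<forall>i<n. a i = 0)"
  using lookup_lform[of _ n a] by (auto simp: lform_def)

lemma lform_unit: "k < n \<Longrightarrow> lform n (\<lambda>i. if i = k then c else 0) = const c * var k"
  by (simp add: lform_def if_distrib[of const] if_distrib[of "\<lambda>x. x * _"] cong: if_cong)

lemma lform_eq_var: "k < n \<Longrightarrow> (\<And>i. i < n \<Longrightarrow> i \<noteq> k \<Longrightarrow> a i = 0) \<Longrightarrow> lform n a = const (a k) * var k"
  by (subst lform_unit[symmetric, of k n]) (auto intro: lform_cong)

lemma lform_eq_smaller: "r \<le> n \<Longrightarrow> (\<And>i. r \<le> i \<Longrightarrow> i < n \<Longrightarrow> a i = 0) \<Longrightarrow> lform n a = lform r a"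
  unfolding lform_def by (rule sum.mono_neutral_right) auto

text \<open>A linear form generates the kernel of the substitution that solves it for one of its
  variables. As the target of that substitution is an integral domain, linear forms are prime.\<close>

lemma lform_dvd_iff:
  assumes k: "k < n" "a k \<noteq> 0"
  shows "lform n a dvd f \<longleftrightarrow>
    poly_subst (\<lambda>i. if i = k then - (const (inverse (a k)) * lform n (a(k := 0))) else var i) f = 0"
    (is "_ \<longleftrightarrow> poly_subst ?s f = 0")
proof
  have split: "lform n b = const (b k) * var k + lform n (b(k := 0))" for b :: "nat \<Rightarrow> 'a"
    unfolding lform_def using k by (simp add: sum.remove[of _ k])
  have low: "poly_subst ?s (lform n (a(k := 0))) = lform n (a(k := 0))"
    unfolding poly_subst_lform unfolding lform_def by (rule sum.cong) auto
  { assume "lform n a dvd f"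
    then have "poly_subst ?s (lform n a) dvd poly_subst ?s f" by (rule poly_subst_dvd)
    moreover have "poly_subst ?s (lform n a) = 0"
      using const_inverse[OF k(2)] by (subst split) (simp add: low flip: mult.assoc)
    ultimately show "poly_subst ?s f = 0" by simp }
  assume f: "poly_subst ?s f = 0"
  have "lform n a dvd var i - ?s i" for i
  proof (cases "i = k")
    case True
    have "var k - ?s k = const (inverse (a k)) * lform n a"
      using const_inverse[OF k(2)] by (subst split) (simp add: algebra_simps mult.left_commute flip: mult.assoc)
    then show ?thesis using True by simp
  qed simp
  then have "lform n a dvd poly_subst var f - poly_subst ?s f"
    by (rule poly_subst_congruent)
  then show "lform n a dvd f" using f by simp
qed

lemma prime_lform:
  assumes "k < n" "a k \<noteq> 0"
  shows "prime_elem (lform n a)"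
proof (rule prime_elemI)
  show "lform n a \<noteq> 0" using assms by (auto simp: lform_eq_0_iff)
  show "\<not> lform n a dvd 1" by (subst lform_dvd_iff[of k n a, OF assms]) simp
  show "lform n a dvd f \<or> lform n a dvd g" if "lform n a dvd f * g" for f g
    using that unfolding lform_dvd_iff[of k n a, OF assms] by simp
qed

lemma prime_var: "prime_elem (var k)"
  using prime_lform[of k "Suc k" "\<lambda>i. if i = k then 1 else 0"] by (simp add: lform_unit)

lemma var_nonzero [simp]: "var k \<noteq> 0"
  using prime_var[of k] by (auto simp: prime_elem_def)

lemma lform_dvd_lform:
  assumes "lform n a dvd lform n b" "k < n" "b k \<noteq> 0"
  shows "\<exists>c. c \<noteq> 0 \<and> (\<forall>i<n. b i = c * a i)"
proof -
  have b: "lform n b \<noteq> 0" using assms by (auto simp: lform_eq_0_iff)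
  obtain g where g: "lform n b = lform n a * g" using assms by (auto simp: dvd_def)
  then have "lform n a \<noteq> 0" "g \<noteq> 0" using b by auto
  with g homogeneous_factor[of 1 "lform n a" g 1] have "homogeneous 0 g"
    by (metis diff_self_eq_0 homogeneous_lform(1))
  then obtain c where c: "g = const c" using homogeneous_0_const by blast
  then have "lform n b = lform n (\<lambda>i. c * a i)" using g by (simp add: lform_scale mult.commute)
  then have "b i = c * a i" if "i < n" for i using lookup_lform[OF that] by metis
  moreover have "c \<noteq> 0" using c \<open>g \<noteq> 0\<close> by auto
  ultimately show ?thesis by blast
qed

definition nonprop :: "nat \<Rightarrow> 'i set \<Rightarrow> ('i \<Rightarrow> nat \<Rightarrow> 'k::field) \<Rightarrow> bool" where
  "nonprop n I a \<longleftrightarrow> finite I \<and> (\<forall>h\<in>I. \<exists>k<n. a h k \<noteq> 0) \<and>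
     (\<forall>h\<in>I. \<forall>h'\<in>I. (\<exists>c. \<forall>k<n. a h' k = c * a h k) \<longrightarrow> h = h')"

lemma nonprop_subset: "nonprop n I a \<Longrightarrow> J \<subseteq> I \<Longrightarrow> nonprop n J a"
  unfolding nonprop_def by (meson finite_subset subsetD)

lemma nonprop_finite: "nonprop n I a \<Longrightarrow> finite I"
  by (simp add: nonprop_def)

lemma nonprop_prime: "nonprop n I a \<Longrightarrow> h \<in> I \<Longrightarrow> prime_elem (lform n (a h))"
  by (metis nonprop_def prime_lform)

lemma nonprop_not_dvd: "nonprop n I a \<Longrightarrow> h \<in> I \<Longrightarrow> h' \<in> I \<Longrightarrow> lform n (a h) dvd lform n (a h') \<Longrightarrow> h = h'"
  unfolding nonprop_def by (metis lform_dvd_lform)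

lemma prime_power_dvd_cancel:
  fixes p :: "'a::idom"
  assumes p: "prime_elem p" and u: "\<not> p dvd u" and "p ^ m dvd u * g"
  shows "p ^ m dvd g"
  using assms(3)
proof (induction m arbitrary: g)
  case (Suc m)
  have p0: "p \<noteq> 0" using p by (simp add: prime_elem_def)
  have "p dvd p ^ Suc m" by simp
  then have "p dvd u * g" using Suc.prems by (rule dvd_trans)
  then have "p dvd g" using prime_elem_dvd_multD[OF p] u by blast
  then obtain g' where g': "g = p * g'" by (rule dvdE)
  have "p * p ^ m dvd p * (u * g')" using Suc.prems unfolding g' power_Suc by (simp only: mult.left_commute)
  then have "p ^ m dvd u * g'" using p0 by (simp only: dvd_mult_cancel_left) simp
  then have "p ^ m dvd g'" by (rule Suc.IH)
  then show ?case unfolding g' power_Suc by (rule mult_dvd_mono[OF dvd_refl])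
qed simp

lemma prime_dvd_prodD:
  fixes p :: "'a::idom"
  assumes "prime_elem p" "p dvd (\<Prod>i\<in>S. f i)"
  shows "\<exists>i\<in>S. p dvd f i"
  using assms(2)
proof (induction S rule: infinite_finite_induct)
  case (insert x F)
  then show ?case using prime_elem_dvd_multD[OF assms(1), of "f x" "\<Prod>i\<in>F. f i"] by auto
qed (use assms(1) in \<open>auto simp: prime_elem_def\<close>)

lemma prime_powers_prod_dvd:
  fixes p :: "'i \<Rightarrow> 'a::idom"
  assumes "finite S" "\<And>i. i \<in> S \<Longrightarrow> prime_elem (p i)"
    and "\<And>i j. i \<in> S \<Longrightarrow> j \<in> S \<Longrightarrow> p i dvd p j \<Longrightarrow> i = j"
    and "\<And>i. i \<in> S \<Longrightarrow> p i ^ e i dvd f"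
  shows "(\<Prod>i\<in>S. p i ^ e i) dvd f"
  using assms
proof (induction S)
  case (insert x F)
  have "(\<Prod>i\<in>F. p i ^ e i) dvd f" by (rule insert.IH) (use insert.prems in blast)+
  then obtain g where g: "f = (\<Prod>i\<in>F. p i ^ e i) * g" by (rule dvdE)
  have px: "prime_elem (p x)" by (rule insert.prems) simp
  have "\<not> p x dvd (\<Prod>i\<in>F. p i ^ e i)"
  proof
    assume "p x dvd (\<Prod>i\<in>F. p i ^ e i)"
    then obtain i where i: "i \<in> F" "p x dvd p i ^ e i"
      using prime_dvd_prodD[OF px] by blast
    then have "p x dvd p i" using prime_elem_dvd_power[OF px] by blast
    then have "x = i" using insert.prems(2) i by blast
    then show False using insert.hyps i by blast
  qed
  moreover have "p x ^ e x dvd (\<Prod>i\<in>F. p i ^ e i) * g" using insert.prems(3)[of x] unfolding g by blast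
  ultimately have "p x ^ e x dvd g" by (rule prime_power_dvd_cancel[OF px])
  then show ?case unfolding prod.insert[OF insert.hyps] g mult.commute[of "p x ^ e x"]
    by (rule mult_dvd_mono[OF dvd_refl])
qed simp

lemma dvd_prime_prod_unit:
  fixes p :: "'i \<Rightarrow> 'a::idom"
  assumes "finite S" "\<And>i. i \<in> S \<Longrightarrow> prime_elem (p i)" "\<And>i. i \<in> S \<Longrightarrow> \<not> p i dvd g"
    and "g dvd (\<Prod>i\<in>S. p i ^ e i)"
  shows "g dvd 1"
  using assms
proof (induction S)
  case (insert x F)
  have px: "prime_elem (p x)" and pg: "\<not> p x dvd g" by (rule insert.prems; simp)+
  have *: "g dvd u" if "g dvd p x ^ k * u" for k u
    using that
  proof (induction k arbitrary: u)
    case (Suc k)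
    from Suc.prems obtain h where h: "p x ^ Suc k * u = g * h" by (rule dvdE)
    have "p x dvd g * h" unfolding h[symmetric] by simp
    then have "p x dvd h" using prime_elem_dvd_multD[OF px] pg by blast
    then obtain h' where h': "h = p x * h'" by (rule dvdE)
    have "p x * (p x ^ k * u) = p x * (g * h')"
      using h unfolding h' power_Suc by (simp only: mult.assoc mult.left_commute)
    then have "p x ^ k * u = g * h'" using px by (simp only: mult_cancel_left) (simp add: prime_elem_def)
    then have "g dvd p x ^ k * u" by (simp only: dvd_triv_left)
    then show ?case by (rule Suc.IH)
  qed simp
  have "g dvd (\<Prod>i\<in>F. p i ^ e i)"
    using insert.prems(3) unfolding prod.insert[OF insert.hyps] by (rule *)
  then show ?case by (intro insert.IH) (use insert.prems in blast)+
qed simp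

section \<open>Determinants\<close>

text \<open>With functions of two indices in place of matrices the size is a mere bound, so that
  rows and columns can be shifted, replaced and added without changing a carrier.\<close>

definition mdet :: "nat \<Rightarrow> (nat \<Rightarrow> nat \<Rightarrow> 'a::comm_ring_1) \<Rightarrow> 'a" where
  "mdet n M = det (mat n n (\<lambda>(i, j). M i j))"

definition madj :: "nat \<Rightarrow> (nat \<Rightarrow> nat \<Rightarrow> 'a::comm_ring_1) \<Rightarrow> nat \<Rightarrow> nat \<Rightarrow> 'a" where
  "madj n M i j = adj_mat (mat n n (\<lambda>(i, j). M i j)) $$ (i, j)"

lemma permutes_less: "p permutes {0..<n::nat} \<Longrightarrow> i < n \<Longrightarrow> p i < n"
  using permutes_in_image[of p "{0..<n}" i] by simp

lemma mdet_leibniz: "mdet n M = (\<Sum>p | p permutes {0..<n}. signof p * (\<Prod>i = 0..<n. M i (p i)))"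
proof -
  have "mdet n M = (\<Sum>p | p permutes {0..<n}. signof p * (\<Prod>i = 0..<n. mat n n (\<lambda>(i, j). M i j) $$ (i, p i)))"
    unfolding mdet_def by (rule det_def') simp
  also have "\<dots> = (\<Sum>p | p permutes {0..<n}. signof p * (\<Prod>i = 0..<n. M i (p i)))"
    by (intro sum.cong arg_cong2[where f="(*)"] prod.cong refl)
      (simp add: permutes_less)
  finally show ?thesis .
qed

lemma mdet_cong:
  assumes "\<And>i j. i < n \<Longrightarrow> j < n \<Longrightarrow> M i j = N i j"
  shows "mdet n M = mdet n N"
proof -
  have "mat n n (\<lambda>(i, j). M i j) = mat n n (\<lambda>(i, j). N i j)" by (rule eq_matI) (auto simp: assms)
  then show ?thesis by (simp add: mdet_def)
qed

lemma mdet_mult: "mdet n (\<lambda>i j. \<Sum>k<n. M i k * N k j) = mdet n M * mdet n N"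
proof -
  have "mat n n (\<lambda>(i, j). \<Sum>k<n. M i k * N k j) = mat n n (\<lambda>(i, j). M i j) * mat n n (\<lambda>(i, j). N i j)"
    by (rule eq_matI) (auto simp: scalar_prod_def atLeast0LessThan)
  then show ?thesis by (simp add: mdet_def det_mult[of _ n])
qed

lemma mdet_subst: "poly_subst s (mdet n M) = mdet n (\<lambda>i j. poly_subst s (M i j))"
proof -
  interpret comm_ring_hom "poly_subst s" by (rule poly_subst_hom)
  have "map_mat (poly_subst s) (mat n n (\<lambda>(i, j). M i j)) = mat n n (\<lambda>(i, j). poly_subst s (M i j))"
    by (rule eq_matI) auto
  then show ?thesis using hom_det[of "mat n n (\<lambda>(i, j). M i j)"] by (simp add: mdet_def)
qed

lemma madj_left:
  assumes "k < n" "j < n"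
  shows "(\<Sum>i<n. madj n M k i * M i j) = (if k = j then mdet n M else 0)"
proof -
  let ?A = "mat n n (\<lambda>(i, j). M i j)"
  note a = adj_mat[of ?A n, OF mat_carrier]
  have "(adj_mat ?A * ?A) $$ (k, j) = (if k = j then mdet n M else 0)"
    using a assms by (simp add: mdet_def)
  moreover have "(adj_mat ?A * ?A) $$ (k, j) = (\<Sum>i<n. madj n M k i * M i j)"
    using a(1) assms by (simp add: scalar_prod_def madj_def atLeast0LessThan)
  ultimately show ?thesis by simp
qed

lemma madj_right:
  assumes "k < n" "j < n"
  shows "(\<Sum>i<n. M k i * madj n M i j) = (if k = j then mdet n M else 0)"
proof -
  let ?A = "mat n n (\<lambda>(i, j). M i j)"
  note a = adj_mat[of ?A n, OF mat_carrier]
  have "(?A * adj_mat ?A) $$ (k, j) = (if k = j then mdet n M else 0)"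
    using a assms by (simp add: mdet_def)
  moreover have "(?A * adj_mat ?A) $$ (k, j) = (\<Sum>i<n. M k i * madj n M i j)"
    using a(1) assms by (simp add: scalar_prod_def madj_def atLeast0LessThan)
  ultimately show ?thesis by simp
qed

lemma mdet_replace_row:
  assumes i: "i < n"
  shows "mdet n (\<lambda>r c. if r = i then v c else M r c) = (\<Sum>j<n. v j * madj n M j i)"
proof -
  let ?A = "mat n n (\<lambda>(i, j). M i j)" and ?B = "mat n n (\<lambda>(r, c). if r = i then v c else M r c)"
  have del: "mat_delete ?B i j = mat_delete ?A i j" for j
    by (rule eq_matI) (auto simp: mat_delete_def)
  have "det ?B = (\<Sum>j<n. ?B $$ (i, j) * cofactor ?B i j)"
    by (rule laplace_expansion_row) (use i in auto)
  also have "\<dots> = (\<Sum>j<n. v j * madj n M j i)"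
    using i by (intro sum.cong) (auto simp: madj_def adj_mat_def cofactor_def del)
  finally show ?thesis by (simp add: mdet_def)
qed

lemma mdet_scale_row:
  assumes "i < n"
  shows "mdet n (\<lambda>r j. if r = i then c * M r j else M r j) = c * mdet n M"
proof -
  have "mdet n M = mdet n (\<lambda>r j. if r = i then M i j else M r j)" by (rule mdet_cong) auto
  moreover have "mdet n (\<lambda>r j. if r = i then c * M r j else M r j)
    = mdet n (\<lambda>r j. if r = i then c * M i j else M r j)" by (rule mdet_cong) auto
  ultimately show ?thesis using assms
    by (simp add: mdet_replace_row sum_distrib_left mult.assoc)
qed

lemma mdet_combine_row:
  assumes "i < n"
  shows "mdet n (\<lambda>r j. if r = i then (\<Sum>k<n. c k * M k j) else M r j) = c i * mdet n M"
proof -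
  have "mdet n (\<lambda>r j. if r = i then (\<Sum>k<n. c k * M k j) else M r j)
    = (\<Sum>j<n. \<Sum>k<n. c k * (M k j * madj n M j i))"
    using assms by (simp add: mdet_replace_row sum_distrib_right mult.assoc)
  also have "\<dots> = (\<Sum>k<n. c k * (\<Sum>j<n. M k j * madj n M j i))"
    by (subst sum.swap) (simp add: sum_distrib_left)
  also have "\<dots> = (\<Sum>k<n. if k = i then c i * mdet n M else 0)"
    using assms by (intro sum.cong) (auto simp: madj_right)
  finally show ?thesis using assms by simp
qed

lemma mdet_permute:
  assumes "p permutes {0..<n}"
  shows "mdet n (\<lambda>i j. M (p i) j) = signof p * mdet n M"
proof -
  have "mat n n (\<lambda>(i, j). mat n n (\<lambda>(i, j). M i j) $$ (p i, j)) = mat n n (\<lambda>(i, j). M (p i) j)"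
    by (rule eq_matI) (simp_all add: permutes_less[OF assms])
  then show ?thesis using det_permute_rows[of "mat n n (\<lambda>(i, j). M i j)" n p] assms by (simp add: mdet_def)
qed

lemma mdet_col0:
  assumes "\<And>i. 0 < i \<Longrightarrow> i < Suc m \<Longrightarrow> M i 0 = 0"
  shows "mdet (Suc m) M = M 0 0 * mdet m (\<lambda>i j. M (Suc i) (Suc j))"
proof -
  let ?A = "mat (Suc m) (Suc m) (\<lambda>(i, j). M i j)"
  have "mdet (Suc m) M = (\<Sum>i<Suc m. ?A $$ (i, 0) * cofactor ?A i 0)"
    unfolding mdet_def by (rule laplace_expansion_column) auto
  also have "\<dots> = (\<Sum>i<Suc m. if i = 0 then M 0 0 * cofactor ?A 0 0 else 0)"
    by (rule sum.cong) (use assms in auto)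
  also have "\<dots> = M 0 0 * cofactor ?A 0 0" by simp
  also have "mat_delete ?A 0 0 = mat m m (\<lambda>(i, j). M (Suc i) (Suc j))"
    by (rule eq_matI) (auto simp: mat_delete_def)
  then have "cofactor ?A 0 0 = mdet m (\<lambda>i j. M (Suc i) (Suc j))"
    by (simp add: cofactor_def mdet_def)
  finally show ?thesis .
qed

lemma mdet_0 [simp]: "mdet 0 M = 1"
  by (simp add: mdet_def)

lemma mdet_last_row:
  assumes "\<And>j. j < m \<Longrightarrow> M m j = 0"
  shows "mdet (Suc m) M = M m m * mdet m M"
proof -
  let ?A = "mat (Suc m) (Suc m) (\<lambda>(i, j). M i j)"
  have "mdet (Suc m) M = (\<Sum>j<Suc m. ?A $$ (m, j) * cofactor ?A m j)"
    unfolding mdet_def by (rule laplace_expansion_row) auto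
  also have "\<dots> = (\<Sum>j<Suc m. if j = m then M m m * cofactor ?A m m else 0)"
    by (rule sum.cong) (use assms in auto)
  also have "\<dots> = M m m * cofactor ?A m m" by simp
  also have "mat_delete ?A m m = mat m m (\<lambda>(i, j). M i j)"
    by (rule eq_matI) (auto simp: mat_delete_def)
  then have "cofactor ?A m m = mdet m M"
    by (simp add: cofactor_def mdet_def flip: mult_2)
  finally show ?thesis .
qed

lemma mdet_unit_rows:
  assumes "r \<le> n" "\<And>i j. r \<le> i \<Longrightarrow> i < n \<Longrightarrow> j < n \<Longrightarrow> M i j = (if i = j then 1 else 0)"
  shows "mdet n M = mdet r M"
  using assms
proof (induction n)
  case (Suc n)
  show ?case
  proof (cases "r = Suc n")
    case False
    then have "mdet (Suc n) M = mdet n M" using Suc.prems by (subst mdet_last_row) auto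
    then show ?thesis using Suc False by simp
  qed simp
qed simp

lemma mdet_one: "mdet n (\<lambda>i j. if i = j then 1 else 0) = 1"
  using mdet_unit_rows[of 0 n "\<lambda>i j. if i = j then 1 else 0"] by simp

lemma mdet_2: "mdet 2 M = M 0 0 * M 1 1 - M 0 1 * M 1 0"
proof -
  have one: "mdet (Suc 0) N = N 0 0" for N :: "nat \<Rightarrow> nat \<Rightarrow> 'a"
    by (subst mdet_last_row) auto
  let ?A = "mat 2 2 (\<lambda>(i, j). M i j)"
  have d: "mat_delete ?A 0 0 = mat (Suc 0) (Suc 0) (\<lambda>(i, j). M 1 1)" "mat_delete ?A 0 1 = mat (Suc 0) (Suc 0) (\<lambda>(i, j). M 1 0)"
    by (rule eq_matI; auto simp: mat_delete_def)+
  have "mdet 2 M = (\<Sum>j<2. ?A $$ (0, j) * cofactor ?A 0 j)"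
    unfolding mdet_def by (rule laplace_expansion_row) auto
  also have "\<dots> = M 0 0 * M 1 1 - M 0 1 * M 1 0"
    using one[of "\<lambda>i j. M 1 1"] one[of "\<lambda>i j. M 1 0"] d
    by (simp add: cofactor_def numeral_2_eq_2 mdet_def)
  finally show ?thesis .
qed

lemma mdet_in_poly_ring:
  assumes "\<And>i j. i < n \<Longrightarrow> j < n \<Longrightarrow> M i j \<in> poly_ring k"
  shows "mdet n M \<in> poly_ring k"
proof -
  have s: "signof p \<in> poly_ring k" for p :: "nat \<Rightarrow> nat"
    by (simp add: sign_def)
  show ?thesis unfolding mdet_leibniz
    by (intro poly_ring_closed poly_ring_closed2 s assms)
      (simp_all add: permutes_less)
qed

lemma homogeneous_mdet:
  assumes "\<And>i j. i < n \<Longrightarrow> j < n \<Longrightarrow> homogeneous (d i) (M i j)"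
  shows "homogeneous (\<Sum>i<n. d i) (mdet n M)"
proof -
  have s: "homogeneous 0 (signof p :: 'a mpoly)" for p :: "nat \<Rightarrow> nat"
    by (simp add: sign_def)
  have "homogeneous (\<Sum>i<n. d i) (signof p * (\<Prod>i = 0..<n. M i (p i)))" if p: "p permutes {0..<n}" for p
  proof -
    have "homogeneous (\<Sum>i=0..<n. d i) (\<Prod>i = 0..<n. M i (p i))"
      by (rule homogeneous_prod) (simp add: assms permutes_less[OF p])
    from homogeneous_mult[OF s[of p] this] show ?thesis by (simp add: atLeast0LessThan)
  qed
  then show ?thesis unfolding mdet_leibniz by (intro homogeneous_sum) auto
qed

text \<open>A square matrix in which too many rows are supported in too few columns is singular: every
  permutation meets the block of zeros.\<close>

lemma mdet_zero_block:
  assumes "R \<subseteq> {..<n}" "finite C" "card C < card R"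
    and "\<And>i j. i \<in> R \<Longrightarrow> j < n \<Longrightarrow> j \<notin> C \<Longrightarrow> M i j = 0"
  shows "mdet n M = 0"
proof -
  have "(\<Prod>i = 0..<n. M i (p i)) = 0" if p: "p permutes {0..<n}" for p
  proof -
    have "inj_on p R" using p by (meson inj_on_subset permutes_inj subset_UNIV)
    then have "\<not> p ` R \<subseteq> C" using assms(2,3) by (metis card_image card_mono not_less)
    then obtain i where i: "i \<in> R" "p i \<notin> C" by auto
    then have "i < n" using assms(1) by blast
    then have "p i < n" by (rule permutes_less[OF p])
    then have "M i (p i) = 0" using assms(4) i by blast
    then show ?thesis using \<open>i < n\<close> by (intro prod_zero) auto
  qed
  then show ?thesis by (simp add: mdet_leibniz)
qed

section \<open>Saito matrices\<close>

text \<open>A derivation is represented by the vector v of its values on the variables. Then app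
  n a v is its value on the form with coefficients a, and tang requires that this value is
  divisible by a power of the form.\<close>

definition app :: "nat \<Rightarrow> (nat \<Rightarrow> 'k::field) \<Rightarrow> (nat \<Rightarrow> 'k mpoly) \<Rightarrow> 'k mpoly" where
  "app n a v = (\<Sum>k<n. const (a k) * v k)"

definition tang :: "nat \<Rightarrow> (nat \<Rightarrow> 'k::field) \<Rightarrow> nat \<Rightarrow> (nat \<Rightarrow> 'k mpoly) \<Rightarrow> bool" where
  "tang n a m v \<longleftrightarrow> lform n a ^ m dvd app n a v"

definition defpoly :: "nat \<Rightarrow> 'i set \<Rightarrow> ('i \<Rightarrow> nat \<Rightarrow> 'k::field) \<Rightarrow> ('i \<Rightarrow> nat) \<Rightarrow> 'k mpoly" where
  "defpoly n I a \<mu> = (\<Prod>h\<in>I. lform n (a h) ^ \<mu> h)"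

definition polyvec :: "nat \<Rightarrow> (nat \<Rightarrow> 'k::field mpoly) \<Rightarrow> bool" where
  "polyvec n v \<longleftrightarrow> (\<forall>k<n. v k \<in> poly_ring n)"

definition homvec :: "nat \<Rightarrow> nat \<Rightarrow> (nat \<Rightarrow> 'k::field mpoly) \<Rightarrow> bool" where
  "homvec n e v \<longleftrightarrow> (\<forall>k<n. homogeneous e (v k))"

definition log_rows :: "nat \<Rightarrow> 'i set \<Rightarrow> ('i \<Rightarrow> nat \<Rightarrow> 'k::field) \<Rightarrow> ('i \<Rightarrow> nat) \<Rightarrow>
    (nat \<Rightarrow> nat \<Rightarrow> 'k mpoly) \<Rightarrow> (nat \<Rightarrow> nat) \<Rightarrow> bool" where
  "log_rows n I a \<mu> M d \<longleftrightarrow>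
     (\<forall>i<n. polyvec n (M i) \<and> homvec n (d i) (M i) \<and> (\<forall>h\<in>I. tang n (a h) (\<mu> h) (M i)))"

text \<open>A matrix of logarithmic derivations is in this relation exactly if its rows are a
  basis of the module of all of them, by Saito's criterion; the row degrees d are then the
  exponents.\<close>

definition saito :: "nat \<Rightarrow> 'i set \<Rightarrow> ('i \<Rightarrow> nat \<Rightarrow> 'k::field) \<Rightarrow> ('i \<Rightarrow> nat) \<Rightarrow>
    (nat \<Rightarrow> nat \<Rightarrow> 'k mpoly) \<Rightarrow> (nat \<Rightarrow> nat) \<Rightarrow> bool" where
  "saito n I a \<mu> M d \<longleftrightarrow> log_rows n I a \<mu> M d \<and>
     (\<exists>c. c \<noteq> 0 \<and> mdet n M = const c * defpoly n I a \<mu>)"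

lemma app_diff: "app n a (\<lambda>k. v k - w k) = app n a v - app n a w"
  by (simp add: app_def algebra_simps sum_subtractf)

lemma app_mult: "app n a (\<lambda>k. f * v k) = f * app n a v"
  by (simp add: app_def sum_distrib_left mult.left_commute)

lemma app_sum: "app n a (\<lambda>k. \<Sum>i\<in>S. v i k) = (\<Sum>i\<in>S. app n a (v i))"
  unfolding app_def sum_distrib_left by (rule sum.swap)

lemma app_cong: "(\<And>k. k < n \<Longrightarrow> a k = b k) \<Longrightarrow> (\<And>k. k < n \<Longrightarrow> v k = w k) \<Longrightarrow> app n a v = app n b w"
  by (simp add: app_def)

lemma app_var: "app n a var = lform n a"
  by (simp add: app_def lform_def)

lemma app_scale: "app n (\<lambda>i. c * a i) v = const c * app n a v"
  by (simp add: app_def sum_distrib_left mult.assoc)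

lemma poly_subst_app: "poly_subst s (app n a v) = app n a (\<lambda>k. poly_subst s (v k))"
  by (simp add: app_def poly_subst_sum)

lemma app_smaller: "r \<le> n \<Longrightarrow> (\<And>i. r \<le> i \<Longrightarrow> i < n \<Longrightarrow> a i = 0) \<Longrightarrow> app n a v = app r a v"
  unfolding app_def by (rule sum.mono_neutral_right) auto

lemma app_unit: "k < n \<Longrightarrow> (\<And>i. i < n \<Longrightarrow> i \<noteq> k \<Longrightarrow> a i = 0) \<Longrightarrow> app n a v = const (a k) * v k"
  unfolding app_def by (subst sum.remove[of _ k]) auto

lemma tang_diff: "tang n a m v \<Longrightarrow> tang n a m w \<Longrightarrow> tang n a m (\<lambda>k. v k - w k)"
  unfolding tang_def app_diff by (rule dvd_diff)

lemma tang_mult: "tang n a m v \<Longrightarrow> tang n a m (\<lambda>k. f * v k)"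
  unfolding tang_def app_mult by (rule dvd_mult)

lemma tang_sum: "(\<And>i. i \<in> S \<Longrightarrow> tang n a m (v i)) \<Longrightarrow> tang n a m (\<lambda>k. \<Sum>i\<in>S. v i k)"
  unfolding tang_def app_sum by (rule dvd_sum)

lemma tang_cong: "(\<And>k. k < n \<Longrightarrow> a k = b k) \<Longrightarrow> (\<And>k. k < n \<Longrightarrow> v k = w k) \<Longrightarrow> tang n a m v = tang n b m w"
  unfolding tang_def using app_cong[of n a b v w] lform_cong[of n a b] by auto

lemma tang_scale: "c \<noteq> 0 \<Longrightarrow> tang n (\<lambda>i. c * a i) m v = tang n a m v"
  unfolding tang_def app_scale lform_scale power_mult_distrib const_power[symmetric]
  by (simp only: const_unit const_unit2 power_eq_0_iff simp_thms)

lemma tang_var: "tang n a 1 var" "tang n a (Suc 0) var"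
  by (simp_all add: tang_def app_var)

lemma tang_mono: "tang n a m v \<Longrightarrow> m' \<le> m \<Longrightarrow> tang n a m' v"
  unfolding tang_def by (meson dvd_trans le_imp_power_dvd)

lemma defpoly_in_poly_ring [simp]: "defpoly n I a \<mu> \<in> poly_ring n"
  by (auto simp: defpoly_def)

lemma homogeneous_defpoly: "homogeneous (\<Sum>h\<in>I. \<mu> h) (defpoly n I a \<mu>)"
  unfolding defpoly_def by (rule homogeneous_prod) (use homogeneous_power[OF homogeneous_lform(1)] in simp)

lemma defpoly_nonzero: "nonprop n I a \<Longrightarrow> defpoly n I a \<mu> \<noteq> 0"
  unfolding defpoly_def by (simp add: nonprop_finite) (metis nonprop_prime not_prime_elem_zero)

lemma defpoly_cong:
  "(\<And>h k. h \<in> I \<Longrightarrow> k < n \<Longrightarrow> a h k = b h k) \<Longrightarrow> (\<And>h. h \<in> I \<Longrightarrow> \<mu> h = \<nu> h) \<Longrightarrow> defpoly n I a \<mu> = defpoly n I b \<nu>"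
  unfolding defpoly_def by (intro prod.cong refl arg_cong2[where f="(^)"] lform_cong) auto

lemma dvd_defpoly: "finite I \<Longrightarrow> h \<in> I \<Longrightarrow> lform n (a h) ^ \<mu> h dvd defpoly n I a \<mu>"
  unfolding defpoly_def by (rule dvd_prodI)

lemma nonprop_defpoly_dvd:
  assumes "nonprop n I a" "\<And>h. h \<in> I \<Longrightarrow> lform n (a h) ^ \<mu> h dvd f"
  shows "defpoly n I a \<mu> dvd f"
  unfolding defpoly_def
proof (rule prime_powers_prod_dvd[where p = "\<lambda>h. lform n (a h)" and e = \<mu>])
  show "finite I" using assms(1) by (rule nonprop_finite)
qed (use nonprop_prime[OF assms(1)] nonprop_not_dvd[OF assms(1)] assms(2) in blast)+

lemma nonprop_dvd_defpoly:
  assumes np: "nonprop n I a" and J: "J \<subseteq> I" and h: "h \<in> I" and d: "lform n (a h) dvd defpoly n J a \<mu>"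
  shows "h \<in> J \<and> \<mu> h \<noteq> 0"
proof -
  have p: "prime_elem (lform n (a h))" using np h by (rule nonprop_prime)
  obtain h' where h': "h' \<in> J" and d': "lform n (a h) dvd lform n (a h') ^ \<mu> h'"
    using prime_dvd_prodD[OF p d[unfolded defpoly_def]] by (rule bexE)
  have "lform n (a h) dvd lform n (a h')" by (rule prime_elem_dvd_power[OF p d'])
  then have eq: "h = h'" by (rule nonprop_not_dvd[OF np h subsetD[OF J h']])
  have "\<mu> h' \<noteq> 0"
  proof
    assume "\<mu> h' = 0"
    then have "lform n (a h) dvd 1" using d' by (simp only: power_0)
    then show False using prime_elem_not_unit[OF p] by (rule notE[rotated])
  qed
  then show ?thesis using h' eq by simp
qed

lemma log_rowsD:
  assumes "log_rows n I a \<mu> M d" "i < n"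
  shows "polyvec n (M i)" "homvec n (d i) (M i)" "\<And>h. h \<in> I \<Longrightarrow> tang n (a h) (\<mu> h) (M i)"
    "\<And>k. k < n \<Longrightarrow> M i k \<in> poly_ring n" "\<And>k. k < n \<Longrightarrow> homogeneous (d i) (M i k)"
  using assms by (simp_all add: log_rows_def polyvec_def homvec_def)

text \<open>A determinant of logarithmic derivations is divisible by the defining polynomial: multiplying
  the matrix by the coefficient vector of a form gives a vector divisible by a power of the form,
  and the adjugate carries this to a nonzero multiple of the determinant.\<close>

lemma defpoly_dvd_mdet:
  assumes np: "nonprop n I a" and t: "\<And>i h. i < n \<Longrightarrow> h \<in> I \<Longrightarrow> tang n (a h) (\<mu> h) (M i)"
  shows "defpoly n I a \<mu> dvd mdet n M"
proof (rule nonprop_defpoly_dvd[OF np])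
  fix h assume h: "h \<in> I"
  obtain k where k: "k < n" "a h k \<noteq> 0" using np h by (auto simp: nonprop_def)
  have "(\<Sum>i<n. madj n M k i * app n (a h) (M i)) = (\<Sum>i<n. \<Sum>j<n. const (a h j) * (madj n M k i * M i j))"
    unfolding app_def sum_distrib_left by (simp add: mult.left_commute)
  also have "\<dots> = (\<Sum>j<n. const (a h j) * (\<Sum>i<n. madj n M k i * M i j))"
    by (subst sum.swap) (simp add: sum_distrib_left)
  also have "\<dots> = (\<Sum>j<n. if j = k then const (a h k) * mdet n M else 0)"
    using k by (intro sum.cong) (auto simp: madj_left)
  also have "\<dots> = const (a h k) * mdet n M" using k by simp
  finally have eq: "(\<Sum>i<n. madj n M k i * app n (a h) (M i)) = const (a h k) * mdet n M" .
  have "lform n (a h) ^ \<mu> h dvd (\<Sum>i<n. madj n M k i * app n (a h) (M i))"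
    by (intro dvd_sum dvd_mult) (use t h in \<open>simp add: tang_def\<close>)
  then show "lform n (a h) ^ \<mu> h dvd mdet n M" unfolding eq const_unit2[OF k(2)] .
qed

lemma log_rows_mdet_homogeneous:
  "log_rows n I a \<mu> M d \<Longrightarrow> homogeneous (\<Sum>i<n. d i) (mdet n M)"
  by (rule homogeneous_mdet) (simp add: log_rowsD)

lemma saito_mdet_nonzero: "nonprop n I a \<Longrightarrow> saito n I a \<mu> M d \<Longrightarrow> mdet n M \<noteq> 0"
  by (auto simp: saito_def defpoly_nonzero)

lemma saito_degree_sum:
  assumes "nonprop n I a" "saito n I a \<mu> M d"
  shows "(\<Sum>i<n. d i) = (\<Sum>h\<in>I. \<mu> h)"
proof -
  obtain c where c: "c \<noteq> 0" "mdet n M = const c * defpoly n I a \<mu>" using assms by (auto simp: saito_def)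
  have "homogeneous (\<Sum>h\<in>I. \<mu> h) (mdet n M)" unfolding c by (intro homogeneous_const_mult homogeneous_defpoly)
  moreover have "homogeneous (\<Sum>i<n. d i) (mdet n M)"
    using assms by (auto simp: saito_def intro: log_rows_mdet_homogeneous)
  ultimately show ?thesis using saito_mdet_nonzero[OF assms] homogeneous_unique by blast
qed

lemma defpoly_multiple_const:
  assumes np: "nonprop n I a" and dvd: "defpoly n I a \<mu> dvd f" and f: "f \<noteq> 0" and h: "homogeneous (\<Sum>h\<in>I. \<mu> h) f"
  shows "\<exists>c. c \<noteq> 0 \<and> f = const c * defpoly n I a \<mu>"
proof -
  obtain g where g: "f = defpoly n I a \<mu> * g" using dvd by (rule dvdE)
  then have "g \<noteq> 0" using f by auto
  then have "homogeneous 0 g"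
    using homogeneous_factor[of "\<Sum>h\<in>I. \<mu> h" "defpoly n I a \<mu>" g "\<Sum>h\<in>I. \<mu> h"] h defpoly_nonzero[OF np]
      homogeneous_defpoly[of \<mu> I n a] g by simp
  then obtain c where "g = const c" using homogeneous_0_const by blast
  then show ?thesis using g \<open>g \<noteq> 0\<close> by (intro exI[of _ c]) (auto simp: mult.commute)
qed

lemma saitoI_degree:
  assumes "nonprop n I a" "log_rows n I a \<mu> M d" "mdet n M \<noteq> 0" "(\<Sum>i<n. d i) = (\<Sum>h\<in>I. \<mu> h)"
  shows "saito n I a \<mu> M d"
  unfolding saito_def
  using defpoly_multiple_const[OF assms(1) defpoly_dvd_mdet[OF assms(1)] assms(3), of \<mu>]
    log_rows_mdet_homogeneous[OF assms(2)] log_rowsD(3)[OF assms(2)] assms by auto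

text \<open>Saito's criterion: by Cramer's rule, a logarithmic derivation is a combination of the rows
  whose coefficients are quotients of two determinants of logarithmic derivations.\<close>

lemma saito_expand:
  assumes np: "nonprop n I a" and s: "saito n I a \<mu> M d"
    and v: "polyvec n v" "\<And>h. h \<in> I \<Longrightarrow> tang n (a h) (\<mu> h) v"
  shows "\<exists>c. (\<forall>i<n. c i \<in> poly_ring n) \<and> (\<forall>k<n. v k = (\<Sum>i<n. c i * M i k))"
proof -
  obtain u where u: "u \<noteq> 0" "mdet n M = const u * defpoly n I a \<mu>" using s by (auto simp: saito_def)
  have lr: "log_rows n I a \<mu> M d" using s by (simp add: saito_def)
  define P where "P i = (\<Sum>j<n. v j * madj n M j i)" for i
  have P: "P i = mdet n (\<lambda>r c. if r = i then v c else M r c)" if "i < n" for i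
    using mdet_replace_row[OF that, of v M] by (simp add: P_def)
  have "\<exists>g\<in>poly_ring n. P i = mdet n M * g" if i: "i < n" for i
  proof (rule dvd_in_poly_ring)
    have "tang n (a h) (\<mu> h) (\<lambda>c. if r = i then v c else M r c)" if "r < n" "h \<in> I" for r h
      using v(2) log_rowsD(3)[OF lr] that by (cases "r = i") auto
    then have "defpoly n I a \<mu> dvd mdet n (\<lambda>r c. if r = i then v c else M r c)"
      by (rule defpoly_dvd_mdet[OF np])
    then show "mdet n M dvd P i"
      unfolding u const_unit[OF u(1)] P[OF i] .
    show "mdet n M \<in> poly_ring n" by (rule mdet_in_poly_ring) (simp add: log_rowsD[OF lr])
    show "P i \<in> poly_ring n" unfolding P[OF i]
      by (rule mdet_in_poly_ring) (use v in \<open>auto simp: log_rowsD[OF lr] polyvec_def\<close>)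
  qed
  then obtain c where c: "\<And>i. i < n \<Longrightarrow> c i \<in> poly_ring n" "\<And>i. i < n \<Longrightarrow> P i = mdet n M * c i" by metis
  have "v k = (\<Sum>i<n. c i * M i k)" if k: "k < n" for k
  proof -
    have "mdet n M * (\<Sum>i<n. c i * M i k) = (\<Sum>i<n. P i * M i k)"
      by (simp add: sum_distrib_left c mult.assoc)
    also have "\<dots> = (\<Sum>i<n. \<Sum>j<n. v j * (madj n M j i * M i k))"
      by (simp add: P_def sum_distrib_right mult.assoc)
    also have "\<dots> = (\<Sum>j<n. v j * (\<Sum>i<n. madj n M j i * M i k))"
      by (subst sum.swap) (simp add: sum_distrib_left)
    also have "\<dots> = (\<Sum>j<n. if j = k then v k * mdet n M else 0)"
      using k by (intro sum.cong) (auto simp: madj_left)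
    also have "\<dots> = mdet n M * v k" using k by simp
    finally show ?thesis using saito_mdet_nonzero[OF np s] by (simp only: mult_cancel_left) simp
  qed
  then show ?thesis using c by blast
qed

lemma homogeneous_expansion:
  assumes v: "homvec n e v" and c: "\<forall>i<m. c i \<in> poly_ring n" and ex: "\<forall>k<n. v k = (\<Sum>i<m. c i * M i k)"
    and M: "\<And>i. i < m \<Longrightarrow> homvec n (d i) (M i)"
  shows "\<exists>c. (\<forall>i<m. c i \<in> poly_ring n) \<and> (\<forall>k<n. v k = (\<Sum>i<m. c i * M i k)) \<and>
    (\<forall>i<m. homogeneous (e - d i) (c i) \<and> (e < d i \<longrightarrow> c i = 0))"
proof -
  define c' where "c' i = (if d i \<le> e then hcomp (e - d i) (c i) else 0)" for i
  have "v k = (\<Sum>i<m. c' i * M i k)" if k: "k < n" for k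
  proof -
    have "v k = hcomp e (v k)" using v k by (simp add: homvec_def hcomp_id)
    also have "\<dots> = (\<Sum>i<m. hcomp e (M i k * c i))" using ex k by (simp add: hcomp_sum mult.commute)
    also have "\<dots> = (\<Sum>i<m. c' i * M i k)"
    proof (rule sum.cong[OF refl])
      fix i assume "i \<in> {..<m}"
      then have "homogeneous (d i) (M i k)" using M k by (simp add: homvec_def)
      then show "hcomp e (M i k * c i) = c' i * M i k" by (simp add: hcomp_mult c'_def mult.commute[of "hcomp _ _"])
    qed
    finally show ?thesis .
  qed
  moreover have "\<forall>i<m. c' i \<in> poly_ring n" using c by (simp add: c'_def)
  moreover have "\<forall>i<m. homogeneous (e - d i) (c' i) \<and> (e < d i \<longrightarrow> c' i = 0)" by (simp add: c'_def)
  ultimately show ?thesis by blast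
qed

lemma saito_expand_hom:
  assumes "nonprop n I a" "saito n I a \<mu> M d"
    and "polyvec n v" "homvec n e v" "\<And>h. h \<in> I \<Longrightarrow> tang n (a h) (\<mu> h) v"
  shows "\<exists>c. (\<forall>i<n. c i \<in> poly_ring n) \<and> (\<forall>k<n. v k = (\<Sum>i<n. c i * M i k)) \<and>
    (\<forall>i<n. homogeneous (e - d i) (c i) \<and> (e < d i \<longrightarrow> c i = 0))"
proof -
  obtain c where "\<forall>i<n. c i \<in> poly_ring n" "\<forall>k<n. v k = (\<Sum>i<n. c i * M i k)"
    using saito_expand[OF assms(1,2,3,5)] by blast
  then show ?thesis
    using assms(2,4) by (intro homogeneous_expansion) (auto simp: saito_def log_rowsD)
qed

lemma mdet_rows_independent:
  fixes M :: "nat \<Rightarrow> nat \<Rightarrow> 'a::idom"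
  assumes "mdet n M \<noteq> 0" "\<forall>k<n. (\<Sum>i<n. c i * M i k) = 0" "i < n"
  shows "c i = 0"
proof -
  have "0 = (\<Sum>k<n. (\<Sum>i<n. c i * M i k) * madj n M k i)" using assms by simp
  also have "\<dots> = (\<Sum>k<n. \<Sum>j<n. c j * (M j k * madj n M k i))" by (simp add: sum_distrib_right mult.assoc)
  also have "\<dots> = (\<Sum>j<n. c j * (\<Sum>k<n. M j k * madj n M k i))" by (subst sum.swap) (simp add: sum_distrib_left)
  also have "\<dots> = (\<Sum>j<n. if j = i then c i * mdet n M else 0)"
    using assms(3) by (intro sum.cong) (auto simp: madj_right)
  also have "\<dots> = c i * mdet n M" using assms(3) by simp
  finally show ?thesis using assms(1) by simp
qed

subsection \<open>Bases of derivations are Saito matrices\<close>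

lemma mdet_diag: "mdet n (\<lambda>i j. if i = j then x i else 0) = (\<Prod>i<n. x i)"
  by (induction n) (simp_all add: mdet_last_row mult.commute)

text \<open>Zero rows added to the second factor make it singular, so that a nonzero scalar
  matrix has no factorization through a smaller size.\<close>

lemma rank_le:
  fixes A B :: "nat \<Rightarrow> nat \<Rightarrow> 'a::idom"
  assumes "\<And>i l. i < p \<Longrightarrow> l < p \<Longrightarrow> (\<Sum>j<q. A i j * B j l) = (if i = l then x else 0)" "x \<noteq> 0"
  shows "p \<le> q"
proof (rule ccontr)
  assume "\<not> p \<le> q"
  then have q: "q < p" by simp
  define B' where "B' j l = (if j < q then B j l else 0)" for j l
  have "mdet p B' = 0" by (rule mdet_zero_block[of "{q}" p "{}"]) (use q in \<open>auto simp: B'_def\<close>)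
  moreover have "(\<Sum>j<p. A i j * B' j l) = (if i = l then x else 0)" if "i < p" "l < p" for i l
  proof -
    have "(\<Sum>j<p. A i j * B' j l) = (\<Sum>j<q. A i j * B' j l)"
      by (rule sum.mono_neutral_right) (use q in \<open>auto simp: B'_def\<close>)
    then show ?thesis using assms(1)[OF that] by (simp add: B'_def)
  qed
  then have "mdet p A * mdet p B' = mdet p (\<lambda>i l. if i = l then x else 0)"
    unfolding mdet_mult[symmetric] by (intro mdet_cong) blast
  ultimately have "x ^ p = 0" using mdet_diag[of p "\<lambda>_. x"] by simp
  then show False using assms(2) by simp
qed

text \<open>The converse of Saito's criterion, for a basis of unknown length k. As the multiples
  by Q of the coordinate derivations are logarithmic, k is n. The determinant is a multiple Q g,
  and g divides a power of the product of the forms other than h, for every h. So no form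
  divides g, and g is a constant.\<close>

lemma saito_of_basis:
  fixes \<theta> :: "nat \<Rightarrow> nat \<Rightarrow> 'k::field mpoly"
  assumes np: "nonprop n I a"
    and th: "\<And>i. i < k \<Longrightarrow> polyvec n (\<theta> i) \<and> homvec n (d i) (\<theta> i) \<and> (\<forall>h\<in>I. tang n (a h) (\<mu> h) (\<theta> i))"
    and span: "\<And>v. polyvec n v \<Longrightarrow> (\<And>h. h \<in> I \<Longrightarrow> tang n (a h) (\<mu> h) v) \<Longrightarrow>
        \<exists>c. (\<forall>i<k. c i \<in> poly_ring n) \<and> (\<forall>j<n. v j = (\<Sum>i<k. c i * \<theta> i j))"
    and indep: "\<And>c. (\<forall>i<k. c i \<in> poly_ring n) \<Longrightarrow> (\<forall>j<n. (\<Sum>i<k. c i * \<theta> i j) = 0) \<Longrightarrow> (\<forall>i<k. c i = 0)"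
  shows "k = n \<and> saito n I a \<mu> \<theta> d"
proof -
  let ?Q = "defpoly n I a \<mu>"
  have fin: "finite I" using np by (rule nonprop_finite)
  have Q0: "?Q \<noteq> 0" using np by (rule defpoly_nonzero)
  have "polyvec n (\<lambda>j. if j = i then ?Q else 0)" for i by (simp add: polyvec_def)
  moreover have "tang n (a h) (\<mu> h) (\<lambda>j. if j = i then ?Q else 0)" if "h \<in> I" for h i
    unfolding tang_def app_def
    by (intro dvd_sum dvd_mult) (use dvd_defpoly[OF fin that, of n a \<mu>] in simp)
  ultimately have "\<exists>c. (\<forall>i<k. c i \<in> poly_ring n) \<and> (\<forall>j<n. (if j = l then ?Q else 0) = (\<Sum>i<k. c i * \<theta> i j))" for l
    by (rule span)
  then have "\<forall>l. \<exists>c. (\<forall>i<k. c i \<in> poly_ring n) \<and> (\<forall>j<n. (if j = l then ?Q else 0) = (\<Sum>i<k. c i * \<theta> i j))"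
    by (rule allI)
  from choice[OF this] obtain C
    where C0: "\<forall>l. (\<forall>i<k. C l i \<in> poly_ring n) \<and> (\<forall>j<n. (if j = l then ?Q else 0) = (\<Sum>i<k. C l i * \<theta> i j))"
    by (rule exE)
  have C: "\<And>l i. i < k \<Longrightarrow> C l i \<in> poly_ring n"
      "\<And>l j. j < n \<Longrightarrow> (\<Sum>i<k. C l i * \<theta> i j) = (if j = l then ?Q else 0)"
    using C0 by simp_all
  have "n \<le> k" by (rule rank_le[where p = n and q = k and A = C and B = \<theta> and x = ?Q]) (use C(2) Q0 in auto)
  have CC: "(\<Sum>j<n. \<theta> r j * C j i) = (if r = i then ?Q else 0)" if ri: "r < k" "i < k" for r i
  proof -
    define e where "e i = (\<Sum>j<n. \<theta> r j * C j i) - (if r = i then ?Q else 0)" for i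
    have "\<forall>i<k. e i \<in> poly_ring n"
      using th[OF ri(1)] C(1) unfolding e_def polyvec_def
      by (intro allI impI poly_ring_closed2 poly_ring_closed(6)) auto
    moreover have "(\<Sum>i<k. e i * \<theta> i l) = 0" if l: "l < n" for l
    proof -
      have "(\<Sum>i<k. e i * \<theta> i l) = (\<Sum>i<k. \<Sum>j<n. \<theta> r j * (C j i * \<theta> i l)) - (\<Sum>i<k. if r = i then ?Q * \<theta> r l else 0)"
        by (simp add: e_def left_diff_distrib sum_subtractf sum_distrib_right mult.assoc if_distrib[of "\<lambda>x. x * _"] cong: if_cong)
      also have "(\<Sum>i<k. \<Sum>j<n. \<theta> r j * (C j i * \<theta> i l)) = (\<Sum>j<n. \<theta> r j * (\<Sum>i<k. C j i * \<theta> i l))"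
        by (subst sum.swap) (simp add: sum_distrib_left)
      also have "\<dots> = (\<Sum>j<n. if j = l then \<theta> r l * ?Q else 0)"
        by (rule sum.cong) (use C(2)[OF l] in auto)
      also have "\<dots> = \<theta> r l * ?Q" using l by simp
      finally show ?thesis using ri by (simp add: mult.commute)
    qed
    ultimately have "e i = 0" using indep ri by blast
    then show ?thesis by (simp add: e_def)
  qed
  have "k \<le> n" by (rule rank_le[where p = k and q = n and A = \<theta> and B = C and x = ?Q]) (use CC Q0 in auto)
  then have kn: "k = n" using \<open>n \<le> k\<close> by simp
  have lr: "log_rows n I a \<mu> \<theta> d" using th by (simp add: log_rows_def kn)
  have dvd: "?Q dvd mdet n \<theta>" by (rule defpoly_dvd_mdet[OF np]) (use th kn in blast)
  then obtain g where g: "mdet n \<theta> = ?Q * g" by (rule dvdE)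
  have "mdet n C * mdet n \<theta> = mdet n (\<lambda>i j. if i = j then ?Q else 0)"
    unfolding mdet_mult[symmetric] by (rule mdet_cong) (use C(2) kn in auto)
  also have "\<dots> = ?Q ^ n" using mdet_diag[of n "\<lambda>_. ?Q"] by simp
  finally have Qn: "mdet n C * mdet n \<theta> = ?Q ^ n" .
  then have det0: "mdet n \<theta> \<noteq> 0" using Q0 by auto
  \<comment> \<open>Derivations that annihilate the form of h, multiplied by the other forms, are logarithmic. The
    matrix T consists of n - 1 of these and of a multiple by Q of a coordinate derivation.\<close>
  have gh: "g dvd defpoly n (I - {h}) a (\<lambda>x. \<mu> x * (n - 1))" if h: "h \<in> I" for h
  proof -
    let ?R = "defpoly n (I - {h}) a \<mu>"
    obtain q where q: "q < n" "a h q \<noteq> 0" using np h by (auto simp: nonprop_def)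
    have QR: "?Q = lform n (a h) ^ \<mu> h * ?R" unfolding defpoly_def using fin h by (simp add: prod.remove)
    define D where "D i = (if i = q then ?Q else ?R)" for i
    define E where "E i j = (if i = j then 1 else if j = q then - const (a h i / a h q) else 0)" for i j
    define E' where "E' i j = (if i = j then 1 else if j = q then const (a h i / a h q) else 0)" for i j
    have "(\<Sum>j<n. E i j * E' j l) = (if i = l then 1 else 0)" if "i < n" "l < n" for i l
    proof (cases "i = q")
      case True
      then have "(\<Sum>j<n. E i j * E' j l) = (\<Sum>j<n. if j = q then E' q l else 0)"
        by (intro sum.cong) (auto simp: E_def)
      also have "\<dots> = E' q l" using q by simp
      finally show ?thesis using True by (auto simp: E'_def)
    next
      case False
      have "(\<Sum>j<n. E i j * E' j l) = (\<Sum>j\<in>{i, q}. E i j * E' j l)"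
        by (rule sum.mono_neutral_right) (use that q in \<open>auto simp: E_def\<close>)
      also have "\<dots> = E' i l - const (a h i / a h q) * E' q l" using False by (simp add: E_def)
      finally show ?thesis using False by (auto simp: E'_def)
    qed
    then have "mdet n E * mdet n E' = mdet n (\<lambda>i j. if i = j then 1 else 0)"
      unfolding mdet_mult[symmetric] by (intro mdet_cong) blast
    then have EE: "mdet n E * mdet n E' = 1" by (simp add: mdet_one)
    define T where "T i j = D i * E i j" for i j
    have "polyvec n (T i)" for i unfolding polyvec_def T_def D_def E_def by auto
    moreover have "tang n (a h') (\<mu> h') (T i)" if h': "h' \<in> I" and i: "i < n" for h' i
    proof (cases "h' = h \<and> i \<noteq> q")
      case True
      have "app n (a h) (E i) = (\<Sum>j\<in>{i, q}. const (a h j) * E i j)"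
        unfolding app_def by (rule sum.mono_neutral_right) (use i q in \<open>auto simp: E_def\<close>)
      also have "\<dots> = const (a h i) - const (a h q) * const (a h i / a h q)" using True by (simp add: E_def)
      also have "const (a h q) * const (a h i / a h q) = const (a h i)"
        unfolding const_simps(6)[symmetric] using q by (simp del: const_simps)
      finally have "app n (a h) (T i) = 0" unfolding T_def app_mult by simp
      then show ?thesis using True by (simp add: tang_def)
    next
      case False
      have "lform n (a h') ^ \<mu> h' dvd D i"
      proof (cases "i = q")
        case True then show ?thesis using dvd_defpoly[OF fin h', of n a \<mu>] by (simp add: D_def)
      next
        case iq: False
        then show ?thesis using False dvd_defpoly[of "I - {h}" h' n a \<mu>] fin h' by (simp add: D_def)
      qed
      then show ?thesis unfolding tang_def T_def app_mult by (rule dvd_mult2)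
    qed
    ultimately have "\<forall>i\<in>{..<n}. \<exists>c. \<forall>j<n. T i j = (\<Sum>l<k. c l * \<theta> l j)"
      using span[of "T _"] by (meson lessThan_iff)
    from bchoice[OF this] obtain F where "\<forall>i\<in>{..<n}. \<forall>j<n. T i j = (\<Sum>l<k. F i l * \<theta> l j)"
      by (rule exE)
    then have F: "\<And>i j. i < n \<Longrightarrow> j < n \<Longrightarrow> T i j = (\<Sum>l<k. F i l * \<theta> l j)" by simp
    have "mdet n T = mdet n F * mdet n \<theta>"
      unfolding mdet_mult[symmetric] using F kn by (intro mdet_cong) auto
    moreover have "mdet n T = mdet n (\<lambda>i j. if i = j then D i else 0) * mdet n E"
      unfolding mdet_mult[symmetric] T_def
      by (rule mdet_cong) (simp add: if_distrib[of "\<lambda>x. x * _"] cong: if_cong)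
    ultimately have DE: "(\<Prod>i<n. D i) * mdet n E = mdet n F * mdet n \<theta>" by (simp add: mdet_diag)
    have "(\<Prod>i<n. D i) = (\<Prod>i<n. D i) * mdet n E * mdet n E'" unfolding mult.assoc EE by simp
    then have "(\<Prod>i<n. D i) = ?Q * g * (mdet n F * mdet n E')"
      unfolding DE g by (simp only: mult_ac)
    moreover have "(\<Prod>i<n. D i) = ?Q * ?R ^ (n - 1)"
    proof -
      have "(\<Prod>i<n. D i) = D q * (\<Prod>i\<in>{..<n} - {q}. D i)" using q by (simp add: prod.remove)
      also have "(\<Prod>i\<in>{..<n} - {q}. D i) = (\<Prod>i\<in>{..<n} - {q}. ?R)" by (rule prod.cong) (auto simp: D_def)
      also have "\<dots> = ?R ^ (n - 1)" using q by simp
      finally show ?thesis by (simp add: D_def)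
    qed
    ultimately have "?Q * ?R ^ (n - 1) = ?Q * (g * (mdet n F * mdet n E'))" by (simp only: mult.assoc)
    then have "?R ^ (n - 1) = g * (mdet n F * mdet n E')" using Q0 by (simp only: mult_cancel_left simp_thms)
    moreover have "?R ^ (n - 1) = defpoly n (I - {h}) a (\<lambda>x. \<mu> x * (n - 1))"
      unfolding defpoly_def by (simp add: prod_power_distrib power_mult)
    ultimately show ?thesis by (simp only: dvd_triv_left)
  qed
  have "g dvd 1"
  proof (cases "I = {}")
    case True
    then have Q1: "?Q = 1" by (simp add: defpoly_def)
    have "mdet n \<theta> dvd mdet n C * mdet n \<theta>" by (rule dvd_triv_right)
    then show ?thesis unfolding Qn unfolding g Q1 by simp
  next
    case False
    then obtain h0 where h0: "h0 \<in> I" by blast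
    have "\<not> lform n (a h) dvd g" if h: "h \<in> I" for h
    proof
      assume "lform n (a h) dvd g"
      then have "lform n (a h) dvd defpoly n (I - {h}) a (\<lambda>x. \<mu> x * (n - 1))" using gh[OF h] dvd_trans by blast
      then show False using nonprop_dvd_defpoly[OF np, of "I - {h}" h] h by blast
    qed
    then show ?thesis using gh[OF h0] fin nonprop_prime[OF np] unfolding defpoly_def
      by (intro dvd_prime_prod_unit[of "I - {h0}" "\<lambda>h. lform n (a h)" g "\<lambda>x. \<mu> x * (n - 1)"]) auto
  qed
  moreover have "homogeneous ((\<Sum>i<n. d i) - (\<Sum>h\<in>I. \<mu> h)) g"
    using homogeneous_factor[of "\<Sum>i<n. d i" ?Q g] log_rows_mdet_homogeneous[OF lr] homogeneous_defpoly[of \<mu> I n a]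
      Q0 det0 g by (cases "g = 0") simp_all
  ultimately obtain c where "c \<noteq> 0" "g = const c" using homogeneous_unit by blast
  then have "saito n I a \<mu> \<theta> d" unfolding saito_def using lr g by (auto simp: mult.commute)
  then show ?thesis using kn by blast
qed

section \<open>Operations on Saito matrices\<close>

lemma mdet_rowops:
  assumes p: "p < n"
  shows "mdet n (\<lambda>i j. if i = p then M p j else M i j - f i * M p j) = mdet n M"
proof -
  define N where "N l i j = (if i = p \<or> l \<le> i then M i j else M i j - f i * M p j)" for l i j
  have "mdet n (N l) = mdet n M" if "l \<le> n" for l
    using that
  proof (induction l)
    case 0
    show ?case by (rule mdet_cong) (simp add: N_def)
  next
    case (Suc l)
    then have IH: "mdet n (N l) = mdet n M" by simp
    show ?case
    proof (cases "l = p")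
      case True
      then have "N (Suc l) = N l" by (intro ext) (auto simp: N_def)
      then show ?thesis using IH by simp
    next
      case False
      define c where "c k = (if k = l then 1 else if k = p then - f l else 0)" for k
      have "(\<Sum>k<n. c k * N l k j) = (\<Sum>k\<in>{l, p}. c k * N l k j)" for j
        by (rule sum.mono_neutral_right) (use p Suc.prems in \<open>auto simp: c_def\<close>)
      then have "(\<Sum>k<n. c k * N l k j) = M l j - f l * M p j" for j
        using False by (simp add: c_def N_def)
      then have "mdet n (N (Suc l)) = mdet n (\<lambda>r j. if r = l then (\<Sum>k<n. c k * N l k j) else N l r j)"
        using False by (intro mdet_cong) (auto simp: N_def)
      also have "\<dots> = c l * mdet n (N l)" using Suc.prems by (intro mdet_combine_row) simp
      finally show ?thesis using IH by (simp add: c_def)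
    qed
  qed
  from this[of n] have "mdet n (N n) = mdet n M" by simp
  moreover have "mdet n (N n) = mdet n (\<lambda>i j. if i = p then M p j else M i j - f i * M p j)"
    by (rule mdet_cong) (auto simp: N_def)
  ultimately show ?thesis by simp
qed

definition degs :: "nat \<Rightarrow> (nat \<Rightarrow> nat) \<Rightarrow> nat multiset" where
  "degs n d = mset (map d [0..<n])"

lemma degs_alt: "degs n d = image_mset d (mset_set {..<n})"
  by (simp add: degs_def atLeast0LessThan)

lemma degs_permute: "p permutes {0..<n} \<Longrightarrow> degs n (\<lambda>i. d (p i)) = degs n d"
proof -
  assume p: "p permutes {0..<n}"
  have "image_mset p (mset_set {0..<n}) = mset_set (p ` {0..<n})"
    using p by (intro image_mset_mset_set) (meson inj_on_subset permutes_inj subset_UNIV)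
  then have "image_mset p (mset_set {0..<n}) = mset_set {0..<n}" using permutes_image[OF p] by simp
  then have "image_mset d (mset_set {0..<n}) = image_mset d (image_mset p (mset_set {0..<n}))" by simp
  then show ?thesis by (simp add: degs_def image_mset.compositionality o_def)
qed

lemma degs_Suc: "degs (Suc n) d = add_mset (d 0) (degs n (\<lambda>i. d (Suc i)))"
  unfolding degs_def by (subst upt_conv_Cons) (simp_all flip: map_Suc_upt add: o_def del: upt_Suc)

lemma degs_remove: "k < n \<Longrightarrow> degs n d = add_mset (d k) (image_mset d (mset_set ({..<n} - {k})))"
  unfolding degs_alt by (subst mset_set.remove[of _ k]) auto

lemma degs_upd: "k < n \<Longrightarrow> degs n (\<lambda>i. if i = k then x else d i) = add_mset x (degs n d - {#d k#})"
proof -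
  assume k: "k < n"
  have "image_mset (\<lambda>i. if i = k then x else d i) (mset_set ({..<n} - {k})) = image_mset d (mset_set ({..<n} - {k}))"
    by (rule image_mset_cong) auto
  then show ?thesis using degs_remove[OF k, of "\<lambda>i. if i = k then x else d i"] degs_remove[OF k, of d] by simp
qed

lemma sum_mset_degs: "sum_mset (degs n d) = (\<Sum>i<n. d i)"
  by (simp add: degs_alt sum_unfold_sum_mset)

lemma size_degs [simp]: "size (degs n d) = n"
  by (simp add: degs_def)

lemma size_filter_degs: "size (filter_mset P (degs n d)) = card {i. i < n \<and> P (d i)}"
proof -
  have "filter_mset P (degs n d) = image_mset d (mset_set {i. i < n \<and> P (d i)})"
    by (simp add: degs_alt filter_mset_image_mset Collect_conj_eq lessThan_def Int_commute)
  then show ?thesis by simp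
qed

lemma log_rows_permute:
  assumes "log_rows n I a \<mu> M d" "p permutes {0..<n}"
  shows "log_rows n I a \<mu> (\<lambda>i. M (p i)) (\<lambda>i. d (p i))"
  using assms(1) permutes_less[OF assms(2)] by (simp add: log_rows_def)

lemma saitoI: "log_rows n I a \<mu> M d \<Longrightarrow> u \<noteq> 0 \<Longrightarrow> mdet n M = const u * defpoly n I a \<mu> \<Longrightarrow> saito n I a \<mu> M d"
  unfolding saito_def by (intro conjI exI[of _ u])

lemma saitoE:
  assumes "saito n I a \<mu> M d"
  obtains u where "log_rows n I a \<mu> M d" "u \<noteq> 0" "mdet n M = const u * defpoly n I a \<mu>"
proof -
  from assms[unfolded saito_def] show ?thesis by (elim conjE exE) (rule that)
qed

lemma saito_permute:
  assumes "saito n I a \<mu> M d" "p permutes {0..<n}"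
  shows "saito n I a \<mu> (\<lambda>i. M (p i)) (\<lambda>i. d (p i))"
proof -
  obtain c where c: "log_rows n I a \<mu> M d" "c \<noteq> 0" "mdet n M = const c * defpoly n I a \<mu>"
    using assms(1) by (rule saitoE)
  have "mdet n (\<lambda>i. M (p i)) = const (signof p * c) * defpoly n I a \<mu>"
    using mdet_permute[OF assms(2), of M] c by (auto simp: sign_def)
  moreover have "signof p * c \<noteq> 0" using c by (simp add: sign_def)
  ultimately show ?thesis using log_rows_permute[OF c(1) assms(2)] by (intro saitoI)
qed

lemma saito_row_to_front:
  assumes "saito n I a \<mu> M d" "k < n"
  obtains N e where "saito n I a \<mu> N e" "degs n e = degs n d" "N 0 = M k" "e 0 = d k"
proof -
  have p: "Transposition.transpose 0 k permutes {0..<n}"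
    using assms(2) by (intro permutes_swap_id) auto
  show ?thesis
    using that[OF saito_permute[OF assms(1) p] degs_permute[OF p]] by simp
qed

text \<open>P and R are base changes inverse to each other, given by their effect on the forms.
  Polynomials are transported by the substitution that belongs to R, and the values on the
  variables are recombined by P.\<close>

lemma saito_change_coordinates:
  assumes s: "saito n I a \<mu> M d"
    and P: "\<And>h i. h \<in> I \<Longrightarrow> i < n \<Longrightarrow> a h i = (\<Sum>j<n. P i j * a' h j)"
    and R: "\<And>h j. h \<in> I \<Longrightarrow> j < n \<Longrightarrow> a' h j = (\<Sum>i<n. R j i * a h i)"
    and PR: "\<And>i l. i < n \<Longrightarrow> l < n \<Longrightarrow> (\<Sum>j<n. P i j * R j l) = (if i = l then 1 else 0)"
  shows "\<exists>N. saito n I a' \<mu> N d"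
proof -
  define \<sigma> where "\<sigma> = poly_subst (\<lambda>i. if i < n then \<Sum>j<n. const (R j i) * var j else 0)"
  define N where "N r j = (\<Sum>i<n. \<sigma> (M r i) * const (P i j))" for r j
  have lr: "log_rows n I a \<mu> M d" using s by (simp add: saito_def)
  have sl: "\<sigma> (lform n (a h)) = lform n (a' h)" if h: "h \<in> I" for h
  proof -
    have "\<sigma> (lform n (a h)) = (\<Sum>i<n. \<Sum>j<n. const (R j i * a h i) * var j)"
      unfolding \<sigma>_def poly_subst_lform by (rule sum.cong) (auto simp: sum_distrib_left mult_ac)
    also have "\<dots> = (\<Sum>j<n. const (\<Sum>i<n. R j i * a h i) * var j)"
      by (subst sum.swap) (simp add: const_sum sum_distrib_right)
    also have "\<dots> = lform n (a' h)" using R[OF h] by (simp add: lform_def)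
    finally show ?thesis .
  qed
  have sa: "app n (a' h) (N r) = \<sigma> (app n (a h) (M r))" if h: "h \<in> I" for h r
  proof -
    have "app n (a' h) (N r) = (\<Sum>j<n. \<Sum>i<n. const (P i j * a' h j) * \<sigma> (M r i))"
      unfolding app_def N_def by (simp add: sum_distrib_left mult_ac)
    also have "\<dots> = (\<Sum>i<n. const (\<Sum>j<n. P i j * a' h j) * \<sigma> (M r i))"
      by (subst sum.swap) (simp add: const_sum sum_distrib_right)
    also have "\<dots> = (\<Sum>i<n. const (a h i) * \<sigma> (M r i))" using P[OF h] by (intro sum.cong) auto
    finally show ?thesis unfolding \<sigma>_def poly_subst_app unfolding app_def .
  qed
  have hs: "homogeneous 1 (if i < n then \<Sum>j<n. const (R j i) * var j else 0)" for i
    by (auto intro!: homogeneous_sum homogeneous_const_mult)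
  have "log_rows n I a' \<mu> N d"
    unfolding log_rows_def
  proof (intro allI impI conjI ballI)
    fix i assume i: "i < n"
    show "polyvec n (N i)"
      unfolding polyvec_def N_def \<sigma>_def
      by (intro allI impI poly_ring_closed2 poly_ring_closed poly_subst_in_poly_ring[of _ n])
        (use log_rowsD(4)[OF lr i] in auto)
    have "homogeneous (d i + 0) (\<sigma> (M i j) * const (P j k))" if "j < n" for j k
      unfolding \<sigma>_def by (intro homogeneous_mult homogeneous_poly_subst hs) (use log_rowsD(5)[OF lr i that] in auto)
    then show "homvec n (d i) (N i)"
      unfolding homvec_def N_def by (auto intro!: homogeneous_sum)
    fix h assume h: "h \<in> I"
    have "lform n (a h) ^ \<mu> h dvd app n (a h) (M i)" using log_rowsD(3)[OF lr i h] by (simp add: tang_def)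
    then have "\<sigma> (lform n (a h) ^ \<mu> h) dvd \<sigma> (app n (a h) (M i))" unfolding \<sigma>_def by (rule poly_subst_dvd)
    then show "tang n (a' h) (\<mu> h) (N i)"
      unfolding tang_def sa[OF h] using sl[OF h] by (simp add: \<sigma>_def)
  qed
  moreover have "\<exists>c. c \<noteq> 0 \<and> mdet n N = const c * defpoly n I a' \<mu>"
  proof -
    obtain c where c: "c \<noteq> 0" "mdet n M = const c * defpoly n I a \<mu>" using s by (rule saitoE)
    have "mdet n (\<lambda>i j. const (P i j)) * mdet n (\<lambda>i j. const (R i j)) = mdet n (\<lambda>i j. if i = j then 1 else 0)"
      unfolding mdet_mult[symmetric]
    proof (rule mdet_cong)
      fix i l assume il: "i < n" "l < n"
      have "(\<Sum>j<n. const (P i j) * const (R j l)) = const (\<Sum>j<n. P i j * R j l)" by (simp add: const_sum)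
      also have "\<dots> = (if i = l then 1 else 0)" unfolding PR[OF il] by simp
      finally show "(\<Sum>j<n. const (P i j) * const (R j l)) = (if i = l then 1 else 0)" .
    qed
    then have one: "mdet n (\<lambda>i j. const (P i j)) dvd 1" unfolding mdet_one by (rule dvdI[OF sym])
    moreover have "homogeneous (\<Sum>i<n. 0) (mdet n (\<lambda>i j. const (P i j)))" by (rule homogeneous_mdet) simp
    ultimately obtain u where u: "u \<noteq> 0" "mdet n (\<lambda>i j. const (P i j)) = const u"
      using homogeneous_unit[OF _ one] by blast
    have "mdet n N = \<sigma> (mdet n M) * const u"
      unfolding u(2)[symmetric] \<sigma>_def mdet_subst mdet_mult[symmetric] by (rule mdet_cong) (simp add: N_def \<sigma>_def)
    also have "\<sigma> (mdet n M) = const c * defpoly n I a' \<mu>"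
      unfolding c(2) using sl by (simp add: defpoly_def \<sigma>_def poly_subst_prod)
    finally have "mdet n N = const (c * u) * defpoly n I a' \<mu>" by (simp add: mult_ac)
    then show ?thesis using c(1) u(1) by (intro exI[of _ "c * u"]) auto
  qed
  ultimately show ?thesis unfolding saito_def by (intro exI[of _ N] conjI)
qed

text \<open>A logarithmic derivation whose degree is the multiplicity of a form and which does not
  annihilate this form can replace a row of the same degree: comparing degrees shows that a row with
  nonzero contribution enters with a constant coefficient.\<close>

lemma saito_row_of_degree:
  assumes np: "nonprop n I a" and s: "saito n I a \<mu> M d" and h: "h \<in> I"
    and w: "polyvec n w" "homvec n (\<mu> h) w" "\<And>h. h \<in> I \<Longrightarrow> tang n (a h) (\<mu> h) w" "app n (a h) w \<noteq> 0"
  obtains k c \<gamma> g where "k < n" "d k = \<mu> h" "\<forall>i<n. c i \<in> poly_ring n" "\<forall>j<n. w j = (\<Sum>i<n. c i * M i j)"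
    "c k = const \<gamma>" "\<gamma> \<noteq> 0" "app n (a h) (M k) = const g * lform n (a h) ^ \<mu> h" "g \<noteq> 0"
proof -
  let ?L = "lform n (a h) ^ \<mu> h"
  have lr: "log_rows n I a \<mu> M d" using s by (simp add: saito_def)
  have L0: "?L \<noteq> 0" using nonprop_prime[OF np h] by (auto simp: prime_elem_def)
  have hL: "homogeneous (\<mu> h) ?L" using homogeneous_power[OF homogeneous_lform(1)[of n "a h"], of "\<mu> h"] by simp
  obtain c where c: "\<forall>i<n. c i \<in> poly_ring n" "\<forall>k<n. w k = (\<Sum>i<n. c i * M i k)"
    "\<forall>i<n. homogeneous (\<mu> h - d i) (c i) \<and> (\<mu> h < d i \<longrightarrow> c i = 0)"
    using saito_expand_hom[OF np s w(1,2,3)] by blast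
  have "app n (a h) w = app n (a h) (\<lambda>k. \<Sum>i<n. c i * M i k)" by (rule app_cong) (use c in auto)
  also have "\<dots> = (\<Sum>i<n. c i * app n (a h) (M i))" by (simp add: app_sum app_mult)
  finally have "(\<Sum>i<n. c i * app n (a h) (M i)) \<noteq> 0" using w(4) by simp
  then obtain k where k: "k < n" "c k * app n (a h) (M k) \<noteq> 0" by (metis (no_types, lifting) lessThan_iff sum.neutral)
  obtain q where q: "app n (a h) (M k) = ?L * q" using log_rowsD(3)[OF lr k(1) h] unfolding tang_def by (rule dvdE)
  have "homogeneous (d k) (?L * q)"
    unfolding q[symmetric] app_def using log_rowsD(5)[OF lr k(1)] by (intro homogeneous_sum homogeneous_const_mult) auto
  moreover have "q \<noteq> 0" using k q by auto
  ultimately have 1: "\<mu> h \<le> d k \<and> homogeneous (d k - \<mu> h) q" using homogeneous_factor hL L0 by blast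
  have "\<not> \<mu> h < d k" using c(3) k by auto
  then have dk: "d k = \<mu> h" using 1 by simp
  then have "homogeneous 0 q" "homogeneous 0 (c k)" using 1 c(3) k(1) by auto
  then obtain \<gamma> g where "c k = const \<gamma>" "q = const g" using homogeneous_0_const by blast
  then show ?thesis using that[OF k(1) dk c(1,2)] q k by (auto simp: mult.commute)
qed

section \<open>Restriction to a hyperplane in coordinates\<close>

text \<open>rho k sets the variable of index k to zero and closes the gap in the numbering; ups
  k reopens the gap. Thus rho restricts polynomials to a coordinate hyperplane, and ups is a
  section of it.\<close>

definition rho :: "nat \<Rightarrow> 'k::field mpoly \<Rightarrow> 'k mpoly" where
  "rho k = poly_subst (\<lambda>j. if j < k then var j else if j = k then 0 else var (j - 1))"

definition ups :: "nat \<Rightarrow> 'k::field mpoly \<Rightarrow> 'k mpoly" where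
  "ups k = poly_subst (\<lambda>j. var (insert_index k j))"

lemma rho_simps [simp]:
  "rho k 0 = 0" "rho k 1 = 1" "rho k (const c) = const c" "rho k (f + g) = rho k f + rho k g"
  "rho k (f - g) = rho k f - rho k g" "rho k (- f) = - rho k f" "rho k (f * g) = rho k f * rho k g"
  "rho k (f ^ m) = rho k f ^ m" "rho k (var k) = 0" "rho k (var (insert_index k j)) = var j"
  by (simp_all add: rho_def insert_index_def)

lemma ups_simps [simp]:
  "ups k 0 = 0" "ups k 1 = 1" "ups k (const c) = const c" "ups k (f + g) = ups k f + ups k g"
  "ups k (f - g) = ups k f - ups k g" "ups k (- f) = - ups k f" "ups k (f * g) = ups k f * ups k g"
  "ups k (f ^ m) = ups k f ^ m" "ups k (var j) = var (insert_index k j)"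
  by (simp_all add: ups_def)

lemma rho_sum: "rho k (\<Sum>i\<in>S. F i) = (\<Sum>i\<in>S. rho k (F i))"
  and rho_prod: "rho k (\<Prod>i\<in>S. F i) = (\<Prod>i\<in>S. rho k (F i))"
  and ups_sum: "ups k (\<Sum>i\<in>S. F i) = (\<Sum>i\<in>S. ups k (F i))"
  and ups_prod: "ups k (\<Prod>i\<in>S. F i) = (\<Prod>i\<in>S. ups k (F i))"
  by (simp_all add: rho_def ups_def poly_subst_sum poly_subst_prod)

lemma rho_dvd: "f dvd g \<Longrightarrow> rho k f dvd rho k g"
  unfolding rho_def by (rule poly_subst_dvd)

lemma rho_ups [simp]: "rho k (ups k f) = f"
proof -
  have "rho k (ups k f) = poly_subst var f"
    unfolding rho_def ups_def poly_subst_comp by (rule arg_cong[of _ _ "\<lambda>s. poly_subst s f"]) (auto simp: insert_index_def)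
  then show ?thesis by simp
qed

lemma var_dvd_ups_rho: "var k dvd f - ups k (rho k f)"
proof -
  have "var k dvd poly_subst var f - poly_subst (\<lambda>j. if j = k then 0 else var j) f"
    by (rule poly_subst_congruent) simp
  moreover have "(if i = k then 0 else var i) = poly_subst (\<lambda>j. var (insert_index k j))
      (if i < k then var i else if i = k then 0 else var (i - 1))" for i
    by (auto simp: insert_index_def)
  then have "poly_subst (\<lambda>j. if j = k then 0 else var j) f = ups k (rho k f)"
    unfolding rho_def ups_def poly_subst_comp by (rule arg_cong[of _ _ "\<lambda>s. poly_subst s f", OF ext])
  ultimately show ?thesis by simp
qed

lemma var_dvd_iff: "var k dvd f \<longleftrightarrow> rho k f = 0"
proof
  assume "var k dvd f"
  then have "rho k (var k) dvd rho k f" by (rule rho_dvd)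
  then show "rho k f = 0" by simp
qed (use var_dvd_ups_rho[of k f] in simp)

lemma rho_in_poly_ring: "f \<in> poly_ring n \<Longrightarrow> k < n \<Longrightarrow> rho k f \<in> poly_ring (n - 1)"
  unfolding rho_def by (rule poly_subst_in_poly_ring) auto

lemma ups_in_poly_ring: "f \<in> poly_ring n \<Longrightarrow> ups k f \<in> poly_ring (Suc n)"
  unfolding ups_def by (rule poly_subst_in_poly_ring) (auto simp: insert_index_def)

lemma homogeneous_rho: "homogeneous e f \<Longrightarrow> homogeneous e (rho k f)"
  unfolding rho_def by (rule homogeneous_poly_subst) auto

lemma homogeneous_ups: "homogeneous e f \<Longrightarrow> homogeneous e (ups k f)"
  unfolding ups_def by (rule homogeneous_poly_subst) auto

lemma sum_insert_index:
  assumes "k < n"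
  shows "(\<Sum>i<n. F i) = F k + (\<Sum>j<n - 1. F (insert_index k j))"
proof -
  have "{..<n} - {k} = insert_index k ` {..<n - 1}"
  proof -
    have "i \<in> insert_index k ` {..<n - 1}" if "i < n" "i \<noteq> k" for i
    proof (cases "i < k")
      case True
      then have "i = insert_index k i" by simp
      then show ?thesis using True assms by (intro image_eqI[of _ _ i]) auto
    next
      case False
      then have "i = insert_index k (i - 1)" using that by (simp add: insert_index_def)
      then show ?thesis using False that by (intro image_eqI[of _ _ "i - 1"]) auto
    qed
    then show ?thesis using assms by (auto simp: insert_index_def split: if_splits)
  qed
  moreover have "inj_on (insert_index k) {..<n - 1}" by (auto simp: inj_on_def insert_index_def split: if_splits)
  ultimately show ?thesis using assms by (simp add: sum.remove[of _ k] sum.reindex)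
qed

lemma rho_lform: "k < n \<Longrightarrow> rho k (lform n a) = lform (n - 1) (\<lambda>j. a (insert_index k j))"
  unfolding lform_def by (subst sum_insert_index) (auto simp: rho_sum)

lemma rho_app: "k < n \<Longrightarrow> rho k (app n a v) =
    const (a k) * rho k (v k) + app (n - 1) (\<lambda>j. a (insert_index k j)) (\<lambda>j. rho k (v (insert_index k j)))"
  unfolding app_def by (subst sum_insert_index) (auto simp: rho_sum)

lemma insert_index_0 [simp]: "insert_index 0 = Suc"
  by (auto simp: insert_index_def)

lemma ups_0_lform: "ups 0 (lform m b) = lform (Suc m) (case_nat 0 b)"
  by (simp add: lform_def ups_sum sum.lessThan_Suc_shift del: sum.lessThan_Suc)

text \<open>The arrangement I is restricted to its member i0, whose form is a multiple of the
  variable of index k. The member h of I - {i0} restricts to the member r h of J, and c h is the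
  factor by which its form differs from the chosen form of r h. The index k is arbitrary because
  two hyperplanes are later put into coordinates simultaneously.\<close>

locale restr =
  fixes n k :: nat and I :: "'i set" and i0 :: 'i and a :: "'i \<Rightarrow> nat \<Rightarrow> 'k::field"
    and J :: "'j set" and b :: "'j \<Rightarrow> nat \<Rightarrow> 'k" and r :: "'i \<Rightarrow> 'j" and c :: "'i \<Rightarrow> 'k"
  assumes kn: "k < n" and i0: "i0 \<in> I" and npI: "nonprop n I a" and npJ: "nonprop (n - 1) J b"
    and a0: "\<And>j. j < n \<Longrightarrow> j \<noteq> k \<Longrightarrow> a i0 j = 0"
    and rJ: "r ` (I - {i0}) = J"
    and c0: "\<And>h. h \<in> I - {i0} \<Longrightarrow> c h \<noteq> 0"
    and ab: "\<And>h j. h \<in> I - {i0} \<Longrightarrow> j < n - 1 \<Longrightarrow> a h (insert_index k j) = c h * b (r h) j"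
begin

text \<open>Its cardinality is Ziegler's multiplicity of w.\<close>

definition fib :: "'j \<Rightarrow> 'i set" where
  "fib w = {h \<in> I - {i0}. r h = w}"

lemma finI: "finite I" and finJ: "finite J"
  using npI npJ by (auto intro: nonprop_finite)

lemma fin_fib [simp]: "finite (fib w)"
  using finI by (simp add: fib_def)

lemma card_fib: "w \<in> J \<Longrightarrow> card (fib w) \<ge> 1"
proof -
  assume "w \<in> J"
  then have "fib w \<noteq> {}" using rJ by (auto simp: fib_def)
  then show ?thesis by (simp add: Suc_le_eq card_gt_0_iff)
qed

lemma ak: "a i0 k \<noteq> 0"
  using npI i0 a0 by (force simp: nonprop_def)

lemma lform_i0: "lform n (a i0) = const (a i0 k) * var k"
  by (rule lform_eq_var) (use kn a0 in auto)

lemma app_i0: "app n (a i0) v = const (a i0 k) * v k"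
  by (rule app_unit) (use kn a0 in auto)

lemma tang_i0: "tang n (a i0) m v \<longleftrightarrow> var k ^ m dvd v k"
  unfolding tang_def lform_i0 app_i0 power_mult_distrib const_power[symmetric]
  using ak by (simp only: const_unit const_unit2 power_eq_0_iff simp_thms)

lemma rho_form: "h \<in> I - {i0} \<Longrightarrow> rho k (lform n (a h)) = const (c h) * lform (n - 1) (b (r h))"
  unfolding rho_lform[OF kn] lform_scale[symmetric] by (rule lform_cong) (rule ab)

lemma sum_fib: "S \<subseteq> I - {i0} \<Longrightarrow> r ` S \<subseteq> T \<Longrightarrow> T \<subseteq> J \<Longrightarrow> (\<Sum>w\<in>T. card {h \<in> S. r h = w}) = card S"
  using sum.group[of S T r "\<lambda>_. 1 :: nat"] finI finJ by (simp add: finite_subset)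

lemma rho_prod_forms:
  assumes "S \<subseteq> I - {i0}" "r ` S \<subseteq> T" "T \<subseteq> J"
  shows "\<exists>u. u \<noteq> 0 \<and> rho k (\<Prod>h\<in>S. lform n (a h)) = const u * defpoly (n - 1) T b (\<lambda>w. card {h \<in> S. r h = w})"
proof (intro exI conjI)
  have fS: "finite S" "finite T" using assms finI finJ by (auto intro: finite_subset)
  show "(\<Prod>h\<in>S. c h) \<noteq> 0" using assms c0 fS by auto
  have "rho k (\<Prod>h\<in>S. lform n (a h)) = (\<Prod>h\<in>S. const (c h) * lform (n - 1) (b (r h)))"
    unfolding rho_prod by (rule prod.cong) (use assms rho_form in auto)
  also have "\<dots> = const (\<Prod>h\<in>S. c h) * (\<Prod>h\<in>S. lform (n - 1) (b (r h)))"
    by (simp add: prod.distrib const_prod)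
  also have "(\<Prod>h\<in>S. lform (n - 1) (b (r h))) = (\<Prod>w\<in>T. \<Prod>h\<in>{h \<in> S. r h = w}. lform (n - 1) (b (r h)))"
    using fS assms by (intro prod.group[symmetric]) auto
  also have "\<dots> = defpoly (n - 1) T b (\<lambda>w. card {h \<in> S. r h = w})"
    unfolding defpoly_def by (rule prod.cong) auto
  finally show "rho k (\<Prod>h\<in>S. lform n (a h)) = const (\<Prod>h\<in>S. c h) * defpoly (n - 1) T b (\<lambda>w. card {h \<in> S. r h = w})" .
qed

lemma rho_defpoly:
  "\<exists>u. u \<noteq> 0 \<and> rho k (defpoly n (I - {i0}) a (\<lambda>_. 1)) = const u * defpoly (n - 1) J b (\<lambda>w. card (fib w))"
  using rho_prod_forms[of "I - {i0}" J] rJ by (simp add: defpoly_def fib_def)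

text \<open>The key to Ziegler's multiplicity: a derivation that annihilates the coordinate of the
  hyperplane takes the same value, up to scalars, on all forms with the same restriction. If it is
  tangent to all of them, this value is divisible by their product.\<close>

lemma tang_restrict:
  assumes v: "v k = 0" and S: "S \<subseteq> I - {i0}" and t: "\<And>h. h \<in> S \<Longrightarrow> tang n (a h) 1 v"
  shows "tang (n - 1) (b w) (card {h \<in> S. r h = w}) (\<lambda>j. rho k (v (insert_index k j)))"
proof -
  let ?S = "{h \<in> S. r h = w}"
  let ?X = "app (n - 1) (b w) (\<lambda>j. v (insert_index k j))"
  have fS: "finite ?S" using S finI by (auto intro: finite_subset)
  have "lform n (a h) dvd ?X" if h: "h \<in> ?S" for h
  proof -
    have h': "h \<in> I - {i0}" "r h = w" using h S by auto
    have "app n (a h) v = const (a h k) * v k + (\<Sum>j<n - 1. const (a h (insert_index k j)) * v (insert_index k j))"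
      unfolding app_def by (rule sum_insert_index[OF kn])
    also have "\<dots> = (\<Sum>j<n - 1. const (c h * b w j) * v (insert_index k j))"
      using v ab[OF h'(1)] h'(2) by simp
    also have "\<dots> = const (c h) * ?X" unfolding app_def sum_distrib_left by (simp add: mult.assoc)
    finally have "app n (a h) v = const (c h) * ?X" .
    then show ?thesis using t[of h] h const_unit2[OF c0[OF h'(1)], of "lform n (a h)" ?X] by (simp add: tang_def)
  qed
  moreover have SI: "?S \<subseteq> I" using S by blast
  ultimately have "defpoly n ?S a (\<lambda>_. 1) dvd ?X"
    by (intro nonprop_defpoly_dvd[OF nonprop_subset[OF npI SI]]) simp
  then have d: "rho k (\<Prod>h\<in>?S. lform n (a h)) dvd rho k ?X" unfolding defpoly_def power_one_right by (rule rho_dvd)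
  have "rho k (\<Prod>h\<in>?S. lform n (a h)) = (\<Prod>h\<in>?S. const (c h) * lform (n - 1) (b w))"
    unfolding rho_prod by (rule prod.cong) (use S rho_form in auto)
  also have "\<dots> = const (\<Prod>h\<in>?S. c h) * lform (n - 1) (b w) ^ card ?S"
    by (simp add: prod.distrib const_prod)
  finally have e: "rho k (\<Prod>h\<in>?S. lform n (a h)) = const (\<Prod>h\<in>?S. c h) * lform (n - 1) (b w) ^ card ?S" .
  have "(\<Prod>h\<in>?S. c h) \<noteq> 0" using c0 S fS by auto
  then have "lform (n - 1) (b w) ^ card ?S dvd rho k ?X" using d[unfolded e] by (rule const_unit[THEN iffD1])
  then show ?thesis by (simp add: tang_def app_def rho_sum)
qed

lemma tang_restrict_simple:
  assumes v: "rho k (v k) = 0" and w: "w \<in> J" and t: "\<And>h. h \<in> I - {i0} \<Longrightarrow> tang n (a h) 1 v"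
  shows "tang (n - 1) (b w) 1 (\<lambda>j. rho k (v (insert_index k j)))"
proof -
  obtain h where h: "h \<in> I - {i0}" "r h = w" using w rJ by auto
  have "rho k (lform n (a h)) dvd rho k (app n (a h) v)" using t[OF h(1)] by (simp add: tang_def rho_dvd)
  then have "tang (n - 1) (\<lambda>j. c h * b w j) 1 (\<lambda>j. rho k (v (insert_index k j)))"
    unfolding rho_app[OF kn] rho_lform[OF kn] tang_def using v ab[OF h(1)] h(2)
    by (simp cong: app_cong lform_cong)
  then show ?thesis using tang_scale[OF c0[OF h(1)]] by blast
qed

end

locale restr0 = restr "Suc m" 0 I i0 a J b r c
  for m :: nat and I :: "'i set" and i0 :: 'i and a :: "'i \<Rightarrow> nat \<Rightarrow> 'k::field"
    and J :: "'j set" and b :: "'j \<Rightarrow> nat \<Rightarrow> 'k" and r :: "'i \<Rightarrow> 'j" and c :: "'i \<Rightarrow> 'k"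
begin

lemma npJ': "nonprop m J b"
  using npJ by simp

subsection \<open>Derivations annihilating the coordinate\<close>

text \<open>The rows are derivations annihilating the coordinate of i0, without their zero
  entry. They are tangent to i0 to every order.\<close>

definition core :: "(nat \<Rightarrow> nat \<Rightarrow> 'k mpoly) \<Rightarrow> (nat \<Rightarrow> nat) \<Rightarrow> bool" where
  "core N e \<longleftrightarrow>
     (\<forall>i<m. \<forall>j<m. N i j \<in> poly_ring (Suc m) \<and> homogeneous (e i) (N i j)) \<and>
     (\<forall>i<m. \<forall>h\<in>I - {i0}. tang (Suc m) (a h) 1 (case_nat 0 (N i))) \<and>
     (\<exists>u. u \<noteq> 0 \<and> mdet m N = const u * defpoly (Suc m) (I - {i0}) a (\<lambda>_. 1))"

definition delta :: "nat \<Rightarrow> 'i \<Rightarrow> nat" where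
  "delta m0 h = (if h = i0 then m0 else 1)"

lemma defpoly_delta:
  "defpoly (Suc m) I a (delta m0) = (const (a i0 0) * var 0) ^ m0 * defpoly (Suc m) (I - {i0}) a (\<lambda>_. 1)"
proof -
  have "defpoly (Suc m) (I - {i0}) a (delta m0) = defpoly (Suc m) (I - {i0}) a (\<lambda>_. 1)"
    by (rule defpoly_cong) (auto simp: delta_def)
  moreover have "defpoly (Suc m) I a (delta m0) = lform (Suc m) (a i0) ^ delta m0 i0 * defpoly (Suc m) (I - {i0}) a (delta m0)"
    unfolding defpoly_def by (rule prod.remove[OF finI i0])
  ultimately show ?thesis using lform_i0 by (simp add: delta_def)
qed

text \<open>The Euler derivation times a power of the coordinate of i0, which accounts for the
  exponent m0.\<close>

definition euler_multiple :: "nat \<Rightarrow> nat \<Rightarrow> 'k mpoly" where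
  "euler_multiple m0 j = var 0 ^ (m0 - 1) * var j"

lemma app_euler: "app (Suc m) (a h) (euler_multiple m0) = var 0 ^ (m0 - 1) * lform (Suc m) (a h)"
  unfolding euler_multiple_def app_mult app_var ..

lemma euler_multiple_0: "1 \<le> m0 \<Longrightarrow> euler_multiple m0 0 = var 0 ^ m0"
  unfolding euler_multiple_def by (simp flip: power_Suc2)

lemma euler_multiple_log:
  assumes "1 \<le> m0"
  shows "polyvec (Suc m) (euler_multiple m0)" "homvec (Suc m) m0 (euler_multiple m0)"
    "tang (Suc m) (a h) (delta m0 h) (euler_multiple m0)"
proof -
  show "polyvec (Suc m) (euler_multiple m0)" by (auto simp: polyvec_def euler_multiple_def)
  have "homogeneous (1 * (m0 - 1) + 1) (euler_multiple m0 j)" for j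
    unfolding euler_multiple_def by (intro homogeneous_mult homogeneous_power) auto
  then show "homvec (Suc m) m0 (euler_multiple m0)" using assms by (simp add: homvec_def)
  show "tang (Suc m) (a h) (delta m0 h) (euler_multiple m0)"
  proof (cases "h = i0")
    case True
    then show ?thesis using assms by (simp add: tang_i0 delta_def euler_multiple_0)
  next
    case False
    then show ?thesis by (simp add: delta_def tang_def app_euler)
  qed
qed

lemma mult_const_cancel: "u \<noteq> 0 \<Longrightarrow> const u * x = const v * y \<Longrightarrow> x = const (inverse u * v) * y"
proof -
  assume u: "u \<noteq> 0" and e: "const u * x = const v * y"
  have "x = const (inverse u * u) * x" using u by simp
  also have "\<dots> = const (inverse u) * (const u * x)" by (simp only: const_simps mult.assoc)
  also have "\<dots> = const (inverse u * v) * y" unfolding e by (simp only: const_simps mult.assoc)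
  finally show ?thesis .
qed

text \<open>Expanding the multiple of the Euler derivation, one finds a row whose value on the coordinate is
  a constant times its power m0. All other values on the coordinate are divisible by this power.
  Clearing them leaves derivations that annihilate the coordinate, so that m0 no longer matters.\<close>

lemma core_of_saito:
  assumes m0: "1 \<le> m0" and s: "saito (Suc m) I a (delta m0) M d"
  shows "\<exists>N e. core N e \<and> degs (Suc m) d = add_mset m0 (degs m e)"
proof -
  have app0: "app (Suc m) (a i0) (euler_multiple m0) \<noteq> 0"
    using ak by (simp add: app_i0 euler_multiple_0[OF m0])
  obtain k \<gamma> g where k: "k < Suc m" "d k = delta m0 i0"
    and Mk: "app (Suc m) (a i0) (M k) = const g * lform (Suc m) (a i0) ^ delta m0 i0" "g \<noteq> 0"
    by (rule saito_row_of_degree[OF npI s i0, of "euler_multiple m0"])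
      (use euler_multiple_log[OF m0] app0 in \<open>auto simp: delta_def\<close>)
  obtain M1 d1 where M1: "saito (Suc m) I a (delta m0) M1 d1" "degs (Suc m) d1 = degs (Suc m) d" "M1 0 = M k" "d1 0 = d k"
    using s k(1) by (rule saito_row_to_front)
  obtain u1 where lr: "log_rows (Suc m) I a (delta m0) M1 d1" and u1: "u1 \<noteq> 0" "mdet (Suc m) M1 = const u1 * defpoly (Suc m) I a (delta m0)"
    using M1(1) by (rule saitoE)
  have d10: "d1 0 = m0" using M1(4) k(2) by (simp add: delta_def)
  have "const (a i0 0) * M1 0 0 = const (g * a i0 0 ^ m0) * var 0 ^ m0"
    using Mk(1) unfolding app_i0 lform_i0 M1(3) by (simp add: delta_def power_mult_distrib const_power mult.assoc)
  note M100 = mult_const_cancel[OF ak this]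
  define v where "v = inverse (a i0 0) * (g * a i0 0 ^ m0)"
  have v: "M1 0 0 = const v * var 0 ^ m0" "v \<noteq> 0"
    using M100 Mk(2) ak unfolding v_def by auto
  have "\<exists>f. M1 i 0 = f * M1 0 0 \<and> f \<in> poly_ring (Suc m) \<and> (\<forall>j<Suc m. homogeneous (d1 i) (f * M1 0 j))" if i: "i < Suc m" for i
  proof -
    have "var 0 ^ m0 dvd M1 i 0" using log_rowsD(3)[OF lr i i0] by (simp add: tang_i0 delta_def)
    then obtain q where q: "q \<in> poly_ring (Suc m)" "M1 i 0 = var 0 ^ m0 * q"
      using dvd_in_poly_ring[of "var 0 ^ m0" "M1 i 0" "Suc m"] log_rowsD(4)[OF lr i, of 0] by auto
    have "homogeneous (d1 i) (const (inverse v) * q * M1 0 j)" if j: "j < Suc m" for j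
    proof (cases "q = 0")
      case False
      have "homogeneous m0 (var 0 ^ m0 :: 'k mpoly)" using homogeneous_power[of 1 "var 0" m0] by simp
      moreover have "homogeneous (d1 i) (var 0 ^ m0 * q)" using log_rowsD(5)[OF lr i, of 0] q by simp
      moreover have "var 0 ^ m0 \<noteq> (0 :: 'k mpoly)" by simp
      ultimately have "m0 \<le> d1 i \<and> homogeneous (d1 i - m0) q" using homogeneous_factor False by blast
      moreover have "homogeneous m0 (M1 0 j)" using log_rowsD(5)[OF lr _ j, of 0] d10 by simp
      ultimately show ?thesis
        using homogeneous_mult[of "d1 i - m0" "const (inverse v) * q" m0 "M1 0 j"] by (simp add: homogeneous_const_mult)
    qed simp
    moreover have "const (inverse v) * q * M1 0 0 = (const v * const (inverse v)) * (var 0 ^ m0 * q)"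
      unfolding v(1) by (simp only: mult_ac)
    then have "M1 i 0 = const (inverse v) * q * M1 0 0" unfolding const_inverse[OF v(2)] q(2) mult_1_left by (rule sym)
    ultimately show ?thesis using q(1) by (intro exI[of _ "const (inverse v) * q"]) auto
  qed
  then have "\<forall>i\<in>{..<Suc m}. \<exists>f. M1 i 0 = f * M1 0 0 \<and> f \<in> poly_ring (Suc m) \<and> (\<forall>j<Suc m. homogeneous (d1 i) (f * M1 0 j))"
    by blast
  from bchoice[OF this] obtain f where f: "\<And>i. i < Suc m \<Longrightarrow> M1 i 0 = f i * M1 0 0" "\<And>i. i < Suc m \<Longrightarrow> f i \<in> poly_ring (Suc m)"
      "\<And>i j. i < Suc m \<Longrightarrow> j < Suc m \<Longrightarrow> homogeneous (d1 i) (f i * M1 0 j)"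
    by auto
  define M2 where "M2 i j = (if i = 0 then M1 0 j else M1 i j - f i * M1 0 j)" for i j
  define N where "N i j = M2 (Suc i) (Suc j)" for i j
  have zero: "M2 (Suc i) 0 = 0" if "i < m" for i using f(1)[of "Suc i"] that by (simp add: M2_def)
  have "mdet (Suc m) M2 = mdet (Suc m) M1"
    unfolding M2_def by (rule mdet_rowops) simp
  moreover have "mdet (Suc m) M2 = M1 0 0 * mdet m N"
    unfolding N_def by (subst mdet_col0) (use zero in \<open>auto simp: M2_def gr0_conv_Suc\<close>)
  ultimately have "M1 0 0 * mdet m N = const u1 * defpoly (Suc m) I a (delta m0)" using u1 by simp
  then have "var 0 ^ m0 * (const v * mdet m N) = var 0 ^ m0 * (const (u1 * a i0 0 ^ m0) * defpoly (Suc m) (I - {i0}) a (\<lambda>_. 1))"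
    unfolding v(1) defpoly_delta by (simp add: power_mult_distrib const_power mult_ac)
  then have "const v * mdet m N = const (u1 * a i0 0 ^ m0) * defpoly (Suc m) (I - {i0}) a (\<lambda>_. 1)"
    by (simp only: mult_cancel_left power_eq_0_iff var_nonzero simp_thms)
  from mult_const_cancel[OF v(2) this]
  have "\<exists>u. u \<noteq> 0 \<and> mdet m N = const u * defpoly (Suc m) (I - {i0}) a (\<lambda>_. 1)"
    using v(2) u1(1) ak by (intro exI[of _ "inverse v * (u1 * a i0 0 ^ m0)"]) auto
  moreover have "N i j \<in> poly_ring (Suc m) \<and> homogeneous (d1 (Suc i)) (N i j)" if "i < m" "j < m" for i j
    using log_rowsD(4,5)[OF lr] f(2,3) that by (simp add: N_def M2_def)
  moreover have "tang (Suc m) (a h) 1 (case_nat 0 (N i))" if i: "i < m" and h: "h \<in> I - {i0}" for i h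
  proof -
    have "tang (Suc m) (a h) 1 (M2 (Suc i))"
      using log_rowsD(3)[OF lr, of "Suc i" h] log_rowsD(3)[OF lr, of 0 h] i h
      unfolding M2_def by (auto simp: delta_def intro!: tang_diff tang_mult)
    moreover have "case_nat 0 (N i) j = M2 (Suc i) j" for j
      using zero[OF i] by (simp add: N_def split: nat.split)
    ultimately show ?thesis by presburger
  qed
  ultimately have "core N (\<lambda>i. d1 (Suc i))" unfolding core_def by blast
  moreover have "degs (Suc m) d = add_mset m0 (degs m (\<lambda>i. d1 (Suc i)))"
    using M1(2) degs_Suc[of m d1] d10 by simp
  ultimately show ?thesis by blast
qed

lemma saito_of_core:
  assumes m0: "1 \<le> m0" and N: "core N e"
  shows "\<exists>M. saito (Suc m) I a (delta m0) M (case_nat m0 e)"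
proof -
  obtain u where u: "u \<noteq> 0" "mdet m N = const u * defpoly (Suc m) (I - {i0}) a (\<lambda>_. 1)" using N by (auto simp: core_def)
  define M where "M = case_nat (euler_multiple m0) (\<lambda>i. case_nat 0 (N i))"
  have "mdet (Suc m) M = M 0 0 * mdet m (\<lambda>i j. M (Suc i) (Suc j))"
    by (rule mdet_col0) (auto simp: M_def gr0_conv_Suc)
  also have "\<dots> = var 0 ^ m0 * mdet m N"
    using euler_multiple_0[OF m0] by (simp add: M_def)
  finally have "const (a i0 0 ^ m0) * mdet (Suc m) M = const u * defpoly (Suc m) I a (delta m0)"
    unfolding u(2) defpoly_delta by (simp add: power_mult_distrib const_power mult_ac)
  from mult_const_cancel[OF _ this]
  have det: "mdet (Suc m) M = const (inverse (a i0 0 ^ m0) * u) * defpoly (Suc m) I a (delta m0)"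
    using ak by simp
  have "log_rows (Suc m) I a (delta m0) M (case_nat m0 e)"
    unfolding log_rows_def
  proof (intro allI impI)
    fix i assume i: "i < Suc m"
    show "polyvec (Suc m) (M i) \<and> homvec (Suc m) (case_nat m0 e i) (M i) \<and> (\<forall>h\<in>I. tang (Suc m) (a h) (delta m0 h) (M i))"
    proof (cases i)
      case 0
      then show ?thesis using euler_multiple_log[OF m0] by (simp add: M_def)
    next
      case (Suc i')
      then have i': "i' < m" using i by simp
      have "polyvec (Suc m) (case_nat 0 (N i'))" "homvec (Suc m) (e i') (case_nat 0 (N i'))"
        using N i' by (auto simp: core_def polyvec_def homvec_def split: nat.split)
      moreover have "tang (Suc m) (a h) (delta m0 h) (case_nat 0 (N i'))" if "h \<in> I" for h
        using N i' that by (cases "h = i0") (auto simp: core_def delta_def tang_i0)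
      ultimately show ?thesis using Suc by (simp add: M_def)
    qed
  qed
  then have "saito (Suc m) I a (delta m0) M (case_nat m0 e)" using ak u(1) by (intro saitoI[OF _ _ det]) auto
  then show ?thesis by blast
qed

text \<open>Ziegler's theorem: on the hyperplane, the determinant of the derivations annihilating its
  coordinate is the product of the restrictions of all the other forms.\<close>

lemma saito_ziegler:
  assumes N: "core N e"
  shows "saito m J b (\<lambda>w. card (fib w)) (\<lambda>i j. rho 0 (N i j)) e"
proof -
  obtain u where u: "u \<noteq> 0" "mdet m N = const u * defpoly (Suc m) (I - {i0}) a (\<lambda>_. 1)" using N by (auto simp: core_def)
  obtain u' where u': "u' \<noteq> 0" "rho 0 (defpoly (Suc m) (I - {i0}) a (\<lambda>_. 1)) = const u' * defpoly m J b (\<lambda>w. card (fib w))"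
    using rho_defpoly by auto
  have "mdet m (\<lambda>i j. rho 0 (N i j)) = rho 0 (mdet m N)" by (simp add: rho_def mdet_subst)
  also have "\<dots> = const (u * u') * defpoly m J b (\<lambda>w. card (fib w))" unfolding u(2) rho_simps u'(2) by (simp add: mult.assoc)
  finally have det: "mdet m (\<lambda>i j. rho 0 (N i j)) = const (u * u') * defpoly m J b (\<lambda>w. card (fib w))" .
  have "log_rows m J b (\<lambda>w. card (fib w)) (\<lambda>i j. rho 0 (N i j)) e"
    unfolding log_rows_def
  proof (intro allI impI conjI ballI)
    fix i assume i: "i < m"
    show "polyvec m (\<lambda>j. rho 0 (N i j))" using N i rho_in_poly_ring[of _ "Suc m" 0] by (auto simp: core_def polyvec_def)
    show "homvec m (e i) (\<lambda>j. rho 0 (N i j))" using N i by (auto simp: core_def homvec_def homogeneous_rho)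
    fix w assume w: "w \<in> J"
    have "tang m (b w) (card {h \<in> I - {i0}. r h = w}) (\<lambda>j. rho 0 (case_nat 0 (N i) (Suc j)))"
      using tang_restrict[of "case_nat 0 (N i)" "I - {i0}" w] N i by (simp add: core_def)
    then show "tang m (b w) (card (fib w)) (\<lambda>j. rho 0 (N i j))" by (simp add: fib_def)
  qed
  then show ?thesis using u(1) u'(1) by (intro saitoI[OF _ _ det]) auto
qed

subsection \<open>Addition\<close>

text \<open>Terao's polynomial, restricted to the hyperplane: modulo the coordinate of i0, it
  divides the value on this coordinate of every derivation of the deletion, and its degree is
  the difference of the numbers of hyperplanes of the deletion and of the restriction.\<close>

definition bpoly :: "'k mpoly" where
  "bpoly = defpoly m J b (\<lambda>w. card (fib w) - 1)"

lemma bpoly_mult: "bpoly * defpoly m J b (\<lambda>_. 1) = defpoly m J b (\<lambda>w. card (fib w))"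
  unfolding bpoly_def defpoly_def prod.distrib[symmetric]
proof (rule prod.cong)
  fix w assume "w \<in> J"
  then have "card (fib w) = Suc (card (fib w) - 1)" using card_fib by force
  then show "lform m (b w) ^ (card (fib w) - 1) * lform m (b w) ^ 1 = lform m (b w) ^ card (fib w)"
    by (metis power_Suc2 power_one_right)
qed simp

lemma bpoly_degree: "(\<Sum>w\<in>J. card (fib w) - 1) + card J = card (I - {i0})"
proof -
  have "(\<Sum>w\<in>J. card (fib w) - 1) + card J = (\<Sum>w\<in>J. (card (fib w) - 1) + 1)" unfolding sum.distrib by simp
  also have "\<dots> = (\<Sum>w\<in>J. card (fib w))" by (rule sum.cong) (use card_fib in force)+
  also have "\<dots> = card (I - {i0})" using sum_fib[of "I - {i0}" J] rJ by (simp add: fib_def)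
  finally show ?thesis .
qed

text \<open>Let b be the form of w, and let the form a of h be c b + a_0 x, where x is the
  coordinate of i0. Then b \<theta>(x) - x \<theta>(b) is divisible by a, since its multiple by
  c is a \<theta>(x) - x \<theta>(a). It is thus divisible by the product of the forms over w.
  For x = 0, this product becomes a power of b, of which one factor is cancelled.\<close>

lemma bpoly_dvd:
  assumes t: "\<And>h. h \<in> I - {i0} \<Longrightarrow> tang (Suc m) (a h) 1 v"
  shows "bpoly dvd rho 0 (v 0)"
  unfolding bpoly_def
proof (rule nonprop_defpoly_dvd[OF npJ'])
  fix w assume w: "w \<in> J"
  define x1 where "x1 = lform (Suc m) (case_nat 0 (b w))"
  define P where "P = x1 * v 0 - var 0 * app (Suc m) (case_nat 0 (b w)) v"
  have "lform (Suc m) (a h) dvd P" if h: "h \<in> fib w" for h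
  proof -
    have h': "h \<in> I - {i0}" "r h = w" using h by (auto simp: fib_def)
    have co: "a h j = c h * case_nat 0 (b w) j + (if j = 0 then a h 0 else 0)" if "j < Suc m" for j
      using ab[OF h'(1)] h'(2) that by (cases j) auto
    have l: "lform (Suc m) (a h) = const (c h) * x1 + const (a h 0) * var 0"
    proof -
      have "lform (Suc m) (a h) = (\<Sum>j<Suc m. const (c h) * (const (case_nat 0 (b w) j) * var j) + const (if j = 0 then a h 0 else 0) * var j)"
        unfolding lform_def by (rule sum.cong) (auto simp: co algebra_simps)
      also have "\<dots> = const (c h) * x1 + lform (Suc m) (\<lambda>j. if j = 0 then a h 0 else 0)"
        unfolding sum.distrib x1_def lform_def sum_distrib_left ..
      finally show ?thesis by (simp add: lform_unit)
    qed
    have ap: "app (Suc m) (a h) v = const (c h) * app (Suc m) (case_nat 0 (b w)) v + const (a h 0) * v 0"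
    proof -
      have "app (Suc m) (a h) v = (\<Sum>j<Suc m. const (c h) * (const (case_nat 0 (b w) j) * v j) + const (if j = 0 then a h 0 else 0) * v j)"
        unfolding app_def by (rule sum.cong) (auto simp: co algebra_simps)
      also have "\<dots> = const (c h) * app (Suc m) (case_nat 0 (b w)) v + app (Suc m) (\<lambda>j. if j = 0 then a h 0 else 0) v"
        unfolding sum.distrib app_def sum_distrib_left ..
      finally show ?thesis using app_unit[of 0 "Suc m" "\<lambda>j. if j = 0 then a h 0 else 0" v] by simp
    qed
    have "const (c h) * P = lform (Suc m) (a h) * v 0 - var 0 * app (Suc m) (a h) v"
      unfolding l ap P_def by (simp add: algebra_simps)
    moreover have "lform (Suc m) (a h) dvd lform (Suc m) (a h) * v 0 - var 0 * app (Suc m) (a h) v"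
      using t[OF h'(1)] by (intro dvd_diff dvd_mult dvd_triv_left) (simp add: tang_def)
    ultimately have "lform (Suc m) (a h) dvd const (c h) * P" by simp
    then show ?thesis by (rule const_unit2[OF c0[OF h'(1)], THEN iffD1])
  qed
  then have "defpoly (Suc m) (fib w) a (\<lambda>_. 1) dvd P"
    by (intro nonprop_defpoly_dvd[OF nonprop_subset[OF npI]]) (auto simp: fib_def)
  then have d: "rho 0 (\<Prod>h\<in>fib w. lform (Suc m) (a h)) dvd rho 0 P" unfolding defpoly_def power_one_right by (rule rho_dvd)
  have "rho 0 (\<Prod>h\<in>fib w. lform (Suc m) (a h)) = (\<Prod>h\<in>fib w. const (c h) * lform m (b w))"
    unfolding rho_prod by (rule prod.cong) (auto simp: fib_def rho_form)
  also have "\<dots> = const (\<Prod>h\<in>fib w. c h) * lform m (b w) ^ card (fib w)"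
    by (simp add: prod.distrib const_prod)
  finally have e: "rho 0 (\<Prod>h\<in>fib w. lform (Suc m) (a h)) = const (\<Prod>h\<in>fib w. c h) * lform m (b w) ^ card (fib w)" .
  have "(\<Prod>h\<in>fib w. c h) \<noteq> 0" using c0 by (auto simp: fib_def finI)
  then have d': "lform m (b w) ^ card (fib w) dvd rho 0 P" using d[unfolded e] by (rule const_unit[THEN iffD1])
  have "rho 0 x1 = lform m (b w)" unfolding x1_def by (simp add: rho_lform)
  then have "lform m (b w) * lform m (b w) ^ (card (fib w) - 1) dvd lform m (b w) * rho 0 (v 0)"
    using d' card_fib[OF w] by (simp add: P_def flip: power_Suc)
  then show "lform m (b w) ^ (card (fib w) - 1) dvd rho 0 (v 0)"
    using nonprop_prime[OF npJ' w] by (simp only: dvd_mult_cancel_left) (simp add: prime_elem_def)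
qed

lemma mdet_rho: "mdet n (\<lambda>i j. rho k (M i j)) = rho k (mdet n M)"
  by (simp add: rho_def mdet_subst)

text \<open>A degree count: if all rows of degree at most the additional exponent were tangent to the
  new hyperplane, their restrictions would be too many combinations of too few basis elements.\<close>

lemma addition_row_exists:
  assumes s': "saito (Suc m) (I - {i0}) a (\<lambda>_. 1) M d" and s'': "saito m J b (\<lambda>_. 1) M'' d''"
    and exps: "degs (Suc m) d = add_mset e (degs m d'')"
  shows "\<exists>i<Suc m. d i \<le> e \<and> rho 0 (M i 0) \<noteq> 0"
proof (rule ccontr)
  assume neg: "\<not> ?thesis"
  obtain u where lr: "log_rows (Suc m) (I - {i0}) a (\<lambda>_. 1) M d" and u: "u \<noteq> 0" "mdet (Suc m) M = const u * defpoly (Suc m) (I - {i0}) a (\<lambda>_. 1)"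
    using s' by (rule saitoE)
  obtain u2 where u2: "u2 \<noteq> 0" "rho 0 (defpoly (Suc m) (I - {i0}) a (\<lambda>_. 1)) = const u2 * defpoly m J b (\<lambda>w. card (fib w))"
    using rho_defpoly by auto
  define Mb where "Mb i j = rho 0 (M i j)" for i j
  have "mdet (Suc m) Mb \<noteq> 0"
    unfolding Mb_def mdet_rho u(2) using u(1) u2 defpoly_nonzero[OF npJ'] by simp
  define G where "G = {i. i < Suc m \<and> d i \<le> e}"
  define K where "K = {k. k < m \<and> d'' k \<le> e}"
  have "card G = Suc (card K)"
    unfolding G_def K_def size_filter_degs[symmetric, where P = "\<lambda>x. x \<le> e"] exps by simp
  define M2 where "M2 = case_nat (case_nat 1 (\<lambda>_. 0)) (\<lambda>i. case_nat 0 (M'' i))"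
  have "mdet (Suc m) M2 = M2 0 0 * mdet m (\<lambda>i j. M2 (Suc i) (Suc j))"
    by (rule mdet_col0) (auto simp: M2_def gr0_conv_Suc)
  then have det2: "mdet (Suc m) M2 \<noteq> 0" using saito_mdet_nonzero[OF npJ' s''] by (simp add: M2_def)
  have "mdet (Suc m) (madj (Suc m) M2) * mdet (Suc m) M2 = mdet (Suc m) (\<lambda>i j. if i = j then mdet (Suc m) M2 else 0)"
    unfolding mdet_mult[symmetric] by (rule mdet_cong) (simp add: madj_left del: sum.lessThan_Suc)
  then have adj0: "mdet (Suc m) (madj (Suc m) M2) \<noteq> 0" using det2 by (auto simp: mdet_diag)
  define A where "A i j = (\<Sum>l<Suc m. Mb i l * madj (Suc m) M2 l j)" for i j
  have "mdet (Suc m) A = mdet (Suc m) Mb * mdet (Suc m) (madj (Suc m) M2)"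
    unfolding A_def by (rule mdet_mult)
  then have "mdet (Suc m) A \<noteq> 0" using adj0 \<open>mdet (Suc m) Mb \<noteq> 0\<close> by simp
  moreover have "mdet (Suc m) A = 0"
  proof (rule mdet_zero_block[of G "Suc m" "Suc ` K"])
    show "G \<subseteq> {..<Suc m}" by (auto simp: G_def)
    show "finite (Suc ` K)" by (simp add: K_def)
    show "card (Suc ` K) < card G" using \<open>card G = Suc (card K)\<close> by (simp add: card_image)
    fix i j assume i: "i \<in> G" and j: "j < Suc m" "j \<notin> Suc ` K"
    have i': "i < Suc m" "d i \<le> e" using i by (auto simp: G_def)
    then have Mb0: "Mb i 0 = 0" using neg by (auto simp: Mb_def)
    define \<phi> where "\<phi> = (\<lambda>j. Mb i (Suc j))"
    have "polyvec m \<phi>" using log_rowsD(4)[OF lr i'(1)] rho_in_poly_ring[of _ "Suc m" 0] by (auto simp: polyvec_def \<phi>_def Mb_def)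
    moreover have "homvec m (d i) \<phi>" using log_rowsD(5)[OF lr i'(1)] by (auto simp: homvec_def \<phi>_def Mb_def homogeneous_rho)
    moreover have "tang m (b w) 1 \<phi>" if "w \<in> J" for w
      using tang_restrict_simple[of "M i" w] Mb0 log_rowsD(3)[OF lr i'(1)] that by (simp add: \<phi>_def Mb_def)
    ultimately obtain C where C: "\<forall>k<m. \<phi> k = (\<Sum>i<m. C i * M'' i k)" "\<forall>k<m. homogeneous (d i - d'' k) (C k) \<and> (d i < d'' k \<longrightarrow> C k = 0)"
      using saito_expand_hom[OF npJ' s'', of \<phi> "d i"] by blast
    have "Mb i l = (\<Sum>q<m. C q * M2 (Suc q) l)" if "l < Suc m" for l
      using that C(1) Mb0 by (cases l) (auto simp: M2_def \<phi>_def)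
    then have "A i j = (\<Sum>l<Suc m. \<Sum>q<m. C q * (M2 (Suc q) l * madj (Suc m) M2 l j))"
      unfolding A_def by (intro sum.cong) (auto simp: sum_distrib_right mult.assoc)
    also have "\<dots> = (\<Sum>q<m. C q * (\<Sum>l<Suc m. M2 (Suc q) l * madj (Suc m) M2 l j))"
      by (subst sum.swap) (simp only: sum_distrib_left)
    also have "\<dots> = (\<Sum>q<m. 0)"
    proof (rule sum.cong[OF refl])
      fix q assume "q \<in> {..<m}"
      then have q: "q < m" by simp
      show "C q * (\<Sum>l<Suc m. M2 (Suc q) l * madj (Suc m) M2 l j) = 0"
      proof (cases "Suc q = j")
        case True
        then have "q \<notin> K" using j by auto
        then have "d i < d'' q" using q i' by (auto simp: K_def)
        then show ?thesis using C(2) q by simp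
      next
        case False
        then show ?thesis using madj_right[of "Suc q" "Suc m" j M2] q j by simp
      qed
    qed
    finally show "A i j = 0" by simp
  qed
  ultimately show False by simp
qed

text \<open>The shape to which a basis for the deletion can be brought if addition is possible:
  in particular, the derivations of the arrangement restrict onto those of the
  restriction.\<close>

definition addition_matrix :: "(nat \<Rightarrow> nat \<Rightarrow> 'k mpoly) \<Rightarrow> (nat \<Rightarrow> nat) \<Rightarrow> bool" where
  "addition_matrix M d \<longleftrightarrow> saito (Suc m) (I - {i0}) a (\<lambda>_. 1) M d \<and>
     (\<forall>i<m. rho 0 (M (Suc i) 0) = 0) \<and> (\<exists>u. u \<noteq> 0 \<and> rho 0 (M 0 0) = const u * bpoly) \<and>
     saito m J b (\<lambda>_. 1) (\<lambda>i j. rho 0 (M (Suc i) (Suc j))) (\<lambda>i. d (Suc i))"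

text \<open>Let e be the exponent that the deletion has in excess of the restriction. Comparing
  the sums of the exponents, e is the degree of bpoly. So a row of degree at most e that is not
  tangent to the new hyperplane takes on the coordinate the value bpoly, up to a constant factor
  and modulo the coordinate, and it clears the other rows.\<close>

theorem addition:
  assumes s': "saito (Suc m) (I - {i0}) a (\<lambda>_. 1) M' d'" and s'': "saito m J b (\<lambda>_. 1) M'' d''"
    and exps: "degs m d'' \<subseteq># degs (Suc m) d'"
  shows "\<exists>M d. addition_matrix M d \<and> degs (Suc m) d = degs (Suc m) d' \<and> degs m (\<lambda>i. d (Suc i)) = degs m d''"
proof -
  have npI': "nonprop (Suc m) (I - {i0}) a" using npI by (rule nonprop_subset) auto
  have "size (degs (Suc m) d' - degs m d'') = 1" using size_Diff_submset[OF exps] by simp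
  then obtain e where "degs (Suc m) d' - degs m d'' = {#e#}" using size_1_singleton_mset by blast
  then have ex: "degs (Suc m) d' = add_mset e (degs m d'')" using exps
    by (metis add_mset_add_single subset_mset.diff_add union_commute)
  have eB: "e = (\<Sum>w\<in>J. card (fib w) - 1)"
  proof -
    have "sum_mset (degs (Suc m) d') = card (I - {i0})"
      unfolding sum_mset_degs using saito_degree_sum[OF npI' s'] by simp
    moreover have "sum_mset (degs m d'') = card J"
      unfolding sum_mset_degs using saito_degree_sum[OF npJ' s''] by simp
    ultimately show ?thesis using bpoly_degree unfolding ex by simp
  qed
  obtain k where k: "k < Suc m" "d' k \<le> e" "rho 0 (M' k 0) \<noteq> 0" using addition_row_exists[OF s' s'' ex] by blast
  obtain M1 d1 where M1: "saito (Suc m) (I - {i0}) a (\<lambda>_. 1) M1 d1" "degs (Suc m) d1 = degs (Suc m) d'" "M1 0 = M' k" "d1 0 = d' k"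
    using s' k(1) by (rule saito_row_to_front)
  obtain u1 where lr: "log_rows (Suc m) (I - {i0}) a (\<lambda>_. 1) M1 d1" and u1: "u1 \<noteq> 0"
      "mdet (Suc m) M1 = const u1 * defpoly (Suc m) (I - {i0}) a (\<lambda>_. 1)"
    using M1(1) by (rule saitoE)
  have hB: "homogeneous e bpoly" unfolding eB bpoly_def by (rule homogeneous_defpoly)
  have B0: "bpoly \<noteq> 0" unfolding bpoly_def by (rule defpoly_nonzero[OF npJ'])
  have Bring: "bpoly \<in> poly_ring m" by (simp add: bpoly_def)
  have quot: "\<exists>q. q \<in> poly_ring m \<and> rho 0 (M1 i 0) = bpoly * q \<and> (q = 0 \<or> (e \<le> d1 i \<and> homogeneous (d1 i - e) q))" if i: "i < Suc m" for i
  proof -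
    have "bpoly dvd rho 0 (M1 i 0)" by (rule bpoly_dvd) (rule log_rowsD(3)[OF lr i])
    moreover have "rho 0 (M1 i 0) \<in> poly_ring m" using rho_in_poly_ring[OF log_rowsD(4)[OF lr i], of 0 0] by simp
    ultimately obtain q where q: "q \<in> poly_ring m" "rho 0 (M1 i 0) = bpoly * q" using dvd_in_poly_ring[OF _ Bring] by blast
    have "homogeneous (d1 i) (bpoly * q)" unfolding q(2)[symmetric] by (rule homogeneous_rho) (rule log_rowsD(5)[OF lr i], simp)
    then have "q = 0 \<or> (e \<le> d1 i \<and> homogeneous (d1 i - e) q)" using homogeneous_factor[OF _ hB B0] by blast
    then show ?thesis using q by blast
  qed
  then have "\<forall>i\<in>{..<Suc m}. \<exists>q. q \<in> poly_ring m \<and> rho 0 (M1 i 0) = bpoly * q \<and> (q = 0 \<or> (e \<le> d1 i \<and> homogeneous (d1 i - e) q))"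
    by blast
  from bchoice[OF this] obtain q where q: "\<And>i. i < Suc m \<Longrightarrow> q i \<in> poly_ring m" "\<And>i. i < Suc m \<Longrightarrow> rho 0 (M1 i 0) = bpoly * q i"
      "\<And>i. i < Suc m \<Longrightarrow> q i = 0 \<or> (e \<le> d1 i \<and> homogeneous (d1 i - e) (q i))"
    by auto
  have q0: "q 0 \<noteq> 0" using k(3) q(2)[of 0] M1(3) by auto
  then have d10: "d1 0 = e" "homogeneous 0 (q 0)" using q(3)[of 0] k(2) M1(4) by auto
  then obtain v where v: "q 0 = const v" using homogeneous_0_const by blast
  have v0: "v \<noteq> 0" using v q0 by auto
  define f where "f i = ups 0 (const (inverse v) * q i)" for i
  define M where "M i j = (if i = 0 then M1 0 j else M1 i j - f i * M1 0 j)" for i j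
  have fh: "homogeneous (d1 i) (f i * M1 0 j)" if i: "i < Suc m" "j < Suc m" for i j
  proof (cases "q i = 0")
    case False
    then have "homogeneous (d1 i - e) (f i)" "e \<le> d1 i" using q(3)[OF i(1)] unfolding f_def by (auto intro: homogeneous_ups homogeneous_const_mult)
    moreover have "homogeneous e (M1 0 j)" using log_rowsD(5)[OF lr _ i(2), of 0] d10 by simp
    ultimately show ?thesis using homogeneous_mult[of "d1 i - e" "f i" e "M1 0 j"] by simp
  qed (simp add: f_def)
  have fr: "f i \<in> poly_ring (Suc m)" if "i < Suc m" for i unfolding f_def using q(1)[OF that] by (intro ups_in_poly_ring) simp
  have rM: "rho 0 (M (Suc i) 0) = 0" if i: "i < m" for i
  proof -
    have "rho 0 (M (Suc i) 0) = rho 0 (M1 (Suc i) 0) - (const (inverse v) * q (Suc i)) * rho 0 (M1 0 0)"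
      by (simp add: M_def f_def)
    also have "\<dots> = bpoly * q (Suc i) - (const v * const (inverse v)) * (bpoly * q (Suc i))"
      using q(2)[of "Suc i"] q(2)[of 0] i unfolding v by (simp add: mult_ac)
    finally show ?thesis using const_inverse[OF v0] by simp
  qed
  have mM: "mdet (Suc m) M = mdet (Suc m) M1" unfolding M_def by (rule mdet_rowops) simp
  have lrM: "log_rows (Suc m) (I - {i0}) a (\<lambda>_. 1) M d1"
    unfolding log_rows_def
  proof (intro allI impI conjI ballI)
    fix i assume i: "i < Suc m"
    show "polyvec (Suc m) (M i)" unfolding polyvec_def M_def using log_rowsD(4)[OF lr] i fr by auto
    show "homvec (Suc m) (d1 i) (M i)" unfolding homvec_def M_def using log_rowsD(5)[OF lr] i fh by auto
    fix h assume h: "h \<in> I - {i0}"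
    show "tang (Suc m) (a h) 1 (M i)"
      using log_rowsD(3)[OF lr i h] log_rowsD(3)[OF lr _ h, of 0] unfolding M_def
      by (cases "i = 0") (auto intro!: tang_diff tang_mult)
  qed
  have sM: "saito (Suc m) (I - {i0}) a (\<lambda>_. 1) M d1" using lrM u1(1) mM[unfolded u1(2)] by (rule saitoI)
  have r00: "rho 0 (M 0 0) = const v * bpoly" using q(2)[of 0] by (simp add: M_def v mult.commute)
  define \<Phi> where "\<Phi> = (\<lambda>i j. rho 0 (M (Suc i) (Suc j)))"
  have "saito m J b (\<lambda>_. 1) \<Phi> (\<lambda>i. d1 (Suc i))"
  proof -
    obtain u2 where u2: "u2 \<noteq> 0" "rho 0 (defpoly (Suc m) (I - {i0}) a (\<lambda>_. 1)) = const u2 * defpoly m J b (\<lambda>w. card (fib w))"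
      using rho_defpoly by auto
    have "mdet (Suc m) (\<lambda>i j. rho 0 (M i j)) = rho 0 (M 0 0) * mdet m \<Phi>"
      unfolding \<Phi>_def by (subst mdet_col0) (use rM in \<open>auto simp: gr0_conv_Suc\<close>)
    then have "bpoly * (const v * mdet m \<Phi>) = rho 0 (mdet (Suc m) M)"
      unfolding mdet_rho r00 by (simp add: mult_ac)
    also have "\<dots> = bpoly * (const (u1 * u2) * defpoly m J b (\<lambda>_. 1))"
      unfolding mM u1(2) rho_simps u2(2) bpoly_mult[symmetric] by (simp add: mult_ac)
    finally have "const v * mdet m \<Phi> = const (u1 * u2) * defpoly m J b (\<lambda>_. 1)"
      using B0 by (simp only: mult_cancel_left) simp
    from mult_const_cancel[OF v0 this] have det: "mdet m \<Phi> = const (inverse v * (u1 * u2)) * defpoly m J b (\<lambda>_. 1)" .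
    have "log_rows m J b (\<lambda>_. 1) \<Phi> (\<lambda>i. d1 (Suc i))"
      unfolding log_rows_def
    proof (intro allI impI conjI ballI)
      fix i assume i: "i < m"
      show "polyvec m (\<Phi> i)" using log_rowsD(4)[OF lrM, of "Suc i"] i rho_in_poly_ring[of _ "Suc m" 0]
        by (auto simp: polyvec_def \<Phi>_def)
      show "homvec m (d1 (Suc i)) (\<Phi> i)" using log_rowsD(5)[OF lrM, of "Suc i"] i
        by (auto simp: homvec_def \<Phi>_def homogeneous_rho)
      fix w assume "w \<in> J"
      then show "tang m (b w) 1 (\<Phi> i)"
        using tang_restrict_simple[of "M (Suc i)" w] rM[OF i] log_rowsD(3)[OF lrM, of "Suc i"] i by (simp add: \<Phi>_def)
    qed
    then show ?thesis using v0 u1(1) u2(1) by (intro saitoI[OF _ _ det]) auto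
  qed
  then have "addition_matrix M d1" unfolding addition_matrix_def \<Phi>_def using sM rM r00 v0 by blast
  moreover have "degs m (\<lambda>i. d1 (Suc i)) = degs m d''"
    using M1(2) degs_Suc[of m d1] d10(1) ex by simp
  ultimately show ?thesis using M1(2) by blast
qed

text \<open>Only the first row fails to be tangent to the new hyperplane; it is multiplied by
  the coordinate.\<close>

corollary addition_saito:
  assumes "addition_matrix M d"
  shows "\<exists>M'. saito (Suc m) I a (\<lambda>_. 1) M' (case_nat (Suc (d 0)) (\<lambda>i. d (Suc i)))"
proof -
  obtain u where lr: "log_rows (Suc m) (I - {i0}) a (\<lambda>_. 1) M d" and u: "u \<noteq> 0" "mdet (Suc m) M = const u * defpoly (Suc m) (I - {i0}) a (\<lambda>_. 1)"
    using assms unfolding addition_matrix_def by (elim conjE saitoE)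
  define M' where "M' i j = (if i = 0 then var 0 * M i j else M i j)" for i j
  have "delta 1 = (\<lambda>_. 1)" by (auto simp: delta_def)
  then have dp: "defpoly (Suc m) I a (\<lambda>_. 1) = const (a i0 0) * var 0 * defpoly (Suc m) (I - {i0}) a (\<lambda>_. 1)"
    using defpoly_delta[of 1] by simp
  have "mdet (Suc m) M' = var 0 * mdet (Suc m) M" unfolding M'_def by (rule mdet_scale_row) simp
  then have "const (a i0 0) * mdet (Suc m) M' = const u * defpoly (Suc m) I a (\<lambda>_. 1)" unfolding u(2) dp by (simp add: mult_ac)
  from mult_const_cancel[OF ak this] have det: "mdet (Suc m) M' = const (inverse (a i0 0) * u) * defpoly (Suc m) I a (\<lambda>_. 1)" .
  have "log_rows (Suc m) I a (\<lambda>_. 1) M' (case_nat (Suc (d 0)) (\<lambda>i. d (Suc i)))"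
    unfolding log_rows_def
  proof (intro allI impI conjI ballI)
    fix i assume i: "i < Suc m"
    show "polyvec (Suc m) (M' i)" unfolding polyvec_def M'_def using log_rowsD(4)[OF lr i] by auto
    have "homogeneous (1 + d 0) (var 0 * M 0 j)" if "j < Suc m" for j
      using log_rowsD(5)[OF lr _ that, of 0] by (intro homogeneous_mult) auto
    then show "homvec (Suc m) (case_nat (Suc (d 0)) (\<lambda>i. d (Suc i)) i) (M' i)"
      unfolding homvec_def M'_def using log_rowsD(5)[OF lr i] by (cases i) auto
    fix h assume h: "h \<in> I"
    show "tang (Suc m) (a h) 1 (M' i)"
    proof (cases "h = i0")
      case True
      have "var 0 dvd M' i 0"
        using assms i unfolding M'_def addition_matrix_def by (cases i) (auto simp: var_dvd_iff)
      then show ?thesis using True by (simp add: tang_i0)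
    next
      case False
      then show ?thesis using log_rowsD(3)[OF lr i, of h] h unfolding M'_def
        by (cases "i = 0") (auto intro: tang_mult)
    qed
  qed
  from saitoI[OF this _ det] have "saito (Suc m) I a (\<lambda>_. 1) M' (case_nat (Suc (d 0)) (\<lambda>i. d (Suc i)))"
    using ak u(1) by simp
  then show ?thesis by blast
qed

subsection \<open>Multiplicities between the simple one and Ziegler's\<close>

text \<open>The Euler derivation is tangent with multiplicity one, and a row of degree 1 enters
  its expansion with a constant coefficient. This row gives way to a multiple of the Euler
  derivation. The others are corrected by multiples of the Euler derivation such that their
  lifts annihilate the coordinate, and are then tangent even with Ziegler's
  multiplicity.\<close>

theorem saito_intermediate:
  assumes add: "addition_matrix M d" and J: "J \<noteq> {}"
    and \<mu>: "\<And>w. w \<in> J \<Longrightarrow> 1 \<le> \<mu> w \<and> \<mu> w \<le> card (fib w)"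
  shows "1 \<in># degs m (\<lambda>i. d (Suc i)) \<and> (\<exists>M' d'. saito m J b \<mu> M' d' \<and>
    degs m d' = add_mset (Suc (\<Sum>w\<in>J. \<mu> w - 1)) (degs m (\<lambda>i. d (Suc i)) - {#1#}))"
proof -
  define \<Phi> where "\<Phi> = (\<lambda>i j. rho 0 (M (Suc i) (Suc j)))"
  define \<delta> where "\<delta> = (\<lambda>i. d (Suc i))"
  have s\<Phi>: "saito m J b (\<lambda>_. 1) \<Phi> \<delta>" and col0: "\<And>i. i < m \<Longrightarrow> rho 0 (M (Suc i) 0) = 0"
    using add by (auto simp: addition_matrix_def \<Phi>_def \<delta>_def)
  obtain u where lr: "log_rows (Suc m) (I - {i0}) a (\<lambda>_. 1) M d" and "u \<noteq> 0" "mdet (Suc m) M = const u * defpoly (Suc m) (I - {i0}) a (\<lambda>_. 1)"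
    using add unfolding addition_matrix_def by (elim conjE saitoE)
  obtain u1 where lr\<Phi>: "log_rows m J b (\<lambda>_. 1) \<Phi> \<delta>" and u1: "u1 \<noteq> 0" "mdet m \<Phi> = const u1 * defpoly m J b (\<lambda>_. 1)"
    using s\<Phi> by (rule saitoE)
  obtain w0 where w0: "w0 \<in> J" using J by blast
  have app0: "app m (b w0) var \<noteq> 0" using nonprop_prime[OF npJ' w0] by (auto simp: app_var prime_elem_def)
  obtain k c \<gamma> g where k: "k < m" "\<delta> k = 1" and c: "\<forall>j<m. var j = (\<Sum>i<m. c i * \<Phi> i j)" and ck: "c k = const \<gamma>" "\<gamma> \<noteq> 0"
    by (rule saito_row_of_degree[OF npJ' s\<Phi> w0, of var]) (use app0 in \<open>auto simp: polyvec_def homvec_def tang_def app_var\<close>)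
  have "\<exists>q. M (Suc i) 0 = var 0 * q \<and> q \<in> poly_ring (Suc m) \<and> (q = 0 \<or> 1 \<le> \<delta> i \<and> homogeneous (\<delta> i - 1) q)" if i: "i < m" for i
  proof -
    have "var 0 dvd M (Suc i) 0" using col0[OF i] by (simp add: var_dvd_iff)
    then obtain q where q: "q \<in> poly_ring (Suc m)" "M (Suc i) 0 = var 0 * q"
      using dvd_in_poly_ring[of "var 0" "M (Suc i) 0" "Suc m"] log_rowsD(4)[OF lr, of "Suc i" 0] i by auto
    have "homogeneous (\<delta> i) (var 0 * q)" using log_rowsD(5)[OF lr, of "Suc i" 0] i q by (simp add: \<delta>_def)
    then have "q = 0 \<or> 1 \<le> \<delta> i \<and> homogeneous (\<delta> i - 1) q" using homogeneous_factor[of "\<delta> i" "var 0" q 1] by auto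
    then show ?thesis using q by blast
  qed
  then have "\<forall>i\<in>{..<m}. \<exists>q. M (Suc i) 0 = var 0 * q \<and> q \<in> poly_ring (Suc m) \<and> (q = 0 \<or> 1 \<le> \<delta> i \<and> homogeneous (\<delta> i - 1) q)"
    by blast
  from bchoice[OF this] obtain q where q: "\<And>i. i < m \<Longrightarrow> M (Suc i) 0 = var 0 * q i" "\<And>i. i < m \<Longrightarrow> q i \<in> poly_ring (Suc m)"
      "\<And>i. i < m \<Longrightarrow> q i = 0 \<or> 1 \<le> \<delta> i \<and> homogeneous (\<delta> i - 1) (q i)"
    by auto
  \<comment> \<open>Before restriction, M (Suc i) minus q i times the Euler derivation annihilates the coordinate.\<close>
  define \<phi> where "\<phi> i j = \<Phi> i j - rho 0 (q i) * var j" for i j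
  have \<phi>_tang: "tang m (b w) (\<mu> w) (\<phi> i)" if i: "i < m" and w: "w \<in> J" for i w
  proof -
    have t: "tang (Suc m) (a h) 1 (\<lambda>j. M (Suc i) j - q i * var j)" if "h \<in> I - {i0}" for h
      using log_rowsD(3)[OF lr, of "Suc i" h] i that by (intro tang_diff tang_mult tang_var) auto
    have "tang m (b w) (card {h \<in> I - {i0}. r h = w}) (\<lambda>j. rho 0 (M (Suc i) (Suc j) - q i * var (Suc j)))"
      using tang_restrict[of "\<lambda>j. M (Suc i) j - q i * var j" "I - {i0}" w, OF _ _ t] q(1)[OF i] by (simp add: mult.commute)
    moreover have "rho 0 (var (Suc j)) = (var j :: 'k mpoly)" for j using rho_simps(10)[of 0 j] by simp
    ultimately have "tang m (b w) (card (fib w)) (\<phi> i)" by (simp add: fib_def \<phi>_def[abs_def] \<Phi>_def)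
    then show ?thesis by (rule tang_mono) (use \<mu> w in blast)
  qed
  have q_ring: "rho 0 (q i) \<in> poly_ring m" if "i < m" for i using rho_in_poly_ring[OF q(2)[OF that], of 0] by simp
  have \<phi>_hom: "homvec m (\<delta> i) (\<phi> i)" if i: "i < m" for i
    unfolding homvec_def \<phi>_def
  proof (intro allI impI homogeneous_diff)
    fix j assume j: "j < m"
    show "homogeneous (\<delta> i) (\<Phi> i j)" by (rule log_rowsD(5)[OF lr\<Phi> i j])
    show "homogeneous (\<delta> i) (rho 0 (q i) * var j)"
    proof (cases "q i = 0")
      case False
      then have *: "homogeneous (\<delta> i - 1) (q i)" "1 \<le> \<delta> i" using q(3)[OF i] by blast+
      show ?thesis using homogeneous_mult[OF homogeneous_rho[OF *(1), of 0] homogeneous_base(4)[of j]] *(2) by simp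
    qed simp
  qed
  define F where "F = defpoly m J b (\<lambda>w. \<mu> w - 1)"
  define M' where "M' i j = (if i = k then F * var j else \<phi> i j)" for i j
  define d' where "d' i = (if i = k then Suc (\<Sum>w\<in>J. \<mu> w - 1) else \<delta> i)" for i
  have FQ: "F * defpoly m J b (\<lambda>_. 1) = defpoly m J b \<mu>"
    unfolding F_def defpoly_def prod.distrib[symmetric]
  proof (rule prod.cong)
    fix w assume "w \<in> J"
    then have "\<mu> w = Suc (\<mu> w - 1)" using \<mu> by force
    then show "lform m (b w) ^ (\<mu> w - 1) * lform m (b w) ^ 1 = lform m (b w) ^ \<mu> w"
      by (metis power_Suc2 power_one_right)
  qed simp
  have "mdet m M' = F * mdet m (\<lambda>i j. if i = k then var j else \<phi> i j)"
    unfolding mdet_scale_row[OF k(1), symmetric] M'_def by (rule mdet_cong) simp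
  also have "mdet m (\<lambda>i j. if i = k then var j else \<phi> i j) = mdet m (\<lambda>i j. if i = k then var j else \<Phi> i j)"
    using mdet_rowops[OF k(1), of "\<lambda>i j. if i = k then var j else \<Phi> i j" "\<lambda>i. rho 0 (q i)"]
    by (simp add: \<phi>_def cong: if_cong)
  also have "mdet m (\<lambda>i j. if i = k then var j else \<Phi> i j) = mdet m (\<lambda>i j. if i = k then (\<Sum>l<m. c l * \<Phi> l j) else \<Phi> i j)"
    by (rule mdet_cong) (simp only: c[rule_format])
  also have "\<dots> = c k * mdet m \<Phi>" using k(1) by (rule mdet_combine_row)
  finally have "mdet m M' = const \<gamma> * const u1 * (F * defpoly m J b (\<lambda>_. 1))" unfolding ck u1(2) by (simp only: mult_ac)
  then have det: "mdet m M' = const (\<gamma> * u1) * defpoly m J b \<mu>" unfolding FQ by simp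
  have "log_rows m J b \<mu> M' d'"
    unfolding log_rows_def
  proof (intro allI impI conjI ballI)
    fix i assume i: "i < m"
    show "polyvec m (M' i)"
      using log_rowsD(4)[OF lr\<Phi> i] q_ring[OF i] unfolding polyvec_def M'_def \<phi>_def F_def by auto
    have "homogeneous ((\<Sum>w\<in>J. \<mu> w - 1) + 1) (F * var j)" for j
      unfolding F_def by (intro homogeneous_mult homogeneous_defpoly) auto
    then show "homvec m (d' i) (M' i)"
      using \<phi>_hom[OF i] unfolding homvec_def M'_def d'_def by auto
    fix w assume w: "w \<in> J"
    show "tang m (b w) (\<mu> w) (M' i)"
    proof (cases "i = k")
      case True
      have "lform m (b w) ^ (\<mu> w - 1) * lform m (b w) dvd F * lform m (b w)"
        unfolding F_def using dvd_defpoly[OF finJ w, of m b "\<lambda>w. \<mu> w - 1"] by (rule mult_dvd_mono) simp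
      also have "lform m (b w) ^ (\<mu> w - 1) * lform m (b w) = lform m (b w) ^ \<mu> w"
        using \<mu>[OF w] by (simp flip: power_Suc2)
      finally have "tang m (b w) (\<mu> w) (\<lambda>j. F * var j)" unfolding tang_def app_mult app_var .
      then show ?thesis using True by (simp add: M'_def[abs_def])
    next
      case False
      then show ?thesis using \<phi>_tang[OF i w] by (simp add: M'_def[abs_def])
    qed
  qed
  from saitoI[OF this _ det] have "saito m J b \<mu> M' d'" using ck(2) u1(1) by simp
  moreover have "degs m d' = add_mset (Suc (\<Sum>w\<in>J. \<mu> w - 1)) (degs m \<delta> - {#1#})"
    unfolding d'_def using degs_upd[OF k(1), of _ \<delta>] k(2) by simp
  moreover have "1 \<in># degs m \<delta>" using degs_remove[OF k(1), of \<delta>] k(2) by simp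
  ultimately show ?thesis unfolding \<delta>_def by blast
qed

end

subsection \<open>Extraction of local derivations\<close>

lemma mon_eval_var: "mon_eval var m = Poly_Mapping.single m (1::'k::field)"
  using poly_subst_single[of var m "1::'k"] by simp

lemma lookup_subst_zero:
  fixes f :: "'k::field mpoly"
  shows "Poly_Mapping.lookup (poly_subst (\<lambda>i. if i < r then 0 else var i) f) m =
    (if Poly_Mapping.keys m \<inter> {..<r} = {} then Poly_Mapping.lookup f m else 0)"
proof (induction f rule: mpoly_add_induct)
  case (single k c)
  let ?s = "\<lambda>i. if i < r then 0 else var i :: 'k mpoly"
  have "mon_eval ?s k = (if Poly_Mapping.keys k \<inter> {..<r} = {} then Poly_Mapping.single k 1 else 0)"
  proof (cases "Poly_Mapping.keys k \<inter> {..<r} = {}")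
    case True
    then have "mon_eval ?s k = mon_eval var k" by (intro mon_eval_cong) auto
    then show ?thesis using True by (simp add: mon_eval_var)
  next
    case False
    then obtain i where "i \<in> Poly_Mapping.keys k" "i < r" by auto
    then have "mon_eval ?s k = 0" unfolding mon_eval_def by (intro prod_zero) (auto simp: in_keys_iff)
    then show ?thesis using False by simp
  qed
  then show ?case
    by (auto simp: poly_subst_single lookup_single when_def)
qed (auto simp: lookup_add)

text \<open>Setting the first r variables to zero leaves a product of nonzero forms. A point at
  which it does not vanish need not exist over a finite field, but some monomial always occurs
  in it.\<close>

lemma exists_outer_monomial:
  assumes "finite S" "\<And>x. x \<in> S \<Longrightarrow> \<exists>j<n. r \<le> j \<and> A x j \<noteq> 0"
  shows "\<exists>\<alpha>. Poly_Mapping.keys \<alpha> \<inter> {..<r} = {} \<and> Poly_Mapping.lookup (\<Prod>x\<in>S. lform n (A x) ^ e x) \<alpha> \<noteq> 0"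
proof -
  let ?s = "\<lambda>i. if i < r then 0 else var i"
  have "poly_subst ?s (lform n (A x)) \<noteq> 0" if x: "x \<in> S" for x
  proof -
    have "poly_subst ?s (lform n (A x)) = lform n (\<lambda>i. if i < r then 0 else A x i)"
      unfolding poly_subst_lform unfolding lform_def by (rule sum.cong) auto
    moreover obtain j where "j < n" "r \<le> j" "A x j \<noteq> 0" using assms(2)[OF x] by blast
    then have "lform n (\<lambda>i. if i < r then 0 else A x i) \<noteq> 0" unfolding lform_eq_0_iff by (auto intro!: exI[of _ j])
    ultimately show ?thesis by simp
  qed
  then have "poly_subst ?s (\<Prod>x\<in>S. lform n (A x) ^ e x) \<noteq> 0"
    using assms(1) by (simp add: poly_subst_prod)
  then have "Poly_Mapping.keys (poly_subst ?s (\<Prod>x\<in>S. lform n (A x) ^ e x)) \<noteq> {}" unfolding keys_eq_empty .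
  then obtain \<alpha> where "\<alpha> \<in> Poly_Mapping.keys (poly_subst ?s (\<Prod>x\<in>S. lform n (A x) ^ e x))"
    by (rule ex_in_conv[THEN iffD2, THEN exE])
  then have "Poly_Mapping.lookup (poly_subst ?s (\<Prod>x\<in>S. lform n (A x) ^ e x)) \<alpha> \<noteq> 0" unfolding in_keys_iff .
  then have "Poly_Mapping.keys \<alpha> \<inter> {..<r} = {} \<and> Poly_Mapping.lookup (\<Prod>x\<in>S. lform n (A x) ^ e x) \<alpha> \<noteq> 0"
    unfolding lookup_subst_zero by (simp only: split: if_splits) simp_all
  then show ?thesis by (rule exI)
qed

text \<open>The coefficient of a monomial in the last variables, of a given degree in the first ones.
  It commutes with multiplication by polynomials in the first variables, up to the degree.\<close>

definition zpart :: "nat \<Rightarrow> (nat \<Rightarrow>\<^sub>0 nat) \<Rightarrow> nat \<Rightarrow> 'k::field mpoly \<Rightarrow> 'k mpoly" where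
  "zpart r \<alpha> e f = hcomp e (zcoeff r \<alpha> f)"

lemma zpart_in [simp]: "zpart r \<alpha> e f \<in> poly_ring r" "homogeneous e (zpart r \<alpha> e f)"
  by (simp_all add: zpart_def)

lemma zpart_add: "zpart r \<alpha> e (f + g) = zpart r \<alpha> e f + zpart r \<alpha> e g"
  by (simp add: zpart_def)

lemma zpart_0 [simp]: "zpart r \<alpha> e 0 = 0"
  by (simp add: zpart_def)

lemma zpart_diff: "zpart r \<alpha> e (f - g) = zpart r \<alpha> e f - zpart r \<alpha> e g"
  using zpart_add[of r \<alpha> e "f - g" g] by (simp add: algebra_simps)

lemma zpart_sum: "zpart r \<alpha> e (\<Sum>i\<in>S. F i) = (\<Sum>i\<in>S. zpart r \<alpha> e (F i))"
  by (induction S rule: infinite_finite_induct) (simp_all add: zpart_add)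

lemma zpart_dvd:
  assumes a: "Poly_Mapping.keys \<alpha> \<inter> {..<r} = {}" and p: "p \<in> poly_ring r" "homogeneous k p" and d: "p dvd f"
  shows "p dvd zpart r \<alpha> e f"
proof -
  obtain g where g: "f = p * g" using d by (rule dvdE)
  then have "p dvd zcoeff r \<alpha> f" using zcoeff_mult[OF a p(1), of g] by simp
  then show ?thesis unfolding zpart_def by (rule homogeneous_dvd_hcomp[OF p(2)])
qed

lemma zpart_const: "Poly_Mapping.keys \<alpha> \<inter> {..<r} = {} \<Longrightarrow> zpart r \<alpha> e (const c * f) = const c * zpart r \<alpha> e f"
  unfolding zpart_def by (simp add: zcoeff_mult hcomp_mult[of 0])

lemma zpart_mult:
  assumes a: "Poly_Mapping.keys \<alpha> \<inter> {..<r} = {}" and p: "p \<in> poly_ring r" "homogeneous e p"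
  shows "zpart r \<alpha> e (p * f) = p * const (Poly_Mapping.lookup f \<alpha>)"
  unfolding zpart_def zcoeff_mult[OF a p(1)] by (simp add: hcomp_mult[OF p(2)])

lemma zpart_app:
  assumes a: "Poly_Mapping.keys \<alpha> \<inter> {..<r} = {}" and "r \<le> n" "\<And>j. r \<le> j \<Longrightarrow> j < n \<Longrightarrow> b j = 0"
  shows "app r b (\<lambda>j. zpart r \<alpha> e (v j)) = zpart r \<alpha> e (app n b v)"
proof -
  have "app n b v = app r b v" by (rule app_smaller) (use assms in auto)
  then show ?thesis unfolding app_def by (simp add: zpart_sum zpart_const[OF a])
qed

lemma tang_zpart:
  assumes a: "Poly_Mapping.keys \<alpha> \<inter> {..<r} = {}" and n: "r \<le> n" "\<And>j. r \<le> j \<Longrightarrow> j < n \<Longrightarrow> b j = 0" and t: "tang n b 1 v"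
  shows "tang r b 1 (\<lambda>j. zpart r \<alpha> e (v j))"
proof -
  have "lform r b dvd zpart r \<alpha> e (app n b v)"
    by (rule zpart_dvd[OF a _ homogeneous_lform(1)]) (use t lform_eq_smaller[OF n] in \<open>auto simp: tang_def\<close>)
  moreover have "app r b (\<lambda>j. zpart r \<alpha> e (v j)) = zpart r \<alpha> e (app n b v)"
    by (rule zpart_app[OF a]) (use n in auto)
  ultimately show ?thesis unfolding tang_def by simp
qed

text \<open>A polynomial with restriction p q differs from the lift of p q by a multiple of the
  variable of index 0, and extraction preserves this divisibility.\<close>

lemma zpart_congruent:
  assumes a: "Poly_Mapping.keys \<alpha> \<inter> {..<r} = {}" and r: "0 < r" and p: "ups 0 p \<in> poly_ring r" "homogeneous e p"
    and f: "rho 0 f = p * q"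
  shows "rho 0 (zpart r \<alpha> e f) = p * const (Poly_Mapping.lookup (ups 0 q) \<alpha>)"
proof -
  have d: "var 0 dvd f - ups 0 p * ups 0 q" using var_dvd_ups_rho[of 0 f] by (simp add: f)
  have v: "var 0 \<in> poly_ring r" using r by simp
  have "var 0 dvd zpart r \<alpha> e (f - ups 0 p * ups 0 q)"
    by (rule zpart_dvd[OF a v homogeneous_base(4) d])
  then have "var 0 dvd zpart r \<alpha> e f - ups 0 p * const (Poly_Mapping.lookup (ups 0 q) \<alpha>)"
    unfolding zpart_diff by (subst (asm) zpart_mult[OF a p(1) homogeneous_ups[OF p(2)]])
  then show ?thesis unfolding var_dvd_iff by simp
qed

context restr0
begin

text \<open>The localizations at one and the same flat, of codimension three in the space and of
  codimension two in the hyperplane.\<close>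

definition I_loc :: "'i set" where "I_loc = {h \<in> I. \<forall>j<Suc m. 3 \<le> j \<longrightarrow> a h j = 0}"

definition J_loc :: "'j set" where "J_loc = {w \<in> J. \<forall>j<m. 2 \<le> j \<longrightarrow> b w j = 0}"

lemma loc_sub: "I_loc \<subseteq> I" "J_loc \<subseteq> J" "i0 \<in> I_loc"
  using i0 a0 by (auto simp: I_loc_def J_loc_def)

lemma I_loc_iff: "h \<in> I - {i0} \<Longrightarrow> h \<in> I_loc \<longleftrightarrow> r h \<in> J_loc"
proof -
  assume h: "h \<in> I - {i0}"
  have "(\<forall>j<Suc m. 3 \<le> j \<longrightarrow> a h j = 0) \<longleftrightarrow> (\<forall>j<m. 2 \<le> j \<longrightarrow> a h (Suc j) = 0)"
    by (metis (no_types, lifting) Suc_le_mono Suc_less_eq Suc_1 numeral_3_eq_3 numeral_2_eq_2 not0_implies_Suc not_numeral_le_zero)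
  then show ?thesis using h ab[OF h] c0[OF h] rJ by (auto simp: I_loc_def J_loc_def)
qed

lemma fib_loc: "w \<in> J_loc \<Longrightarrow> fib w = {h \<in> I_loc - {i0}. r h = w}"
  using I_loc_iff loc_sub by (auto simp: fib_def)

lemma r_loc: "r ` (I_loc - {i0}) = J_loc"
  using I_loc_iff loc_sub rJ by (auto 4 3)

lemma ups_loc_form:
  assumes "3 \<le> Suc m" "w \<in> J_loc" shows "ups 0 (lform m (b w)) \<in> poly_ring 3"
proof -
  have "lform (Suc m) (case_nat 0 (b w)) = lform 3 (case_nat 0 (b w))"
    using assms by (intro lform_eq_smaller) (auto simp: J_loc_def split: nat.split)
  then show ?thesis by (simp add: ups_0_lform)
qed

lemma outer_monomial:
  "\<exists>\<alpha>. Poly_Mapping.keys \<alpha> \<inter> {..<3} = {} \<and> Poly_Mapping.lookup (ups 0 (defpoly m (J - J_loc) b e)) \<alpha> \<noteq> 0"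
proof -
  have "ups 0 (defpoly m (J - J_loc) b e) = (\<Prod>w\<in>J - J_loc. lform (Suc m) (case_nat 0 (b w)) ^ e w)"
    unfolding defpoly_def ups_prod by (simp add: ups_0_lform)
  moreover have "\<exists>j<Suc m. 3 \<le> j \<and> case_nat 0 (b w) j \<noteq> 0" if w: "w \<in> J - J_loc" for w
  proof -
    obtain j where "j < m" "2 \<le> j" "b w j \<noteq> 0" using w by (auto simp: J_loc_def)
    then show ?thesis by (intro exI[of _ "Suc j"]) auto
  qed
  then have "\<exists>\<alpha>. Poly_Mapping.keys \<alpha> \<inter> {..<3} = {} \<and>
      Poly_Mapping.lookup (\<Prod>w\<in>J - J_loc. lform (Suc m) (case_nat 0 (b w)) ^ e w) \<alpha> \<noteq> 0"
    by (intro exists_outer_monomial) (use finJ in auto)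
  ultimately show ?thesis by simp
qed

lemma defpoly_loc_smaller: "2 \<le> m \<Longrightarrow> T \<subseteq> J_loc \<Longrightarrow> defpoly m T b e = defpoly 2 T b e"
  unfolding defpoly_def
  by (intro prod.cong refl arg_cong2[where f = "(^)"] lform_eq_smaller) (auto simp: J_loc_def)

text \<open>By addition, restriction maps the derivations of the arrangement onto those of its
  restriction. Near the flat, a derivation of the localized restriction becomes one of the
  restriction after multiplication by the other forms; extracting a monomial that occurs in their
  product from a lift gives a lift of the local derivation.\<close>

lemma local_lift:
  assumes add: "addition_matrix M d" and m: "2 \<le> m" and y0: "y0 \<in> J_loc" "\<And>j. j < m \<Longrightarrow> j \<noteq> 0 \<Longrightarrow> b y0 j = 0"
  shows "\<exists>\<theta> u. (\<forall>j. \<theta> j \<in> poly_ring 3 \<and> homogeneous (card J_loc - 1) (\<theta> j)) \<and> (\<forall>h\<in>I_loc. tang 3 (a h) 1 \<theta>) \<and>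
    rho 0 (\<theta> 1) = 0 \<and> u \<noteq> 0 \<and> rho 0 (\<theta> 2) = const u * defpoly 2 (J_loc - {y0}) b (\<lambda>_. 1)"
proof -
  define \<Phi> where "\<Phi> = (\<lambda>i j. rho 0 (M (Suc i) (Suc j)))"
  have s\<Phi>: "saito m J b (\<lambda>_. 1) \<Phi> (\<lambda>i. d (Suc i))" and col0: "\<And>i. i < m \<Longrightarrow> rho 0 (M (Suc i) 0) = 0"
    using add by (auto simp: addition_matrix_def \<Phi>_def)
  obtain u where lr: "log_rows (Suc m) (I - {i0}) a (\<lambda>_. 1) M d" and "u \<noteq> 0" "mdet (Suc m) M = const u * defpoly (Suc m) (I - {i0}) a (\<lambda>_. 1)"
    using add unfolding addition_matrix_def by (elim conjE saitoE)
  define P where "P = defpoly m (J_loc - {y0}) b (\<lambda>_. 1)"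
  define q where "q = defpoly m (J - J_loc) b (\<lambda>_. 1)"
  define \<phi> where "\<phi> j = (if j = 1 then P * q else 0)" for j :: nat
  have fin: "finite J_loc" using finJ loc_sub(2) by (rule finite_subset[rotated])
  have "polyvec m \<phi>" by (simp add: polyvec_def \<phi>_def P_def q_def)
  moreover have "tang m (b w) 1 \<phi>" if w: "w \<in> J" for w
  proof -
    have ap: "app m (b w) \<phi> = const (b w 1) * (P * q)"
      unfolding app_def using m by (subst sum.remove[of _ 1]) (auto simp: \<phi>_def)
    show ?thesis
    proof (cases "w = y0")
      case True
      then show ?thesis unfolding tang_def ap using y0(2)[of 1] m by simp
    next
      case False
      have "lform m (b w) dvd P * q"
      proof (cases "w \<in> J_loc")
        case True
        then have "lform m (b w) ^ 1 dvd P" unfolding P_def using False fin by (intro dvd_defpoly[where \<mu> = "\<lambda>_. 1"]) auto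
        then show ?thesis by simp
      next
        case False
        then have "lform m (b w) ^ 1 dvd q" unfolding q_def using w finJ by (intro dvd_defpoly[where \<mu> = "\<lambda>_. 1"]) auto
        then show ?thesis by simp
      qed
      then show ?thesis unfolding tang_def ap by simp
    qed
  qed
  ultimately obtain c where c: "\<forall>k<m. \<phi> k = (\<Sum>i<m. c i * \<Phi> i k)"
    using saito_expand[OF npJ' s\<Phi>, of \<phi>] by blast
  define \<theta>0 where "\<theta>0 = (\<lambda>j. \<Sum>i<m. ups 0 (c i) * M (Suc i) j)"
  have t: "tang (Suc m) (a h) 1 \<theta>0" if "h \<in> I - {i0}" for h
    unfolding \<theta>0_def by (intro tang_sum tang_mult log_rowsD(3)[OF lr _ that]) auto
  have r0: "rho 0 (\<theta>0 0) = 0" unfolding \<theta>0_def rho_sum by (simp add: col0)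
  have r1: "rho 0 (\<theta>0 (Suc k)) = \<phi> k" if "k < m" for k
    unfolding \<theta>0_def rho_sum using c that by (simp add: \<Phi>_def)
  obtain \<alpha> where \<alpha>: "Poly_Mapping.keys \<alpha> \<inter> {..<3} = {}" "Poly_Mapping.lookup (ups 0 q) \<alpha> \<noteq> 0"
    unfolding q_def using outer_monomial by blast
  define \<theta> where "\<theta> = (\<lambda>j. zpart 3 \<alpha> (card J_loc - 1) (\<theta>0 j))"
  have "tang 3 (a h) 1 \<theta>" if h: "h \<in> I_loc" for h
    unfolding \<theta>_def
  proof (rule tang_zpart[OF \<alpha>(1)])
    show "3 \<le> Suc m" using m by simp
    show "a h j = 0" if "3 \<le> j" "j < Suc m" for j using h that by (simp add: I_loc_def)
    show "tang (Suc m) (a h) 1 \<theta>0"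
      using t[of h] h loc_sub(1) r0 by (cases "h = i0") (auto simp: tang_i0 var_dvd_iff)
  qed
  moreover have "rho 0 (\<theta> 1) = 0"
    using zpart_congruent[of \<alpha> 3 0 "card J_loc - 1" "\<theta>0 1" 0] \<alpha>(1) r1[of 0] m by (simp add: \<theta>_def \<phi>_def)
  moreover have "rho 0 (\<theta> 2) = const (Poly_Mapping.lookup (ups 0 q) \<alpha>) * P"
  proof -
    have "ups 0 P \<in> poly_ring 3" unfolding P_def defpoly_def ups_prod
      using m by (auto intro!: poly_ring_closed2 ups_loc_form)
    moreover have "homogeneous (card J_loc - 1) P"
      using homogeneous_defpoly[of "\<lambda>_. 1" "J_loc - {y0}" m b] y0(1) fin by (simp add: P_def)
    moreover have "rho 0 (\<theta>0 2) = P * q" using r1[of 1] m by (simp add: \<phi>_def numeral_2_eq_2)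
    ultimately show ?thesis unfolding \<theta>_def
      by (subst zpart_congruent[OF \<alpha>(1), of P]) (auto simp: mult.commute)
  qed
  moreover have "P = defpoly 2 (J_loc - {y0}) b (\<lambda>_. 1)" unfolding P_def using m by (intro defpoly_loc_smaller) auto
  ultimately show ?thesis using \<alpha>(2)
    by (intro exI[of _ \<theta>] exI[of _ "Poly_Mapping.lookup (ups 0 q) \<alpha>"]) (simp add: \<theta>_def)
qed

text \<open>The same extraction, applied to the first row: its value bpoly on the coordinate is
  the product of a local part and of a product of the other forms.\<close>

lemma local_transversal:
  assumes add: "addition_matrix M d" and m: "2 \<le> m"
  shows "\<exists>\<eta> u. (\<forall>j. \<eta> j \<in> poly_ring 3 \<and> homogeneous (\<Sum>w\<in>J_loc. card (fib w) - 1) (\<eta> j)) \<and>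
    (\<forall>h\<in>I_loc - {i0}. tang 3 (a h) 1 \<eta>) \<and>
    u \<noteq> 0 \<and> rho 0 (\<eta> 0) = const u * defpoly 2 J_loc b (\<lambda>w. card (fib w) - 1)"
proof -
  obtain v where v: "v \<noteq> 0" "rho 0 (M 0 0) = const v * bpoly" using add by (auto simp: addition_matrix_def)
  obtain u where lr: "log_rows (Suc m) (I - {i0}) a (\<lambda>_. 1) M d" and "u \<noteq> 0" "mdet (Suc m) M = const u * defpoly (Suc m) (I - {i0}) a (\<lambda>_. 1)"
    using add unfolding addition_matrix_def by (elim conjE saitoE)
  let ?e = "\<lambda>w. card (fib w) - 1"
  define P where "P = defpoly m J_loc b ?e"
  define q where "q = defpoly m (J - J_loc) b ?e"
  have "bpoly = P * q" unfolding bpoly_def P_def q_def defpoly_def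
    using prod.subset_diff[OF loc_sub(2) finJ, of "\<lambda>w. lform m (b w) ^ ?e w"] by (simp add: mult.commute)
  then have MP: "rho 0 (M 0 0) = P * (const v * q)" using v(2) by (simp add: mult.left_commute)
  obtain \<alpha> where \<alpha>: "Poly_Mapping.keys \<alpha> \<inter> {..<3} = {}" "Poly_Mapping.lookup (ups 0 q) \<alpha> \<noteq> 0"
    unfolding q_def using outer_monomial by blast
  define \<eta> where "\<eta> = (\<lambda>j. zpart 3 \<alpha> (\<Sum>w\<in>J_loc. ?e w) (M 0 j))"
  have "tang 3 (a h) 1 \<eta>" if h: "h \<in> I_loc - {i0}" for h
    unfolding \<eta>_def
  proof (rule tang_zpart[OF \<alpha>(1)])
    show "3 \<le> Suc m" using m by simp
    show "a h j = 0" if "3 \<le> j" "j < Suc m" for j using h that by (simp add: I_loc_def)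
    show "tang (Suc m) (a h) 1 (M 0)" using log_rowsD(3)[OF lr, of 0 h] h loc_sub(1) by auto
  qed
  moreover have "rho 0 (\<eta> 0) = const (v * Poly_Mapping.lookup (ups 0 q) \<alpha>) * P"
  proof -
    have "ups 0 P \<in> poly_ring 3" unfolding P_def defpoly_def ups_prod
      using m by (auto intro!: poly_ring_closed2 ups_loc_form)
    moreover have "homogeneous (\<Sum>w\<in>J_loc. ?e w) P" unfolding P_def by (rule homogeneous_defpoly)
    ultimately show ?thesis unfolding \<eta>_def
      by (subst zpart_congruent[OF \<alpha>(1) _ _ _ MP]) (auto simp: mult_ac)
  qed
  moreover have "P = defpoly 2 J_loc b ?e" unfolding P_def using m by (intro defpoly_loc_smaller) auto
  ultimately show ?thesis using \<alpha>(2) v(1)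
    by (intro exI[of _ \<eta>] exI[of _ "v * Poly_Mapping.lookup (ups 0 q) \<alpha>"]) (simp add: \<eta>_def)
qed

end

section \<open>Derivations as coefficient vectors\<close>

definition pdiff :: "nat \<Rightarrow> 'k::field mpoly \<Rightarrow> 'k mpoly" where
  "pdiff i f = (\<Sum>m\<in>Poly_Mapping.keys f. Poly_Mapping.single (m - Poly_Mapping.single i 1)
      (of_nat (Poly_Mapping.lookup m i) * Poly_Mapping.lookup f m))"

lemma partial_eq: "partial n i f = (if f \<in> poly_ring n then pdiff i f else 0)"
  by (simp add: partial_def pdiff_def)

lemma pdiff_superset:
  assumes "finite S" "Poly_Mapping.keys f \<subseteq> S"
  shows "pdiff i f = (\<Sum>m\<in>S. Poly_Mapping.single (m - Poly_Mapping.single i 1)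
      (of_nat (Poly_Mapping.lookup m i) * Poly_Mapping.lookup f m))"
  unfolding pdiff_def by (rule sum.mono_neutral_left) (use assms in \<open>auto simp: in_keys_iff\<close>)

lemma pdiff_add: "pdiff i (f + g) = pdiff i f + pdiff i g"
proof -
  let ?S = "Poly_Mapping.keys f \<union> Poly_Mapping.keys g"
  have "pdiff i (f + g) = (\<Sum>m\<in>?S. Poly_Mapping.single (m - Poly_Mapping.single i 1)
      (of_nat (Poly_Mapping.lookup m i) * Poly_Mapping.lookup (f + g) m))"
    by (rule pdiff_superset) (use Poly_Mapping.keys_add[of f g] in auto)
  then show ?thesis
    by (simp add: lookup_add distrib_left single_add sum.distrib pdiff_superset[of ?S f] pdiff_superset[of ?S g])
qed

lemma pdiff_single: "pdiff i (Poly_Mapping.single m c) =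
    Poly_Mapping.single (m - Poly_Mapping.single i 1) (of_nat (Poly_Mapping.lookup m i) * c)"
  by (cases "c = 0") (simp_all add: pdiff_def)

lemma pdiff_0 [simp]: "pdiff i 0 = 0"
  by (simp add: pdiff_def)

lemma shift_monomial:
  "0 < Poly_Mapping.lookup q i \<Longrightarrow> p + q - Poly_Mapping.single i 1 = p + (q - Poly_Mapping.single i (1::nat))"
  by (rule poly_mapping_eqI) (auto simp: lookup_add lookup_minus lookup_single when_def)

lemma pdiff_mult: "pdiff i (f * g) = f * pdiff i g + g * pdiff i f"
proof (induction f rule: mpoly_add_induct)
  case (single m c)
  show ?case
  proof (induction g rule: mpoly_add_induct)
    case (single m' c')
    let ?e = "Poly_Mapping.single i (1::nat)" and ?l = "\<lambda>m. Poly_Mapping.lookup m i"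
    have 1: "Poly_Mapping.single (p + q - ?e) (of_nat (?l q) * x) = Poly_Mapping.single (p + (q - ?e)) (of_nat (?l q) * x)"
      for p q and x :: 'a
      using shift_monomial[of q i p] by (cases "?l q = 0") simp_all
    have "pdiff i (Poly_Mapping.single m c * Poly_Mapping.single m' c') =
      Poly_Mapping.single (m + m' - ?e) (of_nat (?l m') * (c * c')) + Poly_Mapping.single (m' + m - ?e) (of_nat (?l m) * (c * c'))"
      by (simp add: mult_single pdiff_single lookup_add algebra_simps flip: single_add)
    also have "\<dots> = Poly_Mapping.single m c * pdiff i (Poly_Mapping.single m' c') + Poly_Mapping.single m' c' * pdiff i (Poly_Mapping.single m c)"
      unfolding 1 by (simp add: mult_single pdiff_single algebra_simps)
    finally show ?case .
  qed (simp_all add: pdiff_add algebra_simps)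
qed (simp_all add: pdiff_add algebra_simps)

lemma pdiff_const [simp]: "pdiff i (const c) = 0"
  by (simp add: const_def pdiff_single)

lemma pdiff_var: "pdiff i (var j) = (if i = j then 1 else 0)"
  by (auto simp: var_def pdiff_single lookup_single when_def)

lemma pdiff_in_poly_ring: "f \<in> poly_ring n \<Longrightarrow> pdiff i f \<in> poly_ring n"
proof -
  assume f: "f \<in> poly_ring n"
  have "Poly_Mapping.keys (m - Poly_Mapping.single i 1) \<subseteq> Poly_Mapping.keys m" for m :: "nat \<Rightarrow>\<^sub>0 nat"
    by (auto simp: in_keys_iff lookup_minus)
  then show ?thesis unfolding pdiff_def using f
    by (intro poly_ring_closed2 poly_ring_single) (auto simp: poly_ring_def)
qed

lemma Der_simps:
  assumes "\<theta> \<in> Der n"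
  shows "f \<in> poly_ring n \<Longrightarrow> \<theta> f \<in> poly_ring n" "f \<notin> poly_ring n \<Longrightarrow> \<theta> f = 0"
    "f \<in> poly_ring n \<Longrightarrow> g \<in> poly_ring n \<Longrightarrow> \<theta> (f + g) = \<theta> f + \<theta> g"
    "f \<in> poly_ring n \<Longrightarrow> \<theta> (const c * f) = const c * \<theta> f"
    "f \<in> poly_ring n \<Longrightarrow> g \<in> poly_ring n \<Longrightarrow> \<theta> (f * g) = f * \<theta> g + g * \<theta> f"
  using assms unfolding Der_def by auto

lemma Der_zero: "\<theta> \<in> Der n \<Longrightarrow> \<theta> 0 = 0"
  using Der_simps(4)[of \<theta> n 0 0] by simp

lemma Der_sum: "\<theta> \<in> Der n \<Longrightarrow> (\<And>i. i \<in> S \<Longrightarrow> F i \<in> poly_ring n) \<Longrightarrow> \<theta> (\<Sum>i\<in>S. F i) = (\<Sum>i\<in>S. \<theta> (F i))"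
  by (induction S rule: infinite_finite_induct) (auto simp: Der_zero Der_simps(3) poly_ring_closed2)

lemma Der_one: "\<theta> \<in> Der n \<Longrightarrow> \<theta> 1 = 0"
proof -
  assume "\<theta> \<in> Der n"
  from Der_simps(5)[OF this poly_ring_closed(2) poly_ring_closed(2)] have "\<theta> 1 = \<theta> 1 + \<theta> 1"
    by (simp only: mult_1_left)
  then show ?thesis by (simp only: add_cancel_right_right)
qed

definition dvec :: "nat \<Rightarrow> (nat \<Rightarrow> 'k::field mpoly) \<Rightarrow> 'k mpoly \<Rightarrow> 'k mpoly" where
  "dvec n v f = (\<Sum>i<n. v i * partial n i f)"

lemma dvec_in_Der: "polyvec n v \<Longrightarrow> dvec n v \<in> Der n"
  unfolding Der_def dvec_def polyvec_def
  by (auto simp: partial_eq pdiff_in_poly_ring pdiff_add pdiff_mult algebra_simps sum.distrib sum_distrib_left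
      intro!: poly_ring_closed2 poly_ring_closed)

lemma dvec_var: "j < n \<Longrightarrow> dvec n v (var j) = v j"
  by (simp add: dvec_def partial_eq pdiff_var if_distrib[of "\<lambda>x. _ * x"] cong: if_cong)

lemma dvec_unit: "i < n \<Longrightarrow> dvec n (\<lambda>j. if j = i then 1 else 0) = partial n i"
  by (rule ext) (simp add: dvec_def if_distrib[of "\<lambda>x. x * _"] cong: if_cong)

text \<open>By the product rule, derivations that agree on the variables agree on monomials,
  hence everywhere.\<close>

lemma Der_eq_dvec:
  assumes \<theta>: "\<theta> \<in> Der n"
  shows "\<theta> = dvec n (\<lambda>i. \<theta> (var i))"
proof
  fix f
  show "\<theta> f = dvec n (\<lambda>i. \<theta> (var i)) f"
  proof (cases "f \<in> poly_ring n")
    case False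
    then show ?thesis using \<theta> by (simp add: Der_simps(2) dvec_def partial_eq)
  next
    case True
    let ?\<eta> = "dvec n (\<lambda>i. \<theta> (var i))"
    have \<eta>: "?\<eta> \<in> Der n" by (rule dvec_in_Der) (use \<theta> in \<open>auto simp: polyvec_def Der_simps(1)\<close>)
    have pow: "\<theta> (var i ^ k) = ?\<eta> (var i ^ k)" if "i < n" for i k
    proof (induction k)
      case (Suc k)
      then show ?case using that Der_simps(5)[OF \<theta>, of "var i" "var i ^ k"] Der_simps(5)[OF \<eta>, of "var i" "var i ^ k"]
        by (simp add: dvec_var)
    qed (simp add: Der_one[OF \<theta>] Der_one[OF \<eta>])
    have pr: "\<theta> (\<Prod>i\<in>S. var i ^ e i) = ?\<eta> (\<Prod>i\<in>S. var i ^ e i)" if "finite S" "S \<subseteq> {..<n}" for S and e :: "nat \<Rightarrow> nat"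
      using that
    proof (induction S)
      case (insert x F)
      then have *: "var x ^ e x \<in> poly_ring n" "(\<Prod>i\<in>F. var i ^ e i) \<in> poly_ring n"
        by (auto intro!: poly_ring_closed2)
      have IH: "\<theta> (\<Prod>i\<in>F. var i ^ e i) = ?\<eta> (\<Prod>i\<in>F. var i ^ e i)" using insert by blast
      have px: "\<theta> (var x ^ e x) = ?\<eta> (var x ^ e x)" using pow insert by blast
      show ?case unfolding prod.insert[OF insert.hyps] Der_simps(5)[OF \<theta> *] Der_simps(5)[OF \<eta> *] IH px ..
    qed (simp add: Der_one[OF \<theta>] Der_one[OF \<eta>])
    have mono: "\<theta> (Poly_Mapping.single m c) = ?\<eta> (Poly_Mapping.single m c)" if "Poly_Mapping.keys m \<subseteq> {..<n}" for m c
    proof -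
      have eq: "Poly_Mapping.single m c = const c * (\<Prod>i\<in>Poly_Mapping.keys m. var i ^ Poly_Mapping.lookup m i)"
        using poly_subst_single[of var m c] by (simp add: mon_eval_def)
      have *: "(\<Prod>i\<in>Poly_Mapping.keys m. var i ^ Poly_Mapping.lookup m i) \<in> poly_ring n"
        using that by (auto intro!: poly_ring_closed2)
      show ?thesis unfolding eq Der_simps(4)[OF \<theta> *] Der_simps(4)[OF \<eta> *] pr[OF finite_keys that] ..
    qed
    have k: "Poly_Mapping.keys m \<subseteq> {..<n}" if "m \<in> Poly_Mapping.keys f" for m using True that by (auto simp: poly_ring_def)
    have "\<theta> f = (\<Sum>m\<in>Poly_Mapping.keys f. \<theta> (Poly_Mapping.single m (Poly_Mapping.lookup f m)))"
      by (subst poly_as_sum[of f]) (intro Der_sum[OF \<theta>] poly_ring_single k)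
    also have "\<dots> = (\<Sum>m\<in>Poly_Mapping.keys f. ?\<eta> (Poly_Mapping.single m (Poly_Mapping.lookup f m)))"
      by (intro sum.cong refl mono k)
    also have "\<dots> = ?\<eta> (\<Sum>m\<in>Poly_Mapping.keys f. Poly_Mapping.single m (Poly_Mapping.lookup f m))"
      by (rule Der_sum[OF \<eta>, symmetric]) (intro poly_ring_single k)
    also have "\<dots> = ?\<eta> f" using poly_as_sum[of f] by simp
    finally show ?thesis .
  qed
qed

lemma dvec_eq_iff: "dvec n v = dvec n w \<longleftrightarrow> (\<forall>i<n. v i = w i)"
proof
  assume "dvec n v = dvec n w"
  then show "\<forall>i<n. v i = w i" by (metis dvec_var)
qed (auto simp: dvec_def fun_eq_iff)

lemma Der_lform: "\<theta> \<in> Der n \<Longrightarrow> \<theta> (lform n a) = app n a (\<lambda>i. \<theta> (var i))"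
  unfolding lform_def app_def by (subst Der_sum) (auto simp: Der_simps(4))

lemma dvec_mult: "(\<lambda>f. p * dvec n v f) = dvec n (\<lambda>i. p * v i)"
  by (rule ext) (simp add: dvec_def sum_distrib_left mult.assoc)

lemma dvec_zero [simp]: "dvec n (\<lambda>_. 0) = (\<lambda>_. 0)"
  by (rule ext) (simp add: dvec_def)

lemma lin_comb_dvec:
  "lin_comb c (map (\<lambda>i. dvec n (M i)) [0..<k]) = dvec n (\<lambda>j. \<Sum>i<k. c i * M i j)"
proof
  fix f
  have "(\<Sum>i<k. \<Sum>j<n. c i * (M i j * partial n j f)) = (\<Sum>j<n. \<Sum>i<k. c i * (M i j * partial n j f))"
    by (rule sum.swap)
  then show "lin_comb c (map (\<lambda>i. dvec n (M i)) [0..<k]) f = dvec n (\<lambda>j. \<Sum>i<k. c i * M i j) f"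
    by (simp add: lin_comb_def dvec_def sum_distrib_left sum_distrib_right mult.assoc)
qed

lemma has_pdeg_dvec: "has_pdeg n (dvec n v) e \<longleftrightarrow> homvec n e v"
  by (simp add: has_pdeg_def homvec_def dvec_var)

lemma Der_list:
  assumes "set \<theta>s \<subseteq> Der n"
  shows "\<theta>s = map (\<lambda>i. dvec n (\<lambda>j. (\<theta>s ! i) (var j))) [0..<length \<theta>s]"
proof (rule nth_equalityI)
  fix i assume "i < length \<theta>s"
  then show "\<theta>s ! i = map (\<lambda>i. dvec n (\<lambda>j. (\<theta>s ! i) (var j))) [0..<length \<theta>s] ! i"
    using Der_eq_dvec[OF subsetD[OF assms nth_mem]] by simp
qed simp

definition log_module :: "nat \<Rightarrow> 'i set \<Rightarrow> ('i \<Rightarrow> nat \<Rightarrow> 'k::field) \<Rightarrow> ('i \<Rightarrow> nat) \<Rightarrow> ('k mpoly \<Rightarrow> 'k mpoly) set" where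
  "log_module n I a \<mu> = {dvec n v |v. polyvec n v \<and> (\<forall>h\<in>I. tang n (a h) (\<mu> h) v)}"

lemma dvec_in_log_module:
  assumes "polyvec n v"
  shows "dvec n v \<in> log_module n I a \<mu> \<longleftrightarrow> (\<forall>h\<in>I. tang n (a h) (\<mu> h) v)"
proof
  assume "dvec n v \<in> log_module n I a \<mu>"
  then obtain w where w: "dvec n v = dvec n w" "\<forall>h\<in>I. tang n (a h) (\<mu> h) w"
    unfolding log_module_def by blast
  then have vw: "\<And>i. i < n \<Longrightarrow> v i = w i" unfolding dvec_eq_iff by simp
  show "\<forall>h\<in>I. tang n (a h) (\<mu> h) v"
  proof
    fix h assume "h \<in> I"
    then have "tang n (a h) (\<mu> h) w" using w(2) by simp
    moreover have "tang n (a h) (\<mu> h) v = tang n (a h) (\<mu> h) w" by (rule tang_cong) (simp_all add: vw)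
    ultimately show "tang n (a h) (\<mu> h) v" by simp
  qed
next
  assume "\<forall>h\<in>I. tang n (a h) (\<mu> h) v"
  then show "dvec n v \<in> log_module n I a \<mu>" unfolding log_module_def using assms by blast
qed

lemma saito_basis:
  assumes np: "nonprop n I a" and s: "saito n I a \<mu> M d"
  shows "homogeneous_basis n (log_module n I a \<mu>) (map (\<lambda>i. dvec n (M i)) [0..<n]) (map d [0..<n])"
proof -
  have lr: "log_rows n I a \<mu> M d" using s by (auto simp: saito_def)
  let ?\<theta>s = "map (\<lambda>i. dvec n (M i)) [0..<n]"
  have 1: "set ?\<theta>s \<subseteq> log_module n I a \<mu>"
    using log_rowsD(1,3)[OF lr] by (auto simp: dvec_in_log_module)
  have 2: "\<exists>c. (\<forall>i<length ?\<theta>s. c i \<in> poly_ring n) \<and> \<theta> = lin_comb c ?\<theta>s" if th: "\<theta> \<in> log_module n I a \<mu>" for \<theta>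
  proof -
    obtain v where v: "\<theta> = dvec n v" "polyvec n v" "\<And>h. h \<in> I \<Longrightarrow> tang n (a h) (\<mu> h) v"
      using th by (auto simp: log_module_def)
    obtain c where "\<forall>i<n. c i \<in> poly_ring n" "\<forall>k<n. v k = (\<Sum>i<n. c i * M i k)"
      using saito_expand[OF np s v(2,3)] by blast
    then show ?thesis unfolding v(1) lin_comb_dvec dvec_eq_iff by (intro exI[of _ c]) simp
  qed
  have 3: "\<forall>i<length ?\<theta>s. c i = 0" if c: "lin_comb c ?\<theta>s = (\<lambda>_. 0)" for c
  proof -
    have "dvec n (\<lambda>j. \<Sum>i<n. c i * M i j) = dvec n (\<lambda>_. 0)"
      using c unfolding lin_comb_dvec by simp
    then have "\<forall>k<n. (\<Sum>i<n. c i * M i k) = 0" unfolding dvec_eq_iff .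
    then show ?thesis using mdet_rows_independent[OF saito_mdet_nonzero[OF np s]] by simp
  qed
  have "list_all2 (has_pdeg n) ?\<theta>s (map d [0..<n])"
    using log_rowsD(2)[OF lr] by (auto simp: list_all2_conv_all_nth has_pdeg_dvec)
  then show ?thesis unfolding homogeneous_basis_def module_basis_def using 1 2 3 by blast
qed

lemma basis_saito:
  assumes np: "nonprop n I a" and b: "homogeneous_basis n (log_module n I a \<mu>) \<theta>s ds"
  shows "length \<theta>s = n \<and> length ds = n \<and> saito n I a \<mu> (\<lambda>i j. (\<theta>s ! i) (var j)) (\<lambda>i. ds ! i)"
proof -
  define M where "M = (\<lambda>i j. (\<theta>s ! i) (var j))"
  let ?k = "length \<theta>s"
  have sub: "set \<theta>s \<subseteq> log_module n I a \<mu>" and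
    span: "\<And>\<theta>. \<theta> \<in> log_module n I a \<mu> \<Longrightarrow> \<exists>c. (\<forall>i<?k. c i \<in> poly_ring n) \<and> \<theta> = lin_comb c \<theta>s" and
    ind: "\<And>c. (\<forall>i<?k. c i \<in> poly_ring n) \<Longrightarrow> lin_comb c \<theta>s = (\<lambda>_. 0) \<Longrightarrow> (\<forall>i<?k. c i = 0)" and
    deg: "list_all2 (has_pdeg n) \<theta>s ds"
    using b unfolding homogeneous_basis_def module_basis_def by blast+
  have "log_module n I a \<mu> \<subseteq> Der n" by (auto simp: log_module_def dvec_in_Der)
  then have eq: "\<theta>s = map (\<lambda>i. dvec n (M i)) [0..<?k]" unfolding M_def using sub by (intro Der_list) blast
  have len: "length ds = ?k" using deg list_all2_lengthD by fastforce
  have th: "polyvec n (M i) \<and> homvec n (ds ! i) (M i) \<and> (\<forall>h\<in>I. tang n (a h) (\<mu> h) (M i))" if i: "i < ?k" for i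
  proof -
    have in1: "\<theta>s ! i \<in> log_module n I a \<mu>" using sub i nth_mem by blast
    then have "\<theta>s ! i \<in> Der n" using \<open>log_module n I a \<mu> \<subseteq> Der n\<close> by blast
    then have pv: "polyvec n (M i)" and e: "\<theta>s ! i = dvec n (M i)"
      unfolding M_def by (auto simp: polyvec_def Der_simps(1) intro: Der_eq_dvec)
    moreover have "homvec n (ds ! i) (M i)" using deg i has_pdeg_dvec[of n "M i"] e by (auto simp: list_all2_conv_all_nth)
    ultimately show ?thesis using in1 dvec_in_log_module[OF pv, of I a \<mu>] pv by simp
  qed
  have "?k = n \<and> saito n I a \<mu> M (\<lambda>i. ds ! i)"
  proof (rule saito_of_basis[OF np th])
    fix v assume v: "polyvec n v" "\<And>h. h \<in> I \<Longrightarrow> tang n (a h) (\<mu> h) v"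
    then have "dvec n v \<in> log_module n I a \<mu>" by (simp add: dvec_in_log_module)
    then obtain c where "\<forall>i<?k. c i \<in> poly_ring n" "dvec n v = lin_comb c \<theta>s" using span by blast
    then show "\<exists>c. (\<forall>i<?k. c i \<in> poly_ring n) \<and> (\<forall>j<n. v j = (\<Sum>i<?k. c i * M i j))"
      by (subst (asm) eq) (auto simp: lin_comb_dvec dvec_eq_iff)
  next
    fix c assume c: "\<forall>i<?k. c i \<in> poly_ring n" "\<forall>j<n. (\<Sum>i<?k. c i * M i j) = 0"
    have "dvec n (\<lambda>j. \<Sum>i<?k. c i * M i j) = dvec n (\<lambda>_. 0)" unfolding dvec_eq_iff using c(2) by simp
    then have "lin_comb c \<theta>s = dvec n (\<lambda>_. 0)" by (subst eq) (simp only: lin_comb_dvec)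
    then show "\<forall>i<?k. c i = 0" using ind[OF c(1)] by simp
  qed
  then show ?thesis using len by (simp add: M_def)
qed

section \<open>Bases of rank two localizations\<close>

text \<open>The matrix of a basis of the kind that defines the Euler restriction: two rows, followed by
  the constant derivations along the flat.\<close>

definition pair_matrix :: "(nat \<Rightarrow> 'k::field mpoly) \<Rightarrow> (nat \<Rightarrow> 'k mpoly) \<Rightarrow> nat \<Rightarrow> nat \<Rightarrow> 'k mpoly" where
  "pair_matrix t p i j = (if i = 0 then if j < 2 then t j else 0 else if i = 1 then if j < 2 then p j else 0
     else if i = j then 1 else 0)"

definition rank2 :: "nat \<Rightarrow> 'i set \<Rightarrow> ('i \<Rightarrow> nat \<Rightarrow> 'k::field) \<Rightarrow> bool" where
  "rank2 n I a \<longleftrightarrow> 2 \<le> n \<and> nonprop n I a \<and> (\<forall>h\<in>I. \<forall>j<n. 2 \<le> j \<longrightarrow> a h j = 0)"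

lemma rank2_form: "rank2 n I a \<Longrightarrow> h \<in> I \<Longrightarrow> lform n (a h) = lform 2 (a h)"
  by (rule lform_eq_smaller) (auto simp: rank2_def)

lemma rank2_app: "rank2 n I a \<Longrightarrow> h \<in> I \<Longrightarrow> app n (a h) v = const (a h 0) * v 0 + const (a h 1) * v 1"
  using app_smaller[of 2 n "a h" v] by (simp add: rank2_def app_def numeral_2_eq_2)

lemma rank2_lform: "rank2 n I a \<Longrightarrow> h \<in> I \<Longrightarrow> lform n (a h) = const (a h 0) * var 0 + const (a h 1) * var 1"
  using rank2_app[of n I a h var] by (simp add: app_var)

lemma rank2_nonzero: "rank2 n I a \<Longrightarrow> h \<in> I \<Longrightarrow> a h 0 \<noteq> 0 \<or> a h 1 \<noteq> 0"
proof -
  assume r: "rank2 n I a" and h: "h \<in> I"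
  then obtain k where k: "k < n" "a h k \<noteq> 0" by (auto simp: rank2_def nonprop_def)
  then have "k < 2" using r h unfolding rank2_def by (metis not_less)
  then have "k = 0 \<or> k = 1" by auto
  then show ?thesis using k by auto
qed

lemma pair_saito:
  assumes r: "rank2 n I a" and tp: "\<And>j. j < 2 \<Longrightarrow> t j \<in> poly_ring 2 \<and> p j \<in> poly_ring 2 \<and> homogeneous d (t j) \<and> homogeneous e (p j)"
    and t: "\<And>h. h \<in> I \<Longrightarrow> tang n (a h) (\<mu> h) t" and p: "\<And>h. h \<in> I \<Longrightarrow> tang n (a h) (\<mu> h) p"
    and det: "t 0 * p 1 - t 1 * p 0 \<noteq> 0" and sum: "d + e = (\<Sum>h\<in>I. \<mu> h)"
  shows "saito n I a \<mu> (pair_matrix t p) (\<lambda>i. if i = 0 then d else if i = 1 then e else 0)"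
proof (rule saitoI_degree)
  have n: "2 \<le> n" and np: "nonprop n I a" using r by (auto simp: rank2_def)
  show "nonprop n I a" by (rule np)
  have "mdet n (pair_matrix t p) = mdet 2 (pair_matrix t p)"
    using n by (rule mdet_unit_rows) (auto simp: pair_matrix_def)
  then show "mdet n (pair_matrix t p) \<noteq> 0" using det by (simp add: mdet_2 pair_matrix_def)
  have "(\<Sum>i<n. if i = 0 then d else if i = 1 then e else 0) = (\<Sum>i\<in>{0, 1::nat}. if i = 0 then d else if i = 1 then e else 0)"
    by (rule sum.mono_neutral_right) (use n in auto)
  then show "(\<Sum>i<n. if i = 0 then d else if i = 1 then e else 0) = (\<Sum>h\<in>I. \<mu> h)" using sum by simp
  have sub: "f \<in> poly_ring 2 \<Longrightarrow> f \<in> poly_ring n" for f :: "'b mpoly" using n by (rule poly_ring_mono)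
  show "log_rows n I a \<mu> (pair_matrix t p) (\<lambda>i. if i = 0 then d else if i = 1 then e else 0)"
    unfolding log_rows_def
  proof (intro allI impI conjI ballI)
    fix i assume i: "i < n"
    show "polyvec n (pair_matrix t p i)" using tp sub by (auto simp: polyvec_def pair_matrix_def)
    show "homvec n (if i = 0 then d else if i = 1 then e else 0) (pair_matrix t p i)"
      using tp by (auto simp: homvec_def pair_matrix_def)
    fix h assume h: "h \<in> I"
    have "app n (a h) (pair_matrix t p 0) = app n (a h) t" "app n (a h) (pair_matrix t p 1) = app n (a h) p"
      unfolding rank2_app[OF r h] by (simp_all add: pair_matrix_def)
    moreover have "app n (a h) (pair_matrix t p i) = 0" if "2 \<le> i"
      unfolding rank2_app[OF r h] using that by (simp add: pair_matrix_def)
    ultimately show "tang n (a h) (\<mu> h) (pair_matrix t p i)"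
      using t[OF h] p[OF h] unfolding tang_def
      by (cases "i = 0"; cases "i = 1") auto
  qed
qed

lemma unit_rows_expand:
  fixes n :: nat and M :: "nat \<Rightarrow> nat \<Rightarrow> 'a::comm_ring_1"
  assumes n: "2 \<le> n" and M: "\<And>i j. 2 \<le> i \<Longrightarrow> i < n \<Longrightarrow> j < n \<Longrightarrow> M i j = (if i = j then 1 else 0)" and j: "j < 2"
  shows "(\<Sum>i<n. c i * M i j) = c 0 * M 0 j + c 1 * M 1 j"
proof -
  have "(\<Sum>i<n. c i * M i j) = (\<Sum>i\<in>{0, 1}. c i * M i j)"
    by (rule sum.mono_neutral_right) (use n M j in auto)
  then show ?thesis by simp
qed

text \<open>The distinguished form L divides the second rows, but not the first row of M. Hence,
  in the expansion of either first row by the rows of the other matrix, the first row of the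
  latter must occur; by degrees, neither of them can have the larger degree.\<close>

lemma euler_degree_unique:
  assumes n: "2 \<le> n" and np: "nonprop n I a"
    and M: "saito n I a \<mu> M e" "\<And>i j. 2 \<le> i \<Longrightarrow> i < n \<Longrightarrow> j < n \<Longrightarrow> M i j = (if i = j then 1 else 0)"
    and N: "saito n I a \<mu> N f" "\<And>i j. 2 \<le> i \<Longrightarrow> i < n \<Longrightarrow> j < n \<Longrightarrow> N i j = (if i = j then 1 else 0)"
    and L: "L dvd M 1 0" "L dvd M 1 1" "L dvd N 1 0" "L dvd N 1 1" "\<not> (L dvd M 0 0 \<and> L dvd M 0 1)"
  shows "e 0 = f 0"
proof (rule antisym)
  have lM: "log_rows n I a \<mu> M e" and lN: "log_rows n I a \<mu> N f" using M N by (auto simp: saito_def)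
  have n0: "0 < n" "1 < n" using n by auto
  show "f 0 \<le> e 0"
  proof (rule ccontr)
    assume "\<not> f 0 \<le> e 0"
    moreover obtain c where c: "\<forall>k<n. M 0 k = (\<Sum>i<n. c i * N i k)" "\<forall>i<n. homogeneous (e 0 - f i) (c i) \<and> (e 0 < f i \<longrightarrow> c i = 0)"
      using saito_expand_hom[OF np N(1) log_rowsD(1,2,3)[OF lM n0(1)]] by blast
    ultimately have "c 0 = 0" using n0 by simp
    then have "M 0 j = c 1 * N 1 j" if "j < 2" for j
      using c(1) unit_rows_expand[OF n N(2) that, of c] that n by simp
    then have "M 0 0 = c 1 * N 1 0" "M 0 1 = c 1 * N 1 1" by simp_all
    then show False using L by simp
  qed
  show "e 0 \<le> f 0"
  proof (rule ccontr)
    assume "\<not> e 0 \<le> f 0"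
    moreover obtain c where c: "\<forall>k<n. N 0 k = (\<Sum>i<n. c i * M i k)" "\<forall>i<n. homogeneous (f 0 - e i) (c i) \<and> (f 0 < e i \<longrightarrow> c i = 0)"
      using saito_expand_hom[OF np M(1) log_rowsD(1,2,3)[OF lN n0(1)]] by blast
    ultimately have "c 0 = 0" using n0 by simp
    then have "N 0 j = c 1 * M 1 j" if "j < 2" for j
      using c(1) unit_rows_expand[OF n M(2) that, of c] that n by simp
    then have N0: "N 0 0 = c 1 * M 1 0" "N 0 1 = c 1 * M 1 1" by simp_all
    obtain c' where c': "\<forall>k<n. M 0 k = (\<Sum>i<n. c' i * N i k)"
      using saito_expand[OF np N(1) log_rowsD(1,3)[OF lM n0(1)]] by blast
    have "M 0 j = c' 0 * N 0 j + c' 1 * N 1 j" if "j < 2" for j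
      using c' unit_rows_expand[OF n N(2) that, of c'] that n by simp
    then have "M 0 0 = c' 0 * N 0 0 + c' 1 * N 1 0" "M 0 1 = c' 0 * N 0 1 + c' 1 * N 1 1" by simp_all
    then show False using L unfolding N0 by (simp add: dvd_add)
  qed
qed

subsection \<open>Concentrated multiplicities\<close>

text \<open>In rank two, a concentrated multiplicity has an explicit basis: the Euler derivation
  times a power of the form of h, and the derivation that annihilates this form, times all other
  forms.\<close>

definition conc_euler :: "('i \<Rightarrow> nat \<Rightarrow> 'k::field) \<Rightarrow> 'i \<Rightarrow> nat \<Rightarrow> nat \<Rightarrow> 'k mpoly" where
  "conc_euler a h m0 j = lform 2 (a h) ^ (m0 - 1) * var j"

definition conc_rot :: "'i set \<Rightarrow> ('i \<Rightarrow> nat \<Rightarrow> 'k::field) \<Rightarrow> 'i \<Rightarrow> nat \<Rightarrow> 'k mpoly" where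
  "conc_rot I a h j = defpoly 2 (I - {h}) a (\<lambda>_. 1) * const (if j = 0 then a h 1 else - a h 0)"

text \<open>The former derivation comes first if another hyperplane than h is deleted, the
  latter if h itself is.\<close>

lemma conc_pair:
  assumes r: "rank2 n I a" and h: "h \<in> I" and m0: "1 \<le> m0" and \<mu>: "\<And>h'. h' \<in> I \<Longrightarrow> \<mu> h' = (if h' = h then m0 else 1)"
  shows "saito n I a \<mu> (pair_matrix (conc_euler a h m0) (conc_rot I a h)) (\<lambda>i. if i = 0 then m0 else if i = 1 then card I - 1 else 0)"
    and "saito n I a \<mu> (pair_matrix (conc_rot I a h) (conc_euler a h m0)) (\<lambda>i. if i = 0 then card I - 1 else if i = 1 then m0 else 0)"
proof -
  let ?L = "lform 2 (a h)" and ?Q = "defpoly 2 (I - {h}) a (\<lambda>_. 1)"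
  let ?w = "conc_euler a h m0" and ?p = "conc_rot I a h"
  have fin: "finite I" using r by (auto simp: rank2_def nonprop_finite)
  have np: "nonprop n (I - {h}) a" using r by (auto simp: rank2_def intro: nonprop_subset)
  have "homogeneous (1 * (m0 - 1) + 1) (?w j)" for j
    unfolding conc_euler_def by (intro homogeneous_mult homogeneous_power) auto
  then have hw: "homogeneous m0 (?w j)" for j using m0 by simp
  have "homogeneous ((\<Sum>x\<in>I - {h}. 1) + 0) (?p j)" for j
    unfolding conc_rot_def by (intro homogeneous_mult homogeneous_defpoly homogeneous_base)
  then have hp: "homogeneous (card I - 1) (?p j)" for j using fin h by simp
  have rw: "?w j \<in> poly_ring 2" if "j < 2" for j using that by (auto simp: conc_euler_def)
  have rp: "?p j \<in> poly_ring 2" for j by (auto simp: conc_rot_def)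
  have tw: "tang n (a h') (\<mu> h') ?w" if h': "h' \<in> I" for h'
  proof -
    have "app n (a h') ?w = ?L ^ (m0 - 1) * lform n (a h')"
      unfolding rank2_app[OF r h'] rank2_lform[OF r h'] by (simp add: conc_euler_def algebra_simps)
    moreover have "lform n (a h') ^ \<mu> h' dvd ?L ^ (m0 - 1) * lform n (a h')"
    proof (cases "h' = h")
      case True
      then have "lform n (a h') ^ \<mu> h' = ?L ^ (m0 - 1) * lform n (a h')"
        using m0 \<mu>[OF h] rank2_form[OF r h] by (simp flip: power_Suc2)
      then show ?thesis by simp
    next
      case False
      then show ?thesis using \<mu>[OF h'] by simp
    qed
    ultimately show ?thesis by (simp add: tang_def)
  qed
  have tp: "tang n (a h') (\<mu> h') ?p" if h': "h' \<in> I" for h'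
  proof (cases "h' = h")
    case True
    have "app n (a h) ?p = 0" unfolding rank2_app[OF r h] by (simp add: conc_rot_def algebra_simps)
    then show ?thesis using True by (simp add: tang_def)
  next
    case False
    then have "lform 2 (a h') ^ 1 dvd ?Q" using fin h' by (intro dvd_defpoly[where \<mu> = "\<lambda>_. 1"]) auto
    then have "lform n (a h') dvd ?p j" for j
      unfolding rank2_form[OF r h'] conc_rot_def by (simp only: power_one_right dvd_mult2)
    then show ?thesis using False \<mu>[OF h'] unfolding tang_def app_def by (auto intro!: dvd_sum dvd_mult)
  qed
  have Q0: "?Q \<noteq> 0"
  proof -
    have "defpoly n (I - {h}) a (\<lambda>_. 1) = ?Q"
      unfolding defpoly_def using rank2_form[OF r] by (intro prod.cong) auto
    then show ?thesis using defpoly_nonzero[OF np] by metis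
  qed
  have L0: "?L \<noteq> 0" using r h by (metis nonprop_prime not_prime_elem_zero rank2_def rank2_form)
  have "?w 0 * ?p 1 - ?w 1 * ?p 0 = - (?L ^ (m0 - 1) * ?Q * lform n (a h))"
    unfolding rank2_lform[OF r h] by (simp add: conc_euler_def conc_rot_def algebra_simps)
  then have det: "?w 0 * ?p 1 - ?w 1 * ?p 0 \<noteq> 0" using L0 Q0 by (simp add: rank2_form[OF r h])
  have "(\<Sum>h'\<in>I. \<mu> h') = \<mu> h + (\<Sum>h'\<in>I - {h}. \<mu> h')" by (rule sum.remove[OF fin h])
  also have "(\<Sum>h'\<in>I - {h}. \<mu> h') = (\<Sum>h'\<in>I - {h}. 1)" by (rule sum.cong) (use \<mu> in auto)
  finally have sum: "m0 + (card I - 1) = (\<Sum>h\<in>I. \<mu> h)" using \<mu>[OF h] fin h by simp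
  show "saito n I a \<mu> (pair_matrix ?w ?p) (\<lambda>i. if i = 0 then m0 else if i = 1 then card I - 1 else 0)"
    using pair_saito[where t = ?w and p = ?p and d = m0 and e = "card I - 1", OF r] hw hp rw rp tw tp det sum by blast
  have "?p 0 * ?w 1 - ?p 1 * ?w 0 \<noteq> 0" using det by (simp add: mult.commute)
  then show "saito n I a \<mu> (pair_matrix ?p ?w) (\<lambda>i. if i = 0 then card I - 1 else if i = 1 then m0 else 0)"
    using pair_saito[where t = ?p and p = ?w and d = "card I - 1" and e = m0, OF r] hw hp rw rp tw tp sum
    by (simp only: add.commute) blast
qed

lemma not_dvd_both_vars:
  fixes a :: "'i \<Rightarrow> nat \<Rightarrow> 'k::field"
  assumes r: "rank2 n I a" and h: "h \<in> I" and "lform n (a h) dvd var 0" "lform n (a h) dvd var 1"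
  shows False
proof -
  have n: "0 < n" "1 < n" using r by (auto simp: rank2_def)
  have v: "(var i :: 'k mpoly) = lform n (\<lambda>j. if j = i then 1 else 0)" if "i < n" for i by (simp add: lform_unit[OF that])
  obtain c where "\<forall>i<n. (if i = 0 then 1 else 0) = c * a h i"
    using lform_dvd_lform[OF assms(3)[unfolded v[OF n(1)]] n(1)] by auto
  then have "c \<noteq> 0 \<and> a h 1 = 0" using n by (metis mult_eq_0_iff zero_neq_one)
  moreover obtain c where "\<forall>i<n. (if i = 1 then 1 else 0) = c * a h i"
    using lform_dvd_lform[OF assms(4)[unfolded v[OF n(2)]] n(2)] by auto
  then have "a h 1 \<noteq> 0" using n by (metis mult_zero_right zero_neq_one)
  ultimately show False by simp
qed

lemma conc_euler_not_dvd:
  assumes r: "rank2 n I a" and h: "h \<in> I" "h' \<in> I" "h \<noteq> h'"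
  shows "\<not> (lform n (a h') dvd conc_euler a h m0 0 \<and> lform n (a h') dvd conc_euler a h m0 1)"
proof
  assume d: "lform n (a h') dvd conc_euler a h m0 0 \<and> lform n (a h') dvd conc_euler a h m0 1"
  have np: "nonprop n I a" using r by (simp add: rank2_def)
  have p: "prime_elem (lform n (a h'))" using np h(2) by (rule nonprop_prime)
  have "\<not> lform n (a h') dvd lform 2 (a h) ^ (m0 - 1)"
  proof
    assume "lform n (a h') dvd lform 2 (a h) ^ (m0 - 1)"
    then have "lform n (a h') dvd lform n (a h)" unfolding rank2_form[OF r h(1)] by (rule prime_elem_dvd_power[OF p])
    then show False using nonprop_not_dvd[OF np h(2,1)] h(3) by simp
  qed
  then have "lform n (a h') dvd var 0" "lform n (a h') dvd var 1"
    using d prime_elem_dvd_multD[OF p] unfolding conc_euler_def by blast+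
  then show False by (rule not_dvd_both_vars[OF r h(2)])
qed

lemma conc_euler_dvd: "rank2 n I a \<Longrightarrow> h \<in> I \<Longrightarrow> 2 \<le> m0 \<Longrightarrow> lform n (a h) dvd conc_euler a h m0 j"
  unfolding conc_euler_def by (simp add: rank2_form dvd_mult2 dvd_power)

lemma conc_rot_dvd:
  assumes r: "rank2 n I a" and h: "h \<in> I" "h' \<in> I" "h \<noteq> h'"
  shows "lform n (a h') dvd conc_rot I a h j"
proof -
  have "finite I" using r by (auto simp: rank2_def nonprop_finite)
  then have "lform 2 (a h') ^ 1 dvd defpoly 2 (I - {h}) a (\<lambda>_. 1)" using h by (intro dvd_defpoly[where \<mu> = "\<lambda>_. 1"]) auto
  then show ?thesis unfolding conc_rot_def rank2_form[OF r h(2)] by (simp only: power_one_right dvd_mult2)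
qed

lemma conc_rot_not_dvd:
  assumes r: "rank2 n I a" and h: "h \<in> I"
  shows "\<not> (lform n (a h) dvd conc_rot I a h 0 \<and> lform n (a h) dvd conc_rot I a h 1)"
proof
  assume d: "lform n (a h) dvd conc_rot I a h 0 \<and> lform n (a h) dvd conc_rot I a h 1"
  have np: "nonprop n I a" using r by (simp add: rank2_def)
  have eq: "defpoly n (I - {h}) a (\<lambda>_. 1) = defpoly 2 (I - {h}) a (\<lambda>_. 1)"
    unfolding defpoly_def using rank2_form[OF r] by (intro prod.cong) auto
  have "lform n (a h) dvd defpoly n (I - {h}) a (\<lambda>_. 1)"
  proof (cases "a h 0 = 0")
    case True
    then have c: "a h 1 \<noteq> 0" using rank2_nonzero[OF r h] by simp
    have "lform n (a h) dvd const (a h 1) * defpoly n (I - {h}) a (\<lambda>_. 1)"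
      using d unfolding conc_rot_def eq by (simp add: mult.commute)
    then show ?thesis by (rule const_unit2[OF c, THEN iffD1])
  next
    case False
    have "lform n (a h) dvd const (- a h 0) * defpoly n (I - {h}) a (\<lambda>_. 1)"
      using d unfolding conc_rot_def eq by (simp add: mult.commute)
    then show ?thesis by (rule const_unit2[of "- a h 0", THEN iffD1, rotated]) (use False in simp)
  qed
  then show False using nonprop_dvd_defpoly[OF np, of "I - {h}" h "\<lambda>_. 1"] h by blast
qed

subsection \<open>Multiplicities up to Ziegler's\<close>

lemma rho_0_var_Suc: "rho 0 (var (Suc j)) = var j"
  using rho_simps(10)[of 0 j] by simp

context restr0
begin

lemma rank2_loc: "2 \<le> m \<Longrightarrow> rank2 m J_loc b"
  using nonprop_subset[OF npJ' loc_sub(2)] by (auto simp: rank2_def J_loc_def)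

lemma loc_app: "2 \<le> m \<Longrightarrow> h \<in> I_loc \<Longrightarrow> app (Suc m) (a h) v = app 3 (a h) v"
  by (rule app_smaller) (auto simp: I_loc_def)

lemma loc_lform: "2 \<le> m \<Longrightarrow> h \<in> I_loc \<Longrightarrow> lform (Suc m) (a h) = lform 3 (a h)"
  by (rule lform_eq_smaller) (auto simp: I_loc_def)

lemma rho_3: "f \<in> poly_ring 3 \<Longrightarrow> k < 3 \<Longrightarrow> rho k f \<in> poly_ring 2"
  using rho_in_poly_ring[of f 3 k] by simp

lemma first_form: "y0 \<in> J \<Longrightarrow> 1 \<le> m \<Longrightarrow> (\<And>j. j < m \<Longrightarrow> j \<noteq> 0 \<Longrightarrow> b y0 j = 0) \<Longrightarrow>
    lform m (b y0) = const (b y0 0) * var 0 \<and> b y0 0 \<noteq> 0"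
proof -
  assume y: "y0 \<in> J" "1 \<le> m" and z: "\<And>j. j < m \<Longrightarrow> j \<noteq> 0 \<Longrightarrow> b y0 j = 0"
  have l: "lform m (b y0) = const (b y0 0) * var 0" by (rule lform_eq_var) (use y z in auto)
  moreover have "lform m (b y0) \<noteq> 0" using nonprop_prime[OF npJ' y(1)] by (auto simp: prime_elem_def)
  ultimately show ?thesis by auto
qed

text \<open>The local lift, corrected by a multiple of the Euler derivation so as to annihilate
  the coordinate of i0, restricts to a derivation that is tangent with Ziegler's multiplicity.
  The other member of the pair is a multiple of the Euler derivation, which is divisible by the
  form of y0 because \<mu> y0 exceeds 1.\<close>

lemma intermediate_pair:
  assumes add: "addition_matrix M d" and m: "2 \<le> m" and y0: "y0 \<in> J_loc" "\<And>j. j < m \<Longrightarrow> j \<noteq> 0 \<Longrightarrow> b y0 j = 0"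
    and \<mu>: "\<And>w. w \<in> J_loc \<Longrightarrow> 1 \<le> \<mu> w \<and> \<mu> w \<le> card (fib w)" and \<mu>y: "2 \<le> \<mu> y0"
  shows "\<exists>t p e. saito m J_loc b \<mu> (pair_matrix t p) (\<lambda>i. if i = 0 then card J_loc - 1 else if i = 1 then e else 0) \<and>
    \<not> (var 0 dvd t 0 \<and> var 0 dvd t 1) \<and> var 0 dvd p 0 \<and> var 0 dvd p 1"
proof -
  obtain \<theta> u where \<theta>: "\<And>j. \<theta> j \<in> poly_ring 3" "\<And>j. homogeneous (card J_loc - 1) (\<theta> j)"
    and \<theta>t: "\<And>h. h \<in> I_loc \<Longrightarrow> tang 3 (a h) 1 \<theta>"
    and \<theta>1: "rho 0 (\<theta> 1) = 0" and u: "u \<noteq> 0" "rho 0 (\<theta> 2) = const u * defpoly 2 (J_loc - {y0}) b (\<lambda>_. 1)"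
    using local_lift[OF add m y0] by auto
  have fin: "finite J_loc" using finJ loc_sub(2) by (rule finite_subset[rotated])
  have r: "rank2 m J_loc b" using m by (rule rank2_loc)
  have y0J: "y0 \<in> J" using y0(1) loc_sub(2) by blast
  have ly: "lform m (b y0) = const (b y0 0) * var 0" "b y0 0 \<noteq> 0" using first_form[OF y0J] y0(2) m by auto
  have x0i: "var 0 dvd \<theta> 0"
    using \<theta>t[OF loc_sub(3)] tang_i0[of 1 \<theta>] loc_app[OF m loc_sub(3)] loc_lform[OF m loc_sub(3)] by (simp add: tang_def)
  obtain g where g: "g \<in> poly_ring 3" "\<theta> 0 = var 0 * g" using dvd_in_poly_ring[OF x0i _ \<theta>(1)] by auto
  have gh: "homogeneous (card J_loc - 1) (g * var j)" for j
  proof (cases "g = 0")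
    case False
    then have *: "1 \<le> card J_loc - 1" "homogeneous (card J_loc - 1 - 1) g"
      using homogeneous_factor[of "card J_loc - 1" "var 0" g 1] \<theta>(2)[of 0] g by simp_all
    have "homogeneous (card J_loc - 1 - 1 + 1) (g * var j)" by (intro homogeneous_mult *(2) homogeneous_base)
    moreover have "card J_loc - 1 - 1 + 1 = card J_loc - 1" using *(1) by linarith
    ultimately show ?thesis by (simp only:)
  qed simp
  define v where "v = (\<lambda>j. \<theta> j - g * var j)"
  define t where "t = (\<lambda>j. rho 0 (v (Suc j)))"
  have v0: "v 0 = 0" using g by (simp add: v_def mult.commute)
  have t0: "t 0 = - (rho 0 g * var 0)" using \<theta>1 by (simp add: t_def v_def rho_0_var_Suc)
  have t1: "t 1 = rho 0 (\<theta> 2) - rho 0 g * var 1" by (simp add: t_def v_def numeral_2_eq_2 rho_0_var_Suc)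
  have tt: "tang m (b w) (card (fib w)) t" if w: "w \<in> J_loc" for w
  proof -
    have "tang (Suc m) (a h) 1 v" if h: "h \<in> I_loc - {i0}" for h
    proof -
      have "tang 3 (a h) 1 v" unfolding v_def by (intro tang_diff tang_mult tang_var \<theta>t) (use h in simp)
      then show ?thesis using h loc_app[OF m] loc_lform[OF m] by (simp add: tang_def)
    qed
    then have "tang m (b w) (card {h \<in> I_loc - {i0}. r h = w}) (\<lambda>j. rho 0 (v (Suc j)))"
      using tang_restrict[of v "I_loc - {i0}" w] v0 loc_sub(1) by auto
    then show ?thesis by (simp add: t_def fib_loc[OF w])
  qed
  define F where "F = defpoly 2 J_loc b (\<lambda>w. \<mu> w - 1)"
  define p where "p = (\<lambda>j. F * var j)"
  define e where "e = Suc (\<Sum>w\<in>J_loc. \<mu> w - 1)"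
  have x0F: "var 0 dvd F"
  proof -
    have "lform m (b y0) ^ 1 dvd lform m (b y0) ^ (\<mu> y0 - 1)" using \<mu>y by (intro le_imp_power_dvd) simp
    also have "\<dots> dvd F" unfolding F_def rank2_form[OF r y0(1)] by (rule dvd_defpoly[OF fin y0(1)])
    finally have "const (b y0 0) * var 0 dvd F" unfolding ly by (simp only: power_one_right)
    then show ?thesis by (rule const_unit[OF ly(2), THEN iffD1])
  qed
  have Qn: "defpoly m T b e' = defpoly 2 T b e'" if "T \<subseteq> J_loc" for T e' by (rule defpoly_loc_smaller[OF m that])
  have npl: "nonprop m J_loc b" using r by (simp add: rank2_def)
  have F0: "F \<noteq> 0" unfolding F_def Qn[OF subset_refl, symmetric] by (rule defpoly_nonzero[OF npl])
  have P0: "rho 0 (\<theta> 2) \<noteq> 0"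
    unfolding u(2) using Qn[of "J_loc - {y0}" "\<lambda>_. 1"] defpoly_nonzero[OF nonprop_subset[OF npl], of "J_loc - {y0}" "\<lambda>_. 1"] u(1) by auto
  have "saito m J_loc b \<mu> (pair_matrix t p) (\<lambda>i. if i = 0 then card J_loc - 1 else if i = 1 then e else 0)"
  proof (rule pair_saito[OF r])
    fix j :: nat assume j: "j < 2"
    have "v (Suc j) \<in> poly_ring 3" using \<theta>(1) g(1) j by (auto simp: v_def)
    then have "t j \<in> poly_ring 2" unfolding t_def by (rule rho_3) simp
    moreover have "homogeneous (card J_loc - 1) (t j)" unfolding t_def v_def by (intro homogeneous_rho homogeneous_diff \<theta>(2) gh)
    moreover have "p j \<in> poly_ring 2" using j by (auto simp: p_def F_def)
    moreover have "homogeneous ((\<Sum>w\<in>J_loc. \<mu> w - 1) + 1) (p j)" unfolding p_def F_def by (intro homogeneous_mult homogeneous_defpoly) auto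
    ultimately show "t j \<in> poly_ring 2 \<and> p j \<in> poly_ring 2 \<and> homogeneous (card J_loc - 1) (t j) \<and> homogeneous e (p j)"
      by (simp add: e_def)
  next
    fix w assume w: "w \<in> J_loc"
    show "tang m (b w) (\<mu> w) t" by (rule tang_mono[OF tt[OF w]]) (use \<mu>[OF w] in simp)
    have "lform m (b w) ^ (\<mu> w - 1) * lform m (b w) dvd F * lform m (b w)"
      unfolding F_def rank2_form[OF r w] by (rule mult_dvd_mono[OF dvd_defpoly[OF fin w] dvd_refl])
    also have "lform m (b w) ^ (\<mu> w - 1) * lform m (b w) = lform m (b w) ^ \<mu> w" using \<mu>[OF w] by (simp flip: power_Suc2)
    finally show "tang m (b w) (\<mu> w) p" unfolding tang_def p_def app_mult app_var .
  next
    have "t 0 * p 1 - t 1 * p 0 = - (F * var 0 * rho 0 (\<theta> 2))"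
      unfolding t0 t1 p_def by (simp add: algebra_simps)
    then show "t 0 * p 1 - t 1 * p 0 \<noteq> 0" using F0 P0 by simp
  next
    have "(\<Sum>w\<in>J_loc. \<mu> w) = (\<Sum>w\<in>J_loc. (\<mu> w - 1) + 1)" by (rule sum.cong) (use \<mu> in force)+
    also have "\<dots> = (\<Sum>w\<in>J_loc. \<mu> w - 1) + card J_loc" unfolding sum.distrib by simp
    finally have "(\<Sum>w\<in>J_loc. \<mu> w) = (\<Sum>w\<in>J_loc. \<mu> w - 1) + card J_loc" .
    moreover have "0 < card J_loc" using y0(1) fin by (auto simp: card_gt_0_iff)
    ultimately show "card J_loc - 1 + e = (\<Sum>w\<in>J_loc. \<mu> w)" by (simp add: e_def)
  qed
  moreover have "\<not> (var 0 dvd t 0 \<and> var 0 dvd t 1)"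
  proof
    assume d: "var 0 dvd t 0 \<and> var 0 dvd t 1"
    have "tang m (b y0) 2 t" by (rule tang_mono[OF tt[OF y0(1)]]) (use \<mu>[OF y0(1)] \<mu>y in simp)
    then have "(const (b y0 0) * var 0) ^ 2 dvd const (b y0 0) * t 0"
      using app_unit[of 0 m "b y0" t] y0(2) m unfolding tang_def ly(1) by simp
    then have "const (b y0 0 ^ 2) * var 0 ^ 2 dvd const (b y0 0) * t 0" unfolding power_mult_distrib const_power .
    then have "var 0 ^ 2 dvd t 0" using ly(2) by (simp only: const_unit[of "b y0 0 ^ 2"] const_unit2 power_eq_0_iff simp_thms)
    then have "var 0 * var 0 dvd var 0 * rho 0 g" unfolding t0 power2_eq_square by (simp add: mult.commute)
    then have "var 0 dvd rho 0 g" by (simp only: dvd_mult_cancel_left var_nonzero simp_thms)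
    then have "var 0 dvd (rho 0 (\<theta> 2) - rho 0 g * var 1) + rho 0 g * var 1"
      using d unfolding t1 by (intro dvd_add dvd_mult2) auto
    then have "var 0 dvd const u * defpoly 2 (J_loc - {y0}) b (\<lambda>_. 1)" by (simp add: u(2))
    then have "const (b y0 0) * var 0 dvd defpoly 2 (J_loc - {y0}) b (\<lambda>_. 1)"
      unfolding const_unit[OF ly(2)] by (rule const_unit2[OF u(1), THEN iffD1])
    then have "lform m (b y0) dvd defpoly m (J_loc - {y0}) b (\<lambda>_. 1)" unfolding ly(1) Qn[of "J_loc - {y0}", OF Diff_subset] .
    then show False using nonprop_dvd_defpoly[OF npl, of "J_loc - {y0}" y0 "\<lambda>_. 1"] y0(1) by blast
  qed
  ultimately show ?thesis using x0F unfolding p_def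
    by (intro exI[of _ t] exI[of _ p] exI[of _ e]) (simp add: p_def)
qed

end

lemma rho_0_rho_1: "rho 0 (rho 1 f) = rho 0 (rho 0 f)"
  unfolding rho_def poly_subst_comp
  by (rule arg_cong[of _ _ "\<lambda>s. poly_subst s f"]) (auto simp: fun_eq_iff)

context restr0
begin

text \<open>The form of the deleted hyperplane i0 is the coordinate of index 0, and that of
  another hyperplane i1 the coordinate of index 1; the pair is sought on i1. A local lift and
  the local transversal derivation are made to annihilate the coordinate of i1. Their
  determinant D is then the product of the forms of the localization other than those of i0 and
  i1, up to a constant.\<close>

lemma ziegler_pair:
  assumes add: "addition_matrix M d" and m: "2 \<le> m"
    and R: "restr (Suc m) 1 I i1 a K b' r' c'" and i1: "i1 \<noteq> i0"
    and K: "K_loc = {v \<in> K. \<forall>j<m. 2 \<le> j \<longrightarrow> b' v j = 0}"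
  shows "\<exists>t p e. saito m K_loc b' (\<lambda>v. card {h \<in> I - {i1}. r' h = v})
      (pair_matrix t p) (\<lambda>i. if i = 0 then card J_loc - 1 else if i = 1 then e else 0) \<and>
    \<not> (var 0 dvd t 0 \<and> var 0 dvd t 1) \<and> var 0 dvd p 0 \<and> var 0 dvd p 1"
proof -
  interpret R: restr "Suc m" 1 I i1 a K b' r' c' by (rule R)
  have ins: "insert_index (1::nat) 0 = 0" "insert_index (1::nat) 1 = 2" by (simp_all add: insert_index_def numeral_2_eq_2)
  have i1': "i1 \<in> I - {i0}" using R.i0 i1 by simp
  have i1loc: "i1 \<in> I_loc" using R.i0 R.a0 by (auto simp: I_loc_def)
  define y0 where "y0 = r i1"
  have y0: "y0 \<in> J_loc" unfolding y0_def using I_loc_iff[OF i1'] i1loc by simp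
  have by0: "b y0 j = 0" if "j < m" "j \<noteq> 0" for j
    using ab[OF i1', of j] c0[OF i1'] R.a0[of "Suc j"] that by (simp add: y0_def)
  obtain \<theta> u where \<theta>: "\<And>j. \<theta> j \<in> poly_ring 3" "\<And>j. homogeneous (card J_loc - 1) (\<theta> j)"
    and \<theta>t: "\<And>h. h \<in> I_loc \<Longrightarrow> tang 3 (a h) 1 \<theta>"
    and \<theta>1: "rho 0 (\<theta> 1) = 0" and u: "u \<noteq> 0" "rho 0 (\<theta> 2) = const u * defpoly 2 (J_loc - {y0}) b (\<lambda>_. 1)"
    using local_lift[OF add m y0 by0] by auto
  let ?e = "\<Sum>w\<in>J_loc. card (fib w) - 1"
  obtain \<eta> u' where \<eta>: "\<And>j. \<eta> j \<in> poly_ring 3" "\<And>j. homogeneous ?e (\<eta> j)"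
    and \<eta>t: "\<And>h. h \<in> I_loc - {i0} \<Longrightarrow> tang 3 (a h) 1 \<eta>"
    and u': "u' \<noteq> 0" "rho 0 (\<eta> 0) = const u' * defpoly 2 J_loc b (\<lambda>w. card (fib w) - 1)"
    using local_transversal[OF add m] by auto
  have finJl: "finite J_loc" using finJ loc_sub(2) by (rule finite_subset[rotated])
  have finI': "finite I_loc" using finI loc_sub(1) by (rule finite_subset[rotated])
  have r: "rank2 m J_loc b" using m by (rule rank2_loc)
  have npl: "nonprop m J_loc b" using r by (simp add: rank2_def)
  have lift3: "tang (Suc m) (a h) 1 v \<longleftrightarrow> tang 3 (a h) 1 v" if "h \<in> I_loc" for h v
    using loc_app[OF m that] loc_lform[OF m that] by (simp add: tang_def)
  \<comment> \<open>The multiple g of the Euler derivation takes the same value as v on the coordinate of i1.\<close>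
  have kill: "\<exists>g. v 1 = var 1 * g \<and> (\<forall>j<3. g * var j \<in> poly_ring 3) \<and> g \<in> poly_ring 3 \<and> (\<forall>j. homogeneous k (g * var j))"
    if v: "\<And>j. v j \<in> poly_ring 3" "\<And>j. homogeneous k (v j)" "tang 3 (a i1) 1 v" for v :: "nat \<Rightarrow> 'k mpoly" and k
  proof -
    have "var 1 dvd v 1" using v(3) R.tang_i0[of 1 v] lift3[OF i1loc] by simp
    then obtain g where g: "g \<in> poly_ring 3" "v 1 = var 1 * g" using dvd_in_poly_ring[of "var 1" "v 1" 3] v(1) by auto
    have "homogeneous k (g * var j)" for j
    proof (cases "g = 0")
      case False
      then have *: "1 \<le> k" "homogeneous (k - 1) g"
        using homogeneous_factor[of k "var 1" g 1] v(2)[of 1] g by simp_all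
      have "homogeneous (k - 1 + 1) (g * var j)" by (intro homogeneous_mult *(2) homogeneous_base)
      then show ?thesis using *(1) by simp
    qed simp
    then show ?thesis using g by auto
  qed
  obtain g where g: "\<theta> 1 = var 1 * g" "g \<in> poly_ring 3" "\<And>j. homogeneous (card J_loc - 1) (g * var j)"
    using kill[OF \<theta> \<theta>t[OF i1loc]] by blast
  have i1loc': "i1 \<in> I_loc - {i0}" using i1loc i1 by simp
  obtain g' where g': "\<eta> 1 = var 1 * g'" "g' \<in> poly_ring 3" "\<And>j. homogeneous ?e (g' * var j)"
    using kill[OF \<eta> \<eta>t[OF i1loc']] by blast
  define v where "v = (\<lambda>j. \<theta> j - g * var j)"
  define w where "w = (\<lambda>j. \<eta> j - g' * var j)"
  have v1: "v 1 = 0" and w1: "w 1 = 0" using g(1) g'(1) by (simp_all add: v_def w_def mult.commute)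
  have vt: "tang (Suc m) (a h) 1 v" if "h \<in> I_loc" for h
    unfolding lift3[OF that] v_def by (intro tang_diff tang_mult tang_var \<theta>t that)
  have wt: "tang (Suc m) (a h) 1 w" if "h \<in> I_loc - {i0}" for h
    using that \<eta>t[OF that] unfolding w_def by (subst lift3) (auto intro!: tang_diff tang_mult tang_var[unfolded One_nat_def])
  have vr: "v j \<in> poly_ring 3" "w j \<in> poly_ring 3" if "j < 3" for j
    using that \<theta>(1) \<eta>(1) g(2) g'(2) by (auto simp: v_def w_def)
  have vh: "homogeneous (card J_loc - 1) (v j)" "homogeneous ?e (w j)" for j
    unfolding v_def w_def by (intro homogeneous_diff \<theta>(2) \<eta>(2) g(3) g'(3))+
  define D where "D = v 0 * w 2 - v 2 * w 0"
  let ?S = "I_loc - {i0} - {i1}"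
  have npS: "nonprop (Suc m) ?S a" by (rule nonprop_subset[OF npI]) (use loc_sub in auto)
  have "defpoly (Suc m) ?S a (\<lambda>_. 1) dvd D"
  proof (rule nonprop_defpoly_dvd[OF npS])
    fix h assume h: "h \<in> ?S"
    then have hl: "h \<in> I_loc" "h \<in> I_loc - {i0}" by auto
    have ex: "app (Suc m) (a h) x = const (a h 0) * x 0 + const (a h 2) * x 2" if "x 1 = 0" for x
      unfolding loc_app[OF m hl(1)] unfolding app_def using that by (simp add: eval_nat_numeral)
    let ?L = "lform (Suc m) (a h)"
    have dv: "?L dvd const (a h 0) * v 0 + const (a h 2) * v 2" using vt[OF hl(1)] ex[of v] v1 by (simp add: tang_def)
    have dw: "?L dvd const (a h 0) * w 0 + const (a h 2) * w 2" using wt[OF hl(2)] ex[of w] w1 by (simp add: tang_def)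
    have "const (a h 0) * D = (const (a h 0) * v 0 + const (a h 2) * v 2) * w 2 - v 2 * (const (a h 0) * w 0 + const (a h 2) * w 2)"
      by (simp add: D_def algebra_simps)
    then have D0: "?L dvd const (a h 0) * D" using dv dw by (metis dvd_diff dvd_mult dvd_mult2)
    have "const (a h 2) * D = v 0 * (const (a h 0) * w 0 + const (a h 2) * w 2) - (const (a h 0) * v 0 + const (a h 2) * v 2) * w 0"
      by (simp add: D_def algebra_simps)
    then have D2: "?L dvd const (a h 2) * D" using dv dw by (metis dvd_diff dvd_mult dvd_mult2)
    have "a h 0 \<noteq> 0 \<or> a h 2 \<noteq> 0"
    proof (rule ccontr)
      assume neg: "\<not> ?thesis"
      have "a h j = (a h 1 / a i1 1) * a i1 j" if "j < Suc m" for j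
      proof -
        consider "j = 1" | "j = 0 \<or> j = 2" | "3 \<le> j" by linarith
        then show ?thesis
        proof cases
          case 1 then show ?thesis using R.ak by simp
        next
          case 2 then show ?thesis using neg R.a0[of j] that by auto
        next
          case 3 then show ?thesis using hl(1) R.a0[of j] that by (auto simp: I_loc_def)
        qed
      qed
      then have "i1 = h" using npI R.i0 hl(1) loc_sub(1) unfolding nonprop_def by blast
      then show False using h by simp
    qed
    then show "?L ^ 1 dvd D"
    proof
      assume "a h 0 \<noteq> 0" then show ?thesis using D0[unfolded const_unit2[OF \<open>a h 0 \<noteq> 0\<close>]] by simp
    next
      assume "a h 2 \<noteq> 0" then show ?thesis using D2[unfolded const_unit2[OF \<open>a h 2 \<noteq> 0\<close>]] by simp
    qed
  qed
  have rg: "rho 0 g = 0"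
  proof -
    have "var 0 * rho 0 g = rho 0 (\<theta> 1)" unfolding g(1) using rho_0_var_Suc[of 0, where 'a = 'k] by simp
    then show ?thesis using \<theta>1 by simp
  qed
  have Qn: "defpoly m T b e' = defpoly 2 T b e'" if "T \<subseteq> J_loc" for T e' by (rule defpoly_loc_smaller[OF m that])
  have rv0: "rho 0 (v 0) = 0"
  proof -
    have "var 0 dvd \<theta> 0" using \<theta>t[OF loc_sub(3)] tang_i0[of 1 \<theta>] lift3[OF loc_sub(3)] by simp
    then show ?thesis by (simp add: v_def var_dvd_iff)
  qed
  have rv2: "rho 0 (v 2) = rho 0 (\<theta> 2)" by (simp add: v_def rg)
  have rv2': "rho 0 (v 2) \<noteq> 0"
    unfolding rv2 u(2) using Qn[of "J_loc - {y0}" "\<lambda>_. 1"] defpoly_nonzero[OF nonprop_subset[OF npl], of "J_loc - {y0}" "\<lambda>_. 1"] u(1) by auto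
  have rw0: "rho 0 (w 0) \<noteq> 0"
  proof -
    have "rho 0 (w 0) = rho 0 (\<eta> 0)" by (simp add: w_def)
    then show ?thesis unfolding u'(2) Qn[OF subset_refl, symmetric] using u'(1) defpoly_nonzero[OF npl] by simp
  qed
  have "rho 0 D = - (rho 0 (v 2) * rho 0 (w 0))" by (simp add: D_def rv0)
  then have "D \<noteq> 0" using rv2' rw0 by auto
  have sumfib: "(\<Sum>w\<in>J_loc. card (fib w)) = card (I_loc - {i0})"
  proof -
    have "(\<Sum>w\<in>J_loc. card (fib w)) = (\<Sum>w\<in>J_loc. card {h \<in> I_loc - {i0}. r h = w})" by (rule sum.cong) (auto simp: fib_loc)
    also have "\<dots> = card (I_loc - {i0})" by (rule sum_fib) (use loc_sub r_loc in auto)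
    finally show ?thesis .
  qed
  have "(\<Sum>w\<in>J_loc. card (fib w)) = (\<Sum>w\<in>J_loc. (card (fib w) - 1) + 1)"
    by (rule sum.cong) (use card_fib loc_sub(2) in force)+
  then have se: "?e + card J_loc = card (I_loc - {i0})" unfolding sumfib sum.distrib by simp
  have cJ: "0 < card J_loc" using y0 finJl by (auto simp: card_gt_0_iff)
  have cS: "card (I_loc - {i0}) = Suc (card ?S)" using card_Suc_Diff1[OF _ i1loc'] finI' by simp
  have cI: "card I_loc = Suc (card (I_loc - {i0}))" using card_Suc_Diff1[OF finI' loc_sub(3)] by simp
  have "homogeneous (card J_loc - 1 + ?e) D" unfolding D_def by (intro homogeneous_diff homogeneous_mult vh)
  moreover have "card J_loc - 1 + ?e = (\<Sum>h\<in>?S. 1)" using se cJ cS by simp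
  ultimately obtain cD where cD: "cD \<noteq> 0" "D = const cD * defpoly (Suc m) ?S a (\<lambda>_. 1)"
    using defpoly_multiple_const[OF npS \<open>_ dvd D\<close> \<open>D \<noteq> 0\<close>] by metis
  obtain uR where "uR \<noteq> 0" "rho 1 (\<Prod>h\<in>?S. lform (Suc m) (a h)) = const uR * defpoly m K b' (\<lambda>w. card {h \<in> ?S. r' h = w})"
    using R.rho_prod_forms[of ?S K] R.rJ loc_sub(1) by auto
  moreover have "defpoly m K b' (\<lambda>w. card {h \<in> ?S. r' h = w}) \<noteq> 0" using defpoly_nonzero R.npJ by fastforce
  ultimately have "rho 1 D \<noteq> 0" unfolding cD(2) using cD(1) by (simp add: defpoly_def)
  \<comment> \<open>Restricted to i1, the lift t is tangent with Ziegler's multiplicity, and the transversal q is so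
    except for one factor at the trace y1 of i0. The pair consists of t and of q times this factor.\<close>
  have Ksub: "K_loc \<subseteq> K" by (auto simp: K)
  have finK: "finite K_loc" using R.finJ Ksub by (rule finite_subset[rotated])
  have npK: "nonprop m K_loc b'" using nonprop_subset[OF R.npJ Ksub] by simp
  have rK: "rank2 m K_loc b'" using m npK by (auto simp: rank2_def K)
  have K_iff: "h \<in> I_loc \<longleftrightarrow> r' h \<in> K_loc" if h: "h \<in> I - {i1}" for h
  proof -
    have 1: "(\<forall>j<Suc m. 3 \<le> j \<longrightarrow> a h j = 0) \<longleftrightarrow> (\<forall>j<m. 2 \<le> j \<longrightarrow> a h (insert_index 1 j) = 0)"
    proof
      assume *: "\<forall>j<m. 2 \<le> j \<longrightarrow> a h (insert_index 1 j) = 0"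
      show "\<forall>j<Suc m. 3 \<le> j \<longrightarrow> a h j = 0"
      proof (intro allI impI)
        fix j assume "j < Suc m" "3 \<le> j"
        then show "a h j = 0" using *[rule_format, of "j - 1"] by (simp add: insert_index_def)
      qed
    qed (simp add: insert_index_def)
    have 2: "a h (insert_index 1 j) = 0 \<longleftrightarrow> b' (r' h) j = 0" if "j < m" for j
      using R.ab[OF h, of j] R.c0[OF h] that by simp
    have 3: "(\<forall>j<m. 2 \<le> j \<longrightarrow> a h (insert_index 1 j) = 0) \<longleftrightarrow> (\<forall>j<m. 2 \<le> j \<longrightarrow> b' (r' h) j = 0)"
      by (intro all_cong imp_cong refl 2)
    have "h \<in> I" "r' h \<in> K" using h R.rJ by auto
    then have "h \<in> I_loc \<longleftrightarrow> (\<forall>j<Suc m. 3 \<le> j \<longrightarrow> a h j = 0)" "r' h \<in> K_loc \<longleftrightarrow> (\<forall>j<m. 2 \<le> j \<longrightarrow> b' (r' h) j = 0)"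
      by (simp_all add: I_loc_def K)
    then show ?thesis unfolding 1 3 by (rule trans[OF _ sym])
  qed
  define y1 where "y1 = r' i0"
  have i0': "i0 \<in> I - {i1}" using i0 i1 by simp
  have y1: "y1 \<in> K_loc" unfolding y1_def using K_iff[OF i0'] loc_sub(3) by simp
  have by1: "b' y1 j = 0" if "j < m" "j \<noteq> 0" for j
    using R.ab[OF i0', of j] R.c0[OF i0'] a0[of "insert_index 1 j"] that by (simp add: y1_def insert_index_def split: if_splits)
  have ly1: "lform m (b' y1) = const (b' y1 0) * var 0" by (rule lform_eq_var) (use m by1 in auto)
  have b1: "b' y1 0 \<noteq> 0" using R.ab[OF i0', of 0] ak m ins by (auto simp: y1_def)
  define t where "t = (\<lambda>j. rho 1 (v (insert_index 1 j)))"
  define q where "q = (\<lambda>j. rho 1 (w (insert_index 1 j)))"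
  define p where "p = (\<lambda>j. var 0 * q j)"
  have fibK: "{h \<in> I - {i1}. r' h = x} = {h \<in> I_loc - {i1}. r' h = x}" if "x \<in> K_loc" for x
    using K_iff loc_sub(1) that by auto
  have tt: "tang m (b' x) (card {h \<in> I - {i1}. r' h = x}) t" if x: "x \<in> K_loc" for x
  proof -
    have "tang m (b' x) (card {h \<in> I_loc - {i1}. r' h = x}) t"
      using R.tang_restrict[of v "I_loc - {i1}" x] v1 loc_sub(1) vt unfolding t_def by auto
    then show ?thesis unfolding fibK[OF x] .
  qed
  have qt: "tang m (b' x) (card {h \<in> ?S. r' h = x}) q" for x
    using R.tang_restrict[of w ?S x] w1 loc_sub(1) wt unfolding q_def by auto
  have pt: "tang m (b' x) (card {h \<in> I - {i1}. r' h = x}) p" if x: "x \<in> K_loc" for x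
  proof (cases "x = y1")
    case False
    then have "{h \<in> I_loc - {i1}. r' h = x} = {h \<in> ?S. r' h = x}" by (auto simp: y1_def)
    then show ?thesis using qt[of x] unfolding fibK[OF x] p_def by (auto intro: tang_mult)
  next
    case True
    have "{h \<in> I_loc - {i1}. r' h = x} = insert i0 {h \<in> ?S. r' h = x}" using True loc_sub(3) i1 by (auto simp: y1_def)
    then have ck: "card {h \<in> I - {i1}. r' h = x} = Suc (card {h \<in> ?S. r' h = x})" unfolding fibK[OF x] using finI' by simp
    have "lform m (b' x) * lform m (b' x) ^ card {h \<in> ?S. r' h = x} dvd (const (b' y1 0) * var 0) * app m (b' x) q"
      using qt[of x] unfolding tang_def by (intro mult_dvd_mono) (simp_all add: True ly1)
    then have "lform m (b' x) ^ Suc (card {h \<in> ?S. r' h = x}) dvd const (b' y1 0) * (var 0 * app m (b' x) q)"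
      by (simp only: power_Suc mult.assoc)
    then show ?thesis unfolding tang_def ck p_def app_mult by (rule const_unit2[OF b1, THEN iffD1])
  qed
  have t_ring: "t j \<in> poly_ring 2" "q j \<in> poly_ring 2" if "j < 2" for j
    using that unfolding t_def q_def by (auto intro!: rho_3 vr simp: insert_index_def)
  have sumK: "(\<Sum>x\<in>K_loc. card {h \<in> I - {i1}. r' h = x}) = card (I_loc - {i1})"
  proof -
    have "(\<Sum>x\<in>K_loc. card {h \<in> I - {i1}. r' h = x}) = (\<Sum>x\<in>K_loc. card {h \<in> I_loc - {i1}. r' h = x})"
      by (rule sum.cong[OF refl]) (simp only: fibK)
    also have "\<dots> = card (I_loc - {i1})" by (rule R.sum_fib) (use loc_sub K_iff Ksub in auto)
    finally show ?thesis .
  qed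
  have "saito m K_loc b' (\<lambda>v. card {h \<in> I - {i1}. r' h = v})
      (pair_matrix t p) (\<lambda>i. if i = 0 then card J_loc - 1 else if i = 1 then 1 + ?e else 0)"
  proof (rule pair_saito[OF rK])
    fix j :: nat assume j: "j < 2"
    show "t j \<in> poly_ring 2 \<and> p j \<in> poly_ring 2 \<and> homogeneous (card J_loc - 1) (t j) \<and> homogeneous (1 + ?e) (p j)"
      unfolding p_def using t_ring[OF j] vh
      by (auto simp: t_def q_def intro!: homogeneous_rho homogeneous_mult[of 1 _ ?e, simplified])
  next
    have "t 0 * p 1 - t 1 * p 0 = var 0 * rho 1 D" by (simp add: t_def p_def q_def D_def ins algebra_simps del: One_nat_def)
    then show "t 0 * p 1 - t 1 * p 0 \<noteq> 0" using \<open>rho 1 D \<noteq> 0\<close> by simp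
  next
    have "card (I_loc - {i1}) = card (I_loc - {i0})" using i1loc loc_sub(3) finI' by simp
    then show "card J_loc - 1 + (1 + ?e) = (\<Sum>h\<in>K_loc. card {ha \<in> I - {i1}. r' ha = h})"
      using sumK se cJ by simp
  qed (use tt pt in auto)
  moreover have "\<not> var 0 dvd t 1"
  proof
    assume "var 0 dvd t 1"
    then have "rho 0 (rho 0 (v 2)) = 0" unfolding var_dvd_iff by (simp add: t_def ins rho_0_rho_1 del: One_nat_def)
    then have "var 0 dvd const u * defpoly 2 (J_loc - {y0}) b (\<lambda>_. 1)" unfolding var_dvd_iff rv2 u(2) .
    then have d: "var 0 dvd defpoly m (J_loc - {y0}) b (\<lambda>_. 1)" unfolding Qn[of "J_loc - {y0}", OF Diff_subset]
      by (rule const_unit2[OF u(1), THEN iffD1])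
    have ly: "lform m (b y0) = const (b y0 0) * var 0" "b y0 0 \<noteq> 0" using first_form[of y0] y0 loc_sub(2) by0 m by auto
    have "lform m (b y0) dvd defpoly m (J_loc - {y0}) b (\<lambda>_. 1)" unfolding ly(1) const_unit[OF ly(2)] by (rule d)
    then show False using nonprop_dvd_defpoly[OF npl, of "J_loc - {y0}" y0 "\<lambda>_. 1"] y0 by blast
  qed
  ultimately show ?thesis unfolding p_def by (intro exI[of _ t] exI[of _ "\<lambda>j. var 0 * q j"] exI[of _ "1 + ?e"]) simp
qed

end

section \<open>Arrangements in coordinates\<close>

definition ziegler_mult :: "'v set set \<Rightarrow> 'v set \<Rightarrow> 'v set \<Rightarrow> nat" where
  "ziegler_mult A H0 Y = card {H \<in> A - {H0}. H0 \<inter> H = Y}"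

context arrangement_space
begin

definition coord :: "'v list \<Rightarrow> 'v \<Rightarrow> nat \<Rightarrow> 'k" where
  "coord bs v i = representation (set bs) v (bs ! i)"

definition form :: "'v set \<Rightarrow> 'v set \<Rightarrow> 'v \<Rightarrow> 'k" where
  "form X H = (SOME \<alpha>. defining_form X H \<alpha>)"

definition coef :: "'v set \<Rightarrow> 'v list \<Rightarrow> 'v set \<Rightarrow> nat \<Rightarrow> 'k" where
  "coef X bs H i = form X H (bs ! i)"

lemma form: "hyperplane X H \<Longrightarrow> defining_form X H (form X H)"
  unfolding form_def hyperplane_def by (rule someI_ex[of "defining_form X H"])

lemma basis_subspace: "ordered_basis X bs \<Longrightarrow> subspace X"
  by (auto simp: ordered_basis_def)

lemma basis_in: "ordered_basis X bs \<Longrightarrow> i < length bs \<Longrightarrow> bs ! i \<in> X"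
  unfolding ordered_basis_def by (metis nth_mem span_base)

lemma dual_add: "\<alpha> \<in> dual_space X \<Longrightarrow> u \<in> X \<Longrightarrow> v \<in> X \<Longrightarrow> \<alpha> (u + v) = \<alpha> u + \<alpha> v"
  and dual_scale: "\<alpha> \<in> dual_space X \<Longrightarrow> v \<in> X \<Longrightarrow> \<alpha> (scale c v) = c * \<alpha> v"
  by (simp_all add: dual_space_def)

lemma dual_subset: "Y \<subseteq> X \<Longrightarrow> \<alpha> \<in> dual_space X \<Longrightarrow> \<alpha> \<in> dual_space Y"
  unfolding dual_space_def mem_Collect_eq by (meson subsetD)

lemma dual_diff: "subspace X \<Longrightarrow> \<alpha> \<in> dual_space X \<Longrightarrow> u \<in> X \<Longrightarrow> v \<in> X \<Longrightarrow> \<alpha> (u - v) = \<alpha> u - \<alpha> v"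
  using dual_add[of \<alpha> X "u - v" v] by (simp add: subspace_diff)

lemma dual_zero: "subspace X \<Longrightarrow> \<alpha> \<in> dual_space X \<Longrightarrow> \<alpha> 0 = 0"
  using dual_scale[of \<alpha> X 0 0] by (simp add: subspace_0)

lemma dual_sum: "subspace X \<Longrightarrow> \<alpha> \<in> dual_space X \<Longrightarrow> (\<And>i. i \<in> S \<Longrightarrow> F i \<in> X) \<Longrightarrow> \<alpha> (\<Sum>i\<in>S. F i) = (\<Sum>i\<in>S. \<alpha> (F i))"
  by (induction S rule: infinite_finite_induct) (auto simp: dual_zero dual_add subspace_sum)

lemma basis_expand:
  assumes b: "ordered_basis X bs" and v: "v \<in> X"
  shows "v = (\<Sum>i<length bs. scale (coord bs v i) (bs ! i))"
proof -
  have d: "distinct bs" and ind: "independent (set bs)" and sp: "span (set bs) = X" using b by (auto simp: ordered_basis_def)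
  have "v = (\<Sum>x\<in>set bs. scale (representation (set bs) v x) x)"
    using sum_representation_eq[OF ind, of v "set bs"] v sp by simp
  also have "\<dots> = (\<Sum>i<length bs. scale (representation (set bs) v (bs ! i)) (bs ! i))"
    by (rule sum.reindex_bij_betw[OF bij_betw_nth[OF d refl refl], symmetric])
  finally show ?thesis by (simp add: coord_def)
qed

lemma dual_expand:
  assumes b: "ordered_basis X bs" and a: "\<alpha> \<in> dual_space X" and v: "v \<in> X"
  shows "\<alpha> v = (\<Sum>i<length bs. coord bs v i * \<alpha> (bs ! i))"
proof -
  have X: "subspace X" using b by (rule basis_subspace)
  have "\<alpha> v = \<alpha> (\<Sum>i<length bs. scale (coord bs v i) (bs ! i))" using basis_expand[OF b v] by simp
  also have "\<dots> = (\<Sum>i<length bs. \<alpha> (scale (coord bs v i) (bs ! i)))"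
    by (rule dual_sum[OF X a]) (auto intro!: subspace_scale[OF X] basis_in[OF b])
  also have "\<dots> = (\<Sum>i<length bs. coord bs v i * \<alpha> (bs ! i))"
    by (rule sum.cong) (auto simp: dual_scale[OF a] basis_in[OF b])
  finally show ?thesis .
qed

lemma coord_dual: "ordered_basis X bs \<Longrightarrow> (\<lambda>v. coord bs v i) \<in> dual_space X"
  unfolding dual_space_def ordered_basis_def coord_def
  by (auto simp: representation_add representation_scale)

lemma coord_basis: "ordered_basis X bs \<Longrightarrow> i < length bs \<Longrightarrow> j < length bs \<Longrightarrow> coord bs (bs ! j) i = (if j = i then 1 else 0)"
  unfolding ordered_basis_def coord_def by (auto simp: representation_basis nth_eq_iff_index_eq)

lemma basis_length: "ordered_basis X bs \<Longrightarrow> length bs = dim X"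
  unfolding ordered_basis_def by (metis dim_span_eq_card_independent distinct_card)

lemma defining_formD:
  assumes "defining_form X H \<alpha>"
  shows "\<alpha> \<in> dual_space X" "H \<subseteq> X" "\<And>v. v \<in> X \<Longrightarrow> v \<in> H \<longleftrightarrow> \<alpha> v = 0" "\<exists>v\<in>X. \<alpha> v \<noteq> 0"
  using assms by (auto simp: defining_form_def)

lemma kernel_subset_eq:
  assumes X: "subspace X" and \<alpha>: "defining_form X H \<alpha>" and \<beta>: "defining_form X H' \<beta>" and sub: "H \<subseteq> H'"
  shows "H = H' \<and> (\<exists>c. c \<noteq> 0 \<and> (\<forall>v\<in>X. \<beta> v = c * \<alpha> v))"
proof -
  note a = defining_formD[OF \<alpha>] and b = defining_formD[OF \<beta>]
  obtain v where v: "v \<in> X" "\<beta> v \<noteq> 0" using b(4) by blast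
  then have av: "\<alpha> v \<noteq> 0" using sub a(3) b(3) by blast
  have eq: "\<beta> u = (\<beta> v / \<alpha> v) * \<alpha> u" if u: "u \<in> X" for u
  proof -
    let ?w = "u - scale (\<alpha> u / \<alpha> v) v"
    have sv: "scale (\<alpha> u / \<alpha> v) v \<in> X" using X v(1) by (rule subspace_scale)
    have w: "?w \<in> X" using subspace_diff[OF X u sv] .
    have "\<alpha> ?w = 0" using av by (simp add: dual_diff[OF X a(1) u sv] dual_scale[OF a(1) v(1)])
    then have "\<beta> ?w = 0" using sub a(3)[OF w] b(3)[OF w] by blast
    then show ?thesis by (simp add: dual_diff[OF X b(1) u sv] dual_scale[OF b(1) v(1)])
  qed
  have c: "\<beta> v / \<alpha> v \<noteq> 0" using v av by simp
  have "u \<in> H \<longleftrightarrow> u \<in> H'" for u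
    using a(2) b(2) a(3)[of u] b(3)[of u] eq[of u] c by (cases "u \<in> X") auto
  then show ?thesis using eq c by blast
qed

lemma form_unique:
  assumes "subspace X" "defining_form X H \<alpha>" "defining_form X H \<beta>"
  obtains c where "c \<noteq> 0" "\<And>v. v \<in> X \<Longrightarrow> \<beta> v = c * \<alpha> v"
  using kernel_subset_eq[OF assms subset_refl] by blast

lemma arrangementD:
  assumes "arrangement X A"
  shows "finite A" "subspace X" "\<And>H. H \<in> A \<Longrightarrow> hyperplane X H" "\<And>H. H \<in> A \<Longrightarrow> defining_form X H (form X H)"
    "\<And>H. H \<in> A \<Longrightarrow> H \<subseteq> X"
  using assms unfolding arrangement_def by (auto intro: form dest: defining_formD(2)[OF form])

lemma arrangement_subset: "arrangement X A \<Longrightarrow> B \<subseteq> A \<Longrightarrow> arrangement X B"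
  unfolding arrangement_def using finite_subset by blast

lemma coef_nonprop:
  assumes A: "arrangement X A" and b: "ordered_basis X bs"
  shows "nonprop (length bs) A (coef X bs)"
  unfolding nonprop_def
proof (intro conjI ballI impI)
  note a = arrangementD[OF A]
  show "finite A" by (rule a)
  show "\<exists>k<length bs. coef X bs H k \<noteq> 0" if H: "H \<in> A" for H
  proof (rule ccontr)
    assume "\<not> ?thesis"
    then have z: "form X H (bs ! i) = 0" if "i < length bs" for i using that by (auto simp: coef_def)
    have "form X H v = 0" if "v \<in> X" for v
      using dual_expand[OF b defining_formD(1)[OF a(4)[OF H]] that] z by simp
    then show False using defining_formD(4)[OF a(4)[OF H]] by blast
  qed
  show "H = H'" if H: "H \<in> A" "H' \<in> A" and ex: "\<exists>c. \<forall>k<length bs. coef X bs H' k = c * coef X bs H k" for H H'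
  proof -
    obtain c where c: "\<And>k. k < length bs \<Longrightarrow> form X H' (bs ! k) = c * form X H (bs ! k)" using ex by (auto simp: coef_def)
    have eq: "form X H' v = c * form X H v" if "v \<in> X" for v
      using dual_expand[OF b defining_formD(1)[OF a(4)[OF H(1)]] that] dual_expand[OF b defining_formD(1)[OF a(4)[OF H(2)]] that] c
      by (simp add: sum_distrib_left mult.left_commute)
    have "H \<subseteq> H'"
      using eq a(5)[OF H(1)] defining_formD(3)[OF a(4)[OF H(1)]] defining_formD(3)[OF a(4)[OF H(2)]] by auto
    then show ?thesis using kernel_subset_eq[OF a(2) a(4)[OF H(1)] a(4)[OF H(2)]] by blast
  qed
qed

lemma form_poly_lform: "form_poly bs \<alpha> = lform (length bs) (\<lambda>i. \<alpha> (bs ! i))"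
  by (simp add: form_poly_def lform_def)

lemma D_mod_eq:
  assumes A: "arrangement X A" and b: "ordered_basis X bs"
  shows "D_mod X bs A \<mu> = log_module (length bs) A (coef X bs) \<mu>"
proof -
  let ?n = "length bs"
  note a = arrangementD[OF A]
  have key: "(\<exists>g\<in>poly_ring ?n. \<theta> (form_poly bs \<alpha>) = form_poly bs \<alpha> ^ \<mu> H * g) \<longleftrightarrow> tang ?n (coef X bs H) (\<mu> H) (\<lambda>i. \<theta> (var i))"
    if th: "\<theta> \<in> Der ?n" and H: "H \<in> A" and \<alpha>: "defining_form X H \<alpha>" for \<theta> H \<alpha>
  proof -
    obtain c where c: "c \<noteq> 0" "\<And>v. v \<in> X \<Longrightarrow> \<alpha> v = c * form X H v" using form_unique[OF a(2) a(4)[OF H] \<alpha>] by blast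
    have "\<And>i. i < ?n \<Longrightarrow> \<alpha> (bs ! i) = c * coef X bs H i" using c(2) basis_in[OF b] by (simp add: coef_def)
    then have "tang ?n (\<lambda>i. \<alpha> (bs ! i)) (\<mu> H) (\<lambda>i. \<theta> (var i)) = tang ?n (\<lambda>i. c * coef X bs H i) (\<mu> H) (\<lambda>i. \<theta> (var i))"
      by (intro tang_cong) auto
    then have t: "tang ?n (\<lambda>i. \<alpha> (bs ! i)) (\<mu> H) (\<lambda>i. \<theta> (var i)) = tang ?n (coef X bs H) (\<mu> H) (\<lambda>i. \<theta> (var i))"
      using tang_scale[OF c(1)] by blast
    have e: "\<theta> (form_poly bs \<alpha>) = app ?n (\<lambda>i. \<alpha> (bs ! i)) (\<lambda>i. \<theta> (var i))" unfolding form_poly_lform by (rule Der_lform[OF th])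
    have "\<theta> (form_poly bs \<alpha>) \<in> poly_ring ?n" using th by (simp add: form_poly_lform Der_simps(1))
    then have "(\<exists>g\<in>poly_ring ?n. \<theta> (form_poly bs \<alpha>) = form_poly bs \<alpha> ^ \<mu> H * g) \<longleftrightarrow> form_poly bs \<alpha> ^ \<mu> H dvd \<theta> (form_poly bs \<alpha>)"
      using dvd_in_poly_ring[of "form_poly bs \<alpha> ^ \<mu> H" "\<theta> (form_poly bs \<alpha>)" ?n] by (auto simp: form_poly_lform)
    then show ?thesis using t e by (simp add: tang_def form_poly_lform)
  qed
  have "\<theta> \<in> D_mod X bs A \<mu> \<longleftrightarrow> \<theta> \<in> log_module ?n A (coef X bs) \<mu>" for \<theta>
  proof (cases "\<theta> \<in> Der ?n")
    case True
    then have e: "\<theta> = dvec ?n (\<lambda>i. \<theta> (var i))" and pv: "polyvec ?n (\<lambda>i. \<theta> (var i))"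
      by (rule Der_eq_dvec) (use True in \<open>auto simp: polyvec_def Der_simps(1)\<close>)
    have "\<theta> \<in> D_mod X bs A \<mu> \<longleftrightarrow> (\<forall>H\<in>A. tang ?n (coef X bs H) (\<mu> H) (\<lambda>i. \<theta> (var i)))"
      unfolding D_mod_def using True key[OF True] a(4) by blast
    also have "\<dots> \<longleftrightarrow> dvec ?n (\<lambda>i. \<theta> (var i)) \<in> log_module ?n A (coef X bs) \<mu>" using dvec_in_log_module[OF pv] by blast
    finally show ?thesis using e by simp
  next
    case False
    then show ?thesis by (auto simp: D_mod_def log_module_def dvec_in_Der)
  qed
  then show ?thesis by blast
qed

text \<open>The coordinates in the definition of the exponents are existentially quantified; a
  change of coordinates shows that any others do as well.\<close>

theorem has_exponents_iff:
  assumes A: "arrangement X A" and b: "ordered_basis X bs"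
  shows "has_exponents X A \<mu> E \<longleftrightarrow> (\<exists>M d. saito (length bs) A (coef X bs) \<mu> M d \<and> E = degs (length bs) d)"
proof
  assume "has_exponents X A \<mu> E"
  then obtain bs' \<theta>s ds where b': "ordered_basis X bs'" and h: "homogeneous_basis (length bs') (D_mod X bs' A \<mu>) \<theta>s ds" and E: "E = mset ds"
    unfolding has_exponents_def by blast
  have n: "length bs' = length bs" using basis_length[OF b] basis_length[OF b'] by simp
  let ?n = "length bs"
  define M where "M = (\<lambda>i j. (\<theta>s ! i) (var j))"
  have s: "length ds = ?n" "saito ?n A (coef X bs') \<mu> M (\<lambda>i. ds ! i)"
    using basis_saito[OF coef_nonprop[OF A b'], of \<mu> \<theta>s ds] h D_mod_eq[OF A b'] n by (simp_all add: M_def)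
  have "\<exists>N. saito ?n A (coef X bs) \<mu> N (\<lambda>i. ds ! i)"
  proof (rule saito_change_coordinates[OF s(2), where P = "\<lambda>i j. coord bs (bs' ! i) j" and R = "\<lambda>j i. coord bs' (bs ! j) i"])
    fix H i assume "H \<in> A" "i < ?n"
    then show "coef X bs' H i = (\<Sum>j<?n. coord bs (bs' ! i) j * coef X bs H j)"
      unfolding coef_def by (intro dual_expand[OF b] defining_formD(1)[OF arrangementD(4)[OF A]] basis_in[OF b']) (simp_all add: n)
  next
    fix H i assume "H \<in> A" "i < ?n"
    then show "coef X bs H i = (\<Sum>j<?n. coord bs' (bs ! i) j * coef X bs' H j)"
      unfolding coef_def n[symmetric] by (intro dual_expand[OF b'] defining_formD(1)[OF arrangementD(4)[OF A]] basis_in[OF b]) (simp_all add: n)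
  next
    fix i l assume il: "i < ?n" "l < ?n"
    have "coord bs' (bs' ! i) l = (\<Sum>j<?n. coord bs (bs' ! i) j * coord bs' (bs ! j) l)"
      by (rule dual_expand[OF b coord_dual[OF b']]) (use il n basis_in[OF b'] in simp)
    then show "(\<Sum>j<?n. coord bs (bs' ! i) j * coord bs' (bs ! j) l) = (if i = l then 1 else 0)"
      using coord_basis[OF b', of l i] il n by simp
  qed
  moreover have "E = degs ?n (\<lambda>i. ds ! i)" using s(1) E by (metis degs_def map_nth)
  ultimately show "\<exists>M d. saito ?n A (coef X bs) \<mu> M d \<and> E = degs ?n d" by blast
next
  assume "\<exists>M d. saito (length bs) A (coef X bs) \<mu> M d \<and> E = degs (length bs) d"
  then obtain M d where "saito (length bs) A (coef X bs) \<mu> M d" "E = degs (length bs) d" by blast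
  then show "has_exponents X A \<mu> E"
    unfolding has_exponents_def degs_def using saito_basis[OF coef_nonprop[OF A b]] D_mod_eq[OF A b] b by metis
qed

lemma subspace_basis_exists:
  assumes "subspace W" "W \<subseteq> span B" "finite B"
  shows "\<exists>bs. ordered_basis W bs"
proof -
  obtain C where C: "C \<subseteq> W" "independent C" "W \<subseteq> span C" and "card C = dim W" by (rule basis_exists)
  have "C \<subseteq> span B" using C(1) assms(2) by (rule subset_trans)
  then have "finite C" using independent_span_bound[OF assms(3) C(2)] by simp
  from finite_distinct_list[OF this] obtain bs where bs: "set bs = C" "distinct bs" by (elim exE conjE)
  have "span C = W" by (rule equalityI[OF span_minimal[OF C(1) assms(1)] C(3)])
  then have "ordered_basis W bs" using bs C(2) unfolding ordered_basis_def by simp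
  then show ?thesis by (rule exI)
qed

lemma hyperplane_subspace:
  assumes "subspace X" "hyperplane X H" shows "subspace H"
proof -
  note f = defining_formD[OF form[OF assms(2)]]
  show ?thesis
  proof (rule subspaceI)
    show "0 \<in> H" using f(3)[OF subspace_0[OF assms(1)]] dual_zero[OF assms(1) f(1)] by simp
    fix u assume u: "u \<in> H"
    then have uX: "u \<in> X" using f(2) by blast
    show "scale c u \<in> H" for c
      using f(3)[OF subspace_scale[OF assms(1) uX, of c]] f(3)[OF uX] u dual_scale[OF f(1) uX, of c] by simp
    fix v assume v: "v \<in> H"
    then have vX: "v \<in> X" using f(2) by blast
    show "u + v \<in> H"
      using f(3)[OF subspace_add[OF assms(1) uX vX]] f(3)[OF uX] f(3)[OF vX] u v dual_add[OF f(1) uX vX] by simp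
  qed
qed

lemma hyperplane_proper:
  assumes "hyperplane X H" obtains v where "v \<in> X" "v \<notin> H"
  using defining_formD(3,4)[OF form[OF assms]] by blast

lemma extend_basis:
  assumes X: "subspace X" and H: "hyperplane X H" and b: "ordered_basis H bs" and v: "v \<in> X" "v \<notin> H"
  shows "ordered_basis X (v # bs)"
proof -
  note f = defining_formD[OF form[OF H]]
  have sp: "span (set bs) = H" and ind: "independent (set bs)" and d: "distinct bs" using b by (auto simp: ordered_basis_def)
  have "v \<notin> set bs" using v(2) sp span_base by blast
  moreover have "independent (insert v (set bs))" using ind v(2) sp by (simp add: independent_insert)
  moreover have "span (insert v (set bs)) = X"
  proof
    show "span (insert v (set bs)) \<subseteq> X" using v(1) f(2) sp span_superset by (intro span_minimal X) blast
    show "X \<subseteq> span (insert v (set bs))"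
    proof
      fix u assume u: "u \<in> X"
      let ?c = "form X H u / form X H v"
      have fv: "form X H v \<noteq> 0" using f(3)[OF v(1)] v(2) by simp
      have sv: "scale ?c v \<in> X" using X v(1) by (rule subspace_scale)
      have "form X H (u - scale ?c v) = 0" using fv by (simp add: dual_diff[OF X f(1) u sv] dual_scale[OF f(1) v(1)])
      then have "u - scale ?c v \<in> H" using f(3)[OF subspace_diff[OF X u sv]] by simp
      then have "u - scale ?c v \<in> span (insert v (set bs))" using sp span_mono[of "set bs" "insert v (set bs)"] by blast
      moreover have "scale ?c v \<in> span (insert v (set bs))" by (intro span_scale span_base) simp
      ultimately have "(u - scale ?c v) + scale ?c v \<in> span (insert v (set bs))" by (rule span_add)
      then show "u \<in> span (insert v (set bs))" by simp
    qed
  qed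
  ultimately show ?thesis using d by (simp add: ordered_basis_def)
qed

lemma arrangement_basis: "arrangement X A \<Longrightarrow> \<exists>bs. ordered_basis X bs"
  unfolding arrangement_def using subspace_basis_exists[of X] by (metis subset_refl subspace_span)

subsection \<open>Restriction\<close>

lemma localization_self:
  assumes A: "arrangement X A" and H: "H0 \<in> A" shows "localization A H0 = {H0}"
  unfolding localization_def using kernel_subset_eq[OF arrangementD(2)[OF A] arrangementD(4)[OF A H] arrangementD(4)[OF A]] H by blast

lemma restriction_eq: "arrangement X A \<Longrightarrow> H0 \<in> A \<Longrightarrow> restriction A H0 = (\<lambda>H. H0 \<inter> H) ` (A - {H0})"
  unfolding restriction_def by (auto simp: localization_self)

lemma restriction_form:
  assumes A: "arrangement X A" and H: "H0 \<in> A" "H \<in> A" "H \<noteq> H0" and \<alpha>: "defining_form X H \<alpha>"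
  shows "defining_form H0 (H0 \<inter> H) \<alpha>"
proof -
  note a = arrangementD[OF A] and f = defining_formD[OF \<alpha>]
  have "\<not> H0 \<subseteq> H" using kernel_subset_eq[OF a(2) a(4)[OF H(1)] a(4)[OF H(2)]] H(3) by blast
  then obtain v where "v \<in> H0" "v \<notin> H" by blast
  moreover have "\<alpha> \<in> dual_space H0" using a(5)[OF H(1)] f(1) by (rule dual_subset)
  moreover have "H0 \<inter> H = {v \<in> H0. \<alpha> v = 0}" using f(3) a(5)[OF H(1)] by blast
  ultimately show ?thesis unfolding defining_form_def using f(3) a(5)[OF H(1)] by blast
qed

lemma restriction_arrangement:
  assumes A: "arrangement X A" and H: "H0 \<in> A" shows "arrangement H0 (restriction A H0)"
proof -
  note a = arrangementD[OF A]
  obtain B where B: "finite B" "X = span B" using A by (auto simp: arrangement_def)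
  obtain bs where bs: "ordered_basis H0 bs"
    using subspace_basis_exists[OF hyperplane_subspace[OF a(2) a(3)[OF H]], of B] a(5)[OF H] B by blast
  then have "\<exists>B. finite B \<and> H0 = span B" unfolding ordered_basis_def by (metis List.finite_set)
  moreover have "hyperplane H0 Y" if "Y \<in> restriction A H0" for Y
    using that restriction_form[OF A H _ _ a(4)] unfolding restriction_eq[OF A H] hyperplane_def by blast
  moreover have "finite (restriction A H0)" unfolding restriction_eq[OF A H] using a(1) by simp
  ultimately show ?thesis unfolding arrangement_def by blast
qed

lemma restr_coordinates:
  assumes A: "arrangement X A" and H0: "H0 \<in> A" and b: "ordered_basis X bs" and b0: "ordered_basis H0 bs0"
    and k: "k < length bs" and len: "length bs0 = length bs - 1" and nth: "\<And>j. j < length bs - 1 \<Longrightarrow> bs0 ! j = bs ! insert_index k j"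
  shows "\<exists>c. restr (length bs) k A H0 (coef X bs) (restriction A H0) (coef H0 bs0) (\<lambda>H. H0 \<inter> H) c"
proof -
  note a = arrangementD[OF A] and rA = restriction_arrangement[OF A H0]
  have sH0: "subspace H0" using b0 by (rule basis_subspace)
  have "\<forall>H\<in>A - {H0}. \<exists>c. c \<noteq> 0 \<and> (\<forall>v\<in>H0. form X H v = c * form H0 (H0 \<inter> H) v)"
  proof
    fix H assume H: "H \<in> A - {H0}"
    then have "H0 \<inter> H \<in> restriction A H0" unfolding restriction_eq[OF A H0] by blast
    then have 1: "defining_form H0 (H0 \<inter> H) (form H0 (H0 \<inter> H))" by (rule arrangementD(4)[OF rA])
    have 2: "defining_form H0 (H0 \<inter> H) (form X H)" using H by (intro restriction_form[OF A H0 _ _ a(4)]) auto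
    show "\<exists>c. c \<noteq> 0 \<and> (\<forall>v\<in>H0. form X H v = c * form H0 (H0 \<inter> H) v)" using kernel_subset_eq[OF sH0 1 2] by blast
  qed
  from bchoice[OF this] obtain c where c: "\<And>H. H \<in> A - {H0} \<Longrightarrow> c H \<noteq> 0 \<and> (\<forall>v\<in>H0. form X H v = c H * form H0 (H0 \<inter> H) v)"
    by blast
  have "restr (length bs) k A H0 (coef X bs) (restriction A H0) (coef H0 bs0) (\<lambda>H. H0 \<inter> H) c"
  proof
    show "nonprop (length bs) A (coef X bs)" by (rule coef_nonprop[OF A b])
    show "nonprop (length bs - 1) (restriction A H0) (coef H0 bs0)" using coef_nonprop[OF rA b0] len by simp
    show "(\<lambda>H. H0 \<inter> H) ` (A - {H0}) = restriction A H0" by (rule restriction_eq[OF A H0, symmetric])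
    fix j assume j: "j < length bs" "j \<noteq> k"
    define j' where "j' = (if j < k then j else j - 1)"
    have "j = insert_index k j'" "j' < length bs - 1" using j k by (auto simp: j'_def insert_index_def)
    then have "bs ! j \<in> H0" using nth basis_in[OF b0, of j'] len by simp
    then show "coef X bs H0 j = 0" unfolding coef_def using defining_formD(3)[OF a(4)[OF H0] basis_in[OF b j(1)]] by simp
  next
    fix H j assume H: "H \<in> A - {H0}" and j: "j < length bs - 1"
    have "bs0 ! j \<in> H0" using basis_in[OF b0] j len by simp
    then show "coef X bs H (insert_index k j) = c H * coef H0 bs0 (H0 \<inter> H) j"
      unfolding coef_def nth[OF j, symmetric] using c[OF H] by simp
  qed (use k H0 c in auto)
  then show ?thesis by blast
qed

lemma restr0_coordinates:
  assumes A: "arrangement X A" and H0: "H0 \<in> A" and b: "ordered_basis X (v # bs)" and b0: "ordered_basis H0 bs"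
  shows "\<exists>c. restr0 (length bs) A H0 (coef X (v # bs)) (restriction A H0) (coef H0 bs) (\<lambda>H. H0 \<inter> H) c"
proof -
  have "bs ! j = (v # bs) ! insert_index 0 j" for j by simp
  then have "\<exists>c. restr (length (v # bs)) 0 A H0 (coef X (v # bs)) (restriction A H0) (coef H0 bs) (\<lambda>H. H0 \<inter> H) c"
    by (intro restr_coordinates[OF A H0 b b0]) simp_all
  then show ?thesis unfolding restr0_def by (simp only: length_Cons)
qed

lemma ziegler_mult_localization:
  assumes A: "arrangement X A" and H0: "H0 \<in> A" and Y: "Y \<in> restriction A H0"
  shows "card (localization A Y) = Suc (ziegler_mult A H0 Y)" "H0 \<in> localization A Y" "\<exists>H\<in>localization A Y. H \<noteq> H0"
proof -
  note rA = restriction_arrangement[OF A H0]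
  obtain H' where H': "H' \<in> A - {H0}" "Y = H0 \<inter> H'" using Y unfolding restriction_eq[OF A H0] by blast
  have "H0 \<inter> H = Y" if H: "H \<in> A - {H0}" "Y \<subseteq> H" for H
  proof -
    have "H0 \<inter> H \<in> restriction A H0" using H unfolding restriction_eq[OF A H0] by blast
    moreover have "Y \<subseteq> H0 \<inter> H" using H H' by blast
    ultimately show ?thesis
      using kernel_subset_eq[OF arrangementD(2)[OF rA] arrangementD(4)[OF rA Y] arrangementD(4)[OF rA]] by blast
  qed
  then have eq: "localization A Y = insert H0 {H \<in> A - {H0}. H0 \<inter> H = Y}"
    unfolding localization_def using H0 H' by blast
  show "card (localization A Y) = Suc (ziegler_mult A H0 Y)"
    unfolding eq ziegler_mult_def using arrangementD(1)[OF A] by simp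
  show "H0 \<in> localization A Y" unfolding eq by blast
  show "\<exists>H\<in>localization A Y. H \<noteq> H0" unfolding eq using H' by blast
qed

lemma localization_coef:
  assumes A: "arrangement X A" and b: "ordered_basis X bs" and H: "H \<in> A" and Z: "Z = span (set (drop r bs))"
  shows "(\<forall>j<length bs. r \<le> j \<longrightarrow> coef X bs H j = 0) \<longleftrightarrow> Z \<subseteq> H"
proof -
  note a = arrangementD[OF A] and f = defining_formD[OF arrangementD(4)[OF A H]]
  have sH: "subspace H" by (rule hyperplane_subspace[OF a(2) a(3)[OF H]])
  have "(\<forall>j<length bs. r \<le> j \<longrightarrow> coef X bs H j = 0) \<longleftrightarrow> (\<forall>j<length bs. r \<le> j \<longrightarrow> bs ! j \<in> H)"
    unfolding coef_def using f(3)[OF basis_in[OF b]] by blast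
  also have "\<dots> \<longleftrightarrow> set (drop r bs) \<subseteq> H"
  proof
    assume *: "\<forall>j<length bs. r \<le> j \<longrightarrow> bs ! j \<in> H"
    show "set (drop r bs) \<subseteq> H"
    proof
      fix x assume "x \<in> set (drop r bs)"
      then obtain i where "i < length bs - r" "x = bs ! (r + i)" by (auto simp: in_set_conv_nth)
      then show "x \<in> H" using * by simp
    qed
  next
    assume *: "set (drop r bs) \<subseteq> H"
    show "\<forall>j<length bs. r \<le> j \<longrightarrow> bs ! j \<in> H"
    proof (intro allI impI)
      fix j assume "j < length bs" "r \<le> j"
      then have "bs ! j = drop r bs ! (j - r)" "j - r < length (drop r bs)" by auto
      then have "bs ! j \<in> set (drop r bs)" by (metis nth_mem)
      then show "bs ! j \<in> H" using * by blast
    qed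
  qed
  also have "\<dots> \<longleftrightarrow> Z \<subseteq> H" unfolding Z using span_minimal[OF _ sH] span_superset by blast
  finally show ?thesis .
qed

subsection \<open>Exponents\<close>

lemma has_exponents_cong:
  assumes "\<And>H. H \<in> A \<Longrightarrow> \<mu> H = \<nu> H" shows "has_exponents X A \<mu> E = has_exponents X A \<nu> E"
proof -
  have "D_mod X bs A \<mu> = D_mod X bs A \<nu>" for bs unfolding D_mod_def using assms by simp
  then show ?thesis unfolding has_exponents_def by simp
qed

lemma has_exponents_empty: "arrangement X {} \<Longrightarrow> \<exists>E. has_exponents X {} \<mu> E"
proof -
  assume A: "arrangement X {}"
  obtain bs where bs: "ordered_basis X bs" using arrangement_basis[OF A] by blast
  have "mdet (length bs) (\<lambda>i j. if i = j then 1 else 0 :: 'k mpoly) = const 1 * defpoly (length bs) {} (coef X bs) \<mu>"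
    by (simp add: mdet_one defpoly_def)
  then have "saito (length bs) {} (coef X bs) \<mu> (\<lambda>i j. if i = j then 1 else 0) (\<lambda>_. 0)"
    by (intro saitoI[of _ _ _ _ _ _ 1]) (auto simp: log_rows_def polyvec_def homvec_def)
  then show ?thesis using has_exponents_iff[OF A bs] by blast
qed

lemma flag_basis:
  assumes A: "arrangement X A" and H: "H0 \<in> A"
  obtains v bs where "ordered_basis X (v # bs)" "ordered_basis H0 bs"
proof -
  note a = arrangementD[OF A]
  obtain bs where bs: "ordered_basis H0 bs" using arrangement_basis[OF restriction_arrangement[OF A H]] by blast
  obtain v where "v \<in> X" "v \<notin> H0" using hyperplane_proper[OF a(3)[OF H]] by blast
  then show ?thesis using that extend_basis[OF a(2) a(3)[OF H] bs] bs by blast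
qed

lemma coordinates:
  assumes A: "arrangement X A" and H: "H0 \<in> A"
  obtains v bs c where "ordered_basis X (v # bs)" "ordered_basis H0 bs"
    "restr0 (length bs) A H0 (coef X (v # bs)) (restriction A H0) (coef H0 bs) (\<lambda>H. H0 \<inter> H) c"
proof -
  obtain v bs where b: "ordered_basis X (v # bs)" "ordered_basis H0 bs" using flag_basis[OF A H] .
  obtain c where "restr0 (length bs) A H0 (coef X (v # bs)) (restriction A H0) (coef H0 bs) (\<lambda>H. H0 \<inter> H) c"
    using restr0_coordinates[OF A H b] by blast
  then show ?thesis using that b by blast
qed

lemma concentrated_exponents:
  assumes A: "arrangement X A" and H: "H0 \<in> A" and m0: "1 \<le> m0" "1 \<le> m1"
    and E: "has_exponents X A (concentrated_mult H0 m0) E"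
  shows "m0 \<in># E \<and> has_exponents X A (concentrated_mult H0 m1) (add_mset m1 (E - {#m0#}))"
proof -
  obtain v bs c where b: "ordered_basis X (v # bs)" "ordered_basis H0 bs"
    and R: "restr0 (length bs) A H0 (coef X (v # bs)) (restriction A H0) (coef H0 bs) (\<lambda>H. H0 \<inter> H) c"
    using coordinates[OF A H] .
  interpret restr0 "length bs" A H0 "coef X (v # bs)" "restriction A H0" "coef H0 bs" "\<lambda>H. H0 \<inter> H" c by (rule R)
  have eq: "concentrated_mult H0 k = delta k" for k by (auto simp: concentrated_mult_def delta_def)
  obtain M d where M: "saito (Suc (length bs)) A (coef X (v # bs)) (delta m0) M d" "E = degs (Suc (length bs)) d"
    using E has_exponents_iff[OF A b(1), of "delta m0"] unfolding eq by auto
  obtain N e where N: "core N e" "degs (Suc (length bs)) d = add_mset m0 (degs (length bs) e)"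
    using core_of_saito[OF m0(1) M(1)] by blast
  obtain M' where M': "saito (Suc (length bs)) A (coef X (v # bs)) (delta m1) M' (case_nat m1 e)"
    using saito_of_core[OF m0(2) N(1)] by blast
  have "degs (Suc (length bs)) (case_nat m1 e) = add_mset m1 (degs (length bs) e)" by (simp add: degs_Suc)
  moreover have "has_exponents X A (delta m1) (degs (Suc (length bs)) (case_nat m1 e))"
    unfolding has_exponents_iff[OF A b(1)] length_Cons using M' by blast
  ultimately have "has_exponents X A (delta m1) (add_mset m1 (degs (length bs) e))" by (simp only:)
  then show ?thesis using M(2) N(2) unfolding eq by simp
qed

lemma ziegler_exponents:
  assumes A: "arrangement X A" and H: "H0 \<in> A" and E: "has_exponents X A (\<lambda>_. 1) E"
  shows "1 \<in># E \<and> has_exponents H0 (restriction A H0) (ziegler_mult A H0) (E - {#1#})"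
proof -
  obtain v bs c where b: "ordered_basis X (v # bs)" "ordered_basis H0 bs"
    and R: "restr0 (length bs) A H0 (coef X (v # bs)) (restriction A H0) (coef H0 bs) (\<lambda>H. H0 \<inter> H) c"
    using coordinates[OF A H] .
  interpret restr0 "length bs" A H0 "coef X (v # bs)" "restriction A H0" "coef H0 bs" "\<lambda>H. H0 \<inter> H" c by (rule R)
  have d1: "delta 1 = (\<lambda>_. 1)" by (auto simp: delta_def)
  obtain M d where M: "saito (Suc (length bs)) A (coef X (v # bs)) (delta 1) M d" "E = degs (Suc (length bs)) d"
    using E has_exponents_iff[OF A b(1), of "\<lambda>_. 1"] unfolding d1 by auto
  obtain N e where N: "core N e" "degs (Suc (length bs)) d = add_mset 1 (degs (length bs) e)"
    using core_of_saito[OF order_refl M(1)] by blast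
  have "ziegler_mult A H0 = (\<lambda>w. card (fib w))" by (simp add: fun_eq_iff ziegler_mult_def fib_def)
  then have "has_exponents H0 (restriction A H0) (ziegler_mult A H0) (degs (length bs) e)"
    using saito_ziegler[OF N(1)] has_exponents_iff[OF restriction_arrangement[OF A H] b(2)] by metis
  then show ?thesis using M(2) N(2) by simp
qed

lemma addition_coordinates:
  assumes A: "arrangement X A" and H: "H0 \<in> A" and b: "ordered_basis X (v # bs)" "ordered_basis H0 bs"
    and R: "restr0 (length bs) A H0 (coef X (v # bs)) (restriction A H0) (coef H0 bs) (\<lambda>H. H0 \<inter> H) c"
    and E: "has_exponents X (A - {H0}) (\<lambda>_. 1) E'" "has_exponents H0 (restriction A H0) (\<lambda>_. 1) E''" "E'' \<subseteq># E'"
  obtains M d where "restr0.addition_matrix (length bs) A H0 (coef X (v # bs)) (restriction A H0) (coef H0 bs) (\<lambda>H. H0 \<inter> H) M d"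
    "degs (Suc (length bs)) d = E'" "degs (length bs) (\<lambda>i. d (Suc i)) = E''"
proof -
  interpret restr0 "length bs" A H0 "coef X (v # bs)" "restriction A H0" "coef H0 bs" "\<lambda>H. H0 \<inter> H" c by (rule R)
  have A': "arrangement X (A - {H0})" by (rule arrangement_subset[OF A]) blast
  obtain M' d' where M': "saito (Suc (length bs)) (A - {H0}) (coef X (v # bs)) (\<lambda>_. 1) M' d'" "E' = degs (Suc (length bs)) d'"
    using E(1) has_exponents_iff[OF A' b(1), of "\<lambda>_. 1"] by auto
  obtain M'' d'' where M'': "saito (length bs) (restriction A H0) (coef H0 bs) (\<lambda>_. 1) M'' d''" "E'' = degs (length bs) d''"
    using E(2) has_exponents_iff[OF restriction_arrangement[OF A H] b(2), of "\<lambda>_. 1"] by auto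
  obtain M d where "addition_matrix M d" "degs (Suc (length bs)) d = E'" "degs (length bs) (\<lambda>i. d (Suc i)) = E''"
    using addition[OF M'(1) M''(1)] E(3) M'(2) M''(2) by auto
  then show ?thesis by (rule that)
qed

lemma addition_exponents:
  assumes A: "arrangement X A" and H: "H0 \<in> A"
    and E: "has_exponents X (A - {H0}) (\<lambda>_. 1) E'" "has_exponents H0 (restriction A H0) (\<lambda>_. 1) E''" "E'' \<subseteq># E'"
  shows "\<exists>E. has_exponents X A (\<lambda>_. 1) E"
proof -
  obtain v bs c where b: "ordered_basis X (v # bs)" "ordered_basis H0 bs"
    and R: "restr0 (length bs) A H0 (coef X (v # bs)) (restriction A H0) (coef H0 bs) (\<lambda>H. H0 \<inter> H) c"
    using coordinates[OF A H] .
  interpret restr0 "length bs" A H0 "coef X (v # bs)" "restriction A H0" "coef H0 bs" "\<lambda>H. H0 \<inter> H" c by (rule R)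
  obtain M d where "addition_matrix M d" using addition_coordinates[OF A H b R E] by blast
  from addition_saito[OF this] obtain M' e where "saito (Suc (length bs)) A (coef X (v # bs)) (\<lambda>_. 1) M' e" by blast
  then show ?thesis using has_exponents_iff[OF A b(1), of "\<lambda>_. 1"] by auto
qed

lemma intermediate_exponents:
  assumes A: "arrangement X A" and H: "H0 \<in> A"
    and E: "has_exponents X (A - {H0}) (\<lambda>_. 1) E'" "has_exponents H0 (restriction A H0) (\<lambda>_. 1) E''" "E'' \<subseteq># E'"
    and ne: "restriction A H0 \<noteq> {}" and \<mu>: "\<And>Y. Y \<in> restriction A H0 \<Longrightarrow> 1 \<le> \<mu> Y \<and> \<mu> Y \<le> ziegler_mult A H0 Y"
  shows "has_exponents H0 (restriction A H0) \<mu> (add_mset (Suc (\<Sum>Y\<in>restriction A H0. \<mu> Y - 1)) (E'' - {#1#}))"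
proof -
  obtain v bs c where b: "ordered_basis X (v # bs)" "ordered_basis H0 bs"
    and R: "restr0 (length bs) A H0 (coef X (v # bs)) (restriction A H0) (coef H0 bs) (\<lambda>H. H0 \<inter> H) c"
    using coordinates[OF A H] .
  interpret restr0 "length bs" A H0 "coef X (v # bs)" "restriction A H0" "coef H0 bs" "\<lambda>H. H0 \<inter> H" c by (rule R)
  obtain M d where M: "addition_matrix M d" "degs (length bs) (\<lambda>i. d (Suc i)) = E''" using addition_coordinates[OF A H b R E] by blast
  have \<mu>': "1 \<le> \<mu> Y \<and> \<mu> Y \<le> card (fib Y)" if "Y \<in> restriction A H0" for Y
    using \<mu>[OF that] by (simp add: ziegler_mult_def fib_def)
  obtain M' d' where "saito (length bs) (restriction A H0) (coef H0 bs) \<mu> M' d'"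
    "degs (length bs) d' = add_mset (Suc (\<Sum>Y\<in>restriction A H0. \<mu> Y - 1)) (E'' - {#1#})"
    using saito_intermediate[OF M(1) ne \<mu>'] M(2) by auto
  then show ?thesis using has_exponents_iff[OF restriction_arrangement[OF A H] b(2), of \<mu>] by metis
qed

subsection \<open>Euler multiplicities\<close>

lemma euler_mult_at_cong:
  assumes "\<And>H. H \<in> A \<Longrightarrow> \<mu> H = \<nu> H" shows "euler_mult_at X A \<mu> H0 Y d = euler_mult_at X A \<nu> H0 Y d"
proof -
  have "D_mod X bs (localization A Y) \<mu> = D_mod X bs (localization A Y) \<nu>" for bs
    unfolding D_mod_def localization_def using assms by simp
  then show ?thesis unfolding euler_mult_at_def by simp
qed

lemma localization_arrangement: "arrangement X A \<Longrightarrow> arrangement X (localization A Y)"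
  by (rule arrangement_subset) (auto simp: localization_def)

lemma euler_mult_atI:
  assumes A: "arrangement X A" and b: "ordered_basis X bs" and r: "rank2 (length bs) (localization A Y) (coef X bs)"
    and H0: "H0 \<in> localization A Y"
    and s: "saito (length bs) (localization A Y) (coef X bs) \<mu> (pair_matrix t p) (\<lambda>i. if i = 0 then d else if i = 1 then e else 0)"
    and t: "\<not> (lform (length bs) (coef X bs H0) dvd t 0 \<and> lform (length bs) (coef X bs H0) dvd t 1)"
    and p: "lform (length bs) (coef X bs H0) dvd p 0" "lform (length bs) (coef X bs H0) dvd p 1"
  shows "euler_mult_at X A \<mu> H0 Y d"
proof -
  let ?n = "length bs" and ?M = "pair_matrix t p" and ?d = "\<lambda>i::nat. if i = 0 then d else if i = 1 then e else 0"
  have L: "arrangement X (localization A Y)" by (rule localization_arrangement[OF A])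
  have n: "2 \<le> ?n" using r by (simp add: rank2_def)
  let ?\<alpha> = "form X H0"
  have \<alpha>: "defining_form X H0 ?\<alpha>" using arrangementD(4)[OF L H0] .
  have F: "form_poly bs ?\<alpha> = lform ?n (coef X bs H0)" by (simp add: form_poly_lform coef_def[abs_def])
  have lr: "log_rows ?n (localization A Y) (coef X bs) \<mu> ?M ?d" using s by (auto simp: saito_def)
  have lt: "0 < ?n" "Suc 0 < ?n" using n by linarith+
  have up: "[0..<?n] = 0 # 1 # [2..<?n]"
    unfolding upt_conv_Cons[OF lt(1)] upt_conv_Cons[OF lt(2)] One_nat_def numeral_2_eq_2 ..
  have units: "map (\<lambda>i. dvec ?n (?M i)) [2..<?n] = map (partial ?n) [2..<?n]"
  proof (rule map_cong[OF refl])
    fix i assume i: "i \<in> set [2..<?n]"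
    then have "dvec ?n (?M i) = dvec ?n (\<lambda>j. if j = i then 1 else 0)" unfolding dvec_eq_iff by (auto simp: pair_matrix_def)
    then show "dvec ?n (?M i) = partial ?n i" using i dvec_unit[of i ?n] by simp
  qed
  have hb: "homogeneous_basis ?n (D_mod X bs (localization A Y) \<mu>)
     (dvec ?n (?M 0) # dvec ?n (?M 1) # map (partial ?n) [2..<?n]) (d # e # map ?d [2..<?n])"
    using saito_basis[OF coef_nonprop[OF L b] s] unfolding D_mod_eq[OF L b] up list.map units by simp
  have nt: "dvec ?n (?M 0) \<notin> {(\<lambda>f. form_poly bs ?\<alpha> * \<eta> f) |\<eta>. \<eta> \<in> Der ?n}"
  proof
    assume "dvec ?n (?M 0) \<in> {(\<lambda>f. form_poly bs ?\<alpha> * \<eta> f) |\<eta>. \<eta> \<in> Der ?n}"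
    then obtain \<eta> where "dvec ?n (?M 0) = (\<lambda>f. form_poly bs ?\<alpha> * \<eta> f)" by blast
    then have "?M 0 j = form_poly bs ?\<alpha> * \<eta> (var j)" if "j < ?n" for j using dvec_var[OF that, of "?M 0"] by simp
    then have "form_poly bs ?\<alpha> dvd ?M 0 j" if "j < 2" for j using that n by simp
    from this[of 0] this[of 1] show False using t unfolding F by (simp add: pair_matrix_def)
  qed
  have "\<exists>q\<in>poly_ring ?n. p j = lform ?n (coef X bs H0) * q" if "j < 2" for j
  proof (rule dvd_in_poly_ring)
    have "j = 0 \<or> j = 1" using that by auto
    then show "lform ?n (coef X bs H0) dvd p j" using p by auto
    show "p j \<in> poly_ring ?n" using log_rowsD(4)[OF lr, of 1 j] that n by (simp add: pair_matrix_def)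
  qed simp
  then obtain q0 q1 where q: "q0 \<in> poly_ring ?n" "q1 \<in> poly_ring ?n"
      "p 0 = lform ?n (coef X bs H0) * q0" "p 1 = lform ?n (coef X bs H0) * q1"
    by (metis one_less_numeral_iff semiring_norm(76) zero_less_numeral)
  define w where "w = (\<lambda>j::nat. if j = 0 then q0 else if j = 1 then q1 else 0)"
  have wD: "dvec ?n w \<in> Der ?n" by (rule dvec_in_Der) (use q in \<open>auto simp: polyvec_def w_def\<close>)
  have pw: "dvec ?n (?M 1) = (\<lambda>f. form_poly bs ?\<alpha> * dvec ?n w f)"
    unfolding dvec_mult dvec_eq_iff F
  proof (intro allI impI)
    fix i :: nat
    consider "i = 0" | "i = 1" | "2 \<le> i" by linarith
    then show "?M 1 i = lform ?n (coef X bs H0) * w i"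
      by cases (simp_all add: pair_matrix_def w_def q(3) q(4)[unfolded One_nat_def])
  qed
  have pi: "dvec ?n (?M 1) \<in> {(\<lambda>f. form_poly bs ?\<alpha> * \<eta> f) |\<eta>. \<eta> \<in> Der ?n}"
    unfolding mem_Collect_eq by (intro exI[of _ "dvec ?n w"] conjI pw wD)
  have van: "\<forall>H\<in>localization A Y. \<forall>\<alpha>. defining_form X H \<alpha> \<longrightarrow> (\<forall>i. 2 \<le> i \<and> i < ?n \<longrightarrow> \<alpha> (bs ! i) = 0)"
  proof (intro ballI allI impI)
    fix H \<alpha> i assume H: "H \<in> localization A Y" and \<alpha>: "defining_form X H \<alpha>" and i: "2 \<le> i \<and> i < ?n"
    obtain c where "\<And>v. v \<in> X \<Longrightarrow> \<alpha> v = c * form X H v"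
      using form_unique[OF arrangementD(2)[OF A] arrangementD(4)[OF L H] \<alpha>] by blast
    then show "\<alpha> (bs ! i) = 0" using r H i basis_in[OF b, of i] unfolding rank2_def coef_def by simp
  qed
  show ?thesis unfolding euler_mult_at_def
    by (intro exI[of _ bs] exI[of _ "form X H0"] exI[of _ "dvec ?n (?M 0)"] exI[of _ "dvec ?n (?M 1)"]
        exI[of _ "e # map ?d [2..<?n]"] conjI b van hb \<alpha> nt pi)
qed

lemma euler_mult_atD:
  assumes A: "arrangement X A" and H0: "H0 \<in> localization A Y" and e: "euler_mult_at X A \<mu> H0 Y d"
  obtains bs M f where "ordered_basis X bs" "rank2 (length bs) (localization A Y) (coef X bs)"
    "saito (length bs) (localization A Y) (coef X bs) \<mu> M f" "f 0 = d"
    "\<And>i j. 2 \<le> i \<Longrightarrow> i < length bs \<Longrightarrow> j < length bs \<Longrightarrow> M i j = (if i = j then 1 else 0)"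
    "lform (length bs) (coef X bs H0) dvd M 1 0" "lform (length bs) (coef X bs H0) dvd M 1 1"
proof -
  have L: "arrangement X (localization A Y)" by (rule localization_arrangement[OF A])
  obtain bs \<alpha>0 \<theta> \<psi> ds where b: "ordered_basis X bs"
    and van: "\<forall>H\<in>localization A Y. \<forall>\<alpha>. defining_form X H \<alpha> \<longrightarrow> (\<forall>i. 2 \<le> i \<and> i < length bs \<longrightarrow> \<alpha> (bs ! i) = 0)"
    and hb: "homogeneous_basis (length bs) (D_mod X bs (localization A Y) \<mu>)
          (\<theta> # \<psi> # map (partial (length bs)) [2..<length bs]) (d # ds)"
    and \<alpha>0: "defining_form X H0 \<alpha>0" and \<psi>: "\<psi> \<in> {(\<lambda>f. form_poly bs \<alpha>0 * \<eta> f) |\<eta>. \<eta> \<in> Der (length bs)}"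
    using e unfolding euler_mult_at_def by blast
  let ?n = "length bs" and ?l = "\<theta> # \<psi> # map (partial (length bs)) [2..<length bs]"
  define M where "M = (\<lambda>i j. (?l ! i) (var j))"
  have s: "length ?l = ?n" "saito ?n (localization A Y) (coef X bs) \<mu> M (\<lambda>i. (d # ds) ! i)"
    using basis_saito[OF coef_nonprop[OF L b]] hb unfolding D_mod_eq[OF L b] M_def by blast+
  have n: "2 \<le> ?n" using s(1) by simp
  have r: "rank2 ?n (localization A Y) (coef X bs)"
    unfolding rank2_def coef_def using n coef_nonprop[OF L b, unfolded coef_def[abs_def]] van arrangementD(4)[OF L] by blast
  have u: "M i j = (if i = j then 1 else 0)" if ij: "2 \<le> i" "i < ?n" "j < ?n" for i j
  proof -
    have "?l ! i = partial ?n i" using ij by (cases i; cases "i - 1") (auto simp: nth_Cons')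
    then show ?thesis using ij by (simp add: M_def partial_eq pdiff_var)
  qed
  obtain c where c: "c \<noteq> 0" "\<And>v. v \<in> X \<Longrightarrow> \<alpha>0 v = c * form X H0 v"
    using form_unique[OF arrangementD(2)[OF A] arrangementD(4)[OF L H0] \<alpha>0] by blast
  have "form_poly bs \<alpha>0 = lform ?n (\<lambda>i. c * coef X bs H0 i)"
    unfolding form_poly_lform by (rule lform_cong) (simp add: c(2) basis_in[OF b] coef_def)
  then have F: "form_poly bs \<alpha>0 = const c * lform ?n (coef X bs H0)" by (simp add: lform_scale)
  obtain \<eta> where "\<psi> = (\<lambda>f. form_poly bs \<alpha>0 * \<eta> f)" using \<psi> by blast
  then have "M 1 j = lform ?n (coef X bs H0) * (const c * \<eta> (var j))" for j by (simp add: M_def F mult_ac)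
  then have p: "lform ?n (coef X bs H0) dvd M 1 j" for j by (metis dvd_triv_left)
  show ?thesis by (rule that[OF b r s(2) _ u p p]) simp_all
qed

lemma rank2_localization:
  assumes A: "arrangement X A" and b: "ordered_basis X (v0 # v1 # ys)" and Y: "Y = span (set ys)"
  shows "rank2 (length (v0 # v1 # ys)) (localization A Y) (coef X (v0 # v1 # ys))"
proof -
  have L: "arrangement X (localization A Y)" by (rule localization_arrangement[OF A])
  have "coef X (v0 # v1 # ys) H j = 0" if "H \<in> localization A Y" "j < length (v0 # v1 # ys)" "2 \<le> j" for H j
    using localization_coef[OF L b that(1), of Y 2] Y that by (auto simp: localization_def)
  then show ?thesis unfolding rank2_def using coef_nonprop[OF L b] by simp
qed

lemma flag2_basis:
  assumes A: "arrangement X A" and H: "H1 \<in> A" and Y: "Y \<in> restriction A H1"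
  obtains v0 v1 ys where "ordered_basis X (v0 # v1 # ys)" "ordered_basis H1 (v1 # ys)" "ordered_basis Y ys"
proof -
  note a = arrangementD[OF A] and r = restriction_arrangement[OF A H]
  obtain v1 ys where b: "ordered_basis H1 (v1 # ys)" "ordered_basis Y ys" using flag_basis[OF r Y] .
  obtain v0 where "v0 \<in> X" "v0 \<notin> H1" using hyperplane_proper[OF a(3)[OF H]] by blast
  then show ?thesis using that extend_basis[OF a(2) a(3)[OF H] b(1)] b by blast
qed

text \<open>In coordinates adapted to the flag of Y and H1, the explicit pair for the
  concentrated multiplicity is a basis of the required kind. In any other such basis, the first
  derivation has the same degree.\<close>

lemma euler_mult_concentrated:
  assumes A: "arrangement X A" and H1: "H1 \<in> A" and Y: "Y \<in> restriction A H1" and H2: "H2 \<in> localization A Y" "H2 \<noteq> H1"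
    and m: "1 \<le> m" and \<mu>: "\<And>H. H \<in> localization A Y \<Longrightarrow> \<mu> H = (if H = H2 then m else 1)"
  shows "euler_mult_at X A \<mu> H1 Y d \<longleftrightarrow> d = m"
proof
  have H1l: "H1 \<in> localization A Y" by (rule ziegler_mult_localization[OF A H1 Y])
  { assume "euler_mult_at X A \<mu> H1 Y d"
    then obtain bs M f where b: "ordered_basis X bs" and r: "rank2 (length bs) (localization A Y) (coef X bs)"
      and M: "saito (length bs) (localization A Y) (coef X bs) \<mu> M f" "f 0 = d"
        "\<And>i j. 2 \<le> i \<Longrightarrow> i < length bs \<Longrightarrow> j < length bs \<Longrightarrow> M i j = (if i = j then 1 else 0)"
        "lform (length bs) (coef X bs H1) dvd M 1 0" "lform (length bs) (coef X bs H1) dvd M 1 1"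
      by (rule euler_mult_atD[OF A H1l]) (rule that)
    let ?P = "pair_matrix (conc_euler (coef X bs) H2 m) (conc_rot (localization A Y) (coef X bs) H2)"
    have "(\<lambda>i::nat. if i = 0 then m else if i = 1 then card (localization A Y) - 1 else 0) 0 = f 0"
      by (rule euler_degree_unique[OF _ _ conc_pair(1)[OF r H2(1) m \<mu>] _ M(1,3), where L = "lform (length bs) (coef X bs H1)"])
        (use r M(4,5) conc_rot_dvd[OF r H2(1) H1l H2(2)] conc_euler_not_dvd[OF r H2(1) H1l H2(2), of m] in
          \<open>auto simp: pair_matrix_def rank2_def\<close>)
    then show "d = m" using M(2) by simp }
  assume d: "d = m"
  obtain v0 v1 ys where b: "ordered_basis X (v0 # v1 # ys)" "ordered_basis H1 (v1 # ys)" "ordered_basis Y ys"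
    using flag2_basis[OF A H1 Y] .
  have "Y = span (set ys)" using b(3) by (simp add: ordered_basis_def)
  then have r: "rank2 (length (v0 # v1 # ys)) (localization A Y) (coef X (v0 # v1 # ys))" by (rule rank2_localization[OF A b(1)])
  show "euler_mult_at X A \<mu> H1 Y d"
    unfolding d
    by (rule euler_mult_atI[OF A b(1) r H1l conc_pair(1)[OF r H2(1) m \<mu>] conc_euler_not_dvd[OF r H2(1) H1l H2(2)]
          conc_rot_dvd[OF r H2(1) H1l H2(2)] conc_rot_dvd[OF r H2(1) H1l H2(2)]])
qed

text \<open>At the thick hyperplane, the multiple of the Euler derivation is divisible by the
  form of H0 as soon as m is at least 2. So it comes second, and the degree of the other
  derivation counts the hyperplanes through Y other than H0.\<close>

lemma euler_mult_concentrated_self: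
  assumes A: "arrangement X A" and H0: "H0 \<in> A" and Y: "Y \<in> restriction A H0" and m: "2 \<le> m"
  shows "euler_mult_at X A (concentrated_mult H0 m) H0 Y (ziegler_mult A H0 Y)"
proof -
  note z = ziegler_mult_localization[OF A H0 Y]
  obtain v0 v1 ys where b: "ordered_basis X (v0 # v1 # ys)" "ordered_basis H0 (v1 # ys)" "ordered_basis Y ys"
    using flag2_basis[OF A H0 Y] .
  have "Y = span (set ys)" using b(3) by (simp add: ordered_basis_def)
  then have r: "rank2 (length (v0 # v1 # ys)) (localization A Y) (coef X (v0 # v1 # ys))" by (rule rank2_localization[OF A b(1)])
  have m1: "1 \<le> m" using m by simp
  have s: "saito (length (v0 # v1 # ys)) (localization A Y) (coef X (v0 # v1 # ys)) (concentrated_mult H0 m)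
     (pair_matrix (conc_rot (localization A Y) (coef X (v0 # v1 # ys)) H0) (conc_euler (coef X (v0 # v1 # ys)) H0 m))
     (\<lambda>i. if i = 0 then card (localization A Y) - 1 else if i = 1 then m else 0)"
    by (rule conc_pair(2)[OF r z(2) m1]) (simp add: concentrated_mult_def)
  have "ziegler_mult A H0 Y = card (localization A Y) - 1" using z(1) by simp
  then show ?thesis
    using euler_mult_atI[OF A b(1) r z(2) s conc_rot_not_dvd[OF r z(2)] conc_euler_dvd[OF r z(2) m] conc_euler_dvd[OF r z(2) m]] by simp
qed

lemma first_coef:
  assumes A: "arrangement X A" and b: "ordered_basis X (v # bs)" and H: "H \<in> A" and bH: "ordered_basis H bs"
  shows "j < length (v # bs) \<Longrightarrow> j \<noteq> 0 \<Longrightarrow> coef X (v # bs) H j = 0"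
    and "\<exists>u. u \<noteq> 0 \<and> lform (length (v # bs)) (coef X (v # bs) H) = const u * var 0"
proof -
  have z: "coef X (v # bs) H j = 0" if "j < length (v # bs)" "j \<noteq> 0" for j
  proof -
    have "(v # bs) ! j = bs ! (j - 1)" "j - 1 < length bs" using that by auto
    then have "(v # bs) ! j \<in> H" using basis_in[OF bH] by metis
    then show ?thesis unfolding coef_def using defining_formD(3)[OF arrangementD(4)[OF A H] basis_in[OF b that(1)]] by simp
  qed
  then show "j < length (v # bs) \<Longrightarrow> j \<noteq> 0 \<Longrightarrow> coef X (v # bs) H j = 0" .
  have l: "lform (length (v # bs)) (coef X (v # bs) H) = const (coef X (v # bs) H 0) * var 0"
    by (rule lform_eq_var) (use z in auto)
  have "lform (length (v # bs)) (coef X (v # bs) H) \<noteq> 0"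
    using nonprop_prime[OF coef_nonprop[OF A b] H] by (auto simp: prime_elem_def)
  then have "coef X (v # bs) H 0 \<noteq> 0" using l by auto
  then show "\<exists>u. u \<noteq> 0 \<and> lform (length (v # bs)) (coef X (v # bs) H) = const u * var 0" using l by blast
qed

text \<open>The Euler multiplicity does not depend on \<mu>: the transversal member of the local
  pair lifts to the localization of A at Z, and its degree is the number of members of the
  restriction through Z other than Y.\<close>

lemma euler_mult_intermediate:
  assumes A: "arrangement X A" and H: "H0 \<in> A"
    and E: "has_exponents X (A - {H0}) (\<lambda>_. 1) E'" "has_exponents H0 (restriction A H0) (\<lambda>_. 1) E''" "E'' \<subseteq># E'"
    and \<mu>: "\<And>Y. Y \<in> restriction A H0 \<Longrightarrow> 1 \<le> \<mu> Y \<and> \<mu> Y \<le> ziegler_mult A H0 Y"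
    and Y: "Y \<in> restriction A H0" "2 \<le> \<mu> Y" and Z: "Z \<in> restriction (restriction A H0) Y"
  shows "euler_mult_at H0 (restriction A H0) \<mu> Y Z (ziegler_mult (restriction A H0) Y Z)"
proof -
  note a = arrangementD[OF A] and rA = restriction_arrangement[OF A H]
  note z = ziegler_mult_localization[OF rA Y(1) Z]
  obtain v1 v2 zs where b0: "ordered_basis H0 (v1 # v2 # zs)" "ordered_basis Y (v2 # zs)" "ordered_basis Z zs"
    using flag2_basis[OF rA Y(1) Z] .
  obtain v0 where "v0 \<in> X" "v0 \<notin> H0" using hyperplane_proper[OF a(3)[OF H]] by blast
  then have b: "ordered_basis X (v0 # v1 # v2 # zs)" using extend_basis[OF a(2) a(3)[OF H] b0(1)] by blast
  let ?bs = "v1 # v2 # zs"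
  obtain c where R: "restr0 (length ?bs) A H0 (coef X (v0 # ?bs)) (restriction A H0) (coef H0 ?bs) (\<lambda>H. H0 \<inter> H) c"
    using restr0_coordinates[OF A H b b0(1)] by blast
  interpret restr0 "length ?bs" A H0 "coef X (v0 # ?bs)" "restriction A H0" "coef H0 ?bs" "\<lambda>H. H0 \<inter> H" c by (rule R)
  obtain M d where M: "addition_matrix M d" using addition_coordinates[OF A H b b0(1) R E] by blast
  have Zs: "Z = span (set (drop 2 ?bs))" using b0(3) by (simp add: ordered_basis_def)
  have J: "J_loc = localization (restriction A H0) Z"
    unfolding J_loc_def localization_def using localization_coef[OF rA b0(1) _ Zs] by blast
  have y0: "\<And>j. j < length ?bs \<Longrightarrow> j \<noteq> 0 \<Longrightarrow> coef H0 ?bs Y j = 0" by (rule first_coef(1)[OF rA b0(1) Y(1) b0(2)])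
  obtain u where u: "u \<noteq> 0" "lform (length ?bs) (coef H0 ?bs Y) = const u * var 0" using first_coef(2)[OF rA b0(1) Y(1) b0(2)] by blast
  have \<mu>': "1 \<le> \<mu> w \<and> \<mu> w \<le> card (fib w)" if "w \<in> J_loc" for w
    using \<mu>[of w] that loc_sub(2) by (auto simp: ziegler_mult_def fib_def)
  have m2: "2 \<le> length ?bs" by simp
  have YJ: "Y \<in> J_loc" unfolding J by (rule z(2))
  obtain t p e where s: "saito (length ?bs) J_loc (coef H0 ?bs) \<mu> (pair_matrix t p) (\<lambda>i. if i = 0 then card J_loc - 1 else if i = 1 then e else 0)"
    and tp: "\<not> (var 0 dvd t 0 \<and> var 0 dvd t 1)" "var 0 dvd p 0" "var 0 dvd p 1"
    using intermediate_pair[OF M m2 YJ y0 \<mu>' Y(2)] by blast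
  have Zz: "Z = span (set zs)" using Zs by simp
  have "ziegler_mult (restriction A H0) Y Z = card J_loc - 1" unfolding J using z(1) by simp
  then show ?thesis
    using euler_mult_atI[OF rA b0(1) rank2_localization[OF rA b0(1) Zz] z(2) s[unfolded J]] tp
    unfolding u(2) const_unit[OF u(1)] J by simp
qed

lemma restriction_alt: "restriction B Y = (\<lambda>W. Y \<inter> W) ` {W \<in> B. \<not> Y \<subseteq> W}"
  unfolding restriction_def localization_def by blast

lemma image_filter_image: "g ` {w \<in> f ` S. P w} = (\<lambda>x. g (f x)) ` {x \<in> S. P (f x)}"
  by blast

lemma restriction_twice:
  assumes A: "arrangement X A" and H: "H0 \<in> A" "H1 \<in> A" "H0 \<noteq> H1"
  shows "restriction (restriction A H0) (H0 \<inter> H1) = restriction (restriction A H1) (H0 \<inter> H1)"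
proof -
  have *: "restriction (restriction A H) (H \<inter> H') = (\<lambda>K. H \<inter> H' \<inter> K) ` {K \<in> A. \<not> H \<inter> H' \<subseteq> K}"
    if H: "H \<in> A" for H H'
  proof -
    have "restriction (restriction A H) (H \<inter> H') = (\<lambda>K. (H \<inter> H') \<inter> (H \<inter> K)) ` {K \<in> A - {H}. \<not> H \<inter> H' \<subseteq> H \<inter> K}"
      unfolding restriction_alt[of "restriction A H"] unfolding restriction_eq[OF A H] by (rule image_filter_image)
    also have "\<dots> = (\<lambda>K. H \<inter> H' \<inter> K) ` {K \<in> A. \<not> H \<inter> H' \<subseteq> K}"
      by (rule image_cong) auto
    finally show ?thesis .
  qed
  show ?thesis using *[OF H(1), of H1] *[OF H(2), of H0] by (simp only: Int_commute[of H1 H0])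
qed

text \<open>Coordinates are adapted to both hyperplanes: v0 extends a basis of their
  intersection to one of H0, and v1 to one of H1.\<close>

lemma euler_mult_ziegler:
  assumes A: "arrangement X A" and H: "H0 \<in> A" "H1 \<in> A" "H0 \<noteq> H1"
    and E: "has_exponents X (A - {H1}) (\<lambda>_. 1) E'" "has_exponents H1 (restriction A H1) (\<lambda>_. 1) E''" "E'' \<subseteq># E'"
    and Z: "Z \<in> restriction (restriction A H0) (H0 \<inter> H1)"
  shows "euler_mult_at H0 (restriction A H0) (ziegler_mult A H0) (H0 \<inter> H1) Z (ziegler_mult (restriction A H1) (H0 \<inter> H1) Z)"
proof -
  let ?Y = "H0 \<inter> H1"
  note a = arrangementD[OF A] and rA0 = restriction_arrangement[OF A H(1)] and rA1 = restriction_arrangement[OF A H(2)]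
  have Y0: "?Y \<in> restriction A H0" unfolding restriction_eq[OF A H(1)] using H by blast
  have Y1: "?Y \<in> restriction A H1" unfolding restriction_eq[OF A H(2)] using H by blast
  have Z1: "Z \<in> restriction (restriction A H1) ?Y" using Z restriction_twice[OF A H] by simp
  note z0 = ziegler_mult_localization[OF rA0 Y0 Z] and z1 = ziegler_mult_localization[OF rA1 Y1 Z1]
  obtain v1 v2 zs where b1: "ordered_basis H1 (v1 # v2 # zs)" "ordered_basis ?Y (v2 # zs)" "ordered_basis Z zs"
    using flag2_basis[OF rA1 Y1 Z1] .
  obtain v0 where v0: "v0 \<in> H0" "v0 \<notin> ?Y" using hyperplane_proper[OF arrangementD(3)[OF rA0 Y0]] by blast
  have b0: "ordered_basis H0 (v0 # v2 # zs)"
    by (rule extend_basis[OF arrangementD(2)[OF rA0] arrangementD(3)[OF rA0 Y0] b1(2) v0])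
  have b: "ordered_basis X (v0 # v1 # v2 # zs)"
    by (rule extend_basis[OF a(2) a(3)[OF H(2)] b1(1)]) (use v0 a(5)[OF H(1)] in auto)
  let ?bs = "v1 # v2 # zs" and ?cs = "v0 # v2 # zs"
  obtain c where R: "restr0 (length ?bs) A H1 (coef X (v0 # ?bs)) (restriction A H1) (coef H1 ?bs) (\<lambda>H. H1 \<inter> H) c"
    using restr0_coordinates[OF A H(2) b b1(1)] by blast
  have nth: "?cs ! j = (v0 # ?bs) ! insert_index 1 j" for j by (simp add: insert_index_def nth_Cons')
  have "\<exists>c. restr (length (v0 # ?bs)) 1 A H0 (coef X (v0 # ?bs)) (restriction A H0) (coef H0 ?cs) (\<lambda>H. H0 \<inter> H) c"
    by (rule restr_coordinates[OF A H(1) b b0]) (use nth in auto)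
  then obtain c' where R': "restr (Suc (length ?bs)) 1 A H0 (coef X (v0 # ?bs)) (restriction A H0) (coef H0 ?cs) (\<lambda>H. H0 \<inter> H) c'"
    by auto
  interpret restr0 "length ?bs" A H1 "coef X (v0 # ?bs)" "restriction A H1" "coef H1 ?bs" "\<lambda>H. H1 \<inter> H" c by (rule R)
  obtain M d where M: "addition_matrix M d" using addition_coordinates[OF A H(2) b b1(1) R E] by blast
  have Zs: "Z = span (set (drop 2 ?bs))" "Z = span (set (drop 2 ?cs))" using b1(3) by (simp_all add: ordered_basis_def)
  have J: "J_loc = localization (restriction A H1) Z"
    unfolding J_loc_def localization_def using localization_coef[OF rA1 b1(1) _ Zs(1)] by blast
  have K: "localization (restriction A H0) Z = {v \<in> restriction A H0. \<forall>j<length ?bs. 2 \<le> j \<longrightarrow> coef H0 ?cs v j = 0}"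
    unfolding localization_def using localization_coef[OF rA0 b0 _ Zs(2)] by auto
  have m2: "2 \<le> length ?bs" by simp
  have len: "length ?bs = length ?cs" by simp
  have zm: "(\<lambda>v. card {H \<in> A - {H0}. H0 \<inter> H = v}) = ziegler_mult A H0" by (simp add: fun_eq_iff ziegler_mult_def)
  obtain t p e where s: "saito (length ?cs) (localization (restriction A H0) Z) (coef H0 ?cs) (ziegler_mult A H0)
      (pair_matrix t p) (\<lambda>i. if i = 0 then card J_loc - 1 else if i = 1 then e else 0)"
    and tp: "\<not> (var 0 dvd t 0 \<and> var 0 dvd t 1)" "var 0 dvd p 0" "var 0 dvd p 1"
    using ziegler_pair[OF M m2 R' H(3) K] unfolding zm len by blast
  obtain u where u: "u \<noteq> 0" "lform (length ?cs) (coef H0 ?cs ?Y) = const u * var 0" using first_coef(2)[OF rA0 b0 Y0 b1(2)] by blast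
  have Zz: "Z = span (set zs)" using Zs by simp
  have "ziegler_mult (restriction A H1) ?Y Z = card J_loc - 1" unfolding J using z1(1) by simp
  then show ?thesis
    using euler_mult_atI[OF rA0 b0 rank2_localization[OF rA0 b0 Zz] z0(2) s] tp
    unfolding u(2) const_unit[OF u(1)] by simp
qed

end

section \<open>Inductive freeness\<close>

context arrangement_space
begin

lemma multi_inductively_free_cong:
  assumes "multi_inductively_free X A \<mu>" "\<And>H. H \<in> A \<Longrightarrow> \<nu> H = \<mu> H"
  shows "multi_inductively_free X A \<nu>"
  using assms
proof (induction arbitrary: \<nu>)
  case (empty X \<mu>)
  then show ?case by (intro multi_inductively_free.empty)
next
  case (step X A \<mu> H0 \<mu>' E' E'')
  have del: "deletion A \<nu> H0 = deletion A \<mu> H0" using step.prems[OF step.hyps(2)] by (simp add: deletion_def)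
  have sub: "deletion A \<mu> H0 \<subseteq> A" by (auto simp: deletion_def)
  have dm: "deletion_mult \<nu> H0 H = deletion_mult \<mu> H0 H" if "H \<in> deletion A \<mu> H0" for H
    using step.prems[of H] step.prems[OF step.hyps(2)] that sub by (auto simp: deletion_mult_def)
  show ?case
  proof (rule multi_inductively_free.step)
    show "multiarrangement X A \<nu>" using step.hyps(1) step.prems by (simp add: multiarrangement_def)
    show "H0 \<in> A" by (rule step.hyps)
    show "multi_inductively_free X (deletion A \<nu> H0) (deletion_mult \<nu> H0)" unfolding del using dm by (rule step.IH(1))
    show "euler_mult X A \<nu> H0 \<mu>'"
      using step.hyps(4) euler_mult_at_cong[of A \<nu> \<mu>] step.prems unfolding euler_mult_def by simp
    show "multi_inductively_free H0 (restriction A H0) \<mu>'" by (rule step.hyps)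
    show "has_exponents X (deletion A \<nu> H0) (deletion_mult \<nu> H0) E'"
      unfolding del using step.hyps(6) has_exponents_cong[of "deletion A \<mu> H0"] dm by metis
    show "has_exponents H0 (restriction A H0) \<mu>' E''" "E'' \<subseteq># E'" by (rule step.hyps)+
  qed
qed

lemma localization_restriction:
  assumes A: "arrangement X A" and H1: "H1 \<in> A" and Y: "Y \<in> restriction A H1" and H: "H \<in> A" "H \<noteq> H1"
  shows "Y \<subseteq> H \<longleftrightarrow> H1 \<inter> H = Y"
proof
  note rA = restriction_arrangement[OF A H1]
  assume "Y \<subseteq> H"
  moreover have "Y \<subseteq> H1" using Y unfolding restriction_eq[OF A H1] by blast
  moreover have "H1 \<inter> H \<in> restriction A H1" using H unfolding restriction_eq[OF A H1] by blast
  ultimately show "H1 \<inter> H = Y"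
    using kernel_subset_eq[OF arrangementD(2)[OF rA] arrangementD(4)[OF rA Y] arrangementD(4)[OF rA]] by blast
qed blast

lemma euler_mult_simple:
  assumes A: "arrangement X A" and H1: "H1 \<in> A" and \<mu>: "\<And>H. H \<in> A \<Longrightarrow> \<mu> H = 1" and Y: "Y \<in> restriction A H1"
  shows "euler_mult_at X A \<mu> H1 Y d \<longleftrightarrow> d = 1"
proof -
  obtain H2 where "H2 \<in> localization A Y" "H2 \<noteq> H1" using ziegler_mult_localization(3)[OF A H1 Y] by blast
  then show ?thesis
    by (rule euler_mult_concentrated[OF A H1 Y _ _ order_refl]) (use \<mu> in \<open>auto simp: localization_def\<close>)
qed

lemma ziegler_mult_pos:
  assumes A: "arrangement X A" and H0: "H0 \<in> A" and Y: "Y \<in> restriction A H0" shows "1 \<le> ziegler_mult A H0 Y"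
proof -
  obtain H where "H \<in> {H \<in> A - {H0}. H0 \<inter> H = Y}" using Y unfolding restriction_eq[OF A H0] by blast
  then show ?thesis unfolding ziegler_mult_def
    using arrangementD(1)[OF A] by (metis (no_types, lifting) One_nat_def Suc_leI card_gt_0_iff empty_iff finite_Diff finite_filter mem_Collect_eq Collect_mem_eq finite_subset subsetI)
qed

lemma subset_mset_diff: "E'' \<subseteq># E' \<Longrightarrow> E'' - D \<subseteq># E' - (D :: 'x multiset)"
  by (simp add: subseteq_mset_def diff_le_mono)

text \<open>By induction on the excess over the simple multiplicity. A step lowers the
  multiplicity of some Y, which is at least 2, so Y itself remains, and the Euler restriction to
  Y is the same for all \<mu>. The exponents of the deletion are those of the simple restriction
  with one 1 replaced, and those of the Euler restriction omit this 1.\<close>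

lemma multi_inductively_free_climb:
  assumes A: "arrangement X A" and H: "H1 \<in> A"
    and E: "has_exponents X (A - {H1}) (\<lambda>_. 1) E'" "has_exponents H1 (restriction A H1) (\<lambda>_. 1) E''" "E'' \<subseteq># E'"
    and one: "multi_inductively_free H1 (restriction A H1) (\<lambda>_. 1)"
    and zie: "\<And>Y. Y \<in> restriction A H1 \<Longrightarrow>
       multi_inductively_free Y (restriction (restriction A H1) Y) (ziegler_mult (restriction A H1) Y)"
    and \<mu>: "\<And>Y. Y \<in> restriction A H1 \<Longrightarrow> 1 \<le> \<mu> Y \<and> \<mu> Y \<le> ziegler_mult A H1 Y"
  shows "multi_inductively_free H1 (restriction A H1) \<mu>"
  using \<mu>
proof (induction "\<Sum>Y\<in>restriction A H1. \<mu> Y - 1" arbitrary: \<mu> rule: less_induct)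
  case less
  let ?R = "restriction A H1"
  have rA: "arrangement H1 ?R" by (rule restriction_arrangement[OF A H])
  show ?case
  proof (cases "\<forall>Y\<in>?R. \<mu> Y = 1")
    case True
    then show ?thesis using multi_inductively_free_cong[OF one] by blast
  next
    case False
    then obtain Y where Y: "Y \<in> ?R" "\<mu> Y \<noteq> 1" by blast
    then have Y2: "2 \<le> \<mu> Y" using less.prems[of Y] by linarith
    let ?\<nu> = "deletion_mult \<mu> Y"
    have \<nu>: "1 \<le> ?\<nu> W \<and> ?\<nu> W \<le> ziegler_mult A H1 W" if "W \<in> ?R" for W
      using less.prems[OF that] Y2 by (auto simp: deletion_mult_def)
    have "(\<Sum>W\<in>?R. ?\<nu> W - 1) < (\<Sum>W\<in>?R. \<mu> W - 1)"
      by (rule sum_strict_mono_ex1) (use arrangementD(1)[OF rA] Y Y2 in \<open>auto simp: deletion_mult_def intro!: bexI[of _ Y]\<close>)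
    then have IH: "multi_inductively_free H1 ?R ?\<nu>" using \<nu> by (rule less.hyps)
    have del: "deletion ?R \<mu> Y = ?R" using Y2 by (simp add: deletion_def)
    have ne: "?R \<noteq> {}" using Y by blast
    show ?thesis
    proof (rule multi_inductively_free.step)
      show "multiarrangement H1 ?R \<mu>" using rA less.prems by (simp add: multiarrangement_def)
      show "Y \<in> ?R" by (rule Y)
      show "multi_inductively_free H1 (deletion ?R \<mu> Y) ?\<nu>" unfolding del by (rule IH)
      show "euler_mult H1 ?R \<mu> Y (ziegler_mult ?R Y)"
        unfolding euler_mult_def using euler_mult_intermediate[OF A H E less.prems Y(1) Y2] by blast
      show "multi_inductively_free Y (restriction ?R Y) (ziegler_mult ?R Y)" by (rule zie[OF Y(1)])
      show "has_exponents H1 (deletion ?R \<mu> Y) ?\<nu> (add_mset (Suc (\<Sum>W\<in>?R. ?\<nu> W - 1)) (E'' - {#1#}))"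
        unfolding del by (rule intermediate_exponents[OF A H E ne \<nu>])
      show "has_exponents Y (restriction ?R Y) (ziegler_mult ?R Y) (E'' - {#1#})"
        using ziegler_exponents[OF rA Y(1) E(2)] by blast
      show "E'' - {#1#} \<subseteq># add_mset (Suc (\<Sum>W\<in>?R. ?\<nu> W - 1)) (E'' - {#1#})" by simp
    qed
  qed
qed

text \<open>H1 contributes one to Ziegler's multiplicity of its trace on H0, and nothing to that
  of other traces. If no other hyperplane has the same trace, the latter disappears from the
  restriction.\<close>

lemma ziegler_deletion:
  assumes A: "arrangement X A" and H: "H0 \<in> A" "H1 \<in> A" "H0 \<noteq> H1"
  shows "deletion (restriction A H0) (ziegler_mult A H0) (H0 \<inter> H1) = restriction (A - {H1}) H0"
    and "W \<in> restriction (A - {H1}) H0 \<Longrightarrow> deletion_mult (ziegler_mult A H0) (H0 \<inter> H1) W = ziegler_mult (A - {H1}) H0 W"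
proof -
  let ?Y = "H0 \<inter> H1"
  have A': "arrangement X (A - {H1})" by (rule arrangement_subset[OF A]) blast
  have H0': "H0 \<in> A - {H1}" using H by blast
  have r: "restriction A H0 = (\<lambda>H. H0 \<inter> H) ` (A - {H0})" by (rule restriction_eq[OF A H(1)])
  have r': "restriction (A - {H1}) H0 = (\<lambda>H. H0 \<inter> H) ` (A - {H1} - {H0})" by (rule restriction_eq[OF A' H0'])
  have fin: "finite {H \<in> A - {H0}. H0 \<inter> H = W}" for W using arrangementD(1)[OF A] by simp
  have split: "{H \<in> A - {H0}. H0 \<inter> H = W} = (if W = ?Y then insert H1 {H \<in> A - {H1} - {H0}. H0 \<inter> H = W} else {H \<in> A - {H1} - {H0}. H0 \<inter> H = W})" for W
    using H by auto
  have zm: "ziegler_mult A H0 W = (if W = ?Y then Suc (ziegler_mult (A - {H1}) H0 W) else ziegler_mult (A - {H1}) H0 W)" for W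
  proof -
    have "finite {H \<in> A - {H1} - {H0}. H0 \<inter> H = W}" "H1 \<notin> {H \<in> A - {H1} - {H0}. H0 \<inter> H = W}"
      using arrangementD(1)[OF A] by auto
    note c = card_insert_disjoint[OF this]
    show ?thesis
    proof (cases "W = ?Y")
      case True
      then show ?thesis unfolding ziegler_mult_def split[of W] c[symmetric] by (simp only: if_True refl)
    next
      case False
      then show ?thesis unfolding ziegler_mult_def split[of W] by (simp only: if_False)
    qed
  qed
  have "A - {H0} = insert H1 (A - {H1} - {H0})" using H by blast
  then have ins: "restriction A H0 = insert ?Y (restriction (A - {H1}) H0)" unfolding r r' by (simp only: image_insert)
  show "deletion_mult (ziegler_mult A H0) ?Y W = ziegler_mult (A - {H1}) H0 W" by (simp add: deletion_mult_def zm)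
  show "deletion (restriction A H0) (ziegler_mult A H0) ?Y = restriction (A - {H1}) H0"
  proof (cases "?Y \<in> restriction (A - {H1}) H0")
    case True
    then have "1 \<le> ziegler_mult (A - {H1}) H0 ?Y" by (rule ziegler_mult_pos[OF A' H0'])
    then have "deletion (restriction A H0) (ziegler_mult A H0) ?Y = restriction A H0" by (simp add: deletion_def zm)
    then show ?thesis unfolding ins using True by (simp only: insert_absorb)
  next
    case False
    then have "{H \<in> A - {H1} - {H0}. H0 \<inter> H = ?Y} = {}" unfolding r' by blast
    then have "ziegler_mult (A - {H1}) H0 ?Y = 0" unfolding ziegler_mult_def by (simp only: card.empty)
    then have "deletion (restriction A H0) (ziegler_mult A H0) ?Y = restriction A H0 - {?Y}" by (simp add: deletion_def zm)
    then show ?thesis unfolding ins Diff_insert_absorb[OF False] .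
  qed
qed

text \<open>The last hyperplane added is H1. Ziegler's multiplicity on H1 is reached from the
  simple restriction by climbing. On another hyperplane H0, it is reached from Ziegler's
  multiplicity for A - {H1} by adding the trace of H1; the Euler restriction there belongs to
  the restriction of A to H1, for which the second claim is known by induction.\<close>

theorem inductively_free_imp:
  assumes "inductively_free X A"
  shows "multi_inductively_free X A (\<lambda>_. 1) \<and>
    (\<forall>H0\<in>A. multi_inductively_free H0 (restriction A H0) (ziegler_mult A H0)) \<and> (\<exists>E. has_exponents X A (\<lambda>_. 1) E)"
  using assms
proof induction
  case (empty X)
  then show ?case using has_exponents_empty[OF empty] multi_inductively_free.empty[OF empty] by blast
next
  case (step X A H1 E' E'')
  note A = step.hyps(1) and H1 = step.hyps(2)
  note E = step.hyps(5,6,7)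
  let ?R = "restriction A H1"
  have A': "arrangement X (A - {H1})" by (rule arrangement_subset[OF A]) blast
  have rA: "arrangement H1 ?R" by (rule restriction_arrangement[OF A H1])
  have IH1: "multi_inductively_free X (A - {H1}) (\<lambda>_. 1)"
    and IH2: "\<And>H0. H0 \<in> A - {H1} \<Longrightarrow> multi_inductively_free H0 (restriction (A - {H1}) H0) (ziegler_mult (A - {H1}) H0)"
    and IH3: "multi_inductively_free H1 ?R (\<lambda>_. 1)"
    and IH4: "\<And>Y. Y \<in> ?R \<Longrightarrow> multi_inductively_free Y (restriction ?R Y) (ziegler_mult ?R Y)"
    using step.IH by blast+
  have "multi_inductively_free X A (\<lambda>_. 1)"
  proof (rule multi_inductively_free.step)
    have del: "deletion A (\<lambda>_. 1) H1 = A - {H1}" by (simp add: deletion_def)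
    have dm: "deletion_mult (\<lambda>_. 1) H1 H = 1" if "H \<in> A - {H1}" for H using that by (simp add: deletion_mult_def)
    show "multiarrangement X A (\<lambda>_. 1)" using A by (simp add: multiarrangement_def)
    show "H1 \<in> A" by (rule H1)
    show "multi_inductively_free X (deletion A (\<lambda>_. 1) H1) (deletion_mult (\<lambda>_. 1) H1)"
      unfolding del by (rule multi_inductively_free_cong[OF IH1]) (rule dm)
    show "euler_mult X A (\<lambda>_. 1) H1 (\<lambda>_. 1)" unfolding euler_mult_def using euler_mult_simple[OF A H1, of "\<lambda>_. 1" _ 1] by simp
    show "multi_inductively_free H1 ?R (\<lambda>_. 1)" by (rule IH3)
    show "has_exponents X (deletion A (\<lambda>_. 1) H1) (deletion_mult (\<lambda>_. 1) H1) E'"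
      unfolding del using E(1) by (rule has_exponents_cong[OF dm, THEN iffD2, rotated])
    show "has_exponents H1 ?R (\<lambda>_. 1) E''" "E'' \<subseteq># E'" by (rule E)+
  qed
  moreover have "multi_inductively_free H0 (restriction A H0) (ziegler_mult A H0)" if H0: "H0 \<in> A" for H0
  proof (cases "H0 = H1")
    case True
    show ?thesis unfolding True
      by (rule multi_inductively_free_climb[OF A H1 E IH3 IH4]) (simp_all add: ziegler_mult_pos[OF A H1, simplified])
  next
    case False
    let ?Y = "H0 \<inter> H1"
    note d = ziegler_deletion[OF A H0 H1 False]
    have H0': "H0 \<in> A - {H1}" using H0 False by blast
    have Y0: "?Y \<in> restriction A H0" unfolding restriction_eq[OF A H0] using H1 False by blast
    have Y1: "?Y \<in> ?R" unfolding restriction_eq[OF A H1] using H0 False by blast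
    have tw: "restriction (restriction A H0) ?Y = restriction ?R ?Y" by (rule restriction_twice[OF A H0 H1 False])
    show ?thesis
    proof (rule multi_inductively_free.step)
      show "multiarrangement H0 (restriction A H0) (ziegler_mult A H0)"
        using restriction_arrangement[OF A H0] ziegler_mult_pos[OF A H0] by (simp add: multiarrangement_def)
      show "?Y \<in> restriction A H0" by (rule Y0)
      show "multi_inductively_free H0 (deletion (restriction A H0) (ziegler_mult A H0) ?Y) (deletion_mult (ziegler_mult A H0) ?Y)"
        unfolding d(1) by (rule multi_inductively_free_cong[OF IH2[OF H0']]) (rule d(2))
      show "euler_mult H0 (restriction A H0) (ziegler_mult A H0) ?Y (ziegler_mult ?R ?Y)"
        unfolding euler_mult_def using euler_mult_ziegler[OF A H0 H1 False E] by blast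
      show "multi_inductively_free ?Y (restriction (restriction A H0) ?Y) (ziegler_mult ?R ?Y)"
        unfolding tw by (rule IH4[OF Y1])
      show "has_exponents H0 (deletion (restriction A H0) (ziegler_mult A H0) ?Y) (deletion_mult (ziegler_mult A H0) ?Y) (E' - {#1#})"
        unfolding d(1)
        by (rule has_exponents_cong[OF d(2), THEN iffD2]) (use ziegler_exponents[OF A' H0' E(1)] in blast)+
      show "has_exponents ?Y (restriction (restriction A H0) ?Y) (ziegler_mult ?R ?Y) (E'' - {#1#})"
        unfolding tw using ziegler_exponents[OF rA Y1 E(2)] by blast
      show "E'' - {#1#} \<subseteq># E' - {#1#}" by (rule subset_mset_diff[OF E(3)])
    qed
  qed
  ultimately show ?case using addition_exponents[OF A H1 E] by blast
qed

lemma concentrated_mult_1: "concentrated_mult H0 1 = (\<lambda>_. 1)"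
  by (auto simp: concentrated_mult_def)

text \<open>Each step deletes H0 once. The Euler restriction is always Ziegler's, and its
  exponents occur among those of the deletion because only the exponent m of the latter varies
  with m.\<close>

theorem inductively_free_imp_concentrated:
  assumes F: "inductively_free X A" and A: "arrangement X A" and H0: "H0 \<in> A" and m: "1 \<le> m"
  shows "multi_inductively_free X A (concentrated_mult H0 m)"
  using m
proof (induction m rule: dec_induct)
  case base
  show ?case using inductively_free_imp[OF F] by (simp only: concentrated_mult_1)
next
  case (step m)
  obtain E where E: "has_exponents X A (\<lambda>_. 1) E" using inductively_free_imp[OF F] by blast
  have E1: "has_exponents X A (concentrated_mult H0 1) E" using E by (simp only: concentrated_mult_1)
  have del: "deletion A (concentrated_mult H0 (Suc m)) H0 = A" using step.hyps by (simp add: deletion_def concentrated_mult_def)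
  have dm: "deletion_mult (concentrated_mult H0 (Suc m)) H0 = concentrated_mult H0 m"
    by (auto simp: deletion_mult_def concentrated_mult_def)
  have m2: "2 \<le> Suc m" using step.hyps by simp
  show ?case
  proof (rule multi_inductively_free.step)
    show "multiarrangement X A (concentrated_mult H0 (Suc m))" using A by (simp add: multiarrangement_def concentrated_mult_def)
    show "H0 \<in> A" by (rule H0)
    show "multi_inductively_free X (deletion A (concentrated_mult H0 (Suc m)) H0) (deletion_mult (concentrated_mult H0 (Suc m)) H0)"
      unfolding del dm by (rule step.IH)
    show "euler_mult X A (concentrated_mult H0 (Suc m)) H0 (ziegler_mult A H0)"
      unfolding euler_mult_def using euler_mult_concentrated_self[OF A H0 _ m2] by blast
    show "multi_inductively_free H0 (restriction A H0) (ziegler_mult A H0)" using inductively_free_imp[OF F] H0 by blast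
    show "has_exponents X (deletion A (concentrated_mult H0 (Suc m)) H0) (deletion_mult (concentrated_mult H0 (Suc m)) H0) (add_mset m (E - {#1#}))"
      unfolding del dm using concentrated_exponents[OF A H0 order_refl step.hyps(1) E1] by blast
    show "has_exponents H0 (restriction A H0) (ziegler_mult A H0) (E - {#1#})" using ziegler_exponents[OF A H0 E] by blast
    show "E - {#1#} \<subseteq># add_mset m (E - {#1#})" by simp
  qed
qed

lemma add_mset_subset: "E'' \<subseteq># E' \<Longrightarrow> add_mset x (E'' - D) \<subseteq># add_mset x (E' - D)"
  using subset_mset_diff by simp

text \<open>Multiplicities are compared on A only, since those of discarded hyperplanes are
  arbitrary. If H1 is not H0, both the deletion and the Euler restriction are concentrated
  again, with the same m, so that replacing the exponent m by 1 in both gives the exponents of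
  the simple arrangements. If H1 is H0 and m is at least 2, the deletion is the same arrangement
  with a smaller m.\<close>

theorem concentrated_imp_inductively_free:
  assumes "multi_inductively_free X A \<mu>"
    and "A = {} \<or> (\<exists>H0\<in>A. \<exists>m\<ge>1. \<forall>H\<in>A. \<mu> H = concentrated_mult H0 m H)"
  shows "inductively_free X A"
  using assms
proof induction
  case (empty X \<mu>)
  then show ?case by (intro inductively_free.empty)
next
  case (step X A \<mu> H1 \<mu>' E' E'')
  have A: "arrangement X A" using step.hyps(1) by (simp add: multiarrangement_def)
  note H1 = step.hyps(2)
  have A': "arrangement X (A - {H1})" by (rule arrangement_subset[OF A]) blast
  have rA: "arrangement H1 (restriction A H1)" by (rule restriction_arrangement[OF A H1])
  have eul: "euler_mult_at X A \<mu> H1 Y (\<mu>' Y)" if "Y \<in> restriction A H1" for Y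
    using step.hyps(4) that by (simp add: euler_mult_def)
  obtain H0 m where H0: "H0 \<in> A" "1 \<le> m" and \<mu>: "\<And>H. H \<in> A \<Longrightarrow> \<mu> H = concentrated_mult H0 m H"
    using step.prems H1 by blast
  consider (other) "H1 \<noteq> H0" | (thick) "H1 = H0" "2 \<le> m" | (simple) "H1 = H0" "m = 1" using H0(2) by linarith
  then show ?case
  proof cases
    case other
    let ?Y = "H1 \<inter> H0"
    have \<mu>1: "\<mu> H1 = 1" using \<mu>[OF H1] other by (simp add: concentrated_mult_def)
    have del: "deletion A \<mu> H1 = A - {H1}" using \<mu>1 by (simp add: deletion_def)
    have dm: "deletion_mult \<mu> H1 H = concentrated_mult H0 m H" if "H \<in> A - {H1}" for H
      using \<mu>[of H] that by (simp add: deletion_mult_def)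
    have H0': "H0 \<in> A - {H1}" using H0(1) other by blast
    have "\<exists>H0\<in>A - {H1}. \<exists>m\<ge>1. \<forall>H\<in>A - {H1}. deletion_mult \<mu> H1 H = concentrated_mult H0 m H"
      by (intro bexI[of _ H0] exI[of _ m] conjI ballI H0' H0(2) dm)
    then have F1: "inductively_free X (A - {H1})" by (rule step.IH(1)[unfolded del, OF disjI2])
    have Y: "?Y \<in> restriction A H1" unfolding restriction_eq[OF A H1] using H0' by blast
    have \<mu>': "\<mu>' W = concentrated_mult ?Y m W" if W: "W \<in> restriction A H1" for W
    proof (cases "W \<subseteq> H0")
      case True
      have "W = ?Y" using localization_restriction[OF A H1 W H0(1)] other True by blast
      moreover have "\<mu>' W = m"
      proof (rule euler_mult_concentrated[OF A H1 W _ _ H0(2), THEN iffD1])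
        show "H0 \<in> localization A W" using True H0(1) by (simp add: localization_def)
        show "H0 \<noteq> H1" using other by simp
        show "\<mu> H = (if H = H0 then m else 1)" if "H \<in> localization A W" for H
          using \<mu>[of H] that by (simp add: localization_def concentrated_mult_def)
      qed (rule eul[OF W])
      ultimately show ?thesis by (simp add: concentrated_mult_def)
    next
      case False
      obtain H2 where H2: "H2 \<in> localization A W" "H2 \<noteq> H1" using ziegler_mult_localization(3)[OF A H1 W] by blast
      have "\<mu> H = (if H = H2 then 1 else 1)" if "H \<in> localization A W" for H
        using \<mu>[of H] that False by (auto simp: localization_def concentrated_mult_def)
      from euler_mult_concentrated[OF A H1 W H2 order_refl this] have "\<mu>' W = 1" using eul[OF W] by (rule iffD1)
      moreover have "W \<noteq> ?Y" using False by blast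
      ultimately show ?thesis by (simp add: concentrated_mult_def)
    qed
    have "\<exists>K\<in>restriction A H1. \<exists>m\<ge>1. \<forall>W\<in>restriction A H1. \<mu>' W = concentrated_mult K m W"
      by (intro bexI[of _ ?Y] exI[of _ m] conjI ballI Y H0(2) \<mu>')
    then have F2: "inductively_free H1 (restriction A H1)" by (rule step.IH(2)[OF disjI2])
    have E1: "has_exponents X (A - {H1}) (concentrated_mult H0 m) E'"
      using step.hyps(6) unfolding del by (rule has_exponents_cong[OF dm, THEN iffD1, rotated])
    have E2: "has_exponents H1 (restriction A H1) (concentrated_mult ?Y m) E''"
      using step.hyps(7) by (rule has_exponents_cong[OF \<mu>', THEN iffD1, rotated])
    have "has_exponents X (A - {H1}) (\<lambda>_. 1) (add_mset 1 (E' - {#m#}))"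
      using concentrated_exponents[OF A' H0' H0(2) order_refl E1] unfolding concentrated_mult_1 by blast
    moreover have "has_exponents H1 (restriction A H1) (\<lambda>_. 1) (add_mset 1 (E'' - {#m#}))"
      using concentrated_exponents[OF rA Y H0(2) order_refl E2] unfolding concentrated_mult_1 by blast
    ultimately show ?thesis
      by (rule inductively_free.step[OF A H1 F1 F2]) (rule add_mset_subset[OF step.hyps(8)])
  next
    case thick
    have del: "deletion A \<mu> H1 = A" using \<mu>[OF H1] thick by (simp add: deletion_def concentrated_mult_def)
    have "deletion_mult \<mu> H1 H = concentrated_mult H0 (m - 1) H" if "H \<in> A" for H
      using \<mu>[OF that] thick(1) by (cases "H = H0") (simp_all add: deletion_mult_def concentrated_mult_def)
    moreover have "1 \<le> m - 1" using thick by simp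
    ultimately have "\<exists>H0\<in>A. \<exists>m\<ge>1. \<forall>H\<in>A. deletion_mult \<mu> H1 H = concentrated_mult H0 m H"
      by (intro bexI[of _ H0] exI[of _ "m - 1"] conjI ballI H0(1))
    then show ?thesis by (rule step.IH(1)[unfolded del, OF disjI2])
  next
    case simple
    have \<mu>1: "\<mu> H = 1" if "H \<in> A" for H using \<mu>[OF that] simple by (simp add: concentrated_mult_def)
    have del: "deletion A \<mu> H1 = A - {H1}" using \<mu>1[OF H1] by (simp add: deletion_def)
    have dm: "deletion_mult \<mu> H1 H = 1" if "H \<in> A - {H1}" for H using \<mu>1[of H] that by (simp add: deletion_mult_def)
    have \<mu>': "\<mu>' W = 1" if W: "W \<in> restriction A H1" for W
      by (rule euler_mult_simple[OF A H1 \<mu>1 W, THEN iffD1, OF _ eul[OF W]])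
    have one: "B = {} \<or> (\<exists>H0\<in>B. \<exists>m\<ge>1. \<forall>H\<in>B. \<nu> H = concentrated_mult H0 m H)" if "\<And>H. H \<in> B \<Longrightarrow> \<nu> H = 1" for B and \<nu> :: "'v set \<Rightarrow> nat"
    proof (cases "B = {}")
      case False
      then obtain K where "K \<in> B" by blast
      then show ?thesis using that concentrated_mult_1[of K] by (intro disjI2 bexI[of _ K] exI[of _ 1]) simp_all
    qed simp
    have F1: "inductively_free X (A - {H1})" by (rule step.IH(1)[unfolded del, OF one[OF dm]])
    have F2: "inductively_free H1 (restriction A H1)" by (rule step.IH(2)[OF one[OF \<mu>']])
    have "has_exponents X (A - {H1}) (\<lambda>_. 1) E'"
      using step.hyps(6) unfolding del by (rule has_exponents_cong[OF dm, THEN iffD1, rotated])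
    moreover have "has_exponents H1 (restriction A H1) (\<lambda>_. 1) E''"
      using step.hyps(7) by (rule has_exponents_cong[OF \<mu>', THEN iffD1, rotated])
    ultimately show ?thesis by (rule inductively_free.step[OF A H1 F1 F2]) (rule step.hyps(8))
  qed
qed

end

theorem theorem1p11:
  fixes scale :: "'k::field \<Rightarrow> 'v::ab_group_add \<Rightarrow> 'v"
    and V H0 :: "'v set" and A :: "'v set set" and m0 :: nat
  assumes "vector_space scale"
    and "arrangement_space.arrangement scale V A"
    and "H0 \<in> A"
    and "m0 \<ge> 1"
  shows "arrangement_space.inductively_free scale V A \<longleftrightarrow>
         arrangement_space.multi_inductively_free scale V A (concentrated_mult H0 m0)"
proof -
  interpret vector_space scale by (rule assms(1))
  interpret arrangement_space scale ..
  show ?thesis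
    using inductively_free_imp_concentrated[OF _ assms(2,3,4)] concentrated_imp_inductively_free[of V A "concentrated_mult H0 m0"]
      assms(3,4) by blast
qed

end
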